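(* Let $M$ be a homogeneous nilpotent representation of the equioriented cycle $\Delta_n$, let $X=\mathrm{Gr}_{\mathbf e}(M)$ with its action of the torus $T=(\mathbb C^* )^{d+1}$, and let $\chi$ be a generic cocharacter of $T$ inducing on $X$ the $\mathbb C^*$-action given by the attractive grading of $M$. Then $H_T^\bullet(X)$ has a unique Knutson-Tao basis with respect to $\succeq_\chi$; that is, for each $x\in X^T$ there is exactly one Knutson-Tao class $p^x\in H_T^\bullet(X)$, and $\{p^x\}_{x\in X^T}$ is a basis of $H_T^\bullet(X)$ as an $R$-module.
   Context: $\Delta_n$ ($n\ge 1$) is the quiver with vertex set $\mathbb Z_n=\mathbb Z/n\mathbb Z$ and one arrow $i\to i+1$ for each $i$. A finite-dimensional $\Delta_n$-representation $M$ consists of finite-dimensional $\mathbb C$-vector spaces $M^{(i)}$ and linear maps $M_i:M^{(i)}\to M^{(i+1)}$; put $m_i=\dim M^{(i)}$. It is nilpotent if for some $N$ every composition of $N$ consecutive maps is zero. Every nilpotent $M$ is a direct sum of indecomposables $U_1,\dots,U_d$, where $U_j$ has a basis $b_{j,0},\dots,b_{j,\ell_j-1}$ of vectors at consecutive vertices, with the maps sending $b_{j,p}\mapsto b_{j,p+1}$ and $b_{j,\ell_j-1}\mapsto 0$. Let $B$ be the basis of $M$ formed by all $b_{j,p}$, and $B^{(i)}=B\cap M^{(i)}=\{v^{(i)}_1,\dots,v^{(i)}_{m_i}\}$ (an indexing of $B^{(i)}$). $\mathrm{Gr}_{\mathbf e}(M)$ is the projective variety of subrepresentations of $M$ of dimension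 vector $\mathbf e$ (assumed non-empty). The torus $T=(\mathbb C^* )^{d+1}\ni\gamma=(\gamma_0,\gamma_1,\dots,\gamma_d)$ acts on $M$ by $\gamma.b_{j,p}=\gamma_0^p\gamma_j b_{j,p}$, inducing an action on $X=\mathrm{Gr}_{\mathbf e}(M)$ with finitely many fixed points and one-dimensional orbits, and $X$ has vanishing odd rational cohomology. $M$ is homogeneous if $B$ and the indexings can be chosen such that: (H0) there is an attractive grading $\mathrm{wt}:B\to\mathbb Z$, i.e. $\mathrm{wt}(v^{(i)}_k)>\mathrm{wt}(v^{(i)}_\ell)$ whenever $k>\ell$, and for each $i$ there is $d(i)\in\mathbb Z$ with $\mathrm{wt}(v^{(i+1)}_\ell)=\mathrm{wt}(v^{(i)}_k)+d(i)$ whenever $M_iv^{(i)}_k=v^{(i+1)}_\ell$; (H1) alignment: if $M_iv^{(i)}_\ell=0$ and $M_iv^{(i)}_k\ne0$ then $\ell>k$, and if $M_iv^{(i)}_\ell=v^{(i+1)}_{\ell'}$, $M_iv^{(i)}_k=v^{(i+1)}_{k'}$ with $\ell>k$ then $\ell'>k'$; (H2) if $M_iv^{(i)}_k=v^{(i+1)}_{k'}$ and $m_{i+1}-k'>0$, then $M_iv^{(i)}_{k+r}=v^{(i+1)}_{k'+r}$ for all $1\le r\le m_{i+1}-k'$. Such choices are fixed. $\chi:\mathbb C^*\to T$ is a generic cocharacter (i.e. $X^{\chi(\mathbb C^* )}=X^T$) such that the $\mathbb C^*$-action on $X$ through $\chi$ is the one induced by $z\cdot b=z^{\mathrm{wt}(b)}b$,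 $b\in B$. The moment graph $\mathcal G=\mathcal G(X,T,\chi)$ has vertices $X^T$; its edges are the closures of one-dimensional $T$-orbits $E$ (each contains exactly two fixed points $x,y$), oriented $x\to y$ if $\lim_{\lambda\to0}\chi(\lambda).p=x$ for $p\in E$, and labelled by the character $\alpha_E$ of $T$ describing the action on $E$ (well defined up to sign; a choice is fixed). $\mathcal G_1^{\partial x}$ is the set of edges starting at $x$; $x\succeq_\chi y$ means there is a directed path (possibly of length $0$) from $x$ to $y$. $R=H_T^\bullet(\mathrm{pt})=\mathbb Q[T]$ is the polynomial ring on the characters $\delta(\gamma)=\gamma_0$, $\epsilon_j(\gamma)=\gamma_j$ (each of degree $2$). Equivariant cohomology has rational coefficients and is identified, by restriction to $X^T$, with $\{(f_x)\in\bigoplus_{x\in X^T}R: f_x-f_y\in\alpha_ER \text{ for every edge } E \text{ with endpoints } x,y\}$. A Knutson-Tao class for $x$ is an element $p^x=(p^x_y)_{y\in X^T}\in H_T^\bullet(X)$ with: $p^x_x=\prod_{E\in\mathcal G_1^{\partial x}}\alpha_E$; each $p^x_y$ is homogeneous with $\deg p^x_y=\deg p^x_x$ (the zero polynomial being allowed); $p^x_y=0$ whenever $y\not\succeq_\chi x$. *)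

theory Defs
  imports "HOL-Analysis.Analysis" "HOL-Library.Poly_Mapping" "HOL-Library.Function_Algebras"
begin

section \<open>Representations of the equioriented cycle\<close>

text \<open>
  The vertex set Z/n is \<open>{..<n}\<close>, the arrow at \<open>i\<close> goes to \<open>Suc i mod n\<close>.  The spaces
  \<open>M\<^sup>(\<^sup>i\<^sup>)\<close> are subspaces of an ambient complex vector space on the type \<open>'v\<close> with scalar
  multiplication \<open>smult\<close>.  Only the values of \<open>arrow M i\<close> on \<open>space M i\<close> matter.
  The second group of fields records a decomposition into indecomposables:
  \<open>bas j p\<close> with \<open>1 \<le> j \<le> summands\<close> and \<open>p < len j\<close> is the vector \<open>b\<^sub>j\<^sub>,\<^sub>p\<close>, located at the
  vertex \<open>(start j + p) mod n\<close>.
\<close>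

record 'v cycle_rep =
  vertices :: nat
  smult :: "complex \<Rightarrow> 'v \<Rightarrow> 'v"
  space :: "nat \<Rightarrow> 'v set"
  arrow :: "nat \<Rightarrow> 'v \<Rightarrow> 'v"

record 'v based_rep = "'v cycle_rep" +
  summands :: nat
  start :: "nat \<Rightarrow> nat"
  len :: "nat \<Rightarrow> nat"
  bas :: "nat \<Rightarrow> nat \<Rightarrow> 'v"

definition nxt :: "('v, 'z) cycle_rep_scheme \<Rightarrow> nat \<Rightarrow> nat" where
  "nxt M i = Suc i mod vertices M"

definition is_rep :: "('v::ab_group_add, 'z) cycle_rep_scheme \<Rightarrow> bool" where
  "is_rep M \<longleftrightarrow> vertices M \<ge> 1 \<and> vector_space (smult M) \<and>
     (\<forall>i<vertices M.
        module.subspace (smult M) (space M i) \<and>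
        (\<exists>S. finite S \<and> space M i = module.span (smult M) S) \<and>
        (\<forall>x\<in>space M i. arrow M i x \<in> space M (nxt M i)) \<and>
        (\<forall>x\<in>space M i. \<forall>y\<in>space M i. arrow M i (x + y) = arrow M i x + arrow M i y) \<and>
        (\<forall>c. \<forall>x\<in>space M i. arrow M i (smult M c x) = smult M c (arrow M i x)))"

primrec arrow_path :: "('v, 'z) cycle_rep_scheme \<Rightarrow> nat \<Rightarrow> nat \<Rightarrow> 'v \<Rightarrow> 'v" where
  "arrow_path M i 0 x = x"
| "arrow_path M i (Suc k) x = arrow M ((i + k) mod vertices M) (arrow_path M i k x)"

definition nilpotent_rep :: "('v::ab_group_add, 'z) cycle_rep_scheme \<Rightarrow> bool" where
  "nilpotent_rep M \<longleftrightarrow> (\<exists>N. \<forall>i<vertices M. \<forall>x\<in>space M i. arrow_path M i N x = 0)"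

definition vdim :: "('v::ab_group_add, 'z) cycle_rep_scheme \<Rightarrow> nat \<Rightarrow> nat" where
  "vdim M i = vector_space.dim (smult M) (space M i)"

definition basis_index :: "'v based_rep \<Rightarrow> (nat \<times> nat) set" where
  "basis_index M = {(j, p). 1 \<le> j \<and> j \<le> summands M \<and> p < len M j}"

definition basis_vec :: "'v based_rep \<Rightarrow> nat \<times> nat \<Rightarrow> 'v" where
  "basis_vec M q = bas M (fst q) (snd q)"

definition basis_vertex :: "'v based_rep \<Rightarrow> nat \<times> nat \<Rightarrow> nat" where
  "basis_vertex M q = (start M (fst q) + snd q) mod vertices M"

definition basis_set :: "'v based_rep \<Rightarrow> 'v set" where
  "basis_set M = basis_vec M ` basis_index M"

definition basis_at :: "'v based_rep \<Rightarrow> nat \<Rightarrow> 'v set" where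
  "basis_at M i = basis_vec M ` {q \<in> basis_index M. basis_vertex M q = i}"

text \<open>
  Linear independence of the whole family \<open>b\<^sub>j\<^sub>,\<^sub>p\<close> makes the sum of the subspaces \<open>space M i\<close>
  direct, so that \<open>span (basis_set M)\<close> is the total space of \<open>M\<close>.
\<close>

definition decomposition_basis :: "'v::ab_group_add based_rep \<Rightarrow> bool" where
  "decomposition_basis M \<longleftrightarrow>
     (\<forall>j. 1 \<le> j \<and> j \<le> summands M \<longrightarrow> start M j < vertices M \<and> len M j \<ge> 1) \<and>
     inj_on (basis_vec M) (basis_index M) \<and>
     \<not> module.dependent (smult M) (basis_set M) \<and>
     (\<forall>i<vertices M. module.span (smult M) (basis_at M i) = space M i) \<and>
     (\<forall>(j, p)\<in>basis_index M. arrow M (basis_vertex M (j, p)) (bas M j p) =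
        (if Suc p < len M j then bas M j (Suc p) else 0))"


section \<open>Homogeneous representations\<close>

text \<open>\<open>v i k\<close>, for \<open>1 \<le> k \<le> vdim M i\<close>, is the basis vector \<open>v\<^sub>k\<^sup>(\<^sup>i\<^sup>)\<close>.\<close>

definition basis_indexing :: "'v::ab_group_add based_rep \<Rightarrow> (nat \<Rightarrow> nat \<Rightarrow> 'v) \<Rightarrow> bool" where
  "basis_indexing M v \<longleftrightarrow> (\<forall>i<vertices M. bij_betw (v i) {1..vdim M i} (basis_at M i))"

definition attractive_grading ::
    "'v::ab_group_add based_rep \<Rightarrow> (nat \<Rightarrow> nat \<Rightarrow> 'v) \<Rightarrow> ('v \<Rightarrow> int) \<Rightarrow> bool" where
  "attractive_grading M v wt \<longleftrightarrow>
     (\<forall>i<vertices M. \<forall>k\<in>{1..vdim M i}. \<forall>l\<in>{1..vdim M i}.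
        k > l \<longrightarrow> wt (v i k) > wt (v i l)) \<and>
     (\<forall>i<vertices M. \<exists>\<delta>::int. \<forall>k\<in>{1..vdim M i}. \<forall>l\<in>{1..vdim M (nxt M i)}.
        arrow M i (v i k) = v (nxt M i) l \<longrightarrow> wt (v (nxt M i) l) = wt (v i k) + \<delta>)"

definition aligned :: "'v::ab_group_add based_rep \<Rightarrow> (nat \<Rightarrow> nat \<Rightarrow> 'v) \<Rightarrow> bool" where
  "aligned M v \<longleftrightarrow> (\<forall>i<vertices M. \<forall>k\<in>{1..vdim M i}. \<forall>l\<in>{1..vdim M i}.
     (arrow M i (v i l) = 0 \<and> arrow M i (v i k) \<noteq> 0 \<longrightarrow> l > k) \<and>
     (\<forall>k'\<in>{1..vdim M (nxt M i)}. \<forall>l'\<in>{1..vdim M (nxt M i)}.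
        arrow M i (v i l) = v (nxt M i) l' \<and> arrow M i (v i k) = v (nxt M i) k' \<and> l > k
        \<longrightarrow> l' > k'))"

text \<open>In (H2) the existence of the vectors \<open>v i (k + r)\<close> is part of the condition.\<close>

definition strongly_aligned :: "'v::ab_group_add based_rep \<Rightarrow> (nat \<Rightarrow> nat \<Rightarrow> 'v) \<Rightarrow> bool" where
  "strongly_aligned M v \<longleftrightarrow>
     (\<forall>i<vertices M. \<forall>k\<in>{1..vdim M i}. \<forall>k'\<in>{1..vdim M (nxt M i)}.
        arrow M i (v i k) = v (nxt M i) k' \<longrightarrow>
        (\<forall>r\<in>{1..vdim M (nxt M i) - k'}.
           k + r \<le> vdim M i \<and> arrow M i (v i (k + r)) = v (nxt M i) (k' + r)))"

definition homogeneous_choice ::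
    "'v::ab_group_add based_rep \<Rightarrow> (nat \<Rightarrow> nat \<Rightarrow> 'v) \<Rightarrow> ('v \<Rightarrow> int) \<Rightarrow> bool" where
  "homogeneous_choice M v wt \<longleftrightarrow>
     decomposition_basis M \<and> basis_indexing M v \<and>
     attractive_grading M v wt \<and> aligned M v \<and> strongly_aligned M v"


section \<open>Quiver Grassmannians and their classical topology\<close>

definition quiver_Gr :: "('v::ab_group_add, 'z) cycle_rep_scheme \<Rightarrow> (nat \<Rightarrow> nat) \<Rightarrow> (nat \<Rightarrow> 'v set) set" where
  "quiver_Gr M e =
     {N \<in> (\<Pi>\<^sub>E i\<in>{..<vertices M}.
             {W. module.subspace (smult M) W \<and> W \<subseteq> space M i \<and> vector_space.dim (smult M) W = e i}).
      \<forall>i<vertices M. \<forall>x\<in>N i. arrow M i x \<in> N (nxt M i)}"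

definition coords :: "'v::ab_group_add based_rep \<Rightarrow> 'v \<Rightarrow> 'v \<Rightarrow> complex" where
  "coords M x = module.representation (smult M) (basis_set M) x"

text \<open>The canonical topology of the finite-dimensional complex vector space spanned by the basis.\<close>

definition rep_topology :: "'v::ab_group_add based_rep \<Rightarrow> 'v topology" where
  "rep_topology M = pullback_topology (module.span (smult M) (basis_set M)) (coords M) euclidean"

text \<open>
  A frame consists of \<open>e i\<close> vectors for each vertex \<open>i\<close>, spanning a point of the quiver
  Grassmannian (and hence linearly independent at each vertex).  The Grassmannian carries the
  quotient topology under the map sending a frame to its span.  This is the topology
  of the set of complex points of the projective variety.
\<close>

definition frame_index :: "('v, 'z) cycle_rep_scheme \<Rightarrow> (nat \<Rightarrow> nat) \<Rightarrow> (nat \<times> nat) set" where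
  "frame_index M e = (SIGMA i:{..<vertices M}. {..<e i})"

definition frame_span ::
    "('v::ab_group_add, 'z) cycle_rep_scheme \<Rightarrow> (nat \<Rightarrow> nat) \<Rightarrow> (nat \<times> nat \<Rightarrow> 'v) \<Rightarrow> nat \<Rightarrow> 'v set" where
  "frame_span M e u = (\<lambda>i\<in>{..<vertices M}. module.span (smult M) ((\<lambda>k. u (i, k)) ` {..<e i}))"

definition frame_topology :: "'v::ab_group_add based_rep \<Rightarrow> (nat \<Rightarrow> nat) \<Rightarrow> (nat \<times> nat \<Rightarrow> 'v) topology" where
  "frame_topology M e =
     subtopology (product_topology (\<lambda>_. rep_topology M) (frame_index M e))
       {u. frame_span M e u \<in> quiver_Gr M e}"

definition Gr_topology :: "'v::ab_group_add based_rep \<Rightarrow> (nat \<Rightarrow> nat) \<Rightarrow> (nat \<Rightarrow> 'v set) topology" where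
  "Gr_topology M e = topology (\<lambda>U. U \<subseteq> quiver_Gr M e \<and>
     openin (frame_topology M e) {u \<in> topspace (frame_topology M e). frame_span M e u \<in> U})"

lemma openin_Gr_topology:
  "openin (Gr_topology M e) U \<longleftrightarrow> U \<subseteq> quiver_Gr M e \<and>
     openin (frame_topology M e) {u \<in> topspace (frame_topology M e). frame_span M e u \<in> U}"
proof -
  let ?F = "frame_topology M e" and ?X = "quiver_Gr M e"
  let ?pre = "\<lambda>U. {u \<in> topspace ?F. frame_span M e u \<in> U}"
  have "istopology (\<lambda>U. U \<subseteq> ?X \<and> openin ?F (?pre U))"
    unfolding istopology_def
  proof (intro conjI allI impI)
    fix S T assume "S \<subseteq> ?X \<and> openin ?F (?pre S)" and "T \<subseteq> ?X \<and> openin ?F (?pre T)"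
    moreover have "?pre (S \<inter> T) = ?pre S \<inter> ?pre T" by auto
    ultimately show "S \<inter> T \<subseteq> ?X" and "openin ?F (?pre (S \<inter> T))" by auto
  next
    fix K assume K: "\<forall>S\<in>K. S \<subseteq> ?X \<and> openin ?F (?pre S)"
    then show "\<Union>K \<subseteq> ?X" by auto
    have "?pre (\<Union>K) = \<Union>(?pre ` K)" by auto
    then show "openin ?F (?pre (\<Union>K))" using K by auto
  qed
  then show ?thesis
    unfolding Gr_topology_def by (subst topology_inverse') auto
qed


section \<open>Torus actions\<close>

text \<open>
  The torus is \<open>(\<complex>\<^sup>*)\<^sup>d\<^sup>+\<^sup>1\<close> with coordinates indexed by \<open>{0..d}\<close>.  Cocharacters, and the exponent
  vectors of characters, are given by integers indexed by \<open>{0..d}\<close>.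
\<close>

definition torus :: "nat \<Rightarrow> (nat \<Rightarrow> complex) set" where
  "torus d = (\<Pi>\<^sub>E i\<in>{0..d}. - {0})"

definition character :: "nat \<Rightarrow> (nat \<Rightarrow> int) \<Rightarrow> (nat \<Rightarrow> complex) \<Rightarrow> complex" where
  "character d a \<gamma> = (\<Prod>i\<in>{0..d}. \<gamma> i powi a i)"

definition cocharacter :: "nat \<Rightarrow> (complex \<Rightarrow> nat \<Rightarrow> complex) \<Rightarrow> bool" where
  "cocharacter d chi \<longleftrightarrow> (\<exists>a::nat \<Rightarrow> int. \<forall>z. z \<noteq> 0 \<longrightarrow> chi z = (\<lambda>i\<in>{0..d}. z powi a i))"

text \<open>The linear map on the total space of \<open>M\<close> multiplying the basis vector with index \<open>q\<close> by \<open>c q\<close>.\<close>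

definition diag_map :: "'v::ab_group_add based_rep \<Rightarrow> (nat \<times> nat \<Rightarrow> complex) \<Rightarrow> 'v \<Rightarrow> 'v" where
  "diag_map M c x =
     (\<Sum>q\<in>basis_index M. smult M (c q * coords M x (basis_vec M q)) (basis_vec M q))"

definition diag_Gr :: "'v::ab_group_add based_rep \<Rightarrow> (nat \<times> nat \<Rightarrow> complex) \<Rightarrow> (nat \<Rightarrow> 'v set) \<Rightarrow> nat \<Rightarrow> 'v set" where
  "diag_Gr M c N = (\<lambda>i\<in>{..<vertices M}. diag_map M c ` N i)"

definition act :: "'v::ab_group_add based_rep \<Rightarrow> (nat \<Rightarrow> complex) \<Rightarrow> (nat \<Rightarrow> 'v set) \<Rightarrow> nat \<Rightarrow> 'v set" where
  "act M \<gamma> = diag_Gr M (\<lambda>(j, p). \<gamma> 0 ^ p * \<gamma> j)"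

definition grading_act :: "'v::ab_group_add based_rep \<Rightarrow> ('v \<Rightarrow> int) \<Rightarrow> complex \<Rightarrow> (nat \<Rightarrow> 'v set) \<Rightarrow> nat \<Rightarrow> 'v set" where
  "grading_act M wt z = diag_Gr M (\<lambda>q. z powi wt (basis_vec M q))"

definition fixed_points :: "'v::ab_group_add based_rep \<Rightarrow> (nat \<Rightarrow> nat) \<Rightarrow> (nat \<Rightarrow> 'v set) set" where
  "fixed_points M e = {x \<in> quiver_Gr M e. \<forall>\<gamma>\<in>torus (summands M). act M \<gamma> x = x}"

definition generic_cocharacter ::
    "'v::ab_group_add based_rep \<Rightarrow> (nat \<Rightarrow> nat) \<Rightarrow> (complex \<Rightarrow> nat \<Rightarrow> complex) \<Rightarrow> bool" where
  "generic_cocharacter M e chi \<longleftrightarrow> cocharacter (summands M) chi \<and>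
     {x \<in> quiver_Gr M e. \<forall>z. z \<noteq> 0 \<longrightarrow> act M (chi z) x = x} = fixed_points M e"

definition orbit :: "'v::ab_group_add based_rep \<Rightarrow> (nat \<Rightarrow> 'v set) \<Rightarrow> (nat \<Rightarrow> 'v set) set" where
  "orbit M x = (\<lambda>\<gamma>. act M \<gamma> x) ` torus (summands M)"

definition stabilizer :: "'v::ab_group_add based_rep \<Rightarrow> (nat \<Rightarrow> 'v set) \<Rightarrow> (nat \<Rightarrow> complex) set" where
  "stabilizer M x = {\<gamma> \<in> torus (summands M). act M \<gamma> x = x}"

text \<open>
  The orbit of \<open>x\<close> is isomorphic to \<open>T / Stab(x)\<close>, which is again a torus; its dimension is the rank
  of its character lattice, that is, of the lattice of those characters of \<open>T\<close> that are trivial on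
  \<open>Stab(x)\<close>.  The rank is the dimension of the rational span.
\<close>

definition orbit_characters :: "'v::ab_group_add based_rep \<Rightarrow> (nat \<Rightarrow> 'v set) \<Rightarrow> (nat \<Rightarrow> int) set" where
  "orbit_characters M x = {a. (\<forall>i>summands M. a i = 0) \<and>
     (\<forall>\<gamma>\<in>stabilizer M x. character (summands M) a \<gamma> = 1)}"

definition orbit_dim :: "'v::ab_group_add based_rep \<Rightarrow> (nat \<Rightarrow> 'v set) \<Rightarrow> nat" where
  "orbit_dim M x = vector_space.dim (\<lambda>(c::rat) (f::nat \<Rightarrow> rat) i. c * f i)
     ((\<lambda>a i. of_int (a i)) ` orbit_characters M x)"


section \<open>The moment graph\<close>

text \<open>
  An edge, the closure of a one-dimensional orbit, is represented by the orbit itself.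
\<close>

definition edges :: "'v::ab_group_add based_rep \<Rightarrow> (nat \<Rightarrow> nat) \<Rightarrow> (nat \<Rightarrow> 'v set) set set" where
  "edges M e = orbit M ` {x \<in> quiver_Gr M e. orbit_dim M x = 1}"

definition endpoints ::
    "'v::ab_group_add based_rep \<Rightarrow> (nat \<Rightarrow> nat) \<Rightarrow> (nat \<Rightarrow> 'v set) set \<Rightarrow> (nat \<Rightarrow> 'v set) set" where
  "endpoints M e E = fixed_points M e \<inter> (Gr_topology M e closure_of E)"

definition directed_edge ::
    "'v::ab_group_add based_rep \<Rightarrow> (nat \<Rightarrow> nat) \<Rightarrow> (complex \<Rightarrow> nat \<Rightarrow> complex) \<Rightarrow>
     (nat \<Rightarrow> 'v set) set \<Rightarrow> (nat \<Rightarrow> 'v set) \<Rightarrow> (nat \<Rightarrow> 'v set) \<Rightarrow> bool" where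
  "directed_edge M e chi E x y \<longleftrightarrow>
     E \<in> edges M e \<and> x \<in> endpoints M e E \<and> y \<in> endpoints M e E \<and> x \<noteq> y \<and>
     (\<forall>p\<in>E. limitin (Gr_topology M e) (\<lambda>z. act M (chi z) p) x (at 0))"

definition edges_from ::
    "'v::ab_group_add based_rep \<Rightarrow> (nat \<Rightarrow> nat) \<Rightarrow> (complex \<Rightarrow> nat \<Rightarrow> complex) \<Rightarrow>
     (nat \<Rightarrow> 'v set) \<Rightarrow> (nat \<Rightarrow> 'v set) set set" where
  "edges_from M e chi x = {E. \<exists>y. directed_edge M e chi E x y}"

text \<open>\<open>graph_ge M e chi x y\<close> means that there is a directed path from \<open>x\<close> to \<open>y\<close>.\<close>

definition graph_ge ::
    "'v::ab_group_add based_rep \<Rightarrow> (nat \<Rightarrow> nat) \<Rightarrow> (complex \<Rightarrow> nat \<Rightarrow> complex) \<Rightarrow>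
     (nat \<Rightarrow> 'v set) \<Rightarrow> (nat \<Rightarrow> 'v set) \<Rightarrow> bool" where
  "graph_ge M e chi = (\<lambda>x y. \<exists>E. directed_edge M e chi E x y)\<^sup>*\<^sup>*"

text \<open>
  The character \<open>a\<close> describes the action on \<open>E\<close>: under a suitable identification of \<open>E\<close> with \<open>\<complex>\<^sup>*\<close>
  the torus acts by multiplication by the values of \<open>a\<close>.  This determines \<open>a\<close> up to sign.
\<close>

definition describes_action ::
    "'v::ab_group_add based_rep \<Rightarrow> (nat \<Rightarrow> 'v set) set \<Rightarrow> (nat \<Rightarrow> int) \<Rightarrow> bool" where
  "describes_action M E a \<longleftrightarrow>
     (\<exists>\<phi>. bij_betw \<phi> (- {0::complex}) E \<and>
        (\<forall>\<gamma>\<in>torus (summands M). \<forall>z. z \<noteq> 0 \<longrightarrow>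
           act M \<gamma> (\<phi> z) = \<phi> (character (summands M) a \<gamma> * z)))"


section \<open>Equivariant cohomology and Knutson-Tao classes\<close>

text \<open>
  \<open>\<rat>[T]\<close> consists of the polynomials in the variables \<open>0, \<dots>, d\<close>; the variable \<open>0\<close> is \<open>\<delta>\<close> and
  the variable \<open>j \<ge> 1\<close> is \<open>\<epsilon>\<^sub>j\<close>.
\<close>

type_synonym qpoly = "(nat \<Rightarrow>\<^sub>0 nat) \<Rightarrow>\<^sub>0 rat"

definition coeff_ring :: "nat \<Rightarrow> qpoly set" where
  "coeff_ring d = {f. \<forall>m\<in>Poly_Mapping.keys f. Poly_Mapping.keys m \<subseteq> {0..d}}"

text \<open>A character, written additively, as a linear form.\<close>

definition char_form :: "nat \<Rightarrow> (nat \<Rightarrow> int) \<Rightarrow> qpoly" where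
  "char_form d a =
     (\<Sum>i\<in>{0..d}. Poly_Mapping.single (Poly_Mapping.single i 1) (of_int (a i)))"

text \<open>All variables have degree 2.  The zero polynomial is homogeneous of every degree.\<close>

definition monom_deg :: "(nat \<Rightarrow>\<^sub>0 nat) \<Rightarrow> nat" where
  "monom_deg m = 2 * (\<Sum>i\<in>Poly_Mapping.keys m. Poly_Mapping.lookup m i)"

definition poly_deg :: "qpoly \<Rightarrow> nat" where
  "poly_deg f = Max (insert 0 (monom_deg ` Poly_Mapping.keys f))"

definition homogeneous_poly :: "nat \<Rightarrow> qpoly \<Rightarrow> bool" where
  "homogeneous_poly k f \<longleftrightarrow> (\<forall>m\<in>Poly_Mapping.keys f. monom_deg m = k)"

definition eq_cohomology ::
    "'v::ab_group_add based_rep \<Rightarrow> (nat \<Rightarrow> nat) \<Rightarrow> ((nat \<Rightarrow> 'v set) set \<Rightarrow> nat \<Rightarrow> int) \<Rightarrow>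
     ((nat \<Rightarrow> 'v set) \<Rightarrow> qpoly) set" where
  "eq_cohomology M e \<alpha> =
     {f \<in> fixed_points M e \<rightarrow>\<^sub>E coeff_ring (summands M).
      \<forall>E\<in>edges M e. \<forall>x\<in>endpoints M e E. \<forall>y\<in>endpoints M e E.
        \<exists>r\<in>coeff_ring (summands M). f x - f y = char_form (summands M) (\<alpha> E) * r}"

definition KT_class ::
    "'v::ab_group_add based_rep \<Rightarrow> (nat \<Rightarrow> nat) \<Rightarrow> (complex \<Rightarrow> nat \<Rightarrow> complex) \<Rightarrow>
     ((nat \<Rightarrow> 'v set) set \<Rightarrow> nat \<Rightarrow> int) \<Rightarrow> (nat \<Rightarrow> 'v set) \<Rightarrow> ((nat \<Rightarrow> 'v set) \<Rightarrow> qpoly) \<Rightarrow> bool" where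
  "KT_class M e chi \<alpha> x f \<longleftrightarrow> f \<in> eq_cohomology M e \<alpha> \<and>
     f x = (\<Prod>E\<in>edges_from M e chi x. char_form (summands M) (\<alpha> E)) \<and>
     (\<forall>y\<in>fixed_points M e. homogeneous_poly (poly_deg (f x)) (f y)) \<and>
     (\<forall>y\<in>fixed_points M e. \<not> graph_ge M e chi y x \<longrightarrow> f y = 0)"

text \<open>
  The family \<open>P\<close>, indexed by the fixed points, is a basis of the module of tuples \<open>H\<close>:
  each element of \<open>H\<close> is a linear combination of the family in exactly one way.
\<close>

definition module_basis ::
    "qpoly set \<Rightarrow> 'x set \<Rightarrow> ('x \<Rightarrow> qpoly) set \<Rightarrow> ('x \<Rightarrow> 'x \<Rightarrow> qpoly) \<Rightarrow> bool" where
  "module_basis R F H P \<longleftrightarrow> (\<forall>x\<in>F. P x \<in> H) \<and>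
     (\<forall>f\<in>H. \<exists>!c. c \<in> F \<rightarrow>\<^sub>E R \<and> (\<forall>y\<in>F. f y = (\<Sum>x\<in>F. c x * P x y)))"

end

theory Submission
  imports Defs
begin

text \<open>
  By (H1) and (H2) every map of \<open>M\<close> is a shift of the indexed bases.  Hence on the universal cover
  of the cycle the basis vectors can be given integer positions preserved by the arrows; the
  indecomposable summands become strings, that is, positions modulo \<open>om\<close>, and string \<open>P\<close> occupies
  an interval of vertices whose end points are antitone in \<open>P\<close>.  A torus fixed point records where
  the subrepresentation starts on each string, which is a periodic word \<open>h\<close>.
  So \<open>X\<close> behaves like a finite union of Schubert varieties in an affine partial flag variety of type A:
  the edges starting at \<open>h\<close> are the inversions \<open>P < Q\<close>, \<open>h P < h Q\<close>, the edge swaps the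
  two values, and its label is the difference of the weights of the two strings.  Since swapping an
  inversion decreases the number of inversions, the number of outgoing edges is strictly monotone
  along the graph; with the pairwise coprimality of the labels this yields uniqueness and the
  basis property.  For existence, classes on all periodic words are
  constructed by recursion along simple reflections; that they satisfy the
  congruences is proved by induction on the number of inversions, where uniqueness in lower length
  identifies their left divided differences.
\<close>

section \<open>Polynomials\<close>

text \<open>The fixed points of \<open>X\<close> need not be stable under simple reflections:
  raising a word may violate the bounds \<open>lo P \<le> h P \<le> hi P\<close>. The set of all
  periodic words is stable, so simple reflections act on it without side conditions; hence the
  classes are built there and restricted afterwards. Restriction respects the edges because every
  inversion of a word of \<open>X\<close> leads again to a word of \<open>X\<close>, as
  \<open>lo\<close> and \<open>hi\<close> are antitone. The price is additional variables for the
  empty strings, which are set to zero at the end. The recursion for the value at \<open>y\<close>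
  uses one chosen descent \<open>s\<close> of \<open>y\<close>. The congruence for another inversion
  compares \<open>y\<close> with a lower word of which \<open>s\<close> need not be a descent, so
  that the recursion is silent there. The formula for the left divided difference holds for every
  simple \<open>s\<close> and closes this gap; independence of the choice of descents is never
  proved directly.\<close>

abbreviation lookup :: "('a \<Rightarrow>\<^sub>0 'b::zero) \<Rightarrow> 'a \<Rightarrow> 'b" where
  "lookup \<equiv> Poly_Mapping.lookup"
definition Const :: "rat \<Rightarrow> qpoly" where "Const c = Poly_Mapping.single 0 c"
definition Var :: "nat \<Rightarrow> qpoly" where "Var i = Poly_Mapping.single (Poly_Mapping.single i 1) 1"

lemma Const_mult: "Const (a * b) = Const a * Const b" by (simp add: Const_def mult_single)
lemma Const_add: "Const (a + b) = Const a + Const b" by (simp add: Const_def single_add)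
lemma Const_0 [simp]: "Const 0 = 0" and Const_1 [simp]: "Const 1 = 1" by (simp_all add: Const_def)
lemma Const_power: "Const (a ^ k) = Const a ^ k" by (induction k) (simp_all add: Const_mult)
lemma Const_eq_0_iff [simp]: "Const a = 0 \<longleftrightarrow> a = 0"
  unfolding Const_def by (metis lookup_single_eq lookup_zero single_zero)
lemma Const_of_int: "Const (of_int a) = of_int a" by (simp add: Const_def)
lemma Const_prod: "Const (prod f A) = (\<Prod>x\<in>A. Const (f x))"
  by (induction A rule: infinite_finite_induct) (simp_all add: Const_mult)
lemma lookup_Const_times [simp]: "lookup (Const c * f) m = c * lookup f m"
  unfolding Const_def mult_map_scale_conv_mult[symmetric]
  by (simp add: Poly_Mapping.map.rep_eq when_def)

lemma sum_of_terms: "f = (\<Sum>m\<in>Poly_Mapping.keys f. Poly_Mapping.single m (lookup f m))"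
  by (rule poly_mapping_eqI) (auto simp: lookup_sum lookup_single when_def in_keys_iff)

lemma term_eq:
  "Poly_Mapping.single m c = Const c * (\<Prod>i\<in>Poly_Mapping.keys m. Var i ^ lookup m i)"
proof -
  have pw: "Var i ^ k = Poly_Mapping.single (Poly_Mapping.single i k) 1" for i k
    by (induction k) (simp_all add: Var_def mult_single single_add[symmetric])
  have "finite A \<Longrightarrow> (\<Prod>i\<in>A. Var i ^ lookup m i)
      = Poly_Mapping.single (\<Sum>i\<in>A. Poly_Mapping.single i (lookup m i)) 1" for A
    by (induction rule: finite_induct) (simp_all add: pw mult_single del: One_nat_def)
  moreover have "(\<Sum>i\<in>Poly_Mapping.keys m. Poly_Mapping.single i (lookup m i)) = m"
    by (rule poly_mapping_eqI) (auto simp: lookup_sum lookup_single when_def in_keys_iff)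
  ultimately show ?thesis by (simp add: Const_def mult_single)
qed

text \<open>Constants and variables generate the ring, so identities and congruences between
  substitution homomorphisms need only be checked on them.\<close>

lemma qpoly_induct [case_names Const Var add mult]:
  assumes "\<And>c. P (Const c)" "\<And>i. P (Var i)" "\<And>f g. P f \<Longrightarrow> P g \<Longrightarrow> P (f + g)"
    "\<And>f g. P f \<Longrightarrow> P g \<Longrightarrow> P (f * g)"
  shows "P f"
proof -
  have 1: "P 1" using assms(1)[of 1] by simp
  have 0: "P 0" using assms(1)[of 0] by simp
  have pow: "P (g ^ k)" if "P g" for g k by (induction k) (use 1 assms(4) that in auto)
  have pr: "P (prod g A)" if "finite A" "\<And>i. P (g i)" for g and A :: "nat set"
    using that by (induction rule: finite_induct) (use 1 assms(4) in auto)
  have "P (Poly_Mapping.single m c)" for m c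
    unfolding term_eq by (intro assms pr pow finite_keys)
  moreover have "P (sum g A)" if "finite A" "\<And>i. P (g i)" for g and A :: "(nat \<Rightarrow>\<^sub>0 nat) set"
    using that by (induction rule: finite_induct) (use 0 assms(3) in auto)
  ultimately show ?thesis by (subst sum_of_terms) auto
qed

definition subst_mon :: "(nat \<Rightarrow> qpoly) \<Rightarrow> (nat \<Rightarrow>\<^sub>0 nat) \<Rightarrow> qpoly" where
  "subst_mon \<sigma> m = (\<Prod>i\<in>Poly_Mapping.keys m. \<sigma> i ^ lookup m i)"

definition subst :: "(nat \<Rightarrow> qpoly) \<Rightarrow> qpoly \<Rightarrow> qpoly" where
  "subst \<sigma> f = (\<Sum>m\<in>Poly_Mapping.keys f. Const (lookup f m) * subst_mon \<sigma> m)"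

lemma subst_add: "subst \<sigma> (f + g) = subst \<sigma> f + subst \<sigma> g"
  unfolding subst_def
  by (rule setsum_keys_plus_distrib) (simp_all add: Const_add distrib_right)

lemma subst_0 [simp]: "subst \<sigma> 0 = 0" by (simp add: subst_def)

lemma subst_sum: "subst \<sigma> (sum f A) = (\<Sum>a\<in>A. subst \<sigma> (f a))"
  by (induction A rule: infinite_finite_induct) (simp_all add: subst_add)

lemma subst_single: "subst \<sigma> (Poly_Mapping.single m c) = Const c * subst_mon \<sigma> m"
  by (simp add: subst_def)

lemma subst_mon_eq:
  "finite A \<Longrightarrow> Poly_Mapping.keys m \<subseteq> A \<Longrightarrow> subst_mon \<sigma> m = (\<Prod>i\<in>A. \<sigma> i ^ lookup m i)"
  unfolding subst_mon_def by (rule prod.mono_neutral_left) (auto simp: in_keys_iff)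

lemma subst_mon_add: "subst_mon \<sigma> (m + m') = subst_mon \<sigma> m * subst_mon \<sigma> m'"
proof -
  let ?A = "Poly_Mapping.keys m \<union> Poly_Mapping.keys m'"
  have "subst_mon \<sigma> (m + m') = (\<Prod>i\<in>?A. \<sigma> i ^ lookup (m + m') i)"
    using keys_add[of m m'] by (intro subst_mon_eq) auto
  then show ?thesis
    by (simp add: subst_mon_eq[of ?A m] subst_mon_eq[of ?A m'] lookup_add power_add prod.distrib)
qed

lemma subst_mult: "subst \<sigma> (f * g) = subst \<sigma> f * subst \<sigma> g"
proof -
  have "subst \<sigma> (Poly_Mapping.single m c * Poly_Mapping.single m' c')
     = subst \<sigma> (Poly_Mapping.single m c) * subst \<sigma> (Poly_Mapping.single m' c')" for m m' c c'
    by (simp add: mult_single subst_single subst_mon_add Const_mult)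
  then show ?thesis
    by (subst (2) sum_of_terms[of f], subst (2) sum_of_terms[of g],
        subst sum_of_terms[of f], subst sum_of_terms[of g])
      (simp add: sum_product subst_sum)
qed

lemma subst_Const [simp]: "subst \<sigma> (Const c) = Const c"
  by (simp add: Const_def subst_single subst_mon_def)

lemma subst_1 [simp]: "subst \<sigma> 1 = 1" using subst_Const[of \<sigma> 1] by simp

lemma subst_Var [simp]: "subst \<sigma> (Var i) = \<sigma> i"
  by (simp add: Var_def subst_single subst_mon_def)

lemma subst_diff: "subst \<sigma> (f - g) = subst \<sigma> f - subst \<sigma> g"
  by (metis add_diff_cancel_right' diff_add_cancel subst_add)

lemma subst_prod: "subst \<sigma> (prod f A) = (\<Prod>a\<in>A. subst \<sigma> (f a))"
  by (induction A rule: infinite_finite_induct) (simp_all add: subst_mult)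

lemma subst_subst: "subst \<sigma> (subst \<tau> f) = subst (\<lambda>i. subst \<sigma> (\<tau> i)) f"
  by (induction f rule: qpoly_induct) (simp_all add: subst_add subst_mult)

lemma subst_ident [simp]: "subst Var f = f"
  by (induction f rule: qpoly_induct) (simp_all add: subst_add subst_mult)

lemma subst_dvd: "a dvd b \<Longrightarrow> subst \<sigma> a dvd subst \<sigma> b"
  by (auto simp: dvd_def subst_mult)

text \<open>Modulo \<open>l\<close> the two evaluations agree on generators, hence everywhere; the
  product case splits the difference as in the Leibniz rule.\<close>

lemma subst_diff_dvd:
  assumes "\<And>i. l dvd \<sigma> i - \<tau> i"
  shows "l dvd subst \<sigma> f - subst \<tau> f"
proof (induction f rule: qpoly_induct)
  case (add f g)
  then have "l dvd (subst \<sigma> f - subst \<tau> f) + (subst \<sigma> g - subst \<tau> g)" by (rule dvd_add)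
  then show ?case by (simp add: subst_add algebra_simps)
next
  case (mult f g)
  then have "l dvd (subst \<sigma> f - subst \<tau> f) * subst \<sigma> g + subst \<tau> f * (subst \<sigma> g - subst \<tau> g)" by simp
  then show ?case by (simp add: subst_mult algebra_simps)
qed (use assms in auto)

subsection \<open>Homogeneity\<close>

definition tdeg :: "(nat \<Rightarrow>\<^sub>0 nat) \<Rightarrow> nat" where
  "tdeg m = (\<Sum>i\<in>Poly_Mapping.keys m. lookup m i)"

lemma monom_deg_tdeg: "monom_deg m = 2 * tdeg m"
  by (simp add: monom_deg_def tdeg_def)

definition scale2 :: "qpoly \<Rightarrow> qpoly" where
  "scale2 = subst (\<lambda>i. Const 2 * Var i)"

lemma lookup_scale2: "lookup (scale2 f) m = 2 ^ tdeg m * lookup f m"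
proof -
  have "scale2 (Poly_Mapping.single m' c) = Poly_Mapping.single m' (2 ^ tdeg m' * c)" for m' c
  proof -
    have "subst_mon (\<lambda>i. Const 2 * Var i) m'
        = Const (2 ^ tdeg m') * (\<Prod>i\<in>Poly_Mapping.keys m'. Var i ^ lookup m' i)"
      by (simp add: subst_mon_def power_mult_distrib prod.distrib Const_power Const_prod
        tdeg_def power_sum)
    then show ?thesis
      unfolding scale2_def subst_single term_eq[of m' "2 ^ tdeg m' * c"] Const_mult
      by (simp add: ac_simps)
  qed
  note 1 = this
  have "scale2 f = (\<Sum>m'\<in>Poly_Mapping.keys f. scale2 (Poly_Mapping.single m' (lookup f m')))"
    by (subst sum_of_terms[of f]) (simp only: scale2_def subst_sum)
  then show ?thesis
    by (auto simp: 1 lookup_sum lookup_single when_def in_keys_iff)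
qed

text \<open>Multiplying all variables by 2 detects the degree, so that questions on degrees become
  questions on ring homomorphisms.\<close>

lemma homogeneous_iff_scale2: "homogeneous_poly (2 * k) f \<longleftrightarrow> scale2 f = Const (2 ^ k) * f"
proof -
  have "homogeneous_poly (2 * k) f \<longleftrightarrow> (\<forall>m. lookup f m \<noteq> 0 \<longrightarrow> tdeg m = k)"
    by (auto simp: homogeneous_poly_def monom_deg_tdeg in_keys_iff)
  also have "\<dots> \<longleftrightarrow> (\<forall>m. 2 ^ tdeg m * lookup f m = 2 ^ k * lookup f m)"
    by auto
  also have "\<dots> \<longleftrightarrow> scale2 f = Const (2 ^ k) * f"
    by (simp add: poly_mapping_eq_iff fun_eq_iff lookup_scale2 )
  finally show ?thesis .
qed

lemma homogeneous_0 [simp]: "homogeneous_poly k 0"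
  by (simp add: homogeneous_poly_def)

lemma homogeneous_add: "homogeneous_poly k f \<Longrightarrow> homogeneous_poly k g \<Longrightarrow> homogeneous_poly k (f + g)"
  using keys_add[of f g] by (auto simp: homogeneous_poly_def)

lemma homogeneous_minus: "homogeneous_poly k f \<Longrightarrow> homogeneous_poly k (- f)"
  by (auto simp: homogeneous_poly_def)

lemma homogeneous_diff: "homogeneous_poly k f \<Longrightarrow> homogeneous_poly k g \<Longrightarrow> homogeneous_poly k (f - g)"
  using homogeneous_add[OF _ homogeneous_minus, of k f g] by simp

lemma homogeneous_mult:
  "homogeneous_poly (2 * k) f \<Longrightarrow> homogeneous_poly (2 * l) g \<Longrightarrow> homogeneous_poly (2 * (k + l)) (f * g)"
  unfolding homogeneous_iff_scale2 scale2_def subst_mult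
  by (simp add: power_add Const_mult ac_simps )

lemma homogeneous_Const [simp]: "homogeneous_poly 0 (Const c)"
  by (simp add: Const_def homogeneous_poly_def monom_deg_def)

lemma homogeneous_Const_mult: "homogeneous_poly (2 * k) f \<Longrightarrow> homogeneous_poly (2 * k) (Const c * f)"
  using homogeneous_mult[of 0 "Const c" k f] by simp

lemma homogeneous_Var: "homogeneous_poly 2 (Var i)"
  by (simp add: Var_def homogeneous_poly_def monom_deg_def)

lemma homogeneous_prod:
  assumes "\<And>a. a \<in> A \<Longrightarrow> homogeneous_poly 2 (f a)" "finite A"
  shows "homogeneous_poly (2 * card A) (prod f A)"
  using assms(2,1)
proof (induction rule: finite_induct)
  case empty then show ?case using homogeneous_Const[of 1] by simp
next
  case (insert a A)
  then show ?case using homogeneous_mult[of 1 "f a" "card A" "prod f A"] by auto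
qed

lemma homogeneous_subst:
  assumes "\<And>i. homogeneous_poly 2 (\<sigma> i)" "homogeneous_poly (2 * k) f"
  shows "homogeneous_poly (2 * k) (subst \<sigma> f)"
proof -
  have \<sigma>: "scale2 (\<sigma> i) = Const 2 * \<sigma> i" for i
    using assms(1)[of i] homogeneous_iff_scale2[of 1] by simp
  have "scale2 (subst \<sigma> f) = subst \<sigma> (scale2 f)"
    unfolding scale2_def subst_subst
    using \<sigma> by (simp add: subst_mult scale2_def )
  then show ?thesis
    using assms(2) unfolding homogeneous_iff_scale2 by (simp add: subst_mult )
qed

text \<open>As \<open>scale2\<close> is a homomorphism and the ring has no zero divisors,
  \<open>r\<close> is an eigenvector of \<open>scale2\<close> with eigenvalue
  \<open>2^k / 2^l\<close>. Comparing coefficients leaves only monomials of total degree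
  \<open>k - l\<close>, and none if \<open>k < l\<close>.\<close>

lemma homogeneous_factor:
  assumes "homogeneous_poly (2 * k) (p * r)" "homogeneous_poly (2 * l) p" "p \<noteq> 0"
  shows "k < l \<Longrightarrow> r = 0" "l \<le> k \<Longrightarrow> homogeneous_poly (2 * (k - l)) r"
proof -
  have "p * (Const (2 ^ l) * scale2 r) = p * (Const (2 ^ k) * r)"
    using assms(1,2) unfolding homogeneous_iff_scale2 by (simp add: scale2_def subst_mult ac_simps)
  then have "Const (2 ^ l) * scale2 r = Const (2 ^ k) * r"
    using assms(3) by simp
  then have eq: "2 ^ (l + tdeg m) * lookup r m = 2 ^ k * lookup r m" for m
    by (metis ab_semigroup_mult_class.mult_ac(1) lookup_Const_times lookup_scale2 power_add)
  then have *: "lookup r m \<noteq> 0 \<Longrightarrow> l + tdeg m = k" for m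
    using eq[of m] by (metis mult_cancel_right one_less_numeral_iff power_inject_exp semiring_norm(76))
  show "r = 0" if "k < l"
    by (rule poly_mapping_eqI) (use * that in fastforce)
  show "homogeneous_poly (2 * (k - l)) r" if "l \<le> k"
    using * unfolding homogeneous_poly_def monom_deg_tdeg in_keys_iff by fastforce
qed

lemma poly_deg_homogeneous:
  assumes "homogeneous_poly k f" "f \<noteq> 0"
  shows "poly_deg f = k"
proof -
  have "Poly_Mapping.keys f \<noteq> {}" using assms(2) by simp
  then have "monom_deg ` Poly_Mapping.keys f = {k}"
    using assms(1) unfolding homogeneous_poly_def by (metis image_cong image_constant_conv)
  then show ?thesis by (simp add: poly_deg_def)
qed

subsection \<open>Linear forms\<close>

definition linform :: "nat \<Rightarrow> (nat \<Rightarrow> rat) \<Rightarrow> qpoly" where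
  "linform d a = (\<Sum>i\<in>{0..d}. Const (a i) * Var i)"

lemma char_form_linform: "char_form d a = linform d (\<lambda>i. of_int (a i))"
  unfolding char_form_def linform_def Const_def Var_def
  by (intro sum.cong refl) (simp add: mult_single del: single_of_int)

text \<open>Solving \<open>l = 0\<close> for the variable \<open>k\<close> gives an endomorphism whose kernel is generated by \<open>l\<close>.\<close>

lemma dvd_iff_subst:
  assumes c: "c \<noteq> 0" and l: "subst (Var(k := Var k - Const (inverse c) * l)) l = 0"
  shows "l dvd f \<longleftrightarrow> subst (Var(k := Var k - Const (inverse c) * l)) f = 0" (is "_ \<longleftrightarrow> subst ?\<tau> f = 0")
proof
  assume "l dvd f"
  then show "subst ?\<tau> f = 0" using l by (auto simp: subst_mult)
next
  assume *: "subst ?\<tau> f = 0"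
  have "l dvd subst Var f - subst ?\<tau> f"
    by (rule subst_diff_dvd) auto
  then show "l dvd f" by (simp add: *)
qed

lemma subst_linform_elim:
  assumes "k \<le> d" "a k \<noteq> 0"
  shows "subst (Var(k := Var k - Const (inverse (a k)) * linform d a)) (linform d b)
    = linform d b - Const (b k * inverse (a k)) * linform d a"
proof -
  let ?\<tau> = "Var(k := Var k - Const (inverse (a k)) * linform d a)"
  have "subst ?\<tau> (linform d b) = (\<Sum>i\<in>{0..d}. Const (b i) * ?\<tau> i)"
    by (simp add: linform_def subst_sum subst_mult del: fun_upd_apply)
  also have "\<dots> = (\<Sum>i\<in>{0..d}. Const (b i) * Var i
      - (if i = k then Const (b k * inverse (a k)) * linform d a else 0))"
    by (rule sum.cong) (auto simp: algebra_simps Const_mult)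
  also have "\<dots> = linform d b - Const (b k * inverse (a k)) * linform d a"
    using assms by (simp add: sum_subtractf linform_def)
  finally show ?thesis .
qed

lemma linform_dvd_iff:
  assumes "k \<le> d" "a k \<noteq> 0"
  shows "linform d a dvd f \<longleftrightarrow> subst (Var(k := Var k - Const (inverse (a k)) * linform d a)) f = 0"
  by (rule dvd_iff_subst) (use assms in \<open>simp_all add: subst_linform_elim\<close>)

text \<open>The multiples of the form are the kernel of an endomorphism of an integral domain, hence
  a prime ideal.\<close>

lemma linform_dvd_mult:
  assumes "k \<le> d" "a k \<noteq> 0" "linform d a dvd f * g"
  shows "linform d a dvd f \<or> linform d a dvd g"
  using assms(3) unfolding linform_dvd_iff[where a=a and k=k and d=d, OF assms(1,2)] subst_mult by simp

lemma lookup_linform: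
  "lookup (linform d a) (Poly_Mapping.single i 1) = (if i \<le> d then a i else 0)"
proof -
  have "Poly_Mapping.single j 1 = Poly_Mapping.single i (1::nat) \<longleftrightarrow> j = i" for j
    by (metis inj_single injD lookup_single_eq lookup_single_not_eq zero_neq_one)
  then show ?thesis
    by (simp add: linform_def lookup_sum Var_def lookup_single when_def if_distrib[of "(*) _"] cong: if_cong)
qed

text \<open>Eliminating the variable \<open>k\<close> leaves nothing of a multiple, so the two forms
  are proportional; the factor is read off at \<open>k\<close>.\<close>

lemma linform_dvd_linform:
  assumes "k \<le> d" "a k \<noteq> 0" "linform d a dvd linform d b" "i \<le> d"
  shows "b i = b k / a k * a i"
proof -
  have "linform d b = Const (b k * inverse (a k)) * linform d a"
    using assms(3) unfolding linform_dvd_iff[where a=a and k=k and d=d, OF assms(1,2)] subst_linform_elim[where a=a and k=k and d=d, OF assms(1,2)] by simp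
  then have "lookup (linform d b) (Poly_Mapping.single i 1)
    = b k * inverse (a k) * lookup (linform d a) (Poly_Mapping.single i 1)" by simp
  then show ?thesis using assms(4) unfolding lookup_linform by (simp add: divide_inverse)
qed

text \<open>Each \<open>g a\<close> is prime, is no unit and divides no other \<open>g b\<close>. So
  it does not divide the product of the others and must divide the remaining cofactor. This takes
  the place of unique factorisation.\<close>

lemma prod_dvd:
  fixes g :: "'b \<Rightarrow> 'r::idom"
  assumes "finite A" "\<And>a. a \<in> A \<Longrightarrow> g a dvd f"
    "\<And>a u v. a \<in> A \<Longrightarrow> g a dvd u * v \<Longrightarrow> g a dvd u \<or> g a dvd v"
    "\<And>a b. a \<in> A \<Longrightarrow> b \<in> A \<Longrightarrow> a \<noteq> b \<Longrightarrow> \<not> g a dvd g b"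
    "\<And>a. a \<in> A \<Longrightarrow> \<not> g a dvd 1"
  shows "prod g A dvd f"
proof -
  have nd: "\<not> g a dvd prod g B" if "finite B" "B \<subseteq> A" "a \<in> A" "a \<notin> B" for a B
    using that
  proof (induction rule: finite_induct)
    case (insert b B)
    then show ?case using assms(3)[of a "g b" "prod g B"] assms(4)[of a b] by auto
  qed (use assms(5) in auto)
  have "B \<subseteq> A \<Longrightarrow> prod g B dvd f" if "finite B" for B using that
  proof (induction rule: finite_induct)
    case (insert b B)
    then obtain r where r: "f = prod g B * r" by auto
    then have "g b dvd prod g B \<or> g b dvd r" using insert assms(2)[of b] assms(3)[of b] by auto
    then have "g b dvd r" using nd[of B b] insert by auto
    then show ?case using insert r by (auto simp: mult.commute mult_dvd_mono)
  qed auto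
  then show ?thesis using assms(1) by auto
qed

subsection \<open>The coefficient ring\<close>

text \<open>A ring retraction onto \<open>coeff_ring d\<close>. Membership becomes a fixed-point
  equation, from which the closure properties follow; it also removes the variables that empty
  strings introduce.\<close>

definition restrict_vars :: "nat \<Rightarrow> qpoly \<Rightarrow> qpoly" where
  "restrict_vars d = subst (\<lambda>i. if i \<le> d then Var i else 0)"

lemma subst_mon_restrict:
  "subst_mon (\<lambda>i. if i \<le> d then Var i else 0) m =
    (if Poly_Mapping.keys m \<subseteq> {0..d} then Poly_Mapping.single m 1 else 0)"
proof (cases "Poly_Mapping.keys m \<subseteq> {0..d}")
  case True
  then have "subst_mon (\<lambda>i. if i \<le> d then Var i else 0) m = (\<Prod>i\<in>Poly_Mapping.keys m. Var i ^ lookup m i)"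
    unfolding subst_mon_def by (intro prod.cong) auto
  then show ?thesis using True term_eq[of m 1] by simp
next
  case False
  then show ?thesis unfolding subst_mon_def
    by (auto simp: in_keys_iff intro!: prod_zero)
qed

lemma restrict_vars_in: "restrict_vars d f \<in> coeff_ring d"
proof -
  have "Poly_Mapping.keys (restrict_vars d f) \<subseteq> {m. Poly_Mapping.keys m \<subseteq> {0..d}}"
    unfolding restrict_vars_def subst_def subst_mon_restrict
    by (rule order_trans[OF keys_sum]) (auto simp: Const_def mult_single split: if_splits, meson atLeastAtMost_iff subsetD)
  then show ?thesis by (auto simp: coeff_ring_def)
qed

lemma restrict_vars_ident:
  assumes "f \<in> coeff_ring d"
  shows "restrict_vars d f = f"
proof -
  have "restrict_vars d f = (\<Sum>m\<in>Poly_Mapping.keys f. Poly_Mapping.single m (lookup f m))"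
    unfolding restrict_vars_def subst_def using assms
    by (intro sum.cong) (auto simp: coeff_ring_def subst_mon_restrict Const_def mult_single)
  then show ?thesis using sum_of_terms[of f] by simp
qed

lemma coeff_ring_iff: "f \<in> coeff_ring d \<longleftrightarrow> restrict_vars d f = f"
  by (metis restrict_vars_ident restrict_vars_in)

lemma coeff_ring_closed:
  "0 \<in> coeff_ring d" "1 \<in> coeff_ring d" "Const c \<in> coeff_ring d"
  "f \<in> coeff_ring d \<Longrightarrow> g \<in> coeff_ring d \<Longrightarrow> f + g \<in> coeff_ring d"
  "f \<in> coeff_ring d \<Longrightarrow> g \<in> coeff_ring d \<Longrightarrow> f - g \<in> coeff_ring d"
  "f \<in> coeff_ring d \<Longrightarrow> g \<in> coeff_ring d \<Longrightarrow> f * g \<in> coeff_ring d"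
  unfolding coeff_ring_iff restrict_vars_def
  by (simp_all add: subst_add subst_diff subst_mult)

lemma coeff_ring_sum: "(\<And>a. a \<in> A \<Longrightarrow> f a \<in> coeff_ring d) \<Longrightarrow> sum f A \<in> coeff_ring d"
  by (induction A rule: infinite_finite_induct) (auto simp: coeff_ring_closed)

lemma coeff_ring_prod: "(\<And>a. a \<in> A \<Longrightarrow> f a \<in> coeff_ring d) \<Longrightarrow> prod f A \<in> coeff_ring d"
  by (induction A rule: infinite_finite_induct) (auto simp: coeff_ring_closed)

lemma linform_in_coeff_ring: "linform d a \<in> coeff_ring d"
  unfolding coeff_ring_iff linform_def restrict_vars_def
  by (simp add: subst_sum subst_mult)

lemma coeff_ring_dvd:
  assumes "f \<in> coeff_ring d" "g \<in> coeff_ring d" "f dvd g"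
  shows "\<exists>r\<in>coeff_ring d. g = f * r"
proof -
  obtain r where "g = f * r" using assms(3) by auto
  then have "restrict_vars d g = restrict_vars d f * restrict_vars d r"
    by (simp add: restrict_vars_def subst_mult)
  then have "g = f * restrict_vars d r" using assms(1,2) by (simp add: coeff_ring_iff)
  then show ?thesis using restrict_vars_in by blast
qed

section \<open>Knutson-Tao classes from simple reflections\<close>

text \<open>\<open>Phi\<close> plays the positive reflections, \<open>Inv y\<close> those that lower
  \<open>y\<close>, \<open>tr s\<close> the conjugation by a simple reflection on the positive
  reflections other than \<open>s\<close>, and \<open>sg s\<close> the action of \<open>s\<close> on
  polynomials. Words may have stabilisers: by \<open>s_fix\<close> a simple reflection that neither
  lowers nor raises \<open>y\<close> fixes it, so \<open>C\<close> behaves like a union of parabolic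
  quotients.\<close>

locale reflection_system =
  fixes C :: "'c set" and Inv :: "'c \<Rightarrow> 'b set" and r :: "'b \<Rightarrow> 'c \<Rightarrow> 'c"
    and a :: "'b \<Rightarrow> qpoly" and Phi S :: "'b set" and tr :: "'b \<Rightarrow> 'b \<Rightarrow> 'b"
    and sg :: "'b \<Rightarrow> nat \<Rightarrow> qpoly"
  assumes fin: "y \<in> C \<Longrightarrow> finite (Inv y)"
    and Inv_Phi: "y \<in> C \<Longrightarrow> Inv y \<subseteq> Phi"
    and S_Phi: "S \<subseteq> Phi"
    and r_C: "y \<in> C \<Longrightarrow> \<beta> \<in> Inv y \<Longrightarrow> r \<beta> y \<in> C"
    and r_less: "y \<in> C \<Longrightarrow> \<beta> \<in> Inv y \<Longrightarrow> card (Inv (r \<beta> y)) < card (Inv y)"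
    and s_C: "s \<in> S \<Longrightarrow> y \<in> C \<Longrightarrow> r s y \<in> C"
    and s_invol: "s \<in> S \<Longrightarrow> y \<in> C \<Longrightarrow> r s (r s y) = y"
    and s_Inv: "s \<in> S \<Longrightarrow> y \<in> C \<Longrightarrow> Inv (r s y) - {s} = tr s ` (Inv y - {s})"
    and tr_inj: "s \<in> S \<Longrightarrow> y \<in> C \<Longrightarrow> inj_on (tr s) (Inv y - {s})"
    and s_desc: "s \<in> S \<Longrightarrow> y \<in> C \<Longrightarrow> s \<in> Inv y \<Longrightarrow> s \<notin> Inv (r s y)"
    and s_fix: "s \<in> S \<Longrightarrow> y \<in> C \<Longrightarrow> s \<notin> Inv y \<Longrightarrow> s \<notin> Inv (r s y) \<Longrightarrow> r s y = y"
    and r_conj: "s \<in> S \<Longrightarrow> y \<in> C \<Longrightarrow> \<beta> \<in> Inv y \<Longrightarrow> \<beta> \<noteq> s \<Longrightarrow> r (tr s \<beta>) (r s y) = r s (r \<beta> y)"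
    and a_hom: "\<beta> \<in> Phi \<Longrightarrow> homogeneous_poly 2 (a \<beta>)"
    and a_nz: "\<beta> \<in> Phi \<Longrightarrow> a \<beta> \<noteq> 0"
    and a_prime: "\<beta> \<in> Phi \<Longrightarrow> a \<beta> dvd f * g \<Longrightarrow> a \<beta> dvd f \<or> a \<beta> dvd g"
    and a_ndvd: "\<beta> \<in> Phi \<Longrightarrow> \<beta>' \<in> Phi \<Longrightarrow> \<beta> \<noteq> \<beta>' \<Longrightarrow> \<not> a \<beta> dvd a \<beta>'"
    and sg_hom: "s \<in> S \<Longrightarrow> homogeneous_poly 2 (sg s i)"
    and sg_a: "s \<in> S \<Longrightarrow> \<beta> \<in> Phi \<Longrightarrow> \<beta> \<noteq> s \<Longrightarrow> subst (sg s) (a \<beta>) = a (tr s \<beta>)"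
    and sg_s: "s \<in> S \<Longrightarrow> subst (sg s) (a s) = - a s"
    and sg_refl: "s \<in> S \<Longrightarrow> a s dvd Var i - sg s i"
    and sg_invol: "s \<in> S \<Longrightarrow> subst (sg s) (sg s i) = Var i"
    and desc_ex: "y \<in> C \<Longrightarrow> Inv y \<noteq> {} \<Longrightarrow> \<exists>s\<in>S. s \<in> Inv y"
begin

abbreviation len where "len y \<equiv> card (Inv y)"

lemma sg_sg: "s \<in> S \<Longrightarrow> subst (sg s) (subst (sg s) f) = f"
  by (simp add: subst_subst sg_invol)

lemma s_refl_dvd: "s \<in> S \<Longrightarrow> a s dvd f - subst (sg s) f"
  using subst_diff_dvd[of "a s" Var "sg s" f] sg_refl by simp

lemma prod_dvd_Phi:
  assumes "finite B" "B \<subseteq> Phi" "\<And>\<beta>. \<beta> \<in> B \<Longrightarrow> a \<beta> dvd f"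
  shows "prod a B dvd f"
proof (rule prod_dvd)
  show "\<not> a \<beta> dvd 1" if "\<beta> \<in> B" for \<beta>
  proof
    assume "a \<beta> dvd 1"
    then obtain q where q: "1 = a \<beta> * q" by auto
    have "q = 0"
      by (rule homogeneous_factor(1)[of 0 "a \<beta>" q 1])
        (use q homogeneous_Const[of 1] a_hom a_nz that assms(2) in auto)
    with q show False by simp
  qed
qed (use assms a_prime a_ndvd in \<open>meson subsetD\<close>)+

lemma tr_Inv: "s \<in> S \<Longrightarrow> y \<in> C \<Longrightarrow> \<beta> \<in> Inv y \<Longrightarrow> \<beta> \<noteq> s \<Longrightarrow> tr s \<beta> \<in> Inv (r s y)"
  using s_Inv[of s y] by blast

text \<open>\<open>tr s\<close> matches the inversions of \<open>y\<close> other than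
  \<open>s\<close> with those of \<open>r s y\<close>, and \<open>s\<close> itself
  disappears.\<close>

lemma len_s_desc: assumes "s \<in> S" "y \<in> C" "s \<in> Inv y" shows "len y = Suc (len (r s y))"
proof -
  have "Inv (r s y) = tr s ` (Inv y - {s})" using s_Inv[OF assms(1,2)] s_desc[OF assms] by auto
  then have "len (r s y) = card (Inv y - {s})" using card_image[OF tr_inj[OF assms(1,2)]] by simp
  then show ?thesis using fin[OF assms(2)] assms(3) by (metis card.remove)
qed

lemma len_s_cases:
  assumes "s \<in> S" "y \<in> C"
  obtains "s \<in> Inv y" "len y = Suc (len (r s y))"
  | "s \<notin> Inv y" "s \<in> Inv (r s y)" "len (r s y) = Suc (len y)"
  | "s \<notin> Inv y" "r s y = y"
  using len_s_desc[OF assms] len_s_desc[OF assms(1) s_C[OF assms]] s_invol[OF assms] s_fix[OF assms]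
  by metis

section \<open>Recursive construction of the classes\<close>

definition desc where "desc y = (SOME s. s \<in> S \<and> s \<in> Inv y)"

lemma desc: assumes "y \<in> C" "Inv y \<noteq> {}" shows "desc y \<in> S" "desc y \<in> Inv y"
  using someI_ex[of "\<lambda>s. s \<in> S \<and> s \<in> Inv y"] desc_ex[OF assms] unfolding desc_def by auto

text \<open>This solves the expected divided difference formula for the value at \<open>y\<close>.
  Writing \<open>s\<close> also for its actions, \<open>xi x y - s (xi x (s y))\<close> should be
  \<open>a s * xi (s x) y\<close> if \<open>s\<close> lowers \<open>x\<close> and 0 otherwise, and
  \<open>xi (s x) y\<close> should be \<open>s (xi (s x) (s y))\<close> because \<open>s\<close>
  does not lower \<open>s x\<close>. As \<open>sg s\<close> negates \<open>a s\<close>, the sign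
  inside the substitution is minus. The counter is the length of \<open>y\<close>, which drops by
  one in each step.\<close>

primrec xiN :: "nat \<Rightarrow> 'c \<Rightarrow> 'c \<Rightarrow> qpoly" where
  "xiN 0 x y = (if x = y then 1 else 0)"
| "xiN (Suc N) x y = subst (sg (desc y)) (xiN N x (r (desc y) y)
      - (if desc y \<in> Inv x then a (desc y) * xiN N (r (desc y) x) (r (desc y) y) else 0))"

definition xi where "xi x y = xiN (len y) x y"

lemma xi_0: "y \<in> C \<Longrightarrow> len y = 0 \<Longrightarrow> xi x y = (if x = y then 1 else 0)"
  by (simp add: xi_def)

lemma xi_step:
  assumes "y \<in> C" "len y > 0" "s = desc y"
  shows "xi x y = subst (sg s) (xi x (r s y)) + (if s \<in> Inv x then a s * subst (sg s) (xi (r s x) (r s y)) else 0)"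
    "s \<in> S" "s \<in> Inv y"
proof -
  have ne: "Inv y \<noteq> {}" using assms(2) by auto
  show s: "s \<in> S" "s \<in> Inv y" using desc[OF assms(1) ne] assms(3) by auto
  then show "xi x y = subst (sg s) (xi x (r s y)) + (if s \<in> Inv x then a s * subst (sg s) (xi (r s x) (r s y)) else 0)"
    using assms len_s_desc[of s y]
    by (simp add: xi_def subst_diff subst_mult sg_s)
qed

text \<open>Triangularity survives the recursion: \<open>x\<close> is longer than
  \<open>r s y\<close>, hence different from it; if \<open>s\<close> lowers \<open>x\<close>, then
  \<open>r s x \<noteq> r s y\<close> because \<open>r s\<close> is an involution, and both lengths
  have dropped by one.\<close>

lemma xi_low: "x \<in> C \<Longrightarrow> y \<in> C \<Longrightarrow> len y \<le> len x \<Longrightarrow> x \<noteq> y \<Longrightarrow> xi x y = 0"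
proof (induction "len y" arbitrary: x y)
  case 0 then show ?case by (simp add: xi_0)
next
  case (Suc N)
  define s where "s = desc y"
  note st = xi_step[OF Suc.prems(2) _ s_def]
  have s: "s \<in> S" "s \<in> Inv y" using st Suc by auto
  have l: "len y = Suc (len (r s y))" using len_s_desc s Suc by auto
  have "x \<noteq> r s y" using Suc.prems l by auto
  then have 1: "xi x (r s y) = 0"
    using Suc.hyps(1)[of "r s y" x] Suc.hyps(2) Suc.prems l s s_C[of s y] by auto
  have 2: "xi (r s x) (r s y) = 0" if "s \<in> Inv x"
  proof -
    have "len x = Suc (len (r s x))" using len_s_desc s Suc.prems that by auto
    moreover have "r s x \<noteq> r s y" using s_invol s Suc.prems by metis
    ultimately show ?thesis
      using Suc.hyps(1)[of "r s y" "r s x"] Suc.hyps(2) Suc.prems l s s_C by auto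
  qed
  show ?case using st(1)[of x] 1 2 Suc.hyps(2) by simp
qed

lemma prod_Inv_s:
  assumes "s \<in> S" "y \<in> C" "s \<in> Inv y"
  shows "prod a (Inv y) = a s * subst (sg s) (prod a (Inv (r s y)))"
proof -
  have sy: "r s y \<in> C" using s_C assms by auto
  have s: "s \<notin> Inv (r s y)" using s_desc assms by auto
  then have eq: "Inv y - {s} = tr s ` Inv (r s y)"
    using s_Inv[OF assms(1) sy] s_invol[OF assms(1,2)] by auto
  have "prod a (Inv y) = a s * prod a (Inv y - {s})"
    using assms fin by (simp add: prod.remove)
  also have "prod a (Inv y - {s}) = (\<Prod>\<beta>\<in>Inv (r s y). a (tr s \<beta>))"
    unfolding eq using tr_inj[OF assms(1) sy] s by (subst prod.reindex) auto
  also have "\<dots> = (\<Prod>\<beta>\<in>Inv (r s y). subst (sg s) (a \<beta>))"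
    using sg_a[OF assms(1)] s Inv_Phi[OF sy] by (intro prod.cong) (metis subsetD | simp)+
  finally show ?thesis by (simp add: subst_prod)
qed

text \<open>In the recursion at \<open>y = x\<close> the first term vanishes by
  \<open>xi_low\<close>, and the second one builds up the product over the inversions.\<close>

lemma xi_diag: "x \<in> C \<Longrightarrow> xi x x = prod a (Inv x)"
proof (induction "len x" arbitrary: x)
  case 0 then show ?case using fin[of x] by (simp add: xi_0)
next
  case (Suc N)
  define s where "s = desc x"
  note st = xi_step[OF Suc.prems(1) _ s_def]
  have s: "s \<in> S" "s \<in> Inv x" using st Suc by auto
  have l: "len x = Suc (len (r s x))" using len_s_desc s Suc by auto
  have "xi x (r s x) = 0" using xi_low[of x "r s x"] l s_C s Suc.prems by fastforce
  then show ?case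
    using st(1)[of x] Suc.hyps l s s_C[of s x] Suc.prems prod_Inv_s[of s x] by simp
qed

lemma xi_hom: "x \<in> C \<Longrightarrow> y \<in> C \<Longrightarrow> homogeneous_poly (2 * len x) (xi x y)"
proof (induction "len y" arbitrary: x y)
  case 0
  then show ?case using homogeneous_Const[of 1] by (auto simp: xi_0)
next
  case (Suc N)
  define s where "s = desc y"
  note st = xi_step[OF Suc.prems(2) _ s_def]
  have s: "s \<in> S" "s \<in> Inv y" using st Suc by auto
  have l: "len y = Suc (len (r s y))" using len_s_desc s Suc by auto
  have 1: "homogeneous_poly (2 * len x) (subst (sg s) (xi x (r s y)))"
    using Suc.hyps(1)[of "r s y" x] Suc.hyps(2) l Suc.prems s_C s sg_hom
    by (intro homogeneous_subst) auto
  have 2: "homogeneous_poly (2 * len x) (a s * subst (sg s) (xi (r s x) (r s y)))" if "s \<in> Inv x"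
  proof -
    have "len x = 1 + len (r s x)" using len_s_desc s Suc.prems that by auto
    moreover have "homogeneous_poly (2 * len (r s x)) (subst (sg s) (xi (r s x) (r s y)))"
      using Suc.hyps(1)[of "r s y" "r s x"] Suc.hyps(2) l Suc.prems s_C s sg_hom
      by (intro homogeneous_subst) auto
    ultimately show ?thesis
      using homogeneous_mult[of 1 "a s"] a_hom S_Phi s by auto
  qed
  show ?case using st(1)[of x] 1 2 Suc.hyps(2) homogeneous_add by simp
qed

section \<open>Congruences for the recursively constructed classes\<close>

definition GKM where "GKM N \<longleftrightarrow>
  (\<forall>x\<in>C. \<forall>y\<in>C. len y \<le> N \<longrightarrow> (\<forall>\<beta>\<in>Inv y. a \<beta> dvd xi x y - xi x (r \<beta> y)))"

text \<open>The left divided difference of a class is again a class, of degree one less, and so it is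
  determined by its values on elements of small length.\<close>

lemma xi_divided_difference:
  assumes N: "GKM N" and x: "x \<in> C" and s: "s \<in> S" and y: "y \<in> C" "len y \<le> N" "len (r s y) \<le> N"
  shows "xi x y - subst (sg s) (xi x (r s y)) = (if s \<in> Inv x then a s * xi (r s x) y else 0)"
proof -
  let ?\<sigma> = "subst (sg s)"
  \<comment> \<open>\<open>J\<close> consists of the words at which the hypothesis controls both
    \<open>z\<close> and \<open>r s z\<close>. It is stable under \<open>r s\<close> and under
    lowering by an inversion, so the uniqueness argument can be run inside it.\<close>
  define J where "J = {y \<in> C. len y \<le> N \<and> len (r s y) \<le> N}"
  define D where "D z = xi x z - ?\<sigma> (xi x (r s z))" for z
  have dvdN: "a \<beta> dvd xi u z - xi u (r \<beta> z)" if "u \<in> C" "z \<in> C" "len z \<le> N" "\<beta> \<in> Inv z" for u z \<beta>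
    using N that unfolding GKM_def by auto
  have a0: "a s \<noteq> 0" using a_nz S_Phi s by auto
  have sx: "r s x \<in> C" using s_C s x by auto
  have JC: "z \<in> C" "r s z \<in> C" if "z \<in> J" for z using that s_C s unfolding J_def by auto
  have Js: "r s z \<in> J" if "z \<in> J" for z using that s_C s s_invol unfolding J_def by auto
  have Jr: "r \<beta> z \<in> J" if z: "z \<in> J" and b: "\<beta> \<in> Inv z" for z \<beta>
  proof (cases "\<beta> = s")
    case True then show ?thesis using Js z by simp
  next
    case False
    have "r s (r \<beta> z) = r (tr s \<beta>) (r s z)" using r_conj[OF s JC(1)[OF z] b False] by simp
    moreover have "len (r (tr s \<beta>) (r s z)) < len (r s z)"
      using r_less[OF JC(2)[OF z] tr_Inv[OF s JC(1)[OF z] b False]] .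
    ultimately show ?thesis
      using z r_less[OF JC(1)[OF z] b] r_C[OF JC(1)[OF z] b] unfolding J_def by auto
  qed
  have "a s dvd D z" if z: "z \<in> J" for z
  proof -
    have "a s dvd xi x z - xi x (r s z)"
    proof (cases rule: len_s_cases[OF s JC(1)[OF z]])
      case 1 then show ?thesis using dvdN[OF x JC(1)[OF z]] z J_def by auto
    next
      case 2
      then have "a s dvd xi x (r s z) - xi x (r s (r s z))"
        using dvdN[OF x JC(2)[OF z]] z J_def by auto
      then show ?thesis using s_invol[OF s JC(1)[OF z]] by (metis dvd_minus_iff minus_diff_eq)
    qed auto
    from dvd_add[OF this s_refl_dvd[OF s, of "xi x (r s z)"]] show ?thesis by (simp add: D_def)
  qed
  then have "\<forall>z\<in>J. \<exists>g. D z = a s * g" by auto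
  then obtain G where G: "\<And>z. z \<in> J \<Longrightarrow> D z = a s * G z" by metis
  \<comment> \<open>\<open>G\<close> is the left divided difference of the class of
    \<open>x\<close>, and \<open>K\<close> is its deviation from the expected value.
    \<open>K\<close> satisfies the same congruences and its degree is one less than that of the
    class, so it is forced to vanish once it does so in low lengths.\<close>
  define K where "K z = G z - (if s \<in> Inv x then xi (r s x) z else 0)" for z
  have Gdvd: "a \<beta> dvd G z - G (r \<beta> z)" if z: "z \<in> J" and b: "\<beta> \<in> Inv z" for z \<beta>
  proof (cases "\<beta> = s")
    case True
    \<comment> \<open>Passing from \<open>z\<close> to \<open>r s z\<close> applies \<sigma> to
      \<open>D\<close> up to a sign, and \<sigma> also negates \<open>a s\<close>. So
      \<open>G\<close> is equivariant and differs from its reflection by a multiple of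
      \<open>a s\<close>.\<close>
    have "D (r s z) = - ?\<sigma> (D z)"
      using s_invol[OF s JC(1)[OF z]] sg_sg[OF s] by (simp add: D_def subst_diff)
    then have "a s * G (r s z) = a s * ?\<sigma> (G z)"
      using G[OF z] G[OF Js[OF z]] sg_s[OF s] by (simp add: subst_mult)
    then have "G (r s z) = ?\<sigma> (G z)" using a0 by simp
    then show ?thesis using s_refl_dvd[OF s] True by simp
  next
    case False
    let ?b = "tr s \<beta>"
    have bi: "?b \<in> Inv (r s z)" using tr_Inv[OF s JC(1)[OF z] b False] .
    have bP: "\<beta> \<in> Phi" using b Inv_Phi JC[OF z] by auto
    have "?\<sigma> (a ?b) = a \<beta>" using sg_a[OF s bP False] sg_sg[OF s, of "a \<beta>"] by simp
    moreover have "a ?b dvd xi x (r s z) - xi x (r s (r \<beta> z))"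
      using dvdN[OF x JC(2)[OF z] _ bi] z r_conj[OF s JC(1)[OF z] b False] J_def by auto
    ultimately have "a \<beta> dvd ?\<sigma> (xi x (r s z) - xi x (r s (r \<beta> z)))" using subst_dvd by metis
    moreover have "a \<beta> dvd xi x z - xi x (r \<beta> z)" using dvdN[OF x JC(1)[OF z] _ b] z J_def by auto
    ultimately have "a \<beta> dvd (xi x z - xi x (r \<beta> z)) - ?\<sigma> (xi x (r s z) - xi x (r s (r \<beta> z)))"
      by (rule dvd_diff[rotated])
    also have "\<dots> = D z - D (r \<beta> z)" by (simp add: D_def subst_diff)
    also have "\<dots> = a s * (G z - G (r \<beta> z))" using G[OF z] G[OF Jr[OF z b]] by (simp add: algebra_simps)
    finally show ?thesis using a_prime[OF bP] a_ndvd[OF bP _ False] S_Phi s by blast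
  qed
  have Kdvd: "a \<beta> dvd K z - K (r \<beta> z)" if z: "z \<in> J" and b: "\<beta> \<in> Inv z" for z \<beta>
  proof -
    have "a \<beta> dvd xi (r s x) z - xi (r s x) (r \<beta> z)" using dvdN[OF sx JC(1)[OF z] _ b] z J_def by auto
    from dvd_diff[OF Gdvd[OF z b] this] show ?thesis
      using Gdvd[OF z b] by (simp add: K_def algebra_simps)
  qed
  have Dhom: "homogeneous_poly (2 * len x) (D z)" if "z \<in> J" for z
    unfolding D_def using xi_hom[OF x] JC[OF that] sg_hom[OF s]
    by (intro homogeneous_diff homogeneous_subst) auto
  have as: "homogeneous_poly (2 * 1) (a s)" using a_hom S_Phi s by auto
  have K0: "K z = 0" if "z \<in> J" for z
    using that
  proof (induction "len z" arbitrary: z rule: less_induct)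
    case less
    note z = less.prems
    show ?case
    proof (cases "len x = 0")
      case True
      \<comment> \<open>If \<open>x\<close> has length 0, then \<open>D z\<close> has degree 0 and
        cannot be a nonzero multiple of \<open>a s\<close>.\<close>
      then have "G z = 0" using homogeneous_factor(1)[OF _ as a0, of "len x" "G z"] Dhom[OF z] G[OF z] by simp
      then show ?thesis using True fin[OF x] by (simp add: K_def)
    next
      case False
      have "homogeneous_poly (2 * (len x - 1)) (G z)"
        using homogeneous_factor(2)[OF _ as a0, of "len x" "G z"] Dhom[OF z] G[OF z] False by simp
      moreover have "homogeneous_poly (2 * (len x - 1)) (xi (r s x) z)" if "s \<in> Inv x"
        using xi_hom[OF sx JC(1)[OF z]] len_s_desc[OF s x that] by simp
      ultimately have Khom: "homogeneous_poly (2 * (len x - 1)) (K z)"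
        unfolding K_def by (auto intro!: homogeneous_diff)
      show ?thesis
      proof (cases "len z \<le> len x - 1")
        case False
        \<comment> \<open>All lower neighbours vanish by induction, so the product of
          \<open>len z\<close> labels divides \<open>K z\<close>, whose degree suffices for only
          \<open>len x - 1\<close> of them.\<close>
        have "a \<beta> dvd K z" if b: "\<beta> \<in> Inv z" for \<beta>
          using Kdvd[OF z b] less.hyps[OF r_less[OF JC(1)[OF z] b] Jr[OF z b]] by simp
        then have "prod a (Inv z) dvd K z"
          using prod_dvd_Phi fin Inv_Phi JC[OF z] by auto
        then obtain q where q: "K z = prod a (Inv z) * q" by auto
        have "homogeneous_poly (2 * len z) (prod a (Inv z))"
          using fin Inv_Phi JC(1)[OF z] a_hom by (intro homogeneous_prod) auto
        moreover have "prod a (Inv z) \<noteq> 0" using fin Inv_Phi JC(1)[OF z] a_nz by auto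
        ultimately have "q = 0" using homogeneous_factor(1)[of "len x - 1" "prod a (Inv z)" q] q Khom False by auto
        with q show ?thesis by simp
      next
        case True
        \<comment> \<open>Here the class of \<open>x\<close> vanishes at \<open>z\<close>. It can be
          nonzero at \<open>r s z\<close> only if this is \<open>x\<close> itself, and then
          \<open>D z\<close> comes from the diagonal value.\<close>
        then have zx: "len z < len x" using False by auto
        have xz: "xi x z = 0" using xi_low[OF x JC(1)[OF z]] zx by fastforce
        show ?thesis
        proof (cases "r s z = x")
          case T: True
          then have rz: "r s x = z" using s_invol[OF s JC(1)[OF z]] by simp
          have sI: "s \<in> Inv x" using len_s_cases[OF s x] rz zx by fastforce
          have "a s * G z = - ?\<sigma> (prod a (Inv x))"
            using G[OF z] xz T xi_diag[OF x] by (simp add: D_def)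
          also have "\<dots> = a s * prod a (Inv z)"
            using prod_Inv_s[OF s x sI] rz by (simp add: subst_mult sg_s[OF s] sg_sg[OF s])
          finally have "G z = prod a (Inv z)" using a0 by simp
          then show ?thesis using rz xi_diag[OF JC(1)[OF z]] sI by (simp add: K_def)
        next
          case F: False
          have "len (r s z) \<le> len x" using len_s_cases[OF s JC(1)[OF z]] zx
            by (metis Suc_leD Suc_leI less_imp_le_nat)
          then have "xi x (r s z) = 0" using xi_low[OF x JC(2)[OF z]] F by auto
          then have "a s * G z = 0" using G[OF z] xz by (simp add: D_def)
          then have "G z = 0" using a0 by simp
          moreover have "xi (r s x) z = 0" if "s \<in> Inv x"
          proof -
            have "r s x \<noteq> z" using F s_invol[OF s x] by auto
            then show ?thesis
              using xi_low[OF sx JC(1)[OF z]] len_s_desc[OF s x that] zx by auto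
          qed
          ultimately show ?thesis by (simp add: K_def)
        qed
      qed
    qed
  qed
  have yJ: "y \<in> J" using y J_def by auto
  have "G y = (if s \<in> Inv x then xi (r s x) y else 0)" using K0[OF yJ] by (simp add: K_def)
  then show ?thesis using G[OF yJ] by (simp add: D_def split: if_splits)
qed

text \<open>Induction on the length of the upper word \<open>y\<close>, with \<open>s\<close> its
  chosen descent. For \<open>\<beta> = s\<close> the recursion itself gives the congruence.
  Otherwise both ends are reflected by \<open>s\<close>, which turns \<beta> into the inversion
  \<open>tr s \<beta>\<close> of the shorter word \<open>r s y\<close>.\<close>

lemma GKM_all: "GKM N"
proof (induction N)
  case 0
  then show ?case using fin by (auto simp: GKM_def)
next
  case (Suc N)
  have dvdN: "a \<beta> dvd xi u z - xi u (r \<beta> z)" if "u \<in> C" "z \<in> C" "len z \<le> N" "\<beta> \<in> Inv z" for u z \<beta>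
    using Suc that unfolding GKM_def by auto
  show ?case unfolding GKM_def
  proof (intro ballI impI)
    fix x y \<beta> assume x: "x \<in> C" and y: "y \<in> C" and ly: "len y \<le> Suc N" and b: "\<beta> \<in> Inv y"
    show "a \<beta> dvd xi x y - xi x (r \<beta> y)"
    proof (cases "len y \<le> N")
      case True then show ?thesis using dvdN x y b by auto
    next
      case False
      then have lN: "len y = Suc N" using ly by simp
      define s where "s = desc y"
      let ?\<sigma> = "subst (sg s)"
      let ?z = "r \<beta> y"
      note st = xi_step[OF y _ s_def]
      have s: "s \<in> S" "s \<in> Inv y" using st lN by auto
      have lsy: "len (r s y) = N" using len_s_desc[OF s(1) y s(2)] lN by simp
      have syC: "r s y \<in> C" and sx: "r s x \<in> C" using s_C s x y by auto
      have xy: "xi x y = ?\<sigma> (xi x (r s y)) + (if s \<in> Inv x then a s * ?\<sigma> (xi (r s x) (r s y)) else 0)"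
        using st lN by simp
      show ?thesis
      proof (cases "\<beta> = s")
        case True
        have "a s dvd ?\<sigma> (xi x (r s y)) - xi x (r s y)"
          using s_refl_dvd[OF s(1)] by (metis dvd_minus_iff minus_diff_eq)
        moreover have "a s dvd (if s \<in> Inv x then a s * ?\<sigma> (xi (r s x) (r s y)) else 0)" by simp
        ultimately have "a s dvd (?\<sigma> (xi x (r s y)) - xi x (r s y)) + (if s \<in> Inv x then a s * ?\<sigma> (xi (r s x) (r s y)) else 0)"
          by (rule dvd_add)
        then show ?thesis using True xy by (simp add: algebra_simps)
      next
        case F: False
        let ?b = "tr s \<beta>"
        have bi: "?b \<in> Inv (r s y)" using tr_Inv[OF s(1) y b F] .
        have bP: "\<beta> \<in> Phi" using b Inv_Phi y by auto
        have sb: "?\<sigma> (a ?b) = a \<beta>" using sg_a[OF s(1) bP F] sg_sg[OF s(1), of "a \<beta>"] by simp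
        have sz: "r s ?z = r ?b (r s y)" using r_conj[OF s(1) y b F] by simp
        have zC: "?z \<in> C" using r_C y b by auto
        have lz: "len ?z \<le> N" using r_less[OF y b] lN by simp
        have lsz: "len (r s ?z) \<le> N" using r_less[OF syC bi] lsy sz by simp
        \<comment> \<open>The recursion formula at \<open>r \<beta> y\<close> for the descent of
          \<open>y\<close>, which need not be a descent there. It follows from the divided
          difference, applied to \<open>x\<close> and, if \<open>s\<close> lowers \<open>x\<close>,
          also to \<open>r s x\<close>.\<close>
        have xz: "xi x ?z = ?\<sigma> (xi x (r s ?z)) + (if s \<in> Inv x then a s * ?\<sigma> (xi (r s x) (r s ?z)) else 0)"
        proof (cases "s \<in> Inv x")
          case True
          have "xi (r s x) ?z = ?\<sigma> (xi (r s x) (r s ?z))"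
            using xi_divided_difference[OF Suc sx s(1) zC lz lsz] s_desc[OF s(1) x True] by simp
          then show ?thesis
            using xi_divided_difference[OF Suc x s(1) zC lz lsz] True by (simp add: algebra_simps)
        next
          case False
          then show ?thesis using xi_divided_difference[OF Suc x s(1) zC lz lsz] by simp
        qed
        have d: "a \<beta> dvd ?\<sigma> (xi u (r s y) - xi u (r s ?z))" if "u \<in> C" for u
          using subst_dvd[OF dvdN[OF that syC _ bi], of "sg s"] lsy sb sz by simp
        have "xi x y - xi x ?z = ?\<sigma> (xi x (r s y) - xi x (r s ?z))
          + (if s \<in> Inv x then a s * ?\<sigma> (xi (r s x) (r s y) - xi (r s x) (r s ?z)) else 0)"
          unfolding xy xz by (simp add: subst_diff algebra_simps)
        then show ?thesis using d[OF x] d[OF sx] by simp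
      qed
    qed
  qed
qed

lemma xi_GKM: "x \<in> C \<Longrightarrow> y \<in> C \<Longrightarrow> \<beta> \<in> Inv y \<Longrightarrow> a \<beta> dvd xi x y - xi x (r \<beta> y)"
  using GKM_all[of "len y"] by (auto simp: GKM_def)

end

section \<open>Periodic words\<close>

lemma period_mult:
  fixes f :: "int \<Rightarrow> int"
  assumes "\<And>P. f (P + om) = f P + c"
  shows "f (P + om * k) = f P + c * k"
proof (induction k rule: int_induct[where k=0])
  case (step1 i)
  then show ?case using assms[of "P + om * i"] by (simp add: algebra_simps)
next
  case (step2 i)
  then show ?case using assms[of "P + om * (i - 1)"] by (simp add: algebra_simps)
qed simp

text \<open>\<open>om\<close> counts the positions and \<open>n\<close> the vertices in one turn
  around the cycle. \<open>w P\<close> names the residue class of \<open>P\<close> and serves as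
  index of a variable, with 0 left free for the character \<delta>; \<open>kp P\<close> will be
  minus the vertex at which string \<open>P\<close> begins.\<close>

locale periodic_words =
  fixes om n :: int and w :: "int \<Rightarrow> nat" and kp :: "int \<Rightarrow> int"
  assumes om: "om \<ge> 1" and n: "n \<ge> 1"
    and w_iff: "w P = w Q \<longleftrightarrow> om dvd P - Q" and w_pos: "w P \<ge> 1"
    and kp_period: "kp (P + om) = kp P + n"
begin

definition C :: "(int \<Rightarrow> int) set" where "C = {h. \<forall>P. h (P + om) = h P - n}"

text \<open>Affine transpositions exchange \<open>P + om * k\<close> with \<open>Q + om * k\<close>
  for all \<open>k\<close>. The pairs are representatives modulo simultaneous shifts, normalised by
  the first entry; they correspond to the positive real roots of affine type A.\<close>

definition Phi :: "(int \<times> int) set" where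
  "Phi = {(P, Q). 0 \<le> P \<and> P < om \<and> P < Q \<and> \<not> om dvd P - Q}"

definition S :: "(int \<times> int) set" where "S = {(P, Q) \<in> Phi. Q = P + 1}"

definition Inv :: "(int \<Rightarrow> int) \<Rightarrow> (int \<times> int) set" where
  "Inv h = {(P, Q) \<in> Phi. h P < h Q}"

definition swap :: "int \<times> int \<Rightarrow> int \<Rightarrow> int" where
  "swap \<beta> R = (if om dvd R - fst \<beta> then R - fst \<beta> + snd \<beta>
     else if om dvd R - snd \<beta> then R - snd \<beta> + fst \<beta> else R)"

definition rf :: "int \<times> int \<Rightarrow> (int \<Rightarrow> int) \<Rightarrow> int \<Rightarrow> int" where
  "rf \<beta> h = h \<circ> swap \<beta>"

definition nrm :: "int \<times> int \<Rightarrow> int \<times> int" where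
  "nrm \<beta> = (fst \<beta> mod om, snd \<beta> - om * (fst \<beta> div om))"

definition tr :: "int \<times> int \<Rightarrow> int \<times> int \<Rightarrow> int \<times> int" where
  "tr s \<beta> = nrm (swap s (fst \<beta>), swap s (snd \<beta>))"

text \<open>In the application, a basis vector of string \<open>P\<close> over the vertex
  \<open>I\<close> of the universal cover has character \<open>yv P\<close> plus \<open>I\<close>
  times \<open>Var 0\<close>. Hence the difference between two strings does not depend on the common
  vertex.\<close>

definition yv :: "int \<Rightarrow> qpoly" where "yv P = Var (w P) + Const (of_int (kp P)) * Var 0"

definition lab :: "int \<times> int \<Rightarrow> qpoly" where "lab \<beta> = yv (fst \<beta>) - yv (snd \<beta>)"

text \<open>Forced by fixing \<open>Var 0\<close> and sending \<open>yv R\<close> to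
  \<open>yv (swap s R)\<close>. As \<open>swap\<close> and \<open>yv\<close> are compatible with
  shifts by \<open>om\<close>, the representative \<open>R\<close> of the class does not
  matter.\<close>

definition sg :: "int \<times> int \<Rightarrow> nat \<Rightarrow> qpoly" where
  "sg s i = (if \<exists>R. w R = i
     then (let R = SOME R. w R = i in yv (swap s R) - Const (of_int (kp R)) * Var 0) else Var i)"

section \<open>Affine transpositions and normalised pairs\<close>

lemma C_shift: "h \<in> C \<Longrightarrow> h (P + om * k) = h P - n * k"
  using period_mult[of h om "-n" P k] by (auto simp: C_def)

lemma kp_shift: "kp (P + om * k) = kp P + n * k"
  using period_mult[of kp om n P k] kp_period by auto

lemma w_shift: "w (P + om * k) = w P" by (simp add: w_iff)

lemma yv_shift: "yv (P + om * k) = yv P + Const (of_int (n * k)) * Var 0"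
  unfolding yv_def kp_shift w_shift of_int_add Const_add by (simp add: algebra_simps)

lemma dvd_shift: "om dvd R + om * k - P \<longleftrightarrow> om dvd R - P" "om dvd R - (P - om * k) \<longleftrightarrow> om dvd R - P"
proof -
  have "R + om * k - P = (R - P) + om * k" "R - (P - om * k) = (R - P) + om * k" by simp_all
  then show "om dvd R + om * k - P \<longleftrightarrow> om dvd R - P" "om dvd R - (P - om * k) \<longleftrightarrow> om dvd R - P"
    by (simp_all only: dvd_add_left_iff[OF dvd_triv_left])
qed

lemma swap_shift: "swap \<beta> (R + om * k) = swap \<beta> R + om * k"
  by (simp add: swap_def dvd_shift)

lemma dvdE': assumes "om dvd R - P" obtains k where "R = P + om * k"
proof -
  from assms obtain k where "R - P = om * k" by (rule dvdE)
  then show thesis by (intro that[of k]) simp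
qed

lemma swap_fst: "swap (P, Q) (P + om * k) = Q + om * k"
  unfolding swap_shift by (simp add: swap_def)

lemma swap_snd: "\<not> om dvd P - Q \<Longrightarrow> swap (P, Q) (Q + om * k) = P + om * k"
  unfolding swap_shift by (simp add: swap_def dvd_diff_commute)

lemma swap_cases:
  obtains k where "R = P + om * k" | k where "R = Q + om * k"
  | "\<not> om dvd R - P" "\<not> om dvd R - Q" "swap (P, Q) R = R"
proof -
  assume a: "\<And>k. R = P + om * k \<Longrightarrow> thesis" "\<And>k. R = Q + om * k \<Longrightarrow> thesis"
    "\<not> om dvd R - P \<Longrightarrow> \<not> om dvd R - Q \<Longrightarrow> swap (P, Q) R = R \<Longrightarrow> thesis"
  show thesis
  proof (cases "om dvd R - P \<or> om dvd R - Q")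
    case True then show ?thesis using a(1,2) by (elim disjE dvdE')
  next
    case False then show ?thesis using a(3) by (simp add: swap_def)
  qed
qed

lemma swap_swap: assumes "\<not> om dvd fst \<beta> - snd \<beta>" shows "swap \<beta> (swap \<beta> R) = R"
proof -
  obtain P Q where b: "\<beta> = (P, Q)" by force
  have nd: "\<not> om dvd P - Q" using assms b by simp
  show ?thesis unfolding b
    by (rule swap_cases[where R=R and P=P and Q=Q]) (simp_all add: swap_fst swap_snd[OF nd])
qed

lemma swap_nrm: "swap (nrm \<beta>) = swap \<beta>"
proof
  fix R
  have e: "fst \<beta> mod om = fst \<beta> - om * (fst \<beta> div om)" by (simp add: minus_mult_div_eq_mod)
  show "swap (nrm \<beta>) R = swap \<beta> R"
    unfolding swap_def nrm_def e by (simp add: dvd_shift)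
qed

lemma nrm_shift: "nrm (P + om * k, Q + om * k) = nrm (P, Q)"
proof -
  have "(P + om * k) div om = P div om + k" "(P + om * k) mod om = P mod om" using om by simp_all
  then show ?thesis by (simp add: nrm_def distrib_left)
qed

lemma nrm_ident: "\<beta> \<in> Phi \<Longrightarrow> nrm \<beta> = \<beta>"
  by (auto simp: Phi_def nrm_def)

lemma nrm_obtain: obtains k where "nrm (P, Q) = (P + om * k, Q + om * k)" "0 \<le> P + om * k" "P + om * k < om"
proof (rule that[of "- (P div om)"])
  have e: "P + om * - (P div om) = P mod om" unfolding mult_minus_right by (simp only: minus_mult_div_eq_mod flip: diff_conv_add_uminus)
  show "0 \<le> P + om * - (P div om)" "P + om * - (P div om) < om" unfolding e using om by simp_all
  show "nrm (P, Q) = (P + om * - (P div om), Q + om * - (P div om))" unfolding e nrm_def by simp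
qed

lemma nrm_Phi: assumes "P < Q" "\<not> om dvd P - Q" shows "nrm (P, Q) \<in> Phi"
proof -
  obtain k where k: "nrm (P, Q) = (P + om * k, Q + om * k)" "0 \<le> P + om * k" "P + om * k < om"
    by (rule nrm_obtain)
  then show ?thesis using assms by (simp add: Phi_def)
qed

lemma nrm_Inv:
  assumes "h \<in> C" "P < Q" "\<not> om dvd P - Q" "h P < h Q"
  shows "nrm (P, Q) \<in> Inv h"
proof -
  obtain k where "nrm (P, Q) = (P + om * k, Q + om * k)" by (rule nrm_obtain)
  then show ?thesis using nrm_Phi[OF assms(2,3)] assms(4) by (simp add: Inv_def C_shift[OF assms(1)])
qed

lemma nrm_eq:
  assumes "nrm (P, Q) = nrm (P', Q')"
  obtains k where "P' = P + om * k" "Q' = Q + om * k"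
proof -
  obtain k k' where "nrm (P, Q) = (P + om * k, Q + om * k)" "nrm (P', Q') = (P' + om * k', Q' + om * k')"
    by (metis nrm_obtain)
  then have "P' = P + (om * k - om * k')" "Q' = Q + (om * k - om * k')" using assms by auto
  then show ?thesis by (intro that[of "k - k'"]) (simp_all only: right_diff_distrib)
qed

lemma Phi_eqI: "(P, Q) \<in> Phi \<Longrightarrow> (P + om * k, Q + om * k) \<in> Phi \<Longrightarrow> k = 0"
  using nrm_ident[of "(P, Q)"] nrm_ident[of "(P + om * k, Q + om * k)"] nrm_shift[of P k Q] om
  by auto

lemma lab_nrm: "lab (nrm (P, Q)) = yv P - yv Q"
proof -
  obtain k where "nrm (P, Q) = (P + om * k, Q + om * k)" by (rule nrm_obtain)
  then show ?thesis by (simp add: lab_def yv_shift)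
qed

lemma swap_dvd_iff:
  assumes "\<not> om dvd fst \<beta> - snd \<beta>"
  shows "om dvd swap \<beta> A - swap \<beta> B \<longleftrightarrow> om dvd A - B"
proof -
  have *: "om dvd swap \<beta> A - swap \<beta> B" if "om dvd A - B" for A B
    using that by (elim dvdE') (simp add: swap_shift)
  show ?thesis using *[of A B] *[of "swap \<beta> A" "swap \<beta> B"] swap_swap[OF assms] by auto
qed

lemma rf_C: "h \<in> C \<Longrightarrow> rf \<beta> h \<in> C"
  using swap_shift[of \<beta> _ 1] by (auto simp: C_def rf_def)

lemma Phi_ndvd: "\<beta> \<in> Phi \<Longrightarrow> \<not> om dvd fst \<beta> - snd \<beta>"
  by (auto simp: Phi_def)

lemma rf_rf: "\<beta> \<in> Phi \<Longrightarrow> rf \<beta> (rf \<beta> h) = h"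
  by (simp add: rf_def fun_eq_iff swap_swap Phi_ndvd)

section \<open>Inversions and lengths of words\<close>

lemma finite_Inv: assumes "h \<in> C" shows "finite (Inv h)"
proof -
  define H L where "H = Max (h ` {0..<om})" and "L = Min (h ` {0..<om})"
  have HL: "h P \<le> H" "L \<le> h P" if "0 \<le> P" "P < om" for P
    using that by (auto simp: H_def L_def)
  have "Q < om * (H - L + 1)" if "(P, Q) \<in> Inv h" for P Q
  proof -
    have PQ: "0 \<le> P" "P < om" "P < Q" "h P < h Q" using that by (auto simp: Inv_def Phi_def)
    define k q where "k = Q div om" and "q = Q mod om"
    have Q: "Q = q + om * k" and q: "0 \<le> q" "q < om" using om by (auto simp: k_def q_def)
    have "k \<ge> 0" using PQ om by (simp add: k_def pos_imp_zdiv_nonneg_iff)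
    then have "k \<le> n * k" using n by (simp add: mult_le_cancel_right1)
    moreover have "L < H - n * k" using PQ HL[of P] HL[of q] q C_shift[OF assms, of q k] Q by auto
    ultimately have "k < H - L" by linarith
    then have "om * (k + 1) \<le> om * (H - L + 1)" using om by auto
    moreover have "Q < om * (k + 1)" using Q q by (simp add: algebra_simps)
    ultimately show ?thesis by simp
  qed
  then have "Inv h \<subseteq> {0..<om} \<times> {0..<om * (H - L + 1)}" by (auto simp: Inv_def Phi_def)
  then show ?thesis by (rule finite_subset) simp
qed

text \<open>An inversion of \<open>h \<circ> t\<close> on which \<open>t\<close> is increasing is moved by \<open>t\<close> to an inversion of \<open>h\<close>; one on
  which \<open>t\<close> is decreasing is itself an inversion of \<open>h\<close>.  The inversion defining \<open>t\<close> is missed.\<close>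

lemma card_Inv_less:
  assumes h: "h \<in> C" and b: "\<beta> \<in> Inv h"
  shows "card (Inv (rf \<beta> h)) < card (Inv h)"
proof -
  obtain P Q where \<beta>: "\<beta> = (P, Q)" by force
  let ?t = "swap \<beta>"
  have bP: "\<beta> \<in> Phi" and PQ: "P < Q" "h P < h Q" and nd: "\<not> om dvd P - Q"
    using b by (auto simp: \<beta> Inv_def Phi_def)
  have tt: "?t (?t R) = R" for R using swap_swap Phi_ndvd[OF bP] by auto
  \<comment> \<open>\<open>?t\<close> moves a position by \<open>Q - P\<close> or not at all. As
    \<open>h P < h Q\<close>, it raises the value when it raises the position and lowers the value
    when it lowers the position.\<close>
  have mono: "(?t R \<ge> R \<and> h (?t R) \<ge> h R \<or> ?t R = R - (Q - P) \<and> h (?t R) < h R) \<and>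
     (?t R \<le> R \<and> h (?t R) \<le> h R \<or> ?t R = R + (Q - P) \<and> h (?t R) > h R)" for R
    by (rule swap_cases[where R=R and P=P and Q=Q]) (use PQ nd C_shift[OF h] in \<open>auto simp: \<beta> swap_fst swap_snd\<close>)
  define \<psi> where "\<psi> p = (if ?t (fst p) < ?t (snd p) then nrm (?t (fst p), ?t (snd p)) else p)" for p
  have img: "\<psi> p \<in> Inv h - {\<beta>}" if "p \<in> Inv (rf \<beta> h)" for p
  proof -
    obtain A B where p: "p = (A, B)" by force
    have pP: "p \<in> Phi" and AB: "A < B" "h (?t A) < h (?t B)" "\<not> om dvd A - B"
      using that by (auto simp: p Inv_def Phi_def rf_def)
    show ?thesis
    proof (cases "?t A < ?t B")
      case True
      have "\<not> om dvd ?t A - ?t B" using swap_dvd_iff Phi_ndvd[OF bP] AB by auto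
      then have "\<psi> p \<in> Inv h" using nrm_Inv[OF h True] AB True by (simp add: \<psi>_def p)
      moreover have "\<psi> p \<noteq> \<beta>"
      proof
        assume "\<psi> p = \<beta>"
        then have "nrm (?t A, ?t B) = nrm (P, Q)" using True nrm_ident[OF bP] by (simp add: \<psi>_def p \<beta>)
        then obtain k where k: "?t A = P + om * k" "?t B = Q + om * k" using nrm_eq by metis
        then have "A = Q + om * k" "B = P + om * k"
          using tt[of A] tt[of B] swap_fst[of P Q k] swap_snd[OF nd, of k] \<beta> by auto
        then show False using AB PQ by simp
      qed
      ultimately show ?thesis by simp
    next
      case False
      \<comment> \<open>No position moves by more than \<open>Q - P\<close>, so a pair is reversed
        only if \<open>A\<close> does not go down and \<open>B\<close> does not go up. Hence
        \<open>h A \<le> h (?t A) < h (?t B) \<le> h B\<close>.\<close>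
      then have "?t B \<le> ?t A" by simp
      then have "h A \<le> h (?t A)" "h (?t B) \<le> h B" using mono[of A] mono[of B] AB by auto
      then have "(A, B) \<in> Inv h" using AB pP by (simp add: Inv_def p)
      moreover have "(A, B) \<noteq> \<beta>"
      proof
        assume "(A, B) = \<beta>"
        then have "?t A = B" "?t B = A" using swap_fst[of P Q 0] swap_snd[OF nd, of 0] \<beta> by auto
        then show False using AB \<open>(A, B) \<in> Inv h\<close> by (auto simp: Inv_def)
      qed
      ultimately show ?thesis using False by (simp add: \<psi>_def p)
    qed
  qed
  have "inj_on \<psi> (Inv (rf \<beta> h))"
  proof (rule inj_onI)
    fix p q assume p: "p \<in> Inv (rf \<beta> h)" and q: "q \<in> Inv (rf \<beta> h)" and eq: "\<psi> p = \<psi> q"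
    obtain A B A' B' where pq: "p = (A, B)" "q = (A', B')" by force
    have Phi: "(A, B) \<in> Phi" "(A', B') \<in> Phi" using p q by (auto simp: pq Inv_def)
    \<comment> \<open>The image of a moved inversion is increasing under \<open>?t\<close>, since
      \<open>?t\<close> is an involution, whereas one that was kept is not; so the two kinds of
      images never coincide.\<close>
    have mixed: False if "?t U < ?t V" "\<not> ?t U' < ?t V'" "(U, V) \<in> Phi" "(U', V') \<in> Phi"
      "nrm (?t U, ?t V) = (U', V')" for U V U' V'
    proof -
      have "nrm (?t U, ?t V) = nrm (U', V')" using that nrm_ident by auto
      then obtain k where "U' = ?t U + om * k" "V' = ?t V + om * k" using nrm_eq by metis
      then have "?t U' = U + om * k" "?t V' = V + om * k" using swap_shift tt by auto
      then show False using that(2,3) by (auto simp: Phi_def)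
    qed
    show "p = q"
    proof (cases "?t A < ?t B")
      case T: True
      show ?thesis
      proof (cases "?t A' < ?t B'")
        case True
        then have "nrm (?t A, ?t B) = nrm (?t A', ?t B')" using T eq by (simp add: \<psi>_def pq)
        then obtain k where "?t A' = ?t A + om * k" "?t B' = ?t B + om * k" using nrm_eq by metis
        then have k: "A' = A + om * k" "B' = B + om * k" using swap_shift tt by metis+
        then have "k = 0" using Phi_eqI Phi by auto
        then show ?thesis using k pq by simp
      next
        case False
        then show ?thesis using mixed[of A B A' B'] T eq Phi by (simp add: \<psi>_def pq)
      qed
    next
      case F: False
      show ?thesis
      proof (cases "?t A' < ?t B'")
        case True
        then show ?thesis using mixed[of A' B' A B] F eq Phi by (simp add: \<psi>_def pq)
      next
        case False
        then show ?thesis using F eq by (simp add: \<psi>_def pq)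
      qed
    qed
  qed
  then have "card (Inv (rf \<beta> h)) \<le> card (Inv h - {\<beta>})"
    by (rule card_inj_on_le) (use img finite_Inv[OF h] in blast)+
  also have "\<dots> < card (Inv h)" using card_Diff1_less[OF finite_Inv[OF h] b] .
  finally show ?thesis .
qed

text \<open>An adjacent transposition moves each position by at most one, so it can reverse
  \<open>A < B\<close> only if these are neighbours that it exchanges; after normalisation this is
  the pair \<open>s\<close> itself.\<close>

lemma simple_increasing:
  assumes s: "s \<in> S" and p: "(A, B) \<in> Phi" "(A, B) \<noteq> s"
  shows "swap s A < swap s B"
proof -
  obtain k where sk: "s = (k, k + 1)" and sP: "(k, k + 1) \<in> Phi" using s by (auto simp: S_def)
  then have nd: "\<not> om dvd k - (k + 1)" and k: "0 \<le> k" "k < om" by (auto simp: Phi_def)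
  have AB: "A < B" "\<not> om dvd A - B" "0 \<le> A" "A < om" using p by (auto simp: Phi_def)
  have inj: "swap s A \<noteq> swap s B" using swap_dvd_iff[of s A B] nd AB sk by auto
  show ?thesis
  proof (rule ccontr)
    assume "\<not> swap s A < swap s B"
    then have lt: "swap s B < swap s A" using inj by simp
    have bd: "R - 1 \<le> swap s R" "swap s R \<le> R + 1" for R
      by (rule swap_cases[where R=R and P=k and Q="k + 1"]; use nd in \<open>force simp: sk swap_fst swap_snd\<close>)+
    have B: "B = A + 1" using lt bd[of A] bd[of B] AB by simp
    then have "swap s A = A + 1" using lt bd[of A] bd[of B] inj by linarith
    then obtain j where "A = k + om * j"
      by (cases rule: swap_cases[where R=A and P=k and Q="k + 1"]) (use nd in \<open>auto simp: sk swap_snd\<close>)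
    then have "A = k" using AB k
      by (metis mod_mult_self2 mod_pos_pos_trivial)
    then show False using B p(2) sk by simp
  qed
qed

lemma tr_Phi:
  assumes s: "s \<in> S" and p: "\<beta> \<in> Phi" "\<beta> \<noteq> s"
  shows "tr s \<beta> \<in> Phi" "tr s \<beta> \<noteq> s" "tr s (tr s \<beta>) = \<beta>"
proof -
  obtain A B where \<beta>: "\<beta> = (A, B)" by force
  have sP: "s \<in> Phi" using s by (auto simp: S_def)
  have lt: "swap s A < swap s B" using simple_increasing s p \<beta> by auto
  have nd: "\<not> om dvd swap s A - swap s B" using swap_dvd_iff Phi_ndvd[OF sP] p by (auto simp: \<beta> Phi_def)
  show "tr s \<beta> \<in> Phi" using nrm_Phi[OF lt nd] by (simp add: tr_def \<beta>)
  obtain k where k: "tr s \<beta> = (swap s A + om * k, swap s B + om * k)"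
    unfolding tr_def \<beta> fst_conv snd_conv by (rule nrm_obtain)
  have ss: "swap s (swap s R) = R" for R using swap_swap Phi_ndvd[OF sP] by auto
  show *: "tr s (tr s \<beta>) = \<beta>"
    using nrm_ident[OF p(1)] unfolding k by (simp add: tr_def swap_shift ss nrm_shift \<beta>)
  show "tr s \<beta> \<noteq> s"
  proof
    assume "tr s \<beta> = s"
    then have "tr s s = \<beta>" using * by simp
    moreover obtain j where j: "s = (j, j + 1)" using s by (auto simp: S_def)
    moreover have "swap s j = j + 1" "swap s (j + 1) = j"
      using swap_fst[of j "j + 1" 0] swap_snd[of j "j + 1" 0] Phi_ndvd[OF sP] j by auto
    ultimately have "\<beta> = nrm (j + 1, j)" by (simp add: tr_def)
    then obtain m where "\<beta> = (j + 1 + om * m, j + om * m)" using nrm_obtain by metis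
    then show False using p(1) by (auto simp: Phi_def)
  qed
qed

lemma tr_Inv_mem:
  assumes s: "s \<in> S" and h: "h \<in> C" and b: "\<beta> \<in> Inv h - {s}"
  shows "tr s \<beta> \<in> Inv (rf s h) - {s}"
proof -
  obtain A B where \<beta>: "\<beta> = (A, B)" by force
  have sP: "s \<in> Phi" using s by (auto simp: S_def)
  have bP: "\<beta> \<in> Phi" and ne: "\<beta> \<noteq> s" and hAB: "h A < h B" using b by (auto simp: Inv_def \<beta>)
  obtain k where k: "tr s \<beta> = (swap s A + om * k, swap s B + om * k)"
    unfolding tr_def \<beta> fst_conv snd_conv by (rule nrm_obtain)
  show ?thesis
    using tr_Phi[OF s bP ne] hAB swap_swap[OF Phi_ndvd[OF sP]] C_shift[OF h]
    by (auto simp: k Inv_def rf_def swap_shift)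
qed

section \<open>Reflections of the polynomial ring and divisibility of labels\<close>

lemma subst_sg_yv:
  assumes "s \<in> Phi"
  shows "sg s 0 = Var 0" "sg s (w R) = yv (swap s R) - Const (of_int (kp R)) * Var 0"
    "subst (sg s) (yv R) = yv (swap s R)"
proof -
  show 0: "sg s 0 = Var 0" using w_pos by (metis not_one_le_zero sg_def)
  define R' where "R' = (SOME R'. w R' = w R)"
  have "w R' = w R" unfolding R'_def by (rule someI) simp
  then obtain k where "R' = R + om * k" using w_iff dvdE' by metis
  moreover have "sg s (w R) = yv (swap s R') - Const (of_int (kp R')) * Var 0"
    unfolding sg_def R'_def Let_def by auto
  ultimately show *: "sg s (w R) = yv (swap s R) - Const (of_int (kp R)) * Var 0"
    by (simp add: swap_shift yv_shift kp_shift Const_add distrib_right)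
  show "subst (sg s) (yv R) = yv (swap s R)"
    by (subst yv_def) (simp add: subst_add subst_mult 0 *)
qed

text \<open>The coefficient 1 at \<open>w P\<close> reduces primality and nonvanishing of labels to
  statements on linear forms. The bound \<open>D\<close> is left arbitrary because empty strings
  have variables outside the torus.\<close>

lemma lab_linform:
  assumes "w P \<noteq> w Q" "w P \<le> D" "w Q \<le> D"
  shows "lab (P, Q) = linform D (\<lambda>i. if i = w P then 1 else if i = w Q then -1
     else if i = 0 then of_int (kp P - kp Q) else 0)"
proof -
  let ?c = "\<lambda>i. if i = w P then 1 else if i = w Q then -1
     else if i = 0 then of_int (kp P - kp Q) else (0::rat)"
  have m1: "Const (-1) = - 1" using Const_of_int[of "-1"] by simp
  have "linform D ?c = (\<Sum>i\<in>{0..D}. (if i = w P then Var i else 0) + (if i = w Q then - Var i else 0)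
     + (if i = 0 then Const (of_int (kp P - kp Q)) * Var i else 0))"
    unfolding linform_def using assms(1) w_pos[of P] w_pos[of Q]
    by (intro sum.cong) (auto simp: m1)
  also have "\<dots> = Var (w P) - Var (w Q) + Const (of_int (kp P - kp Q)) * Var 0"
    using assms by (simp add: sum.distrib)
  also have "\<dots> = lab (P, Q)"
    by (simp add: lab_def yv_def Const_def single_diff left_diff_distrib del: single_of_int)
  finally show ?thesis by simp
qed

lemma Phi_w: "(P, Q) \<in> Phi \<Longrightarrow> w P \<noteq> w Q" by (auto simp: w_iff Phi_def)

lemma lab_prime:
  assumes "\<beta> \<in> Phi" "lab \<beta> dvd f * g" shows "lab \<beta> dvd f \<or> lab \<beta> dvd g"
proof -
  obtain P Q where b: "\<beta> = (P, Q)" by force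
  show ?thesis
    using assms(2) unfolding b lab_linform[of P Q "w P + w Q", OF Phi_w[OF assms(1)[unfolded b]] le_add1 le_add2]
    by (rule linform_dvd_mult[where k="w P", rotated 2]) auto
qed

lemma lab_nz: assumes "\<beta> \<in> Phi" shows "lab \<beta> \<noteq> 0"
proof -
  obtain P Q where b: "\<beta> = (P, Q)" by force
  have "lookup (lab \<beta>) (Poly_Mapping.single (w P) 1) = 1"
    unfolding b lab_linform[of P Q "w P + w Q", OF Phi_w[OF assms(1)[unfolded b]] le_add1 le_add2] lookup_linform
    by simp
  then show ?thesis by auto
qed

text \<open>Proportional labels have coefficients 1 and -1 in the same two variables, so the factor
  is 1 or -1. The factor 1 makes the pairs equal by the normalisation of \<open>Phi\<close> and the
  coefficient of \<open>Var 0\<close>; the factor -1 would make one pair a shift of the other one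
  reversed, against \<open>P < Q\<close> and \<open>P' < Q'\<close>.\<close>

lemma lab_ndvd:
  assumes "\<beta> \<in> Phi" "\<beta>' \<in> Phi" "lab \<beta> dvd lab \<beta>'" shows "\<beta> = \<beta>'"
proof -
  obtain P Q P' Q' where b: "\<beta> = (P, Q)" "\<beta>' = (P', Q')" by force
  define D where "D = w P + w Q + w P' + w Q'"
  let ?c = "\<lambda>P Q i. if i = w P then 1 else if i = w Q then -1
     else if i = 0 then of_int (kp P - kp Q) else (0::rat)"
  have wne: "w P \<noteq> w Q" "w P' \<noteq> w Q'" using Phi_w assms b by auto
  have PQ: "0 \<le> P" "P < om" "P < Q" "0 \<le> P'" "P' < om" "P' < Q'" using assms by (auto simp: b Phi_def)
  have "linform D (?c P Q) dvd linform D (?c P' Q')"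
    using assms(3) lab_linform[of P Q D] lab_linform[of P' Q' D] wne by (simp add: b D_def)
  then have *: "?c P' Q' i = ?c P' Q' (w P) / ?c P Q (w P) * ?c P Q i" if "i \<le> D" for i
    using that by (intro linform_dvd_linform[where d=D and k="w P"]) (simp_all add: D_def)
  have eq0: "of_int (kp P' - kp Q') = ?c P' Q' (w P) * of_int (kp P - kp Q)"
    using *[of 0] w_pos[of P] w_pos[of Q] w_pos[of P'] w_pos[of Q'] by auto
  have eqP: "?c P' Q' (w P') = ?c P' Q' (w P) * ?c P Q (w P')"
    using *[of "w P'"] by (simp add: D_def)
  have eqQ: "?c P' Q' (w Q') = ?c P' Q' (w P) * ?c P Q (w Q')"
    using *[of "w Q'"] by (simp add: D_def)
  show ?thesis
  proof (cases "w P' = w P")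
    case True
    then obtain k where k: "P' = P + om * k" using w_iff dvdE' by metis
    then have PP: "P' = P" using PQ by (metis mod_mult_self2 mod_pos_pos_trivial)
    have "w Q' = w Q" using eqQ wne True w_pos[of Q'] by (auto split: if_splits)
    then obtain j where j: "Q' = Q + om * j" using w_iff dvdE' by metis
    have "kp Q' = kp Q" using eq0 PP by simp
    then have "j = 0" using j kp_shift n by auto
    then show ?thesis using j PP b by simp
  next
    case False
    then have 1: "w P' = w Q" "w P = w Q'" using eqP wne w_pos[of P'] w_pos[of P] by (auto split: if_splits)
    then obtain k j where k: "P' = Q + om * k" and j: "Q' = P + om * j" using w_iff dvdE' by metis
    have "of_int (kp P' - kp Q') = (of_int (kp Q - kp P) :: rat)" using eq0 1 wne False w_pos[of P] w_pos[of Q] by auto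
    then have "kp P' - kp Q' = kp Q - kp P" by (simp only: of_int_eq_iff)
    then have "n * k = n * j" by (simp add: k j kp_shift)
    then have "k = j" using n by simp
    then show ?thesis using PQ k j by simp
  qed
qed

lemma homogeneous_yv: "homogeneous_poly 2 (yv P)"
  unfolding yv_def
  using homogeneous_add homogeneous_Var homogeneous_Const_mult[of 1] by simp

lemma homogeneous_sg: assumes "s \<in> Phi" shows "homogeneous_poly 2 (sg s i)"
proof (cases "\<exists>R. w R = i")
  case True
  then obtain R where i: "i = w R" by auto
  have "homogeneous_poly 2 (Const c * Var 0)" for c
    using homogeneous_Const_mult[of 1] homogeneous_Var by simp
  then show ?thesis unfolding i subst_sg_yv(2)[OF assms] by (intro homogeneous_diff homogeneous_yv)
qed (simp add: sg_def homogeneous_Var)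

text \<open>Without an inversion of neighbours a word is weakly decreasing on one period, hence
  everywhere by periodicity, and so has no inversion at all.\<close>

lemma exists_descent:
  assumes h: "h \<in> C" and ne: "Inv h \<noteq> {}"
  shows "\<exists>s\<in>S. s \<in> Inv h"
proof (rule ccontr)
  assume no: "\<not> ?thesis"
  obtain P Q where PQ: "(P, Q) \<in> Inv h" using ne by auto
  \<comment> \<open>For \<open>om = 1\<close> all positions are congruent and \<open>Phi\<close> is
    empty; otherwise neighbours are never congruent.\<close>
  then have "om \<noteq> 1" by (auto simp: Inv_def Phi_def)
  then have om2: "\<not> om dvd k - (k + 1)" for k using om by auto
  have 0: "h (k + 1) \<le> h k" if "0 \<le> k" "k < om" for k
    using no that om2 by (force simp: S_def Inv_def Phi_def)
  have step: "h (k + 1) \<le> h k" for k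
  proof -
    have "h (k mod om + 1) \<le> h (k mod om)" using 0 om by simp
    moreover have "h k = h (k mod om) - n * (k div om)"
      using C_shift[OF h, of "k mod om" "k div om"] by simp
    moreover have "k mod om + 1 + om * (k div om) = k + 1" by simp
    then have "h (k + 1) = h (k mod om + 1) - n * (k div om)"
      using C_shift[OF h, of "k mod om + 1" "k div om"] by metis
    ultimately show ?thesis by simp
  qed
  have "h (P + int m) \<le> h P" for m
  proof (induction m)
    case (Suc m)
    then show ?case using step[of "P + int m"] by (simp add: ac_simps)
  qed simp
  from this[of "nat (Q - P)"] have "h Q \<le> h P" using PQ by (auto simp: Inv_def Phi_def)
  then show False using PQ by (auto simp: Inv_def)
qed

sublocale rs: reflection_system C Inv rf lab Phi S tr sg
proof
  fix y \<beta> assume y: "y \<in> C"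
  show "finite (Inv y)" using finite_Inv y .
  show "Inv y \<subseteq> Phi" by (auto simp: Inv_def)
  show "rf \<beta> y \<in> C" using rf_C y .
  show "\<beta> \<in> Inv y \<Longrightarrow> card (Inv (rf \<beta> y)) < card (Inv y)" using card_Inv_less y by auto
  show "Inv y \<noteq> {} \<Longrightarrow> \<exists>s\<in>S. s \<in> Inv y" using exists_descent y by auto
next
  show "S \<subseteq> Phi" by (auto simp: S_def)
next
  fix s y \<beta> assume s: "s \<in> S" and y: "y \<in> C"
  have sP: "s \<in> Phi" using s by (auto simp: S_def)
  show "rf s y \<in> C" using rf_C y .
  show ss: "rf s (rf s y) = y" using rf_rf sP .
  have InvP: "Inv z \<subseteq> Phi" for z by (auto simp: Inv_def)
  show "Inv (rf s y) - {s} = tr s ` (Inv y - {s})"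
  proof
    show "tr s ` (Inv y - {s}) \<subseteq> Inv (rf s y) - {s}" by (intro image_subsetI tr_Inv_mem[OF s y])
    show "Inv (rf s y) - {s} \<subseteq> tr s ` (Inv y - {s})"
    proof
      fix p assume p: "p \<in> Inv (rf s y) - {s}"
      then have "tr s p \<in> Inv y - {s}" using tr_Inv_mem[OF s rf_C[OF y] p] ss by simp
      moreover have "p \<in> Phi" "p \<noteq> s" using p subsetD[OF InvP[of "rf s y"], of p] by simp_all
      then have "p = tr s (tr s p)" using tr_Phi(3)[OF s] by simp
      ultimately show "p \<in> tr s ` (Inv y - {s})" by blast
    qed
  qed
  show "inj_on (tr s) (Inv y - {s})"
  proof (rule inj_on_inverseI[of _ "tr s"])
    fix p assume p: "p \<in> Inv y - {s}"
    then have "p \<in> Phi" "p \<noteq> s" using subsetD[OF InvP[of y], of p] by simp_all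
    then show "tr s (tr s p) = p" by (rule tr_Phi(3)[OF s])
  qed
  obtain k where k: "s = (k, k + 1)" using s by (auto simp: S_def)
  have sw: "swap s k = k + 1" "swap s (k + 1) = k"
    using swap_fst[of k "k + 1" 0] swap_snd[of k "k + 1" 0] Phi_ndvd[OF sP] k by auto
  show "s \<in> Inv y \<Longrightarrow> s \<notin> Inv (rf s y)" using sw by (auto simp: Inv_def k rf_def)
  show "rf s y = y" if "s \<notin> Inv y" "s \<notin> Inv (rf s y)"
  proof
    fix R
    have "y k = y (k + 1)" using that sP sw by (auto simp: Inv_def k rf_def)
    then show "rf s y R = y R"
      by (cases rule: swap_cases[where R=R and P=k and Q="k + 1"])
        (use Phi_ndvd[OF sP] C_shift[OF y] in \<open>auto simp: k rf_def swap_fst swap_snd\<close>)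
  qed
  assume b: "\<beta> \<in> Inv y" "\<beta> \<noteq> s"
  obtain P Q where \<beta>: "\<beta> = (P, Q)" by force
  have ss: "swap s (swap s U) = U" for U using swap_swap[OF Phi_ndvd[OF sP]] .
  have nd: "\<not> om dvd P - Q" using subsetD[OF InvP[of y] b(1)] Phi_ndvd[of \<beta>] by (simp add: \<beta>)
  then have nd': "\<not> om dvd swap s P - swap s Q" using swap_dvd_iff[OF Phi_ndvd[OF sP]] by simp
  \<comment> \<open>Conjugation of affine transpositions: \<open>swap s\<close> carries the classes
    of \<open>swap s P\<close> and \<open>swap s Q\<close> to those of \<open>P\<close> and
    \<open>Q\<close>.\<close>
  have "swap s (swap (tr s \<beta>) R) = swap \<beta> (swap s R)" for R
  proof -
    have e: "swap (tr s \<beta>) = swap (swap s P, swap s Q)" by (simp add: tr_def swap_nrm \<beta>)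
    show ?thesis unfolding e unfolding \<beta>
    proof (rule swap_cases[where R=R and P="swap s P" and Q="swap s Q"])
      fix k assume R: "R = swap s P + om * k"
      show "swap s (swap (swap s P, swap s Q) R) = swap (P, Q) (swap s R)"
        unfolding R swap_fst unfolding swap_shift[of s] ss swap_fst ..
    next
      fix k assume R: "R = swap s Q + om * k"
      show "swap s (swap (swap s P, swap s Q) R) = swap (P, Q) (swap s R)"
        unfolding R swap_snd[OF nd'] unfolding swap_shift[of s] ss swap_snd[OF nd] ..
    next
      assume R: "\<not> om dvd R - swap s P" "\<not> om dvd R - swap s Q" "swap (swap s P, swap s Q) R = R"
      have "\<not> om dvd swap s R - P" "\<not> om dvd swap s R - Q"
        using R(1,2) swap_dvd_iff[OF Phi_ndvd[OF sP], of R "swap s P"]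
          swap_dvd_iff[OF Phi_ndvd[OF sP], of R "swap s Q"] by (simp_all add: ss)
      then show "swap s (swap (swap s P, swap s Q) R) = swap (P, Q) (swap s R)"
        unfolding R(3) by (simp add: swap_def[of "(P, Q)"])
    qed
  qed
  then show "rf (tr s \<beta>) (rf s y) = rf s (rf \<beta> y)" by (auto simp: rf_def fun_eq_iff)
next
  fix \<beta> \<beta>' f g assume b: "\<beta> \<in> Phi"
  show "homogeneous_poly 2 (lab \<beta>)" by (simp add: lab_def homogeneous_diff homogeneous_yv)
  show "lab \<beta> \<noteq> 0" using lab_nz b .
  show "lab \<beta> dvd f * g \<Longrightarrow> lab \<beta> dvd f \<or> lab \<beta> dvd g" using lab_prime b .
  show "\<beta>' \<in> Phi \<Longrightarrow> \<beta> \<noteq> \<beta>' \<Longrightarrow> \<not> lab \<beta> dvd lab \<beta>'" using lab_ndvd b by metis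
next
  fix s i \<beta> assume s: "s \<in> S"
  then have sP: "s \<in> Phi" by (auto simp: S_def)
  show "homogeneous_poly 2 (sg s i)" using homogeneous_sg sP .
  show "subst (sg s) (lab \<beta>) = lab (tr s \<beta>)"
    unfolding tr_def lab_nrm unfolding lab_def subst_diff subst_sg_yv(3)[OF sP] ..
  obtain k where k: "s = (k, k + 1)" using s by (auto simp: S_def)
  have sw: "swap s k = k + 1" "swap s (k + 1) = k"
    using swap_fst[of k "k + 1" 0] swap_snd[of k "k + 1" 0] Phi_ndvd[OF sP] k by auto
  show "subst (sg s) (lab s) = - lab s"
    using sw unfolding k lab_def subst_diff subst_sg_yv(3)[OF sP[unfolded k]] by simp
  show "lab s dvd Var i - sg s i"
  proof (cases "\<exists>R. w R = i")
    case True
    then obtain R where R: "i = w R" by auto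
    have e: "Var i - sg s i = yv R - yv (swap s R)"
      unfolding R subst_sg_yv(2)[OF sP] by (subst (2) yv_def) simp
    have nd: "\<not> om dvd k - (k + 1)" using Phi_ndvd[OF sP] k by simp
    have l: "lab s = yv k - yv (k + 1)" by (simp add: lab_def k)
    show ?thesis unfolding e
    proof (rule swap_cases[where R=R and P=k and Q="k + 1"])
      fix j assume R: "R = k + om * j"
      show "lab s dvd yv R - yv (swap s R)" unfolding R k swap_fst yv_shift by (simp flip: k add: l)
    next
      fix j assume R: "R = k + 1 + om * j"
      have "yv R - yv (swap s R) = - lab s" unfolding R k swap_snd[OF nd] yv_shift by (simp flip: k add: l)
      then show "lab s dvd yv R - yv (swap s R)" by simp
    qed (simp add: k)
  qed (simp add: sg_def)
  show "subst (sg s) (sg s i) = Var i"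
  proof (cases "\<exists>R. w R = i")
    case True
    then obtain R where R: "i = w R" by auto
    show ?thesis
      unfolding R subst_sg_yv(2)[OF sP] subst_diff subst_sg_yv(3)[OF sP] swap_swap[OF Phi_ndvd[OF sP]]
        subst_mult subst_Const subst_Var subst_sg_yv(1)[OF sP]
      by (simp add: yv_def)
  next
    case False
    then have "sg s i = Var i" by (simp add: sg_def)
    then show ?thesis by simp
  qed
qed

end

section \<open>Homogeneous representations as families of strings\<close>

text \<open>An antitone function that drops by \<open>om\<close> in every \<open>n\<close> steps is
  unbounded in both directions, so it passes below each level exactly once.\<close>

lemma threshold_exists:
  fixes f :: "int \<Rightarrow> int"
  assumes anti: "\<And>I J. I \<le> J \<Longrightarrow> f J \<le> f I" and per: "\<And>I. f (I + n) = f I - om"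
    and "om \<ge> 1" "n \<ge> 1"
  shows "\<exists>L. \<forall>I. L \<le> I \<longleftrightarrow> f I < P"
proof -
  have up: "f (int t * n) = f 0 - om * int t" for t
  proof (induction t)
    case (Suc t) then show ?case using per[of "int t * n"] by (simp add: algebra_simps)
  qed simp
  have dn: "f (- int t * n) = f 0 + om * int t" for t
  proof (induction t)
    case (Suc t) then show ?case using per[of "- int (Suc t) * n"] by (simp add: algebra_simps)
  qed simp
  \<comment> \<open>So large that \<open>N\<close> periods upwards or downwards pass the level
    \<open>P\<close>, because each period changes the value by at least 1.\<close>
  define N where "N = nat (\<bar>f 0\<bar> + \<bar>P\<bar> + 1)"
  have N': "int N = \<bar>f 0\<bar> + \<bar>P\<bar> + 1" by (simp add: N_def)
  have N: "int N \<le> om * int N" using assms(3) by (simp add: mult_le_cancel_right1)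
  define I1 where "I1 = - int N * n"
  have I1: "\<not> f I1 < P" unfolding I1_def dn using N N' by linarith
  have I2: "f (int N * n) < P" unfolding up using N N' by linarith
  have "I1 \<le> int N * n" using assms(4) by (simp add: I1_def)
  then have "int N * n = I1 + int (nat (int N * n - I1))" by simp
  then have ex: "f (I1 + int (nat (int N * n - I1))) < P" using I2 by simp
  define t where "t = (LEAST t::nat. f (I1 + int t) < P)"
  have t1: "f (I1 + int t) < P" unfolding t_def by (rule LeastI[of "\<lambda>t. f (I1 + int t) < P", OF ex])
  have t2: "\<not> f (I1 + int u) < P" if "u < t" for u
    using that not_less_Least unfolding t_def by blast
  have "(I1 + int t \<le> I) = (f I < P)" for I
  proof
    assume "I1 + int t \<le> I" then show "f I < P" using t1 anti by (meson le_less_trans)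
  next
    assume fI: "f I < P"
    show "I1 + int t \<le> I"
    proof (rule ccontr)
      assume n: "\<not> I1 + int t \<le> I"
      show False
      proof (cases "I1 \<le> I")
        case True
        then have "nat (I - I1) < t" "I1 + int (nat (I - I1)) = I" using n by auto
        then show False using t2[of "nat (I - I1)"] fI by simp
      next
        case False
        then show False using anti[of I I1] fI I1 by simp
      qed
    qed
  qed
  then show ?thesis by blast
qed

locale decomposed_rep =
  fixes M :: "'v::ab_group_add based_rep"
  assumes rep: "is_rep M" and decomp: "decomposition_basis M"
begin

abbreviation "n \<equiv> vertices M"
abbreviation "m \<equiv> vdim M"

sublocale V: vector_space "smult M"
  using rep by (simp add: is_rep_def)

lemma n_pos: "n \<ge> 1" using rep by (simp add: is_rep_def)

lemma basis_index_iff: "(j, p) \<in> basis_index M \<longleftrightarrow> 1 \<le> j \<and> j \<le> summands M \<and> p < len M j"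
  by (simp add: basis_index_def)

lemma bas_inj: "(j, p) \<in> basis_index M \<Longrightarrow> (j', p') \<in> basis_index M \<Longrightarrow> bas M j p = bas M j' p' \<Longrightarrow> j = j' \<and> p = p'"
  using decomp unfolding decomposition_basis_def inj_on_def basis_vec_def by fastforce

lemma bas_nz: "(j, p) \<in> basis_index M \<Longrightarrow> bas M j p \<noteq> 0"
proof -
  assume "(j, p) \<in> basis_index M"
  then have "bas M j p \<in> basis_set M" by (force simp: basis_set_def basis_vec_def)
  then show ?thesis using decomp V.dependent_zero unfolding decomposition_basis_def by metis
qed

lemma arrow_bas: "(j, p) \<in> basis_index M \<Longrightarrow>
  arrow M ((start M j + p) mod n) (bas M j p) = (if Suc p < len M j then bas M j (Suc p) else 0)"
  using decomp unfolding decomposition_basis_def basis_vertex_def by fastforce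

lemma start_less: "1 \<le> j \<Longrightarrow> j \<le> summands M \<Longrightarrow> start M j < n"
  and len_pos: "1 \<le> j \<Longrightarrow> j \<le> summands M \<Longrightarrow> len M j \<ge> 1"
  using decomp unfolding decomposition_basis_def by auto

lemma nxt_less: "nxt M i < n" using n_pos by (simp add: nxt_def)

end

locale homogeneous_rep = decomposed_rep M for M :: "'v::ab_group_add based_rep" +
  fixes v :: "nat \<Rightarrow> nat \<Rightarrow> 'v" and wt :: "'v \<Rightarrow> int"
  assumes hom: "homogeneous_choice M v wt"
begin

section \<open>Arrows as index shifts\<close>

lemma v_bij: "i < n \<Longrightarrow> bij_betw (v i) {1..m i} (basis_at M i)"
  using hom by (simp add: homogeneous_choice_def basis_indexing_def)

lemma v_obtain:
  assumes "i < n" "k \<in> {1..m i}"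
  obtains j p where "(j, p) \<in> basis_index M" "(start M j + p) mod n = i" "v i k = bas M j p"
proof -
  have "v i k \<in> basis_at M i" using v_bij[OF assms(1)] assms(2) bij_betwE by blast
  then show ?thesis using that by (auto simp: basis_at_def basis_vec_def basis_vertex_def)
qed

lemma bas_obtain:
  assumes "(j, p) \<in> basis_index M"
  obtains k where "k \<in> {1..m ((start M j + p) mod n)}" "v ((start M j + p) mod n) k = bas M j p"
proof -
  let ?i = "(start M j + p) mod n"
  have "?i < n" using n_pos by simp
  moreover have "bas M j p \<in> basis_at M ?i"
    using assms by (force simp: basis_at_def basis_vec_def basis_vertex_def)
  ultimately have "bas M j p \<in> v ?i ` {1..m ?i}" using v_bij[of ?i] by (simp add: bij_betw_def)
  then show ?thesis using that by auto
qed

lemma v_inj: "i < n \<Longrightarrow> k \<in> {1..m i} \<Longrightarrow> l \<in> {1..m i} \<Longrightarrow> v i k = v i l \<Longrightarrow> k = l"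
  using v_bij[of i] by (metis bij_betw_def inj_onD)

lemma arrow_v:
  assumes i: "i < n" "k \<in> {1..m i}"
  shows "arrow M i (v i k) = 0 \<or> (\<exists>k'\<in>{1..m (nxt M i)}. arrow M i (v i k) = v (nxt M i) k')"
proof -
  obtain j p where jp: "(j, p) \<in> basis_index M" "(start M j + p) mod n = i" "v i k = bas M j p"
    using v_obtain[OF i] .
  show ?thesis
  proof (cases "Suc p < len M j")
    case True
    then have "(j, Suc p) \<in> basis_index M" using jp(1) by (simp add: basis_index_iff)
    then obtain k' where "k' \<in> {1..m ((start M j + Suc p) mod n)}" "v ((start M j + Suc p) mod n) k' = bas M j (Suc p)"
      using bas_obtain by metis
    moreover have "(start M j + Suc p) mod n = nxt M i" using jp(2) by (auto simp: nxt_def mod_Suc_eq)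
    ultimately have "k' \<in> {1..m (nxt M i)}" "arrow M i (v i k) = v (nxt M i) k'"
      using arrow_bas[OF jp(1)] True jp(2,3) by simp_all
    then show ?thesis by blast
  qed (use arrow_bas[OF jp(1)] jp in auto)
qed

lemma v_nz: "i < n \<Longrightarrow> k \<in> {1..m i} \<Longrightarrow> v i k \<noteq> 0"
  using v_obtain bas_nz by metis

text \<open>By alignment the vectors killed by the arrow come last, so if anything survives then
  \<open>v i 1\<close> does, with image index \<open>1 + s\<close>. Strong alignment then determines
  the images of the next vectors until the basis of the target is exhausted, and monotonicity leaves
  no index for a further image.\<close>

lemma shift_exists:
  assumes i: "i < n"
  shows "\<exists>s. m (nxt M i) \<le> m i + s \<and>
    (\<forall>k\<in>{1..m i}. arrow M i (v i k) = (if k + s \<le> m (nxt M i) then v (nxt M i) (k + s) else 0))"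
proof (cases "\<exists>k\<in>{1..m i}. arrow M i (v i k) \<noteq> 0")
  case False
  \<comment> \<open>The zero map is a shift past the last index of the target.\<close>
  then show ?thesis by (intro exI[of _ "m (nxt M i)"]) auto
next
  case True
  let ?i' = "nxt M i"
  note nz = v_nz[OF nxt_less, of _ i]
  have al0: "l > k" if "k \<in> {1..m i}" "l \<in> {1..m i}" "arrow M i (v i l) = 0" "arrow M i (v i k) \<noteq> 0" for k l
    using hom i that unfolding homogeneous_choice_def aligned_def by blast
  have al1: "l' > k'" if "k \<in> {1..m i}" "l \<in> {1..m i}" "k' \<in> {1..m ?i'}" "l' \<in> {1..m ?i'}"
    "arrow M i (v i l) = v ?i' l'" "arrow M i (v i k) = v ?i' k'" "l > k" for k l k' l'
    using hom i that unfolding homogeneous_choice_def aligned_def by blast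
  have sal: "k + r \<le> m i \<and> arrow M i (v i (k + r)) = v ?i' (k' + r)"
    if "k \<in> {1..m i}" "k' \<in> {1..m ?i'}" "arrow M i (v i k) = v ?i' k'" "r \<in> {1..m ?i' - k'}" for k k' r
    using hom i that unfolding homogeneous_choice_def strongly_aligned_def by blast
  obtain k0 where k0: "k0 \<in> {1..m i}" "arrow M i (v i k0) \<noteq> 0" using True by auto
  then have 1: "1 \<in> {1..m i}" by auto
  have "arrow M i (v i 1) \<noteq> 0" using al0[OF k0(1) 1] k0 by auto
  then obtain g where g: "g \<in> {1..m ?i'}" "arrow M i (v i 1) = v ?i' g" using arrow_v[OF i 1] by auto
  define s where "s = g - 1"
  have gs: "g = 1 + s" using g by (simp add: s_def)
  have low: "k \<le> m i \<and> arrow M i (v i k) = v ?i' (k + s)" if "1 \<le> k" "k + s \<le> m ?i'" for k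
  proof (cases "k = 1")
    case True then show ?thesis using g gs 1 by simp
  next
    case False
    then have "k - 1 \<in> {1..m ?i' - g}" using that gs by auto
    from sal[OF 1 g(1) g(2) this] that gs show ?thesis by (simp add: add.commute)
  qed
  have high: "arrow M i (v i k) = 0" if k: "k \<in> {1..m i}" "\<not> k + s \<le> m ?i'" for k
  proof (rule ccontr)
    assume "arrow M i (v i k) \<noteq> 0"
    then obtain k' where k': "k' \<in> {1..m ?i'}" "arrow M i (v i k) = v ?i' k'" using arrow_v[OF i k(1)] by auto
    \<comment> \<open>The vector whose image is the last one of the target; a later vector with
      nonzero image would need a larger index.\<close>
    define l where "l = m ?i' - s"
    have l: "1 \<le> l" "l + s \<le> m ?i'" "l < k" using g gs k by (auto simp: l_def)
    have "k' > l + s" using al1[of l k "l + s" k'] low[OF l(1,2)] l k k' by auto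
    then show False using k' l_def l by auto
  qed
  have "m ?i' \<le> m i + s"
  proof (rule ccontr)
    assume "\<not> m ?i' \<le> m i + s"
    then have "m i + 1 \<le> m i" using low[of "m i + 1"] by auto
    then show False by simp
  qed
  moreover have "\<forall>k\<in>{1..m i}. arrow M i (v i k) = (if k + s \<le> m ?i' then v ?i' (k + s) else 0)"
    using low high by auto
  ultimately show ?thesis by blast
qed

definition sh :: "nat \<Rightarrow> nat" where
  "sh i = (SOME s. m (nxt M i) \<le> m i + s \<and>
    (\<forall>k\<in>{1..m i}. arrow M i (v i k) = (if k + s \<le> m (nxt M i) then v (nxt M i) (k + s) else 0)))"

lemma sh:
  assumes "i < n"
  shows "m (nxt M i) \<le> m i + sh i"
    "k \<in> {1..m i} \<Longrightarrow> arrow M i (v i k) = (if k + sh i \<le> m (nxt M i) then v (nxt M i) (k + sh i) else 0)"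
  using someI_ex[OF shift_exists[OF assms]] unfolding sh_def[symmetric] by auto

section \<open>Positions on the universal cover\<close>

definition om :: int where "om = int (\<Sum>t<n. sh t)"

definition vx :: "int \<Rightarrow> nat" where "vx I = nat (I mod int n)"

text \<open>The universal cover of the cycle is the line; \<open>off I + k\<close> is the position of \<open>v (vx I) k\<close>, chosen
  such that the arrows preserve positions.\<close>

definition off :: "int \<Rightarrow> int" where
  "off I = - int (\<Sum>t<vx I. sh t) - (I div int n) * om"

definition top :: "int \<Rightarrow> int" where "top I = off I + int (m (vx I))"

lemma vx_less: "vx I < n" using n_pos by (simp add: vx_def nat_less_iff)

lemma vx_period: "vx (I + int n * k) = vx I" by (simp add: vx_def)

lemma vx_nat: "vx (int a) = a mod n" by (simp add: vx_def nat_mod_as_int)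

lemma off_period: "off (I + int n * k) = off I - om * k"
  using n_pos unfolding off_def vx_period by (simp add: distrib_right)

lemma vx_Suc: "vx (I + 1) = nxt M (vx I)"
proof -
  have "int (nxt M (vx I)) = (1 + I mod int n) mod int n"
    using n_pos by (simp add: nxt_def vx_def zmod_int)
  then show ?thesis using n_pos by (simp add: vx_def mod_simps add.commute)
qed

lemma off_Suc: "off (I + 1) = off I - int (sh (vx I))"
proof -
  define q i where "q = I div int n" and "i = vx I"
  have I: "I = int i + int n * q" using n_pos by (simp add: q_def i_def vx_def)
  have i: "i < n" using vx_less by (simp add: i_def)
  have base: "off (int i + 1) = off (int i) - int (sh i)"
  proof (cases "Suc i < n")
    case True
    then have "vx (int i + 1) = Suc i" using vx_nat[of "Suc i"] by (simp add: add.commute)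
    moreover have "(int i + 1) div int n = 0" using True by simp
    ultimately show ?thesis using i vx_nat[of i] by (simp add: off_def)
  next
    case False
    then have n: "n = Suc i" using i by simp
    have "off (int i + 1) = off (0 + int n * 1)" using n by (simp add: add.commute)
    also have "\<dots> = - om" unfolding off_period using vx_nat[of 0] by (simp add: off_def)
    also have "\<dots> = off (int i) - int (sh i)" using i vx_nat[of i] n by (simp add: off_def om_def)
    finally show ?thesis .
  qed
  have "I + 1 = (int i + 1) + int n * q" using I by simp
  then have "off (I + 1) = off (int i + 1) - om * q" using off_period[of "int i + 1" q] by metis
  moreover have "off I = off (int i) - om * q" using off_period[of "int i" q] I by metis
  ultimately show ?thesis using base by (simp add: i_def)
qed

lemma top_Suc: "top (I + 1) \<le> top I"
  using sh(1)[OF vx_less, of I] by (simp add: top_def vx_Suc off_Suc)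

lemma antimono_steps:
  fixes f :: "int \<Rightarrow> int"
  assumes "\<And>I. f (I + 1) \<le> f I" shows "I \<le> J \<Longrightarrow> f J \<le> f I"
proof -
  assume "I \<le> J"
  have "f (I + int t) \<le> f I" for t
  proof (induction t)
    case (Suc t) then show ?case using assms[of "I + int t"] by (simp add: ac_simps)
  qed simp
  from this[of "nat (J - I)"] show "f J \<le> f I" using \<open>I \<le> J\<close> by simp
qed

lemma off_antimono: "I \<le> J \<Longrightarrow> off J \<le> off I"
  by (rule antimono_steps[of off]) (simp_all add: off_Suc)

lemma top_antimono: "I \<le> J \<Longrightarrow> top J \<le> top I"
  by (rule antimono_steps[of top]) (rule top_Suc)

lemma off_le_top: "off I \<le> top I" by (simp add: top_def)

lemma off_n: "off (I + int n) = off I - om" using off_period[of I 1] by simp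
lemma top_n: "top (I + int n) = top I - om" using vx_period[of I 1] by (simp add: top_def off_n)

text \<open>If the total shift around the cycle vanished, \<open>off\<close> and \<open>top\<close>
  would be constant. Every arrow would then preserve indices between bases of equal size and kill no
  basis vector; but the last vector of the first summand is killed.\<close>

lemma om_pos: assumes "summands M \<ge> 1" shows "om \<ge> 1"
proof (rule ccontr)
  assume "\<not> om \<ge> 1"
  moreover have "om \<ge> 0" unfolding om_def by (rule of_nat_0_le_iff)
  ultimately have om0: "om = 0" by simp
  have const: "f I = f J" if "\<And>I. f (I + 1) \<le> f I" "\<And>I. f (I + int n) = f I" for f :: "int \<Rightarrow> int" and I J
  proof -
    have p: "f (I + int n * int t) = f I" for I t
    proof (induction t)
      case (Suc t) then show ?case using that(2)[of "I + int n * int t"] by (simp add: algebra_simps)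
    qed simp
    have le: "f I \<le> f J" for I J
    proof -
      define t where "t = nat \<bar>J - I\<bar>"
      have "int t \<le> int n * int t" using n_pos by (simp add: mult_le_cancel_right1)
      then have "J \<le> I + int n * int t" by (simp add: t_def)
      from antimono_steps[of f, OF that(1) this] show ?thesis by (simp add: p)
    qed
    show ?thesis using le[of I J] le[of J I] by simp
  qed
  have offc: "off I = off J" for I J by (rule const[of off]) (simp_all add: off_Suc off_n om0)
  have topc: "top I = top J" for I J by (rule const[of top]) (simp_all add: top_Suc top_n om0)
  have 1: "(1, len M 1 - 1) \<in> basis_index M" using assms len_pos[of 1] by (simp add: basis_index_iff)
  let ?i = "(start M 1 + (len M 1 - 1)) mod n"
  obtain k where k: "k \<in> {1..m ?i}" "v ?i k = bas M 1 (len M 1 - 1)" using bas_obtain[OF 1] .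
  have i: "?i < n" using n_pos by simp
  have "\<not> Suc (len M 1 - 1) < len M 1" by simp
  then have z: "arrow M ?i (v ?i k) = 0" using arrow_bas[OF 1] k(2) by (metis (no_types))
  have vi: "vx (int ?i) = ?i" by (simp add: vx_nat)
  have "sh ?i = 0" using off_Suc[of "int ?i"] offc[of "int ?i + 1" "int ?i"] vi by simp
  moreover have "m (nxt M ?i) = m ?i"
    using topc[of "int ?i + 1" "int ?i"] offc[of "int ?i + 1" "int ?i"] vi vx_Suc[of "int ?i"] by (simp add: top_def)
  ultimately have "v (nxt M ?i) k = 0" "k \<in> {1..m (nxt M ?i)}" using sh(2)[OF i k(1)] z k(1) by auto
  then show False using v_nz[OF nxt_less] by blast
qed

text \<open>Position \<open>P\<close> carries a basis vector over the vertex \<open>I\<close>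
  exactly if \<open>off I < P \<le> top I\<close>. As both bounds are antitone, these vertices form
  an interval: \<open>lo P\<close> is the first \<open>I\<close> with \<open>off I < P\<close>, and
  \<open>hi P\<close> the first with \<open>top I < P\<close>.\<close>

definition lo where "lo P = (SOME L. \<forall>I. L \<le> I \<longleftrightarrow> off I < P)"
definition hi where "hi P = (SOME L. \<forall>I. L \<le> I \<longleftrightarrow> top I < P)"

context assumes d: "summands M \<ge> 1"
begin

lemma lo: "lo P \<le> I \<longleftrightarrow> off I < P"
proof -
  have "\<exists>L. \<forall>I. L \<le> I \<longleftrightarrow> off I < P"
    by (rule threshold_exists[of off "int n" om]) (use off_antimono off_n om_pos[OF d] n_pos in auto)
  from someI_ex[OF this] show ?thesis unfolding lo_def by auto
qed

lemma hi: "hi P \<le> I \<longleftrightarrow> top I < P"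
proof -
  have "\<exists>L. \<forall>I. L \<le> I \<longleftrightarrow> top I < P"
    by (rule threshold_exists[of top "int n" om]) (use top_antimono top_n om_pos[OF d] n_pos in auto)
  from someI_ex[OF this] show ?thesis unfolding hi_def by auto
qed

lemma lo_antimono: "P \<le> Q \<Longrightarrow> lo Q \<le> lo P" using lo[of Q "lo P"] lo[of P "lo P"] by simp
lemma hi_antimono: "P \<le> Q \<Longrightarrow> hi Q \<le> hi P" using hi[of Q "hi P"] hi[of P "hi P"] by simp
lemma lo_le_hi: "lo P \<le> hi P" using lo[of P "hi P"] hi[of P "hi P"] off_le_top[of "hi P"] by simp

lemma lo_period: "lo (P + om) = lo P - int n"
proof -
  have "lo (P + om) \<le> I \<longleftrightarrow> lo P - int n \<le> I" for I
    using lo[of "P + om" I] lo[of P "I + int n"] off_n[of I] by auto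
  then show ?thesis by (meson order_antisym order_refl)
qed

lemma hi_period: "hi (P + om) = hi P - int n"
proof -
  have "hi (P + om) \<le> I \<longleftrightarrow> hi P - int n \<le> I" for I
    using hi[of "P + om" I] hi[of P "I + int n"] top_n[of I] by auto
  then show ?thesis by (meson order_antisym order_refl)
qed

section \<open>Strings and indecomposable summands\<close>

definition vec where "vec P I = v (vx I) (nat (P - off I))"

lemma vec_index: "lo P \<le> I \<Longrightarrow> I < hi P \<Longrightarrow> nat (P - off I) \<in> {1..m (vx I)}"
  using lo[of P I] hi[of P I] by (auto simp: top_def)

lemma arrow_vec:
  assumes "lo P \<le> I" "I < hi P"
  shows "arrow M (vx I) (vec P I) = (if I + 1 < hi P then vec P (I + 1) else 0)"
proof -
  have "nat (P - off I) + sh (vx I) = nat (P - off (I + 1))"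
    using lo[of P I] assms by (simp add: off_Suc nat_add_distrib)
  moreover have "nat (P - off (I + 1)) \<le> m (nxt M (vx I)) \<longleftrightarrow> I + 1 < hi P"
    using hi[of P "I + 1"] by (auto simp: top_def vx_Suc)
  ultimately show ?thesis
    using sh(2)[OF vx_less vec_index[OF assms]] by (simp add: vec_def vx_Suc)
qed

text \<open>A predecessor \<open>bas M j (p - 1)\<close> would be mapped to the vector at
  \<open>P\<close>, hence lie at the same position over the previous vertex, before the start of the
  interval. So the string begins where a summand begins.\<close>

lemma string_start:
  assumes "lo P < hi P"
  obtains j where "1 \<le> j" "j \<le> summands M" "vec P (lo P) = bas M j 0" "vx (lo P) = start M j"
proof -
  let ?I = "lo P"
  have ix: "nat (P - off ?I) \<in> {1..m (vx ?I)}" using vec_index[of P ?I] assms by simp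
  obtain j p where jp: "(j, p) \<in> basis_index M" "(start M j + p) mod n = vx ?I" "vec P ?I = bas M j p"
    using v_obtain[OF vx_less ix] unfolding vec_def by metis
  have "p = 0"
  proof (rule ccontr)
    assume p: "p \<noteq> 0"
    then have jp': "(j, p - 1) \<in> basis_index M" using jp(1) by (auto simp: basis_index_iff)
    let ?i = "(start M j + (p - 1)) mod n"
    have iI: "?i = vx (?I - 1)"
    proof -
      have "int (start M j + p) mod int n = ?I mod int n" using jp(2) n_pos
        by (metis int_nat_eq of_nat_mod pos_mod_sign of_nat_0_less_iff vx_def less_le_trans zero_less_one)
      then have "(int (start M j + p) - 1) mod int n = (?I - 1) mod int n" by (metis mod_diff_left_eq)
      then show ?thesis using p unfolding vx_def by (simp add: nat_mod_as_int of_nat_diff)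
    qed
    obtain k where k: "k \<in> {1..m ?i}" "v ?i k = bas M j (p - 1)" using bas_obtain[OF jp'] .
    have i: "?i < n" using n_pos by simp
    have "arrow M ?i (v ?i k) = bas M j p" using arrow_bas[OF jp'] k p jp(1) by (auto simp: basis_index_iff)
    then have eq: "(if k + sh ?i \<le> m (nxt M ?i) then v (nxt M ?i) (k + sh ?i) else 0) = bas M j p"
      using sh(2)[OF i k(1)] by simp
    then have le: "k + sh ?i \<le> m (nxt M ?i)" using bas_nz[OF jp(1)] by (auto split: if_splits)
    have nx: "nxt M ?i = vx ?I" using vx_Suc[of "?I - 1"] iI by simp
    have "k + sh ?i = nat (P - off ?I)"
      using v_inj[OF vx_less, of "k + sh ?i" ?I "nat (P - off ?I)"] le eq nx ix jp(3) k(1)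
      by (auto simp: vec_def)
    then have "off (?I - 1) < P" using off_Suc[of "?I - 1"] iI k(1) by auto
    then show False using lo[of P "?I - 1"] by simp
  qed
  then show ?thesis using that jp start_less by (auto simp: basis_index_iff)
qed

lemma string_vec:
  assumes P: "lo P < hi P" and j: "1 \<le> j" "j \<le> summands M" "vec P (lo P) = bas M j 0" "vx (lo P) = start M j"
  shows "lo P + int p < hi P \<Longrightarrow> p < len M j \<and> vec P (lo P + int p) = bas M j p"
proof (induction p)
  case 0
  then show ?case using j len_pos by force
next
  case (Suc p)
  then have IH: "p < len M j" "vec P (lo P + int p) = bas M j p" by auto
  have "int (vx (lo P)) = lo P mod int n" using n_pos by (simp add: vx_def)
  then have "int (start M j) mod int n = lo P mod int n" using j(4) by simp
  then have "(int (start M j) + int p) mod int n = (lo P + int p) mod int n" by (metis mod_add_left_eq)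
  then have vxp: "vx (lo P + int p) = (start M j + p) mod n" by (simp add: vx_def nat_mod_as_int)
  have ip: "(j, p) \<in> basis_index M" using IH j by (simp add: basis_index_iff)
  have "arrow M (vx (lo P + int p)) (bas M j p) = vec P (lo P + int p + 1)"
    using arrow_vec[of P "lo P + int p"] Suc.prems IH by simp
  then have eq: "vec P (lo P + int (Suc p)) = (if Suc p < len M j then bas M j (Suc p) else 0)"
    using arrow_bas[OF ip] vxp by (simp add: ac_simps)
  have "vec P (lo P + int (Suc p)) \<noteq> 0"
    unfolding vec_def using Suc.prems by (intro v_nz[OF vx_less] vec_index) auto
  then show ?case using eq by (auto split: if_splits)
qed

text \<open>The last vector of the interval is killed by the arrow, and in a summand only the last
  basis vector is.\<close>

lemma string_len:
  assumes P: "lo P < hi P" and j: "1 \<le> j" "j \<le> summands M" "vec P (lo P) = bas M j 0" "vx (lo P) = start M j"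
  shows "hi P = lo P + int (len M j)"
proof -
  define p where "p = nat (hi P - lo P - 1)"
  have h: "hi P = lo P + int (Suc p)" using P by (simp add: p_def)
  have p: "p < len M j" "vec P (lo P + int p) = bas M j p" using string_vec[OF assms, of p] h by auto
  have "int (vx (lo P)) = lo P mod int n" using n_pos by (simp add: vx_def)
  then have "int (start M j) mod int n = lo P mod int n" using j(4) by simp
  then have "(int (start M j) + int p) mod int n = (lo P + int p) mod int n" by (metis mod_add_left_eq)
  then have vxp: "vx (lo P + int p) = (start M j + p) mod n" by (simp add: vx_def nat_mod_as_int)
  have ip: "(j, p) \<in> basis_index M" using p j by (simp add: basis_index_iff)
  have "arrow M (vx (lo P + int p)) (bas M j p) = 0"
    using arrow_vec[of P "lo P + int p"] h p by simp
  then have "(if Suc p < len M j then bas M j (Suc p) else 0) = 0" using arrow_bas[OF ip] vxp by simp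
  then have "\<not> Suc p < len M j" using bas_nz[of j "Suc p"] j by (auto simp: basis_index_iff split: if_splits)
  then show ?thesis using h p by simp
qed

text \<open>The position of the first vector of summand \<open>j\<close>, measured over the lift of
  its vertex to \<open>{0..<n}\<close>; other lifts give the translates by multiples of
  \<open>om\<close>.\<close>

definition pos where
  "pos j = off (int (start M j)) + int (SOME k. k \<in> {1..m (start M j)} \<and> v (start M j) k = bas M j 0)"

lemma pos:
  assumes j: "1 \<le> j" "j \<le> summands M"
  shows "lo (pos j) = int (start M j)" "hi (pos j) = int (start M j) + int (len M j)"
    "vec (pos j) (int (start M j)) = bas M j 0" "vx (int (start M j)) = start M j"
proof -
  let ?s = "start M j" and ?P = "pos j"
  have j0: "(j, 0) \<in> basis_index M" using j len_pos[OF j] by (simp add: basis_index_iff)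
  have s: "?s < n" using start_less j by simp
  show vs: "vx (int ?s) = ?s" using vx_nat[of ?s] s by simp
  define k where "k = (SOME k. k \<in> {1..m ?s} \<and> v ?s k = bas M j 0)"
  have "\<exists>k. k \<in> {1..m ?s} \<and> v ?s k = bas M j 0" using bas_obtain[OF j0] s by auto
  from someI_ex[OF this] have k: "k \<in> {1..m ?s}" "v ?s k = bas M j 0" unfolding k_def[symmetric] by auto
  have P: "?P = off (int ?s) + int k" by (simp add: pos_def k_def)
  have b: "lo ?P \<le> int ?s" "int ?s < hi ?P" using lo[of ?P "int ?s"] hi[of ?P "int ?s"] k P vs by (auto simp: top_def)
  show vec: "vec ?P (int ?s) = bas M j 0" using P k vs by (simp add: vec_def)
  obtain j' where j': "1 \<le> j'" "j' \<le> summands M" "vec ?P (lo ?P) = bas M j' 0" "vx (lo ?P) = start M j'"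
    using string_start[of ?P] b by auto
  define p where "p = nat (int ?s - lo ?P)"
  have e: "int ?s = lo ?P + int p" using b by (simp add: p_def)
  have "p < len M j' \<and> vec ?P (lo ?P + int p) = bas M j' p" by (rule string_vec) (use b j' e in auto)
  then have "j' = j \<and> p = 0" using vec e bas_inj[of j' p j 0] j' j0 by (auto simp: basis_index_iff)
  then show lo: "lo ?P = int ?s" and "hi ?P = int ?s + int (len M j)"
    using e string_len[of ?P j'] j' b by auto
qed

lemma bas_vec:
  assumes "(j, p) \<in> basis_index M"
  shows "bas M j p = vec (pos j) (int (start M j) + int p)" "int (start M j) + int p < hi (pos j)"
proof -
  have j: "1 \<le> j" "j \<le> summands M" "p < len M j" using assms by (auto simp: basis_index_iff)
  show h: "int (start M j) + int p < hi (pos j)" using pos(2)[OF j(1,2)] j by simp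
  show "bas M j p = vec (pos j) (int (start M j) + int p)"
    using string_vec[of "pos j" j p] pos[OF j(1,2)] j h by auto
qed

text \<open>Over one vertex the index of a basis vector is determined, and two lifts of a vertex
  differ by full periods. Together with \<open>pos_inj\<close> this identifies the summands with the
  nonempty strings modulo \<open>om\<close>.\<close>

lemma active_pos:
  assumes "lo P < hi P"
  obtains j where "1 \<le> j" "j \<le> summands M" "om dvd P - pos j"
proof -
  obtain j where j: "1 \<le> j" "j \<le> summands M" "vec P (lo P) = bas M j 0" "vx (lo P) = start M j"
    using string_start[OF assms] .
  define q where "q = lo P div int n"
  have lq: "lo P = int (start M j) + int n * q" using j(4) n_pos by (simp add: q_def vx_def flip: j(4))
  note pj = pos[OF j(1,2)]
  have ix: "nat (P - off (lo P)) \<in> {1..m (start M j)}" using vec_index[of P "lo P"] assms j(4) by simp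
  have ix': "nat (pos j - off (int (start M j))) \<in> {1..m (start M j)}"
    using vec_index[of "pos j" "int (start M j)"] pj len_pos[OF j(1,2)] by auto
  have "v (start M j) (nat (P - off (lo P))) = v (start M j) (nat (pos j - off (int (start M j))))"
    using j(3,4) pj(3,4) by (simp add: vec_def)
  then have "nat (P - off (lo P)) = nat (pos j - off (int (start M j)))"
    using v_inj[OF start_less[OF j(1,2)] ix ix'] by simp
  then have "P - off (lo P) = pos j - off (int (start M j))" using ix ix' by auto
  then have "P - pos j = om * (- q)" using lq off_period[of "int (start M j)" q] by simp
  then show ?thesis using that j by (metis dvd_triv_left)
qed

lemma pos_inj:
  assumes j: "1 \<le> j" "j \<le> summands M" and j': "1 \<le> j'" "j' \<le> summands M" and "om dvd pos j - pos j'"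
  shows "j = j'"
proof -
  obtain q where "pos j - pos j' = om * q" using assms(5) by (rule dvdE)
  then have q: "pos j = pos j' + om * q" by simp
  have "lo (P + om * q) = lo P + (- int n) * q" for P q
    by (rule period_mult) (simp add: lo_period)
  then have "int (start M j) = int (start M j') + (- int n) * q" using pos(1)[OF j] pos(1)[OF j'] q by metis
  then have sq: "int (start M j) = int (start M j') + int n * (- q)" by simp
  then have "int (start M j) mod int n = int (start M j') mod int n" by (metis mod_mult_self2)
  then have "start M j = start M j'" using start_less[OF j] start_less[OF j'] by simp
  then have "q = 0" using sq n_pos by auto
  then have "bas M j 0 = bas M j' 0" using pos(3)[OF j] pos(3)[OF j'] q \<open>start M j = start M j'\<close> by simp
  then show ?thesis using bas_inj[of j 0 j' 0] j j' len_pos[OF j] len_pos[OF j'] by (auto simp: basis_index_iff)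
qed

text \<open>The integer \<open>r\<close> fixes the relative lift of the two summands. Over a common
  vertex the second string has the larger index, hence the larger weight; an arrow changes both
  weights by the same amount, so the difference is constant along the overlap.\<close>

lemma wt_difference:
  assumes j: "1 \<le> j" "j \<le> summands M" and j': "1 \<le> j'" "j' \<le> summands M"
    and less: "pos j < pos j' + om * r"
  shows "\<exists>D>0. \<forall>p p'. p < len M j \<longrightarrow> p' < len M j' \<longrightarrow>
    int (start M j) + int p = int (start M j') - int n * r + int p' \<longrightarrow> wt (bas M j' p') - wt (bas M j p) = D"
proof -
  let ?A = "\<lambda>p p'. p < len M j \<and> p' < len M j' \<and> int (start M j) + int p = int (start M j') - int n * r + int p'"
  let ?w = "\<lambda>p p'. wt (bas M j' p') - wt (bas M j p)"
  have grad: "wt (v i k) > wt (v i l)" if "i < n" "k \<in> {1..m i}" "l \<in> {1..m i}" "k > l" for i k l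
    using hom that unfolding homogeneous_choice_def attractive_grading_def by blast
  have grad2: "\<exists>\<delta>::int. \<forall>k\<in>{1..m i}. \<forall>l\<in>{1..m (nxt M i)}.
        arrow M i (v i k) = v (nxt M i) l \<longrightarrow> wt (v (nxt M i) l) = wt (v i k) + \<delta>" if "i < n" for i
    using hom that unfolding homogeneous_choice_def attractive_grading_def by blast
  have step_wt: "wt (bas M u (Suc p)) = wt (bas M u p) + \<delta>"
    if u: "1 \<le> u" "u \<le> summands M" "Suc p < len M u" "vx I = (start M u + p) mod n"
    and \<delta>: "\<forall>k\<in>{1..m (vx I)}. \<forall>l\<in>{1..m (nxt M (vx I))}.
        arrow M (vx I) (v (vx I) k) = v (nxt M (vx I)) l \<longrightarrow> wt (v (nxt M (vx I)) l) = wt (v (vx I) k) + \<delta>"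
    for u p I \<delta>
  proof -
    have i: "(u, p) \<in> basis_index M" "(u, Suc p) \<in> basis_index M" using u by (auto simp: basis_index_iff)
    obtain k where k: "k \<in> {1..m (vx I)}" "v (vx I) k = bas M u p" using bas_obtain[OF i(1)] u(4) by auto
    have nx: "(start M u + Suc p) mod n = nxt M (vx I)" using u(4) by (simp add: nxt_def mod_Suc_eq)
    obtain l where l: "l \<in> {1..m (nxt M (vx I))}" "v (nxt M (vx I)) l = bas M u (Suc p)"
      using bas_obtain[OF i(2)] nx by auto
    have "arrow M (vx I) (v (vx I) k) = v (nxt M (vx I)) l" using arrow_bas[OF i(1)] u k l by simp
    then show ?thesis using \<delta> k l by metis
  qed
  have vxA: "vx (int (start M j) + int p) = (start M j + p) mod n"
    "vx (int (start M j) + int p) = (start M j' + p') mod n" if "?A p p'" for p p'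
  proof -
    show "vx (int (start M j) + int p) = (start M j + p) mod n" using vx_nat[of "start M j + p"] by simp
    have "int (start M j) + int p = int (start M j' + p') + int n * (- r)" using that by simp
    then show "vx (int (start M j) + int p) = (start M j' + p') mod n"
      using vx_nat[of "start M j' + p'"] vx_period by metis
  qed
  have pos1: "?w p p' > 0" if A: "?A p p'" for p p'
  proof -
    define I where "I = int (start M j) + int p"
    have i: "(j, p) \<in> basis_index M" "(j', p') \<in> basis_index M" using A j j' by (auto simp: basis_index_iff)
    have I': "int (start M j') + int p' = I + int n * r" using A by (simp add: I_def)
    have b: "bas M j p = v (vx I) (nat (pos j - off I))" using bas_vec[OF i(1)] by (simp add: vec_def I_def)
    have b': "bas M j' p' = v (vx I) (nat (pos j' + om * r - off I))"
      using bas_vec(1)[OF i(2)] unfolding vec_def I' vx_period off_period by (simp add: algebra_simps)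
    have ix: "nat (pos j - off I) \<in> {1..m (vx I)}"
      using vec_index[of "pos j" I] pos(1)[OF j] bas_vec(2)[OF i(1)] by (simp add: I_def)
    have "nat (pos j' - off (I + int n * r)) \<in> {1..m (vx (I + int n * r))}"
      using vec_index[of "pos j'" "I + int n * r"] pos(1)[OF j'] bas_vec(2)[OF i(2)] by (simp flip: I')
    then have ix': "nat (pos j' + om * r - off I) \<in> {1..m (vx I)}"
      unfolding vx_period off_period by (simp add: algebra_simps)
    have "nat (pos j - off I) < nat (pos j' + om * r - off I)" using less ix by auto
    then show ?thesis using grad[OF vx_less ix' ix] b b' by simp
  qed
  have step: "?w (Suc p) (Suc p') = ?w p p'" if A: "?A p p'" "?A (Suc p) (Suc p')" for p p'
  proof -
    define I where "I = int (start M j) + int p"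
    obtain \<delta> where \<delta>: "\<forall>k\<in>{1..m (vx I)}. \<forall>l\<in>{1..m (nxt M (vx I))}.
        arrow M (vx I) (v (vx I) k) = v (nxt M (vx I)) l \<longrightarrow> wt (v (nxt M (vx I)) l) = wt (v (vx I) k) + \<delta>"
      using grad2[OF vx_less[of I]] by metis
    show ?thesis
      using step_wt[OF j _ _ \<delta>, of p] step_wt[OF j' _ _ \<delta>, of p'] vxA[OF A(1)] A(2) by (simp add: I_def)
  qed
  have steps: "?A (p + t) (p' + t) \<Longrightarrow> ?w (p + t) (p' + t) = ?w p p'" if "?A p p'" for p p' t
  proof (induction t)
    case (Suc t)
    then have "?A (p + t) (p' + t)" using that by auto
    then show ?case using Suc.IH step[of "p + t" "p' + t"] Suc.prems by simp
  qed simp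
  have const: "?w q q' = ?w p p'" if "?A p p'" "?A q q'" for p p' q q'
  proof (cases "p \<le> q")
    case True
    then have "q = p + (q - p)" "q' = p' + (q - p)" using that by auto
    then show ?thesis using steps[OF that(1), of "q - p"] that(2) by metis
  next
    case False
    then have "p = q + (p - q)" "p' = q' + (p - q)" using that by auto
    then show ?thesis using steps[OF that(2), of "p - q"] that(1) by metis
  qed
  show ?thesis
  proof (cases "\<exists>p p'. ?A p p'")
    case True
    then obtain p p' where A: "?A p p'" by auto
    show ?thesis by (rule exI[of _ "?w p p'"]) (use pos1[OF A] const[OF A] in auto)
  next
    case False
    \<comment> \<open>Without a common vertex any positive value does.\<close>
    then show ?thesis by (intro exI[of _ 1]) auto
  qed
qed

end

end

text \<open>The part of the structure of a homogeneous representation that determines the moment graph: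
  string \<open>P\<close> occupies the vertices \<open>lo P, \<dots>, hi P - 1\<close> of the universal cover.\<close>

definition string_structure where
  "string_structure M wt om lo hi pos \<longleftrightarrow>
    om \<ge> 1 \<and>
    (\<forall>P Q. P \<le> Q \<longrightarrow> lo Q \<le> lo P \<and> hi Q \<le> hi P) \<and> (\<forall>P. lo P \<le> hi P) \<and>
    (\<forall>P. lo (P + om) = lo P - int (vertices M) \<and> hi (P + om) = hi P - int (vertices M)) \<and>
    (\<forall>j\<in>{1..summands M}. lo (pos j) = int (start M j) \<and> hi (pos j) = int (start M j) + int (len M j)) \<and>
    (\<forall>P. lo P < hi P \<longrightarrow> (\<exists>j\<in>{1..summands M}. om dvd P - pos j)) \<and>
    (\<forall>j\<in>{1..summands M}. \<forall>j'\<in>{1..summands M}. om dvd pos j - pos j' \<longrightarrow> j = j') \<and>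
    (\<forall>j\<in>{1..summands M}. \<forall>j'\<in>{1..summands M}. \<forall>r::int. pos j < pos j' + om * r \<longrightarrow>
      (\<exists>D>0::int. \<forall>p p'. p < len M j \<longrightarrow> p' < len M j' \<longrightarrow>
        int (start M j) + int p = int (start M j') - int (vertices M) * r + int p' \<longrightarrow>
        wt (bas M j' p') - wt (bas M j p) = D))"

lemma (in homogeneous_rep) string_structure_exists:
  "\<exists>(om::int) (lo::int \<Rightarrow> int) (hi::int \<Rightarrow> int) (pos::nat \<Rightarrow> int). string_structure M wt om lo hi pos"
proof (cases "summands M \<ge> 1")
  case True
  note d = True
  have "string_structure M wt om lo hi pos"
    unfolding string_structure_def
  proof (intro conjI allI ballI impI)
    show "om \<ge> 1" using om_pos[OF d] .
    show "lo Q \<le> lo P" "hi Q \<le> hi P" if "P \<le> Q" for P Q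
      using lo_antimono[OF d that] hi_antimono[OF d that] .
    show "lo P \<le> hi P" "lo (P + om) = lo P - int n" "hi (P + om) = hi P - int n" for P
      using lo_le_hi[OF d] lo_period[OF d] hi_period[OF d] by simp_all
    show "lo (pos j) = int (start M j)" "hi (pos j) = int (start M j) + int (len M j)"
      if "j \<in> {1..summands M}" for j using pos[OF d, of j] that by simp_all
    show "\<exists>j\<in>{1..summands M}. om dvd P - pos j" if "lo P < hi P" for P
      using active_pos[OF d that] by (metis atLeastAtMost_iff)
    show "j = j'" if "j \<in> {1..summands M}" "j' \<in> {1..summands M}" "om dvd pos j - pos j'" for j j'
      using pos_inj[OF d, of j j'] that by simp
    show "\<exists>D>0. \<forall>p p'. p < len M j \<longrightarrow> p' < len M j' \<longrightarrow>
        int (start M j) + int p = int (start M j') - int n * r + int p' \<longrightarrow>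
        wt (bas M j' p') - wt (bas M j p) = D"
      if "j \<in> {1..summands M}" "j' \<in> {1..summands M}" "pos j < pos j' + om * r" for j j' r
      using wt_difference[OF d, of j j' r] that by simp
  qed
  then show ?thesis by blast
next
  case False
  \<comment> \<open>With no summands all strings are empty; the two end points only have to be
    antitone and periodic.\<close>
  have "string_structure M wt 1 (\<lambda>P. - int (vertices M) * P) (\<lambda>P. - int (vertices M) * P) (\<lambda>_. 0)"
    unfolding string_structure_def using False
    by (auto simp: algebra_simps intro!: mult_left_mono mult_right_mono)
  then show ?thesis by blast
qed

section \<open>Coordinates\<close>

context decomposed_rep
begin

abbreviation "B \<equiv> basis_index M"
abbreviation "bv \<equiv> basis_vec M"
abbreviation "vt \<equiv> basis_vertex M"
abbreviation "TV \<equiv> module.span (smult M) (basis_set M)"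

definition cf :: "'v \<Rightarrow> nat \<times> nat \<Rightarrow> complex" where "cf x q = coords M x (bv q)"

definition comb :: "(nat \<times> nat \<Rightarrow> complex) \<Rightarrow> 'v" where
  "comb u = (\<Sum>q\<in>B. smult M (u q) (bv q))"

lemma finite_B: "finite B"
proof -
  have "B = (SIGMA j:{1..summands M}. {..<len M j})" by (auto simp: basis_index_iff)
  then show ?thesis by simp
qed

lemma bv_inj: "inj_on bv B" using decomp by (simp add: decomposition_basis_def)

lemma indep: "V.independent (basis_set M)" using decomp by (simp add: decomposition_basis_def)

lemma bv_in: "q \<in> B \<Longrightarrow> bv q \<in> TV"
  by (intro V.span_base) (simp add: basis_set_def)

lemma TV_add: "x \<in> TV \<Longrightarrow> y \<in> TV \<Longrightarrow> x + y \<in> TV" by (rule V.span_add)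
lemma TV_scale: "x \<in> TV \<Longrightarrow> smult M c x \<in> TV" by (rule V.span_scale)
lemma TV_0: "0 \<in> TV" by (rule V.span_zero)
lemma TV_diff: "x \<in> TV \<Longrightarrow> y \<in> TV \<Longrightarrow> x - y \<in> TV" by (rule V.span_diff)
lemma TV_sum: "(\<And>a. a \<in> A \<Longrightarrow> f a \<in> TV) \<Longrightarrow> sum f A \<in> TV" by (rule V.span_sum)

lemma comb_in: "comb u \<in> TV"
  unfolding comb_def by (intro TV_sum TV_scale bv_in)

lemma cf_add: "x \<in> TV \<Longrightarrow> y \<in> TV \<Longrightarrow> cf (x + y) q = cf x q + cf y q"
  by (simp add: cf_def coords_def V.representation_add[OF indep])

lemma cf_scale: "x \<in> TV \<Longrightarrow> cf (smult M c x) q = c * cf x q"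
  by (simp add: cf_def coords_def V.representation_scale[OF indep])

lemma cf_0: "cf 0 q = 0"
  by (simp add: cf_def coords_def V.representation_zero)

lemma cf_diff: "x \<in> TV \<Longrightarrow> y \<in> TV \<Longrightarrow> cf (x - y) q = cf x q - cf y q"
  by (simp add: cf_def coords_def V.representation_diff[OF indep])

lemma cf_sum: "(\<And>a. a \<in> A \<Longrightarrow> f a \<in> TV) \<Longrightarrow> cf (sum f A) q = (\<Sum>a\<in>A. cf (f a) q)"
  by (induction A rule: infinite_finite_induct) (auto simp: cf_0 cf_add TV_sum)

lemma cf_bv: "q \<in> B \<Longrightarrow> q' \<in> B \<Longrightarrow> cf (bv q) q' = (if q' = q then 1 else 0)"
proof -
  assume q: "q \<in> B" "q' \<in> B"
  have "V.representation (basis_set M) (bv q) = (\<lambda>b. if b = bv q then 1 else 0)"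
    by (rule V.representation_basis[OF indep]) (use q in \<open>simp add: basis_set_def\<close>)
  then show ?thesis using bv_inj q by (simp add: cf_def coords_def inj_on_eq_iff)
qed

lemma cf_comb: "q \<in> B \<Longrightarrow> cf (comb u) q = u q"
proof -
  assume q: "q \<in> B"
  have "cf (comb u) q = (\<Sum>q'\<in>B. u q' * (if q = q' then 1 else 0))"
    unfolding comb_def using q
    by (subst cf_sum) (auto simp: TV_scale bv_in cf_scale cf_bv intro!: sum.cong)
  also have "\<dots> = u q" using q finite_B by (simp add: if_distrib[of "(*) _"] cong: if_cong)
  finally show ?thesis .
qed

lemma comb_cf: "x \<in> TV \<Longrightarrow> comb (cf x) = x"
proof -
  assume x: "x \<in> TV"
  have fin: "finite (basis_set M)" using finite_B by (simp add: basis_set_def)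
  have "(\<Sum>b\<in>basis_set M. smult M (V.representation (basis_set M) x b) b) = x"
    by (rule V.sum_representation_eq[OF indep x fin]) simp
  moreover have "(\<Sum>b\<in>basis_set M. smult M (V.representation (basis_set M) x b) b) = comb (cf x)"
    unfolding comb_def basis_set_def cf_def coords_def
    by (subst sum.reindex[OF bv_inj]) (simp add: basis_set_def)
  ultimately show ?thesis by simp
qed

lemma cf_ext: "x \<in> TV \<Longrightarrow> y \<in> TV \<Longrightarrow> (\<And>q. q \<in> B \<Longrightarrow> cf x q = cf y q) \<Longrightarrow> x = y"
  using comb_cf[of x] comb_cf[of y] by (metis (no_types, lifting) comb_def sum.cong)

lemma comb_cong: "(\<And>q. q \<in> B \<Longrightarrow> u q = u' q) \<Longrightarrow> comb u = comb u'"
  unfolding comb_def by (rule sum.cong) auto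

lemma span_bv:
  assumes "A \<subseteq> B"
  shows "module.span (smult M) (bv ` A) = {x \<in> TV. \<forall>q\<in>B. q \<notin> A \<longrightarrow> cf x q = 0}" (is "?L = ?R")
proof
  have "V.subspace ?R"
    by (rule V.subspaceI) (auto simp: TV_0 TV_add TV_scale cf_0 cf_add cf_scale)
  moreover have "bv ` A \<subseteq> ?R" using assms by (auto simp: bv_in cf_bv)
  ultimately show "?L \<subseteq> ?R" by (rule V.span_minimal[rotated])
  show "?R \<subseteq> ?L"
  proof
    fix x assume x: "x \<in> ?R"
    have "x = comb (cf x)" using comb_cf x by simp
    also have "\<dots> = (\<Sum>q\<in>A. smult M (cf x q) (bv q))"
      unfolding comb_def using x assms finite_B by (intro sum.mono_neutral_right) auto
    also have "\<dots> \<in> ?L" by (intro V.span_sum V.span_scale V.span_base) auto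
    finally show "x \<in> ?L" .
  qed
qed

lemma space_eq: "i < n \<Longrightarrow> space M i = {x \<in> TV. \<forall>q\<in>B. vt q \<noteq> i \<longrightarrow> cf x q = 0}"
proof -
  assume "i < n"
  then have "space M i = V.span (bv ` {q \<in> B. vt q = i})"
    using decomp by (simp add: decomposition_basis_def basis_at_def)
  then show ?thesis using span_bv[of "{q \<in> B. vt q = i}"] by auto
qed

lemma vt_less: "vt q < n" using n_pos by (simp add: basis_vertex_def)

lemma bv_space: "q \<in> B \<Longrightarrow> bv q \<in> space M (vt q)"
  using space_eq[OF vt_less] by (auto simp: bv_in cf_bv)

lemma vt_Suc: "vt (j, Suc p) = nxt M (vt (j, p))"
  by (simp add: basis_vertex_def nxt_def mod_Suc_eq)

lemma arrow_bv: "(j, p) \<in> B \<Longrightarrow> arrow M (vt (j, p)) (bv (j, p)) = (if (j, Suc p) \<in> B then bv (j, Suc p) else 0)"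
  using arrow_bas[of j p] by (auto simp: basis_vertex_def basis_vec_def basis_index_iff)

lemma space_subspace: "i < n \<Longrightarrow> V.subspace (space M i)"
  using rep by (simp add: is_rep_def)

lemma arrow_add: "i < n \<Longrightarrow> x \<in> space M i \<Longrightarrow> y \<in> space M i \<Longrightarrow> arrow M i (x + y) = arrow M i x + arrow M i y"
  and arrow_scale: "i < n \<Longrightarrow> x \<in> space M i \<Longrightarrow> arrow M i (smult M c x) = smult M c (arrow M i x)"
  using rep by (auto simp: is_rep_def)

lemma arrow_0: "i < n \<Longrightarrow> arrow M i 0 = 0"
  using arrow_scale[of i 0 0] V.subspace_0[OF space_subspace] V.scale_zero_left by metis

lemma arrow_sum:
  "i < n \<Longrightarrow> (\<And>a. a \<in> A \<Longrightarrow> f a \<in> space M i) \<Longrightarrow> arrow M i (sum f A) = (\<Sum>a\<in>A. arrow M i (f a))"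
proof (induction A rule: infinite_finite_induct)
  case (insert a A)
  have "sum f A \<in> space M i" using insert by (intro V.subspace_sum[OF space_subspace]) auto
  then show ?case using insert by (simp add: arrow_add)
qed (auto simp: arrow_0)

lemma space_TV: "i < n \<Longrightarrow> x \<in> space M i \<Longrightarrow> x \<in> TV" by (simp add: space_eq)

lemma cf_arrow:
  assumes i: "i < n" and x: "x \<in> space M i" and q: "(j, p) \<in> B"
  shows "cf (arrow M i x) (j, p) = (if p = 0 then 0 else cf x (j, p - 1))"
proof -
  have xT: "x \<in> TV" using space_TV[OF i x] .
  let ?A = "{q \<in> B. vt q = i}"
  have fA: "finite ?A" using finite_B by simp
  have "x = comb (cf x)" using comb_cf[OF xT] by simp
  also have "\<dots> = (\<Sum>q\<in>?A. smult M (cf x q) (bv q))"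
    unfolding comb_def using x finite_B by (intro sum.mono_neutral_right) (auto simp: space_eq[OF i])
  finally have x_eq: "x = (\<Sum>q\<in>?A. smult M (cf x q) (bv q))" .
  have sp: "smult M (cf x q) (bv q) \<in> space M i" if "q \<in> ?A" for q
    using that bv_space[of q] by (intro V.subspace_scale[OF space_subspace[OF i]]) auto
  have "arrow M i x = (\<Sum>q\<in>?A. arrow M i (smult M (cf x q) (bv q)))"
    by (subst x_eq) (rule arrow_sum[OF i sp])
  also have "\<dots> = (\<Sum>q\<in>?A. smult M (cf x q) (arrow M i (bv q)))"
    using bv_space by (intro sum.cong refl arrow_scale[OF i]) auto
  also have "\<dots> = (\<Sum>q\<in>?A. smult M (cf x q) (if (fst q, Suc (snd q)) \<in> B then bv (fst q, Suc (snd q)) else 0))"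
    using arrow_bv by (intro sum.cong) auto
  finally have ax: "arrow M i x = \<dots>" .
  have "cf (arrow M i x) (j, p) = (\<Sum>q\<in>?A. cf (smult M (cf x q) (if (fst q, Suc (snd q)) \<in> B then bv (fst q, Suc (snd q)) else 0)) (j, p))"
    unfolding ax by (rule cf_sum) (auto simp: TV_scale bv_in TV_0)
  also have "\<dots> = (\<Sum>q\<in>?A. if (fst q, Suc (snd q)) = (j, p) then cf x q else 0)"
    using q by (intro sum.cong) (auto simp: cf_scale TV_0 bv_in cf_0 cf_bv)
  also have "\<dots> = (\<Sum>q\<in>?A. if q = (j, p - 1) \<and> p \<noteq> 0 then cf x (j, p - 1) else 0)"
    by (intro sum.cong) auto
  also have "\<dots> = (if p = 0 then 0 else if (j, p - 1) \<in> ?A then cf x (j, p - 1) else 0)"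
    using fA by (cases "p = 0") simp_all
  also have "\<dots> = (if p = 0 then 0 else cf x (j, p - 1))"
  proof -
    have "(j, p - 1) \<in> B" using q by (auto simp: basis_index_iff)
    then show ?thesis using x by (auto simp: space_eq[OF i])
  qed
  finally show ?thesis .
qed

text \<open>Independence of the family rather than of its set of values: a repetition counts as
  dependence, as needed when the vectors vary and may collide.\<close>

definition lin_indep :: "nat \<Rightarrow> (nat \<Rightarrow> 'v) \<Rightarrow> bool" where
  "lin_indep r w \<longleftrightarrow> (\<forall>l. (\<Sum>k<r. smult M (l k) (w k)) = 0 \<longrightarrow> (\<forall>k<r. l k = 0))"

lemma independent_family:
  assumes "finite S" "\<And>l. (\<Sum>q\<in>S. smult M (l q) (g q)) = 0 \<Longrightarrow> \<forall>q\<in>S. l q = 0"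
  shows "inj_on g S" "V.independent (g ` S)" "V.dim (V.span (g ` S)) = card S"
proof -
  show inj: "inj_on g S"
  proof (rule inj_onI, rule ccontr)
    fix a b assume ab: "a \<in> S" "b \<in> S" "g a = g b" "a \<noteq> b"
    define l where "l q = (if q = a then 1 else if q = b then -1 else 0 :: complex)" for q
    have "(\<Sum>q\<in>S. smult M (l q) (g q)) = (\<Sum>q\<in>{a, b}. smult M (l q) (g q))"
      using ab assms(1) by (intro sum.mono_neutral_right) (auto simp: l_def)
    also have "\<dots> = 0" using ab by (simp add: l_def V.scale_minus_left)
    finally show False using assms(2)[of l] ab by (auto simp: l_def)
  qed
  show ind: "V.independent (g ` S)"
    unfolding V.dependent_finite[OF finite_imageI[OF assms(1)]]
  proof safe
    fix u q assume "q \<in> S" "u (g q) \<noteq> 0" "(\<Sum>v\<in>g ` S. smult M (u v) v) = 0"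
    moreover from this have "(\<Sum>q\<in>S. smult M (u (g q)) (g q)) = 0" by (simp add: sum.reindex[OF inj])
    ultimately show False using assms(2)[of "\<lambda>q. u (g q)"] by auto
  qed
  show "V.dim (V.span (g ` S)) = card S"
    using V.dim_span_eq_card_independent[OF ind] card_image[OF inj] by simp
qed

lemma independent_spans:
  assumes W: "V.subspace W" "W \<subseteq> TV" "V.dim W = card S"
    and g: "finite S" "inj_on g S" "V.independent (g ` S)" "g ` S \<subseteq> W"
  shows "W = V.span (g ` S)"
proof (rule ccontr)
  assume "\<not> ?thesis"
  moreover have "V.span (g ` S) \<subseteq> W" using V.span_minimal[OF g(4) W(1)] .
  ultimately obtain x where x: "x \<in> W" "x \<notin> V.span (g ` S)" by auto
  obtain D where D: "D \<subseteq> W" "V.independent D" "W \<subseteq> V.span D" "card D = V.dim W"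
    using V.basis_exists[of W] by metis
  have "finite (basis_set M)" using finite_B by (simp add: basis_set_def)
  then have fD: "finite D" using V.independent_span_bound[OF _ D(2) subset_trans[OF D(1) W(2)]] by simp
  have "V.independent (insert x (g ` S))" using g(3) x(2) by (simp add: V.independent_insert)
  moreover have "insert x (g ` S) \<subseteq> V.span D" using x(1) g(4) D(3) by auto
  ultimately have "card (insert x (g ` S)) \<le> card D" using V.independent_span_bound[OF fD] by blast
  moreover have "x \<notin> g ` S" using x(2) V.span_base[of x "g ` S"] by metis
  ultimately show False using g(1,2) D(4) W(3) by (simp add: card_image)
qed

lemma lin_indep_of_dim:
  assumes "V.dim (V.span (w ` {..<r})) = r"
  shows "lin_indep r w"
  unfolding lin_indep_def
proof (rule, rule, rule ccontr)
  fix l assume s0: "(\<Sum>k<r. smult M (l k) (w k)) = 0" and "\<not> (\<forall>k<r. l k = 0)"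
  then obtain k where k: "k < r" "l k \<noteq> 0" by auto
  let ?R = "{..<r} - {k}"
  have "smult M (l k) (w k) = - (\<Sum>a\<in>?R. smult M (l a) (w a))"
    using s0 k by (simp add: sum.remove[of _ k] add_eq_0_iff2)
  also have "\<dots> \<in> V.span (w ` ?R)" by (intro V.span_neg V.span_sum V.span_scale V.span_base) auto
  finally have "smult M (inverse (l k)) (smult M (l k) (w k)) \<in> V.span (w ` ?R)" by (rule V.span_scale)
  then have wk: "w k \<in> V.span (w ` ?R)" using k(2) by simp
  have "w ` {..<r} \<subseteq> V.span (w ` ?R)"
  proof
    fix x assume "x \<in> w ` {..<r}"
    then obtain a where "a < r" "x = w a" by auto
    then show "x \<in> V.span (w ` ?R)" using wk by (cases "a = k") (auto intro: V.span_base)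
  qed
  then have "V.dim (w ` {..<r}) \<le> card (w ` ?R)" by (rule V.dim_le_card) simp
  also have "\<dots> \<le> card ?R" by (rule card_image_le) simp
  also have "\<dots> < r" using k by simp
  finally show False using assms V.dim_span[of "w ` {..<r}"] by simp
qed

text \<open>Turns membership in a span into failure of independence of a longer family, and thereby
  into a closed condition.\<close>

lemma lin_indep_Suc:
  assumes "lin_indep r w"
  shows "lin_indep (Suc r) (\<lambda>k. if k < r then w k else x) \<longleftrightarrow> x \<notin> V.span (w ` {..<r})"
proof
  assume L: "lin_indep (Suc r) (\<lambda>k. if k < r then w k else x)"
  show "x \<notin> V.span (w ` {..<r})"
  proof
    assume "x \<in> V.span (w ` {..<r})"
    then have "x \<in> range (\<lambda>u. \<Sum>v\<in>w ` {..<r}. smult M (u v) v)" by (simp add: V.span_finite)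
    moreover have "inj_on w {..<r}"
      by (rule independent_family(1)) (use assms in \<open>auto simp: lin_indep_def\<close>)
    ultimately obtain u where u: "x = (\<Sum>k<r. smult M (u (w k)) (w k))" by (auto simp: sum.reindex)
    define l where "l k = (if k < r then - u (w k) else 1)" for k
    have "(\<Sum>k<Suc r. smult M (l k) (if k < r then w k else x)) = (\<Sum>k<r. smult M (- u (w k)) (w k)) + x"
      by (simp add: l_def)
    also have "\<dots> = 0" by (simp add: u V.scale_minus_left sum_negf)
    finally have "l r = 0" using L unfolding lin_indep_def by blast
    then show False by (simp add: l_def)
  qed
next
  assume x: "x \<notin> V.span (w ` {..<r})"
  show "lin_indep (Suc r) (\<lambda>k. if k < r then w k else x)"
    unfolding lin_indep_def
  proof (rule, rule)
    fix l assume "(\<Sum>k<Suc r. smult M (l k) (if k < r then w k else x)) = 0"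
    then have s: "(\<Sum>k<r. smult M (l k) (w k)) + smult M (l r) x = 0" by simp
    have "l r = 0"
    proof (rule ccontr)
      assume lr: "l r \<noteq> 0"
      have "smult M (l r) x = - (\<Sum>k<r. smult M (l k) (w k))" using s by (simp add: add_eq_0_iff2 add.commute)
      also have "\<dots> \<in> V.span (w ` {..<r})" by (intro V.span_neg V.span_sum V.span_scale V.span_base) auto
      finally have "smult M (inverse (l r)) (smult M (l r) x) \<in> V.span (w ` {..<r})" by (rule V.span_scale)
      then show False using x lr by simp
    qed
    moreover from this have "\<forall>k<r. l k = 0" using s assms by (simp add: lin_indep_def)
    ultimately show "\<forall>k<Suc r. l k = 0" by (auto simp: less_Suc_eq)
  qed
qed

end

section \<open>The topology of the quiver Grassmannian\<close>

context decomposed_rep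
begin

lemma rep_continuousI:
  assumes "\<And>z. z \<in> topspace Z \<Longrightarrow> w z \<in> TV"
    and "\<And>q. q \<in> B \<Longrightarrow> continuous_map Z euclidean (\<lambda>z. cf (w z) q)"
  shows "continuous_map Z (rep_topology M) w"
  unfolding rep_topology_def
proof (rule continuous_map_pullback')
  have "continuous_map Z euclidean (\<lambda>z. coords M (w z) b)" for b
  proof (cases "b \<in> basis_set M")
    case True
    then obtain q where "q \<in> B" "b = bv q" by (auto simp: basis_set_def)
    then show ?thesis using assms(2) by (simp add: cf_def)
  next
    case False
    then have "coords M x b = 0" for x using V.representation_ne_zero by (auto simp: coords_def)
    then show ?thesis by simp
  qed
  then show "continuous_map Z euclidean (coords M \<circ> w)"
    by (simp add: continuous_map_componentwise_UNIV flip: euclidean_product_topology)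
  show "topspace Z \<subseteq> w -` TV" using assms(1) by auto
qed

lemma cf_continuous: "continuous_map (rep_topology M) euclidean (\<lambda>x. cf x q)"
proof -
  have "continuous_map euclidean euclidean (\<lambda>\<phi>::'v \<Rightarrow> complex. \<phi> (bv q))"
    unfolding euclidean_product_topology
    using continuous_map_product_projection[of "bv q" UNIV "\<lambda>_. euclidean :: complex topology"] by simp
  from continuous_map_pullback[OF this, of TV "coords M"] show ?thesis
    by (simp add: rep_topology_def cf_def comp_def)
qed

lemma topspace_rep: "topspace (rep_topology M) = TV"
  by (simp add: rep_topology_def topspace_pullback_topology)

text \<open>Functionals dual to the family, written in coordinates so that they can be evaluated on
  nearby families.\<close>

lemma dual_functionals:
  assumes "lin_indep r w" "\<And>k. k < r \<Longrightarrow> w k \<in> TV"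
  shows "\<exists>L. \<forall>k<r. \<forall>l<r. (\<Sum>q\<in>B. L k q * cf (w l) q) = (if k = l then 1 else 0)"
proof -
  interpret VP: vector_space_pair "smult M" "(*) :: complex \<Rightarrow> complex \<Rightarrow> complex"
    by (intro vector_space_pair.intro V.vector_space_axioms) (unfold_locales, auto simp: algebra_simps)
  have ind: "V.independent (w ` {..<r})" and inj: "inj_on w {..<r}"
    using independent_family[of "{..<r}" w] assms(1) by (auto simp: lin_indep_def)
  have "\<exists>L. \<forall>l<r. (\<Sum>q\<in>B. L q * cf (w l) q) = (if k = l then 1 else 0)" if k: "k < r" for k
  proof -
    obtain g where g: "Vector_Spaces.linear (smult M) (*) g" "\<forall>x\<in>w ` {..<r}. g x = (if x = w k then 1 else 0)"
      using VP.linear_independent_extend[OF ind, of "\<lambda>x. if x = w k then 1 else 0"] by auto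
    have "(\<Sum>q\<in>B. g (bv q) * cf (w l) q) = (if k = l then 1 else 0)" if l: "l < r" for l
    proof -
      have "g (w l) = g (comb (cf (w l)))" using comb_cf assms(2) l by simp
      also have "\<dots> = (\<Sum>q\<in>B. cf (w l) q * g (bv q))"
        unfolding comb_def VP.linear_sum[OF g(1)] by (simp add: VP.linear_scale[OF g(1)])
      finally have "(\<Sum>q\<in>B. g (bv q) * cf (w l) q) = g (w l)" by (simp add: mult.commute)
      also have "\<dots> = (if k = l then 1 else 0)" using g(2) inj k l by (auto simp: inj_on_eq_iff)
      finally show ?thesis .
    qed
    then show ?thesis by (intro exI[of _ "\<lambda>q. g (bv q)"]) blast
  qed
  then show ?thesis by metis
qed

text \<open>Independence is an open condition: the matrix of dual functionals of an independent family,
  evaluated at a nearby family, is strictly diagonally dominant.\<close>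

lemma openin_lin_indep:
  assumes T: "\<And>k z. k < r \<Longrightarrow> z \<in> topspace Z \<Longrightarrow> w k z \<in> TV"
    and cont: "\<And>k q. k < r \<Longrightarrow> q \<in> B \<Longrightarrow> continuous_map Z euclidean (\<lambda>z. cf (w k z) q)"
  shows "openin Z {z \<in> topspace Z. lin_indep r (\<lambda>k. w k z)}"
proof (subst openin_subopen, rule ballI)
  fix z0 assume "z0 \<in> {z \<in> topspace Z. lin_indep r (\<lambda>k. w k z)}"
  then have z0: "z0 \<in> topspace Z" "lin_indep r (\<lambda>k. w k z0)" by auto
  obtain L where L: "\<forall>k<r. \<forall>l<r. (\<Sum>q\<in>B. L k q * cf (w l z0) q) = (if k = l then 1 else 0)"
    using dual_functionals[OF z0(2)] T z0(1) by blast
  define ev where "ev k l z = (\<Sum>q\<in>B. L k q * cf (w l z) q)" for k l z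
  define \<delta> where "\<delta> k l = (if k = l then 1 else 0 :: complex)" for k l :: nat
  \<comment> \<open>Chosen such that the errors in one row of the matrix sum to less than 1;
    \<open>r + 1\<close> allows for \<open>r = 0\<close>.\<close>
  define \<epsilon> where "\<epsilon> = 1 / (2 * (real r + 1))"
  have eps: "\<epsilon> > 0" "real r * \<epsilon> < 1" by (simp_all add: \<epsilon>_def field_simps)
  define U where "U = {z \<in> topspace Z. \<forall>p\<in>{..<r} \<times> {..<r}. norm (ev (fst p) (snd p) z - \<delta> (fst p) (snd p)) < \<epsilon>}"
  have cont_ev: "continuous_map Z euclidean (ev k l)" if "l < r" for k l
    using cont[OF that] unfolding ev_def continuous_map_atin limitin_canonical_iff
    by (intro ballI tendsto_sum tendsto_mult tendsto_const) auto
  have "openin Z U"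
  proof -
    have "openin Z {z \<in> topspace Z. ev k l z \<in> ball (\<delta> k l) \<epsilon>}" if "l < r" for k l
      by (rule openin_continuous_map_preimage[OF cont_ev[OF that]]) simp
    then have op: "openin Z (topspace Z \<inter> (\<Inter>p\<in>{..<r} \<times> {..<r}. {z \<in> topspace Z. ev (fst p) (snd p) z \<in> ball (\<delta> (fst p) (snd p)) \<epsilon>}))"
      by (intro openin_Int_Inter) auto
    have "U = topspace Z \<inter> (\<Inter>p\<in>{..<r} \<times> {..<r}. {z \<in> topspace Z. ev (fst p) (snd p) z \<in> ball (\<delta> (fst p) (snd p)) \<epsilon>})"
      by (auto simp: U_def dist_norm norm_minus_commute)
    then show ?thesis using op by simp
  qed
  moreover have "z0 \<in> U" using z0 L eps by (auto simp: U_def ev_def \<delta>_def)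
  moreover have "lin_indep r (\<lambda>k. w k z)" if z: "z \<in> U" for z
    unfolding lin_indep_def
  proof (rule, rule)
    fix l assume s0: "(\<Sum>a<r. smult M (l a) (w a z)) = 0"
    show "\<forall>a<r. l a = 0"
    proof (cases "r = 0")
      case False
      \<comment> \<open>For a relation whose largest coefficient has modulus \<open>m\<close>,
        attained at \<open>k\<close>, the functional dual to \<open>k\<close> gives
        \<open>m \<le> m * (r * \<epsilon>)\<close>, hence \<open>m = 0\<close>.\<close>
      define m where "m = Max ((\<lambda>a. norm (l a)) ` {..<r})"
      have fin: "finite ((\<lambda>a. norm (l a)) ` {..<r})" "(\<lambda>a. norm (l a)) ` {..<r} \<noteq> {}" using False by auto
      have le: "norm (l a) \<le> m" if "a < r" for a using that fin by (auto simp: m_def)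
      obtain k where k: "k < r" "norm (l k) = m" using Max_in[OF fin] by (auto simp: m_def)
      have zT: "w a z \<in> TV" if "a < r" for a using T[OF that] z by (simp add: U_def)
      have "0 = (\<Sum>q\<in>B. L k q * cf (\<Sum>a<r. smult M (l a) (w a z)) q)" by (simp add: s0 cf_0)
      also have "\<dots> = (\<Sum>q\<in>B. L k q * (\<Sum>a<r. l a * cf (w a z) q))"
        using zT by (intro sum.cong refl arg_cong2[of _ _ _ _ "(*)"]) (subst cf_sum, auto simp: TV_scale cf_scale)
      also have "\<dots> = (\<Sum>a<r. l a * ev k a z)"
        unfolding ev_def sum_distrib_left by (subst sum.swap) (simp add: mult.left_commute)
      also have "\<dots> = (\<Sum>a<r. l a * \<delta> k a) + (\<Sum>a<r. l a * (ev k a z - \<delta> k a))"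
        by (simp add: algebra_simps flip: sum.distrib)
      also have "(\<Sum>a<r. l a * \<delta> k a) = l k" using k by (simp add: \<delta>_def if_distrib[of "(*) _"] cong: if_cong)
      finally have "norm (l k) = norm (\<Sum>a<r. l a * (ev k a z - \<delta> k a))"
        by (metis add_eq_0_iff2 norm_minus_cancel)
      also have "\<dots> \<le> (\<Sum>a<r. norm (l a * (ev k a z - \<delta> k a)))" by (rule norm_sum)
      also have "\<dots> \<le> (\<Sum>a<r. m * \<epsilon>)"
        using z k le unfolding U_def norm_mult by (intro sum_mono mult_mono) (auto intro: less_imp_le order_trans[OF norm_ge_zero])
      also have "\<dots> = m * (real r * \<epsilon>)" by simp
      finally have "m \<le> m * (real r * \<epsilon>)" using k by simp
      moreover have "m \<ge> 0" using k by (metis norm_ge_zero)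
      ultimately have "m = 0" using mult_strict_left_mono[OF eps(2), of m] by linarith
      then show ?thesis using le by auto
    qed simp
  qed
  ultimately show "\<exists>U. openin Z U \<and> z0 \<in> U \<and> U \<subseteq> {z \<in> topspace Z. lin_indep r (\<lambda>k. w k z)}"
    by (intro exI[of _ U]) (auto simp: U_def)
qed

lemma GrD:
  assumes "N \<in> quiver_Gr M e" "i < n"
  shows "V.subspace (N i)" "N i \<subseteq> space M i" "V.dim (N i) = e i" "x \<in> N i \<Longrightarrow> arrow M i x \<in> N (nxt M i)"
    "x \<in> N i \<Longrightarrow> x \<in> TV"
proof -
  show *: "V.subspace (N i)" "N i \<subseteq> space M i" "V.dim (N i) = e i" "x \<in> N i \<Longrightarrow> arrow M i x \<in> N (nxt M i)"
    using assms by (auto simp: quiver_Gr_def PiE_iff)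
  show "x \<in> N i \<Longrightarrow> x \<in> TV" using *(2) space_TV[OF assms(2)] by auto
qed

lemma Gr_ext: "N \<in> quiver_Gr M e \<Longrightarrow> N' \<in> quiver_Gr M e \<Longrightarrow> (\<And>i. i < n \<Longrightarrow> N i = N' i) \<Longrightarrow> N = N'"
  unfolding quiver_Gr_def by (rule PiE_ext[of _ "{..<n}"]) auto

lemma topspace_frame:
  "topspace (frame_topology M e) = {u \<in> frame_index M e \<rightarrow>\<^sub>E TV. frame_span M e u \<in> quiver_Gr M e}"
  by (auto simp: frame_topology_def topspace_rep)

lemma topspace_Gr: "topspace (Gr_topology M e) = quiver_Gr M e"
proof (rule antisym)
  show "topspace (Gr_topology M e) \<subseteq> quiver_Gr M e"
    unfolding topspace_def openin_Gr_topology by blast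
  have "{u \<in> topspace (frame_topology M e). frame_span M e u \<in> quiver_Gr M e} = topspace (frame_topology M e)"
    by (auto simp: topspace_frame)
  then have "openin (Gr_topology M e) (quiver_Gr M e)" unfolding openin_Gr_topology by simp
  then show "quiver_Gr M e \<subseteq> topspace (Gr_topology M e)" by (rule openin_subset)
qed

lemma frame_lin_indep:
  assumes u: "u \<in> topspace (frame_topology M e)" and i: "i < n"
  shows "lin_indep (e i) (\<lambda>k. u (i, k))" "frame_span M e u i = V.span ((\<lambda>k. u (i, k)) ` {..<e i})"
proof -
  show s: "frame_span M e u i = V.span ((\<lambda>k. u (i, k)) ` {..<e i})" using i by (simp add: frame_span_def)
  have "frame_span M e u \<in> quiver_Gr M e" using u by (simp add: topspace_frame)
  from GrD(3)[OF this i] show "lin_indep (e i) (\<lambda>k. u (i, k))"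
    by (intro lin_indep_of_dim) (simp add: s)
qed

lemma frame_coord_continuous:
  assumes "i < n" "k < e i"
  shows "continuous_map (frame_topology M e) euclidean (\<lambda>u. cf (u (i, k)) q)"
proof -
  have "continuous_map (product_topology (\<lambda>_. rep_topology M) (frame_index M e)) (rep_topology M) (\<lambda>u. u (i, k))"
    by (rule continuous_map_product_projection) (use assms in \<open>simp add: frame_index_def\<close>)
  from continuous_map_compose[OF this cf_continuous[of q]] show ?thesis
    unfolding frame_topology_def comp_def by (rule continuous_map_from_subtopology)
qed

text \<open>The condition that a point of the Grassmannian contains a compact family of configurations of
  vectors at some parameter is closed, because projections along compact spaces are closed.\<close>

lemma closedin_contains:
  assumes Q: "finite Q" "Q \<subseteq> B" and D: "compact D"
    and g: "\<And>c q. q \<in> Q \<Longrightarrow> g c q \<in> TV"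
    and cont: "\<And>q q'. q \<in> Q \<Longrightarrow> q' \<in> B \<Longrightarrow> continuous_on UNIV (\<lambda>c::complex. cf (g c q) q')"
  shows "closedin (Gr_topology M e) {N \<in> quiver_Gr M e. \<exists>c\<in>D. \<forall>q\<in>Q. g c q \<in> N (vt q)}"
    (is "closedin _ ?F")
proof -
  let ?FT = "frame_topology M e"
  let ?Y = "top_of_set D"
  let ?P = "prod_topology ?FT ?Y"
  \<comment> \<open>The frame at the vertex of \<open>q\<close>, extended by the vector
    \<open>g c q\<close>: this family is independent exactly if the vector is not in the span of the
    frame.\<close>
  let ?w = "\<lambda>q k z. if k < e (vt q) then fst z (vt q, k) else g (snd z) q"
  define Z where "Z = {z \<in> topspace ?P. \<forall>q\<in>Q. g (snd z) q \<in> frame_span M e (fst z) (vt q)}"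
  have "openin ?P {z \<in> topspace ?P. lin_indep (Suc (e (vt q))) (\<lambda>k. ?w q k z)}" if q: "q \<in> Q" for q
  proof (rule openin_lin_indep)
    fix k z assume "k < Suc (e (vt q))" "z \<in> topspace ?P"
    then show "?w q k z \<in> TV"
      using g[OF q] vt_less[of q] by (auto simp: topspace_frame frame_index_def PiE_iff)
  next
    fix k q' assume "k < Suc (e (vt q))" and q': "q' \<in> B"
    have 1: "continuous_map ?P euclidean (\<lambda>z. cf (fst z (vt q, k)) q')" if "k < e (vt q)"
      using continuous_map_compose[OF continuous_map_fst frame_coord_continuous[where i="vt q" and k=k and e=e and q=q', OF vt_less that], of ?Y]
      by (simp add: comp_def)
    have "continuous_map ?Y euclidean (\<lambda>c. cf (g c q) q')"
      using cont[OF q q'] continuous_on_subset by auto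
    from continuous_map_compose[OF continuous_map_snd this, of ?FT]
    have 2: "continuous_map ?P euclidean (\<lambda>z. cf (g (snd z) q) q')" by (simp add: comp_def)
    show "continuous_map ?P euclidean (\<lambda>z. cf (?w q k z) q')"
      using 1 2 by (cases "k < e (vt q)") simp_all
  qed
  moreover have "{z \<in> topspace ?P. lin_indep (Suc (e (vt q))) (\<lambda>k. ?w q k z)}
     = {z \<in> topspace ?P. g (snd z) q \<notin> frame_span M e (fst z) (vt q)}" for q
  proof -
    have "lin_indep (Suc (e (vt q))) (\<lambda>k. ?w q k z) \<longleftrightarrow> g (snd z) q \<notin> frame_span M e (fst z) (vt q)"
      if "z \<in> topspace ?P" for z
    proof -
      have fz: "fst z \<in> topspace ?FT" using that by auto
      show ?thesis
        unfolding frame_lin_indep(2)[OF fz vt_less]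
        by (rule lin_indep_Suc[OF frame_lin_indep(1)[OF fz vt_less]])
    qed
    then show ?thesis by blast
  qed
  ultimately have "openin ?P {z \<in> topspace ?P. g (snd z) q \<notin> frame_span M e (fst z) (vt q)}" if "q \<in> Q" for q
    using that by simp
  then have "openin ?P (\<Union>q\<in>Q. {z \<in> topspace ?P. g (snd z) q \<notin> frame_span M e (fst z) (vt q)})" by auto
  moreover have "topspace ?P - Z = (\<Union>q\<in>Q. {z \<in> topspace ?P. g (snd z) q \<notin> frame_span M e (fst z) (vt q)})"
    unfolding Z_def by blast
  ultimately have "closedin ?P Z" unfolding closedin_def by (auto simp: Z_def)
  moreover have "compact_space ?Y" using D by (simp add: compact_space_subtopology compactin_euclidean_iff)
  ultimately have cl: "closedin ?FT (fst ` Z)" using closed_map_fst unfolding closed_map_def by blast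
  let ?U = "quiver_Gr M e - ?F"
  \<comment> \<open>The projection of \<open>Z\<close> is the full preimage of the set under
    \<open>frame_span\<close>, so the quotient topology applies.\<close>
  have fZ: "fst ` Z = {u \<in> topspace ?FT. frame_span M e u \<in> ?F}"
  proof (intro equalityI subsetI)
    fix u assume "u \<in> fst ` Z"
    then show "u \<in> {u \<in> topspace ?FT. frame_span M e u \<in> ?F}" by (auto simp: Z_def topspace_frame)
  next
    fix u assume "u \<in> {u \<in> topspace ?FT. frame_span M e u \<in> ?F}"
    then obtain c where "u \<in> topspace ?FT" "c \<in> D" "\<forall>q\<in>Q. g c q \<in> frame_span M e u (vt q)" by auto
    then have "(u, c) \<in> Z" by (simp add: Z_def)
    then show "u \<in> fst ` Z" by force
  qed
  have "{u \<in> topspace ?FT. frame_span M e u \<in> ?U} = topspace ?FT - fst ` Z"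
    unfolding fZ by (auto simp: topspace_frame)
  then have "openin (Gr_topology M e) ?U"
    unfolding openin_Gr_topology using cl by (simp add: openin_diff)
  then show ?thesis unfolding closedin_def topspace_Gr by auto
qed

text \<open>The curve lifts to frames: an enumeration of \<open>S i\<close> that does not depend on
  the parameter turns the spanning vectors into a continuous frame.\<close>

lemma Gr_curve_continuous:
  assumes S: "\<And>i. i < n \<Longrightarrow> card (S i) = e i" "\<And>i. i < n \<Longrightarrow> finite (S i)"
    and g: "\<And>c q. g c q \<in> TV"
    and cont: "\<And>q q'. q' \<in> B \<Longrightarrow> continuous_on UNIV (\<lambda>c::complex. cf (g c q) q')"
    and N: "\<And>c i. i < n \<Longrightarrow> N c i = V.span (g c ` S i)" "\<And>c. N c \<in> quiver_Gr M e"
  shows "continuous_map euclidean (Gr_topology M e) N"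
proof -
  have "\<exists>h. bij_betw h {..<e i} (S i)" if "i < n" for i
    using ex_bij_betw_nat_finite[OF S(2)[OF that]] S(1)[OF that] by (simp add: atLeast0LessThan)
  then obtain h where h: "\<And>i. i < n \<Longrightarrow> bij_betw (h i) {..<e i} (S i)" by metis
  define \<phi> where "\<phi> c = (\<lambda>ik\<in>frame_index M e. g c (h (fst ik) (snd ik)))" for c
  have span: "frame_span M e (\<phi> c) = N c" for c
  proof
    fix i
    show "frame_span M e (\<phi> c) i = N c i"
    proof (cases "i < n")
      case True
      have "(\<lambda>k. \<phi> c (i, k)) ` {..<e i} = (\<lambda>k. g c (h i k)) ` {..<e i}"
        using True by (intro image_cong) (auto simp: \<phi>_def frame_index_def)
      also have "\<dots> = g c ` S i" using h[OF True] by (simp add: bij_betw_def flip: image_image)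
      finally show ?thesis using True N(1) by (simp add: frame_span_def)
    next
      case False
      then show ?thesis using N(2)[of c] by (auto simp: frame_span_def quiver_Gr_def PiE_iff extensional_def)
    qed
  qed
  have "continuous_map euclidean (product_topology (\<lambda>_. rep_topology M) (frame_index M e)) \<phi>"
    unfolding continuous_map_componentwise
  proof (intro conjI ballI)
    show "\<phi> ` topspace euclidean \<subseteq> extensional (frame_index M e)" by (auto simp: \<phi>_def)
    fix ik assume "ik \<in> frame_index M e"
    then show "continuous_map euclidean (rep_topology M) (\<lambda>c. \<phi> c ik)"
      using g cont by (intro rep_continuousI) (auto simp: \<phi>_def)
  qed
  then have \<phi>: "continuous_map euclidean (frame_topology M e) \<phi>"
    unfolding frame_topology_def using span N(2) by (intro continuous_map_into_subtopology) auto
  show ?thesis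
    unfolding continuous_map_def
  proof (intro conjI allI impI)
    show "N \<in> topspace euclidean \<rightarrow> topspace (Gr_topology M e)" using N(2) by (auto simp: topspace_Gr)
    fix U assume "openin (Gr_topology M e) U"
    then have "openin (frame_topology M e) {u \<in> topspace (frame_topology M e). frame_span M e u \<in> U}"
      by (simp add: openin_Gr_topology)
    from openin_continuous_map_preimage[OF \<phi> this]
    have "openin euclidean {c \<in> topspace euclidean. \<phi> c \<in> topspace (frame_topology M e) \<and> frame_span M e (\<phi> c) \<in> U}" by simp
    moreover have "\<phi> c \<in> topspace (frame_topology M e)" for c
      using \<phi> by (auto simp: continuous_map_def)
    ultimately show "openin euclidean {c \<in> topspace euclidean. N c \<in> U}" by (simp add: span)
  qed
qed

end

section \<open>Torus-invariant lines\<close>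

context decomposed_rep
begin

definition pt :: "(nat \<times> nat) set \<Rightarrow> nat \<Rightarrow> 'v set" where
  "pt S = (\<lambda>i\<in>{..<n}. {x \<in> TV. \<forall>q\<in>B. vt q \<noteq> i \<or> q \<notin> S \<longrightarrow> cf x q = 0})"

text \<open>\<open>line K A \<tau> c\<close> is spanned by the basis vectors with index in \<open>K\<close> and by
  \<open>b\<^sub>q + c b\<^sub>\<tau>\<^sub>q\<close> for \<open>q\<close> in \<open>A\<close>.\<close>

definition line :: "(nat \<times> nat) set \<Rightarrow> (nat \<times> nat) set \<Rightarrow> (nat \<times> nat \<Rightarrow> nat \<times> nat) \<Rightarrow> complex \<Rightarrow> nat \<Rightarrow> 'v set" where
  "line K A \<tau> c = (\<lambda>i\<in>{..<n}. {x \<in> TV. (\<forall>q\<in>B. vt q \<noteq> i \<or> q \<notin> K \<union> A \<union> \<tau> ` A \<longrightarrow> cf x q = 0) \<and>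
     (\<forall>q\<in>A. cf x (\<tau> q) = c * cf x q)})"

lemma diag_map_comb: "diag_map M \<kappa> x = comb (\<lambda>q. \<kappa> q * cf x q)"
  by (simp add: diag_map_def comb_def cf_def)

lemma diag_map_TV: "diag_map M \<kappa> x \<in> TV" by (simp add: diag_map_comb comb_in)

lemma cf_diag: "q \<in> B \<Longrightarrow> cf (diag_map M \<kappa> x) q = \<kappa> q * cf x q"
  by (simp add: diag_map_comb cf_comb)

lemma diag_map_inverse:
  assumes "x \<in> TV" "\<And>q. q \<in> B \<Longrightarrow> \<kappa> q \<noteq> 0"
  shows "diag_map M \<kappa> (diag_map M (\<lambda>q. inverse (\<kappa> q)) x) = x"
  by (rule cf_ext) (use assms in \<open>auto simp: diag_map_TV cf_diag\<close>)

lemma diag_pt: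
  assumes "\<And>q. q \<in> B \<Longrightarrow> \<kappa> q \<noteq> 0"
  shows "diag_Gr M \<kappa> (pt S) = pt S"
proof
  fix i show "diag_Gr M \<kappa> (pt S) i = pt S i"
  proof (cases "i < n")
    case True
    let ?W = "{x \<in> TV. \<forall>q\<in>B. vt q \<noteq> i \<or> q \<notin> S \<longrightarrow> cf x q = 0}"
    have "diag_map M \<kappa> ` ?W = ?W"
    proof (intro equalityI subsetI)
      fix y assume "y \<in> diag_map M \<kappa> ` ?W"
      then show "y \<in> ?W" by (auto simp: diag_map_TV cf_diag)
    next
      fix y assume y: "y \<in> ?W"
      then have "y = diag_map M \<kappa> (diag_map M (\<lambda>q. inverse (\<kappa> q)) y)" using diag_map_inverse assms by auto
      moreover have "diag_map M (\<lambda>q. inverse (\<kappa> q)) y \<in> ?W" using y by (auto simp: diag_map_TV cf_diag)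
      ultimately show "y \<in> diag_map M \<kappa> ` ?W" by (rule image_eqI)
    qed
    then show ?thesis using True by (simp add: diag_Gr_def pt_def)
  qed (simp add: diag_Gr_def pt_def)
qed

definition chr :: "(nat \<Rightarrow> complex) \<Rightarrow> nat \<times> nat \<Rightarrow> complex" where
  "chr \<gamma> q = \<gamma> 0 ^ snd q * \<gamma> (fst q)"

lemma act_chr: "act M \<gamma> = diag_Gr M (chr \<gamma>)"
proof -
  have "(\<lambda>(j, p). \<gamma> 0 ^ p * \<gamma> j) = chr \<gamma>" by (auto simp: chr_def)
  then show ?thesis by (simp add: act_def)
qed

lemma torus_nz: "\<gamma> \<in> torus d \<Longrightarrow> i \<le> d \<Longrightarrow> \<gamma> i \<noteq> 0"
  by (auto simp: torus_def PiE_iff)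

lemma chr_nz: "\<gamma> \<in> torus (summands M) \<Longrightarrow> q \<in> B \<Longrightarrow> chr \<gamma> q \<noteq> 0"
  using torus_nz by (cases q) (auto simp: chr_def basis_index_iff)

end

text \<open>\<open>K\<close> and \<open>A\<close> index generators, and \<tau> maps \<open>A\<close>
  to a disjoint copy over the same vertices. By \<open>A_next\<close> the arrow takes the pair
  \<open>q\<close>, \<open>\<tau> q\<close> either to another such pair or to vectors that are zero
  or indexed by \<open>K\<close>; so every parameter of \<open>line\<close> gives a
  subrepresentation.\<close>

locale pencil_data = decomposed_rep M for M :: "'v::ab_group_add based_rep" +
  fixes K A :: "(nat \<times> nat) set" and \<tau> :: "nat \<times> nat \<Rightarrow> nat \<times> nat"
  assumes K_B: "K \<subseteq> B" and A_B: "A \<subseteq> B" and KA: "K \<inter> A = {}" and tau_B: "\<tau> ` A \<subseteq> B"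
    and tau_disj: "\<tau> ` A \<inter> (K \<union> A) = {}" and tau_inj: "inj_on \<tau> A"
    and tau_vt: "\<And>q. q \<in> A \<Longrightarrow> vt (\<tau> q) = vt q" and A_ne: "A \<noteq> {}"
    and K_next: "\<And>j p. (j, p) \<in> K \<Longrightarrow> (j, Suc p) \<in> B \<Longrightarrow> (j, Suc p) \<in> K"
    and A_next: "\<And>j p j' p'. (j, p) \<in> A \<Longrightarrow> \<tau> (j, p) = (j', p') \<Longrightarrow>
      (j, Suc p) \<in> A \<and> \<tau> (j, Suc p) = (j', Suc p') \<or>
      ((j, Suc p) \<in> B \<longrightarrow> (j, Suc p) \<in> K) \<and> ((j', Suc p') \<in> B \<longrightarrow> (j', Suc p') \<in> K)"
begin

abbreviation "L \<equiv> line K A \<tau>"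

definition gen :: "complex \<Rightarrow> nat \<times> nat \<Rightarrow> 'v" where
  "gen c q = (if q \<in> A then bv q + smult M c (bv (\<tau> q)) else if q \<in> K then bv q else 0)"

abbreviation "S i \<equiv> {q \<in> K \<union> A. vt q = i}"

lemma tauA: "q \<in> A \<Longrightarrow> \<tau> q \<in> B" "q \<in> A \<Longrightarrow> \<tau> q \<notin> A" "q \<in> A \<Longrightarrow> \<tau> q \<notin> K"
  using tau_B tau_disj by auto

lemma gen_TV: "gen c q \<in> TV"
  unfolding gen_def using K_B A_B tau_B by (auto intro!: TV_add TV_scale bv_in TV_0)

lemma cf_gen: "q \<in> K \<union> A \<Longrightarrow> q' \<in> B \<Longrightarrow>
  cf (gen c q) q' = (if q' = q then 1 else 0) + (if q \<in> A \<and> q' = \<tau> q then c else 0)"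
proof (cases "q \<in> A")
  case True
  assume q': "q' \<in> B"
  have q: "q \<in> B" "\<tau> q \<in> B" "\<tau> q \<noteq> q" using subsetD[OF A_B True] tauA(1,2)[OF True] True by auto
  show ?thesis using q q' True by (auto simp: gen_def cf_add cf_scale bv_in TV_scale cf_bv)
next
  case False
  assume "q \<in> K \<union> A" "q' \<in> B"
  then show ?thesis using False subsetD[OF K_B, of q] by (simp add: gen_def cf_bv)
qed

lemma gen_line: assumes q: "q \<in> S i" and i: "i < n" shows "gen c q \<in> L c i"
proof -
  have qKA: "q \<in> K \<union> A" "vt q = i" using q by auto
  have 1: "cf (gen c q) q' = 0" if q': "q' \<in> B" "vt q' \<noteq> i \<or> q' \<notin> K \<union> A \<union> \<tau> ` A" for q'
  proof -
    have "q' \<noteq> q" using that qKA by auto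
    moreover have "\<not> (q \<in> A \<and> q' = \<tau> q)" using that qKA tau_vt[of q] by auto
    ultimately show ?thesis by (auto simp: cf_gen[OF qKA(1) q'(1)])
  qed
  have 2: "cf (gen c q) (\<tau> u) = c * cf (gen c q) u" if u: "u \<in> A" for u
  proof -
    have "\<tau> u \<noteq> q" "q \<in> A \<Longrightarrow> u \<noteq> \<tau> q" using qKA tauA[OF u] tauA(2)[of q] u by auto
    moreover have "q \<in> A \<Longrightarrow> \<tau> u = \<tau> q \<Longrightarrow> u = q" using inj_onD[OF tau_inj] u by blast
    ultimately show ?thesis
      using u by (auto simp: cf_gen[OF qKA(1) tauA(1)[OF u]] cf_gen[OF qKA(1) subsetD[OF A_B u]])
  qed
  show ?thesis using 1 2 i by (simp add: line_def gen_TV)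
qed

lemma line_subspace: "i < n \<Longrightarrow> V.subspace (L c i)"
  using A_B tauA
  by (auto intro!: V.subspaceI simp: line_def TV_0 TV_add TV_scale cf_0 cf_add cf_scale algebra_simps)

lemma finite_KA: "finite K" "finite A" "finite (S i)"
proof -
  show *: "finite K" "finite A" using finite_subset[OF K_B finite_B] finite_subset[OF A_B finite_B] .
  show "finite (S i)" by (rule finite_subset[of _ "K \<union> A"]) (use * in auto)
qed

lemma gen_relation:
  assumes "i < n" "(\<Sum>q\<in>S i. smult M (l q) (gen c q)) = 0"
  shows "\<forall>q\<in>S i. l q = 0"
proof
  fix q assume q: "q \<in> S i"
  then have qB: "q \<in> B" using K_B A_B by auto
  have "0 = cf (\<Sum>q\<in>S i. smult M (l q) (gen c q)) q" using assms(2) by (simp add: cf_0)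
  also have "\<dots> = (\<Sum>q'\<in>S i. l q' * cf (gen c q') q)" by (subst cf_sum) (auto simp: TV_scale gen_TV cf_scale)
  also have "\<dots> = (\<Sum>q'\<in>S i. if q' = q then l q else 0)"
    using q qB tauA by (intro sum.cong) (auto simp: cf_gen)
  also have "\<dots> = l q" using q finite_KA(3)[of i] by simp
  finally show "l q = 0" by simp
qed

lemma gen_indep: "i < n \<Longrightarrow> inj_on (gen c) (S i)" "i < n \<Longrightarrow> V.independent (gen c ` S i)"
  "i < n \<Longrightarrow> V.dim (V.span (gen c ` S i)) = card (S i)"
  using independent_family[of "S i" "gen c", OF finite_KA(3) gen_relation] by auto

lemma line_span: assumes i: "i < n" shows "L c i = V.span (gen c ` S i)"
proof
  show "V.span (gen c ` S i) \<subseteq> L c i"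
    by (rule V.span_minimal) (use gen_line line_subspace i in blast)+
  show "L c i \<subseteq> V.span (gen c ` S i)"
  proof
    fix x assume x: "x \<in> L c i"
    then have xT: "x \<in> TV" and x0: "\<And>q. q \<in> B \<Longrightarrow> vt q \<noteq> i \<or> q \<notin> K \<union> A \<union> \<tau> ` A \<Longrightarrow> cf x q = 0"
      and xt: "\<And>q. q \<in> A \<Longrightarrow> cf x (\<tau> q) = c * cf x q" using i by (auto simp: line_def)
    have "x = (\<Sum>q\<in>S i. smult M (cf x q) (gen c q))"
    proof (rule cf_ext[OF xT])
      show "(\<Sum>q\<in>S i. smult M (cf x q) (gen c q)) \<in> TV" by (intro TV_sum TV_scale gen_TV)
      fix q' assume q': "q' \<in> B"
      have "cf (\<Sum>q\<in>S i. smult M (cf x q) (gen c q)) q' = (\<Sum>q\<in>S i. cf x q * cf (gen c q) q')"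
        by (subst cf_sum) (auto simp: TV_scale gen_TV cf_scale)
      also have "\<dots> = (\<Sum>q\<in>S i. (if q' = q then cf x q else 0) + (if q \<in> A \<and> q' = \<tau> q then cf x q * c else 0))"
        using q' by (intro sum.cong) (auto simp: cf_gen algebra_simps)
      also have "\<dots> = (if q' \<in> S i then cf x q' else 0) + (\<Sum>q\<in>S i. if q \<in> A \<and> q' = \<tau> q then cf x q * c else 0)"
        using finite_KA(3)[of i] by (simp add: sum.distrib)
      also have "\<dots> = cf x q'"
      proof (cases "q' \<in> \<tau> ` A")
        case True
        then obtain q where q: "q \<in> A" "q' = \<tau> q" by auto
        have "(\<Sum>q\<in>S i. if q \<in> A \<and> q' = \<tau> q then cf x q * c else 0) = (\<Sum>q''\<in>S i. if q'' = q then cf x q * c else 0)"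
          using q tau_inj by (intro sum.cong) (auto simp: inj_on_eq_iff)
        also have "\<dots> = (if vt q = i then cf x q * c else 0)" using finite_KA(3)[of i] q by simp
        also have "\<dots> = cf x q'" using xt[OF q(1)] x0[of q] q A_B by (auto simp: mult.commute)
        finally show ?thesis using q tauA by auto
      next
        case False
        then have "(\<Sum>q\<in>S i. if q \<in> A \<and> q' = \<tau> q then cf x q * c else 0) = 0" by (intro sum.neutral) auto
        then show ?thesis using False x0[OF q'] by auto
      qed
      finally show "cf x q' = cf (\<Sum>q\<in>S i. smult M (cf x q) (gen c q)) q'" by simp
    qed
    also have "\<dots> \<in> V.span (gen c ` S i)" by (intro V.span_sum V.span_scale V.span_base) auto
    finally show "x \<in> V.span (gen c ` S i)" .
  qed
qed

lemma arrow_gen: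
  assumes q: "q \<in> S i" and i: "i < n"
  shows "arrow M i (gen c q) \<in> L c (nxt M i)"
proof -
  let ?i' = "nxt M i"
  obtain j p where jp: "q = (j, p)" by force
  have qB: "(j, p) \<in> B" and vq: "vt (j, p) = i" using q K_B A_B jp by auto
  have sub: "V.subspace (L c ?i')" using line_subspace nxt_less by auto
  have genK: "bv u \<in> L c ?i'" if "u \<in> K" "vt u = ?i'" for u
  proof -
    have "u \<notin> A" using that KA by blast
    then show ?thesis using gen_line[of u ?i' c] nxt_less that by (simp add: gen_def)
  qed
  show ?thesis
  proof (cases "q \<in> A")
    case False
    then have K: "(j, p) \<in> K" using q jp by auto
    then have "arrow M i (gen c q) = (if (j, Suc p) \<in> B then bv (j, Suc p) else 0)"
      using arrow_bv[OF qB] vq False jp by (simp add: gen_def)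
    then show ?thesis using genK[of "(j, Suc p)"] K_next[OF K] vt_Suc[of j p] vq V.subspace_0[OF sub] by auto
  next
    case True
    obtain j' p' where t: "\<tau> (j, p) = (j', p')" by force
    have tB: "(j', p') \<in> B" and tv: "vt (j', p') = i" using tauA[of q] tau_vt[of q] True t jp vq by auto
    have "arrow M i (gen c q) = arrow M i (bv (j, p)) + smult M c (arrow M i (bv (j', p')))"
    proof -
      have "bv (j, p) \<in> space M i" "bv (j', p') \<in> space M i" using bv_space[OF qB] bv_space[OF tB] vq tv by simp_all
      then show ?thesis
        using True jp t V.subspace_scale[OF space_subspace[OF i]]
        by (simp add: gen_def arrow_add[OF i] arrow_scale[OF i])
    qed
    also have "\<dots> = (if (j, Suc p) \<in> B then bv (j, Suc p) else 0) + smult M c (if (j', Suc p') \<in> B then bv (j', Suc p') else 0)"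
      using arrow_bv[OF qB] arrow_bv[OF tB] vq tv by simp
    also have "\<dots> \<in> L c ?i'"
    proof (rule disjE[OF A_next[OF _ t]])
      show "(j, p) \<in> A" using True jp by simp
      assume a: "(j, Suc p) \<in> A \<and> \<tau> (j, Suc p) = (j', Suc p')"
      then have "(j, Suc p) \<in> B" "(j', Suc p') \<in> B" using A_B tauA(1)[of "(j, Suc p)"] by auto
      then show ?thesis using gen_line[of "(j, Suc p)" ?i' c] a nxt_less vt_Suc[of j p] vq by (auto simp: gen_def)
    next
      assume a: "((j, Suc p) \<in> B \<longrightarrow> (j, Suc p) \<in> K) \<and> ((j', Suc p') \<in> B \<longrightarrow> (j', Suc p') \<in> K)"
      have "(if (j, Suc p) \<in> B then bv (j, Suc p) else 0) \<in> L c ?i'"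
        using a genK[of "(j, Suc p)"] vt_Suc[of j p] vq V.subspace_0[OF sub] by auto
      moreover have "(if (j', Suc p') \<in> B then bv (j', Suc p') else 0) \<in> L c ?i'"
        using a genK[of "(j', Suc p')"] vt_Suc[of j' p'] tv V.subspace_0[OF sub] by auto
      ultimately show ?thesis by (intro V.subspace_add[OF sub] V.subspace_scale[OF sub])
    qed
    finally show ?thesis .
  qed
qed

end

locale pencil = pencil_data M K A \<tau> for M :: "'v::ab_group_add based_rep" and K A \<tau> +
  fixes e :: "nat \<Rightarrow> nat"
  assumes dims: "\<And>i. i < n \<Longrightarrow> card {q \<in> K \<union> A. vt q = i} = e i"
begin

lemma line_Gr: "L c \<in> quiver_Gr M e"
proof -
  have 1: "V.subspace (L c i) \<and> L c i \<subseteq> space M i \<and> V.dim (L c i) = e i" if i: "i < n" for i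
    using line_subspace[OF i] gen_indep(3)[OF i] line_span[OF i] space_eq[OF i] i dims[OF i] by (auto simp: line_def)
  have 2: "arrow M i x \<in> L c (nxt M i)" if i: "i < n" and x: "x \<in> L c i" for i x
  proof -
    have sub: "V.subspace (L c (nxt M i))" using line_subspace nxt_less by auto
    have gs: "gen c q \<in> space M i" if "q \<in> S i" for q using gen_line[OF that i] 1[OF i] by auto
    have "x \<in> range (\<lambda>u. \<Sum>v\<in>gen c ` S i. smult M (u v) v)"
      using x line_span[OF i] finite_KA(3)[of i] by (simp add: V.span_finite)
    then obtain u where u: "x = (\<Sum>q\<in>S i. smult M (u (gen c q)) (gen c q))"
      using gen_indep(1)[OF i, of c] by (auto simp: sum.reindex)
    have "arrow M i x = (\<Sum>q\<in>S i. smult M (u (gen c q)) (arrow M i (gen c q)))"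
      unfolding u using gs V.subspace_scale[OF space_subspace[OF i]]
      by (subst arrow_sum[OF i]) (auto intro!: sum.cong simp: arrow_scale[OF i])
    also have "\<dots> \<in> L c (nxt M i)"
      using arrow_gen[OF _ i] by (intro V.subspace_sum[OF sub] V.subspace_scale[OF sub]) auto
    finally show ?thesis .
  qed
  have "L c \<in> extensional {..<n}" by (simp add: line_def)
  then show ?thesis using 1 2 by (auto simp: quiver_Gr_def PiE_iff)
qed

lemma line_0: "L 0 = pt (K \<union> A)"
proof
  fix i
  have "(\<forall>q\<in>B. vt q \<noteq> i \<or> q \<notin> K \<union> A \<union> \<tau> ` A \<longrightarrow> cf x q = 0) \<and> (\<forall>q\<in>A. cf x (\<tau> q) = 0 * cf x q) \<longleftrightarrow>
    (\<forall>q\<in>B. vt q \<noteq> i \<or> q \<notin> K \<union> A \<longrightarrow> cf x q = 0)" for x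
  proof (intro iffI conjI ballI impI, elim conjE)
    fix q assume "\<forall>q\<in>B. vt q \<noteq> i \<or> q \<notin> K \<union> A \<union> \<tau> ` A \<longrightarrow> cf x q = 0" "\<forall>q\<in>A. cf x (\<tau> q) = 0 * cf x q"
      "q \<in> B" "vt q \<noteq> i \<or> q \<notin> K \<union> A"
    then show "cf x q = 0" by (cases "q \<in> \<tau> ` A") auto
  next
    fix q assume "\<forall>q\<in>B. vt q \<noteq> i \<or> q \<notin> K \<union> A \<longrightarrow> cf x q = 0" "q \<in> A"
    then show "cf x (\<tau> q) = 0 * cf x q" using tauA[of q] by simp
  qed auto
  then show "L 0 i = pt (K \<union> A) i" by (simp add: line_def pt_def)
qed

text \<open>Exchanging \<open>A\<close> with its image under \<tau> describes the same projective
  line from its other fixed point, with inverse coordinate; facts at 0 become facts at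
  infinity.\<close>

lemma pencil_dual: "pencil M K (\<tau> ` A) (inv_into A \<tau>) e"
proof (unfold_locales)
  show "K \<subseteq> B" "\<tau> ` A \<subseteq> B" "\<tau> ` A \<noteq> {}" using K_B tau_B A_ne by auto
  show "K \<inter> \<tau> ` A = {}" using tau_disj by auto
  have inv: "inv_into A \<tau> (\<tau> q) = q" if "q \<in> A" for q using tau_inj that by simp
  have im: "inv_into A \<tau> ` \<tau> ` A = A" using inv by (force simp: image_image)
  show "inv_into A \<tau> ` \<tau> ` A \<subseteq> B" "inv_into A \<tau> ` \<tau> ` A \<inter> (K \<union> \<tau> ` A) = {}"
    unfolding im using A_B KA tau_disj by auto
  show "inj_on (inv_into A \<tau>) (\<tau> ` A)" by (rule inj_on_inv_into) simp
  show "vt (inv_into A \<tau> q) = vt q" if "q \<in> \<tau> ` A" for q using that inv tau_vt by auto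
  show "card {q \<in> K \<union> \<tau> ` A. vt q = i} = e i" if i: "i < n" for i
  proof -
    have "bij_betw (\<lambda>q. if q \<in> A then \<tau> q else q) (S i) {q \<in> K \<union> \<tau> ` A. vt q = i}"
      unfolding bij_betw_def
    proof
      show "inj_on (\<lambda>q. if q \<in> A then \<tau> q else q) (S i)"
      proof (rule inj_onI)
        fix a b assume "a \<in> S i" "b \<in> S i" "(if a \<in> A then \<tau> a else a) = (if b \<in> A then \<tau> b else b)"
        then show "a = b" using inj_onD[OF tau_inj, of a b] tauA[of a] tauA[of b] by (auto split: if_splits)
      qed
      show "(\<lambda>q. if q \<in> A then \<tau> q else q) ` S i = {q \<in> K \<union> \<tau> ` A. vt q = i}"
      proof (intro equalityI subsetI)
        fix x assume "x \<in> {q \<in> K \<union> \<tau> ` A. vt q = i}"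
        then consider "x \<in> K" "vt x = i" | q where "q \<in> A" "x = \<tau> q" "vt (\<tau> q) = i" by auto
        then show "x \<in> (\<lambda>q. if q \<in> A then \<tau> q else q) ` S i"
        proof cases
          case 1 then show ?thesis using KA by (intro image_eqI[of _ _ x]) auto
        next
          case 2 then show ?thesis using tau_vt by (intro image_eqI[of _ _ q]) auto
        qed
      qed (auto simp: tau_vt)
    qed
    from bij_betw_same_card[OF this] show ?thesis using dims[OF i] by simp
  qed
  show "(j, p) \<in> K \<Longrightarrow> (j, Suc p) \<in> B \<Longrightarrow> (j, Suc p) \<in> K" for j p using K_next .
  fix j p j' p' assume a: "(j, p) \<in> \<tau> ` A" "inv_into A \<tau> (j, p) = (j', p')"
  then have A: "(j', p') \<in> A" "\<tau> (j', p') = (j, p)" using inv by auto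
  show "(j, Suc p) \<in> \<tau> ` A \<and> inv_into A \<tau> (j, Suc p) = (j', Suc p') \<or>
      ((j, Suc p) \<in> B \<longrightarrow> (j, Suc p) \<in> K) \<and> ((j', Suc p') \<in> B \<longrightarrow> (j', Suc p') \<in> K)"
    using A_next[OF A] inv[of "(j', Suc p')"] by (metis imageI)
qed

lemma line_dual: assumes "c \<noteq> 0" shows "line K (\<tau> ` A) (inv_into A \<tau>) (inverse c) = L c"
proof
  fix i
  have inv: "inv_into A \<tau> (\<tau> q) = q" if "q \<in> A" for q using tau_inj that by simp
  have im: "inv_into A \<tau> ` \<tau> ` A = A" using inv by (force simp: image_image)
  have "(\<forall>q\<in>\<tau> ` A. cf x (inv_into A \<tau> q) = inverse c * cf x q) \<longleftrightarrow> (\<forall>q\<in>A. cf x (\<tau> q) = c * cf x q)" for x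
    using assms inv by (auto simp: field_simps)
  then show "line K (\<tau> ` A) (inv_into A \<tau>) (inverse c) i = L c i"
    unfolding line_def im by (simp add: Un_commute Un_left_commute)
qed

lemma gen_continuous:
  assumes "q' \<in> B" shows "continuous_on UNIV (\<lambda>c. cf (gen c q) q')"
proof (cases "q \<in> K \<union> A")
  case True
  define b where "b \<longleftrightarrow> q \<in> A \<and> q' = \<tau> q"
  have e: "(\<lambda>c. cf (gen c q) q') = (\<lambda>c. (if q' = q then 1 else 0) + (if b then c else 0))"
    by (simp add: cf_gen[OF True assms] b_def)
  show ?thesis unfolding e by (cases b) (auto intro!: continuous_intros)
next
  case False
  then show ?thesis by (simp add: gen_def cf_0)
qed

lemma line_continuous: "continuous_map euclidean (Gr_topology M e) L"
  by (rule Gr_curve_continuous[where S=S and g=gen])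
    (use dims finite_KA gen_TV gen_continuous line_span line_Gr in auto)

text \<open>The disc is cut out by the condition of containing all generators for some parameter in
  a compact set: by dimension, a point of the Grassmannian with this property is spanned by these
  generators.\<close>

lemma closedin_disc: "closedin (Gr_topology M e) (L ` cball 0 1)"
proof -
  let ?F = "{N \<in> quiver_Gr M e. \<exists>c\<in>cball 0 1. \<forall>q\<in>K \<union> A. gen c q \<in> N (vt q)}"
  have "closedin (Gr_topology M e) ?F"
    using finite_KA K_B A_B gen_TV gen_continuous by (intro closedin_contains) auto
  moreover have "?F = L ` cball 0 1"
  proof (intro equalityI subsetI)
    fix N assume "N \<in> L ` cball 0 1"
    then obtain c where c: "c \<in> cball 0 1" "N = L c" by auto
    have "gen c q \<in> L c (vt q)" if "q \<in> K \<union> A" for q using gen_line[of q "vt q" c] vt_less that by simp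
    then show "N \<in> ?F" using c line_Gr by blast
  next
    fix N assume "N \<in> ?F"
    then obtain c where N: "N \<in> quiver_Gr M e" and c: "c \<in> cball 0 1" "\<forall>q\<in>K \<union> A. gen c q \<in> N (vt q)" by auto
    have "N = L c"
    proof (rule Gr_ext[OF N line_Gr])
      fix i assume i: "i < n"
      have "N i = V.span (gen c ` S i)"
      proof (rule independent_spans)
        show "V.subspace (N i)" "N i \<subseteq> TV" "V.dim (N i) = card (S i)"
          using GrD[OF N i] dims[OF i] by auto
        show "gen c ` S i \<subseteq> N i" using c(2) by auto
      qed (use finite_KA gen_indep[OF i] in auto)
      then show "N i = L c i" using line_span[OF i] by simp
    qed
    then show "N \<in> L ` cball 0 1" using c by auto
  qed
  ultimately show ?thesis by simp
qed

lemma line_inj: "L c = L c' \<Longrightarrow> c = c'"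
proof -
  assume eq: "L c = L c'"
  obtain q where q: "q \<in> A" using A_ne by auto
  then have "gen c q \<in> L c' (vt q)" using gen_line[of q "vt q" c] vt_less eq by auto
  then have "cf (gen c q) (\<tau> q) = c' * cf (gen c q) q" using q vt_less by (auto simp: line_def)
  moreover have "cf (gen c q) (\<tau> q) = c" "cf (gen c q) q = 1"
  proof -
    have "\<tau> q \<noteq> q" using tauA(2)[OF q] q by auto
    then show "cf (gen c q) (\<tau> q) = c" "cf (gen c q) q = 1"
      using q tauA(1)[OF q] subsetD[OF A_B q] by (simp_all add: cf_gen)
  qed
  ultimately show "c = c'" by simp
qed

lemma pt_infinity_notin: "pt (K \<union> \<tau> ` A) \<noteq> L c"
proof
  assume eq: "pt (K \<union> \<tau> ` A) = L c"
  obtain q where q: "q \<in> A" using A_ne by auto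
  then have "bv (\<tau> q) \<in> pt (K \<union> \<tau> ` A) (vt q)"
    using vt_less tau_vt tauA by (auto simp: pt_def bv_in cf_bv)
  then have "bv (\<tau> q) \<in> L c (vt q)" using eq by simp
  then have "cf (bv (\<tau> q)) (\<tau> q) = c * cf (bv (\<tau> q)) q" using q vt_less by (auto simp: line_def)
  then show False using q A_B tauA[of q] by (auto simp: cf_bv split: if_splits)
qed

lemma pt_infinity:
  "pt (K \<union> \<tau> ` A) \<in> quiver_Gr M e"
  "closedin (Gr_topology M e) (line K (\<tau> ` A) (inv_into A \<tau>) ` cball 0 1)"
  "pt (K \<union> \<tau> ` A) = line K (\<tau> ` A) (inv_into A \<tau>) 0"
  "continuous_map euclidean (Gr_topology M e) (line K (\<tau> ` A) (inv_into A \<tau>))"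
  using pencil.line_Gr[OF pencil_dual, of 0] pencil.closedin_disc[OF pencil_dual]
    pencil.line_0[OF pencil_dual] pencil.line_continuous[OF pencil_dual] by simp_all

lemma limit_0_in_closure:
  assumes "continuous_map euclidean X f"
  shows "f (0::complex) \<in> X closure_of (f ` (- {0}))"
proof -
  have "f \<in> euclidean closure_of (- {0}) \<rightarrow> X closure_of (f ` (- {0}))"
    using assms unfolding continuous_map_eq_image_closure_subset by (rule spec)
  moreover have "euclidean closure_of (- {0::complex}) = UNIV"
    using closure_complement[of "{0::complex}"] by simp
  ultimately show ?thesis by auto
qed

text \<open>The orbit together with its two limits is the union of two closed discs, around 0 and
  around infinity, hence closed; both limits are adherent by continuity.\<close>

lemma closure_line:
  "Gr_topology M e closure_of (L ` (- {0})) = L ` (- {0}) \<union> {pt (K \<union> A), pt (K \<union> \<tau> ` A)}"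
proof
  let ?L' = "line K (\<tau> ` A) (inv_into A \<tau>)"
  have E': "?L' ` (- {0}) = L ` (- {0})"
  proof (intro equalityI subsetI)
    fix N assume "N \<in> ?L' ` (- {0})"
    then obtain c where c: "c \<noteq> 0" "N = ?L' c" by auto
    then have "N = L (inverse c)" using line_dual[of "inverse c"] by simp
    then show "N \<in> L ` (- {0})" using c(1) by (intro image_eqI[of _ _ "inverse c"]) auto
  next
    fix N assume "N \<in> L ` (- {0})"
    then obtain c where c: "c \<noteq> 0" "N = L c" by auto
    then have "N = ?L' (inverse c)" using line_dual[of c] by simp
    then show "N \<in> ?L' ` (- {0})" using c(1) by (intro image_eqI[of _ _ "inverse c"]) auto
  qed
  have un: "L ` cball 0 1 \<union> ?L' ` cball 0 1 = L ` (- {0}) \<union> {pt (K \<union> A), pt (K \<union> \<tau> ` A)}"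
  proof (intro equalityI subsetI)
    fix N assume "N \<in> L ` cball 0 1 \<union> ?L' ` cball 0 1"
    then obtain c where "N = L c \<or> N = ?L' c" by blast
    then show "N \<in> L ` (- {0}) \<union> {pt (K \<union> A), pt (K \<union> \<tau> ` A)}"
    proof (cases "c = 0")
      case True
      have "N = pt (K \<union> A) \<or> N = pt (K \<union> \<tau> ` A)"
        using \<open>N = L c \<or> N = ?L' c\<close> unfolding True line_0 pt_infinity(3) .
      then show ?thesis by (elim disjE) simp_all
    next
      case False
      then have "N \<in> L ` (- {0}) \<or> N \<in> ?L' ` (- {0})" using \<open>N = L c \<or> N = ?L' c\<close> by auto
      then show ?thesis unfolding E' by simp
    qed
  next
    fix N assume "N \<in> L ` (- {0}) \<union> {pt (K \<union> A), pt (K \<union> \<tau> ` A)}"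
    then consider c where "c \<noteq> 0" "N = L c" | "N = L 0" | "N = ?L' 0" using line_0 pt_infinity(3) by auto
    then show "N \<in> L ` cball 0 1 \<union> ?L' ` cball 0 1"
    proof cases
      case 1
      show ?thesis
      proof (cases "norm c \<le> 1")
        case False
        then have "norm (inverse c) \<le> 1" by (simp add: norm_inverse inverse_le_1_iff)
        then show ?thesis using 1 line_dual[OF 1(1)] by (intro UnI2 image_eqI[of _ _ "inverse c"]) auto
      next
        case True
        then show ?thesis using 1 by (intro UnI1 image_eqI[of _ _ c]) auto
      qed
    next
      case 2
      then show ?thesis by (intro UnI1 image_eqI[of _ _ 0]) auto
    next
      case 3
      then show ?thesis by (intro UnI2 image_eqI[of _ _ 0]) auto
    qed
  qed
  then have "closedin (Gr_topology M e) (L ` (- {0}) \<union> {pt (K \<union> A), pt (K \<union> \<tau> ` A)})"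
    using closedin_Un[OF closedin_disc pt_infinity(2)] by simp
  then show "Gr_topology M e closure_of (L ` (- {0})) \<subseteq> L ` (- {0}) \<union> {pt (K \<union> A), pt (K \<union> \<tau> ` A)}"
    by (rule closure_of_minimal[rotated]) auto
  have "L ` (- {0}) \<subseteq> Gr_topology M e closure_of (L ` (- {0}))"
    by (rule closure_of_subset) (use line_Gr in \<open>auto simp: topspace_Gr\<close>)
  moreover have "pt (K \<union> A) \<in> Gr_topology M e closure_of (L ` (- {0}))"
    using limit_0_in_closure[OF line_continuous] line_0 by simp
  moreover have "pt (K \<union> \<tau> ` A) \<in> Gr_topology M e closure_of (L ` (- {0}))"
    using limit_0_in_closure[OF pt_infinity(4)] pt_infinity(3) E' by simp
  ultimately show "L ` (- {0}) \<union> {pt (K \<union> A), pt (K \<union> \<tau> ` A)} \<subseteq> Gr_topology M e closure_of (L ` (- {0}))"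
    by auto
qed

lemma limit_line:
  assumes "(f \<longlongrightarrow> 0) F"
  shows "limitin (Gr_topology M e) (\<lambda>z. L (f z)) (pt (K \<union> A)) F"
  using continuous_map_limit[OF line_continuous, of f 0 F] assms line_0 by (simp add: comp_def)

text \<open>A substitute for uniqueness of limits: eventually the curve lies in the closed disc
  around 0, and the point at infinity does not.\<close>

lemma not_limit_line:
  assumes "(f \<longlongrightarrow> 0) F" "F \<noteq> bot"
  shows "\<not> limitin (Gr_topology M e) (\<lambda>z. L (f z)) (pt (K \<union> \<tau> ` A)) F"
proof
  assume l: "limitin (Gr_topology M e) (\<lambda>z. L (f z)) (pt (K \<union> \<tau> ` A)) F"
  have "\<forall>\<^sub>F z in F. norm (f z) < 1" using order_tendstoD(2)[OF tendsto_norm[OF assms(1)], of 1] by simp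
  then have "\<forall>\<^sub>F z in F. L (f z) \<in> L ` cball 0 1" by (rule eventually_mono) auto
  from limitin_closedin[OF l closedin_disc this] assms(2) have "pt (K \<union> \<tau> ` A) \<in> L ` cball 0 1" by simp
  then show False using pt_infinity_notin by auto
qed

lemma diag_line:
  assumes "\<And>q. q \<in> B \<Longrightarrow> \<kappa> q \<noteq> 0" "\<And>q. q \<in> A \<Longrightarrow> \<kappa> (\<tau> q) = \<rho> * \<kappa> q"
  shows "diag_Gr M \<kappa> (L c) = L (\<rho> * c)"
proof
  fix i show "diag_Gr M \<kappa> (L c) i = L (\<rho> * c) i"
  proof (cases "i < n")
    case True
    have "diag_map M \<kappa> ` L c i = L (\<rho> * c) i"
    proof (intro equalityI subsetI)
      fix y assume "y \<in> diag_map M \<kappa> ` L c i"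
      then show "y \<in> L (\<rho> * c) i" using True A_B tauA assms(2) by (auto simp: line_def diag_map_TV cf_diag subsetD)
    next
      fix y assume y: "y \<in> L (\<rho> * c) i"
      have yT: "y \<in> TV" using y True by (auto simp: line_def)
      let ?x = "diag_map M (\<lambda>q. inverse (\<kappa> q)) y"
      have "y = diag_map M \<kappa> ?x" using diag_map_inverse[OF yT assms(1)] by simp
      moreover have "?x \<in> L c i"
      proof -
        have "inverse (\<kappa> (\<tau> q)) * cf y (\<tau> q) = c * (inverse (\<kappa> q) * cf y q)" if q: "q \<in> A" for q
        proof -
          have nz: "\<kappa> q \<noteq> 0" "\<kappa> (\<tau> q) \<noteq> 0" using assms(1)[OF subsetD[OF A_B q]] assms(1)[OF tauA(1)[OF q]] .
          then have "\<rho> \<noteq> 0" using assms(2)[OF q] by auto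
          have "cf y (\<tau> q) = \<rho> * c * cf y q" using y q True by (auto simp: line_def)
          then show ?thesis using nz \<open>\<rho> \<noteq> 0\<close> by (simp add: assms(2)[OF q] field_simps)
        qed
        then show ?thesis using y True A_B tauA by (auto simp: line_def diag_map_TV cf_diag subsetD)
      qed
      ultimately show "y \<in> diag_map M \<kappa> ` L c i" by (rule image_eqI)
    qed
    then show ?thesis using True by (simp add: diag_Gr_def)
  qed (simp add: diag_Gr_def line_def)
qed

end

section \<open>Fixed points and one-dimensional orbits\<close>

text \<open>Since 2 is not a root of unity, torus points whose coordinates are powers of 2 detect
  integral linear relations between exponents.\<close>

lemma two_powi_eq_1: "(2::complex) powi k = 1 \<Longrightarrow> k = 0"
proof -
  assume "(2::complex) powi k = 1"
  then have "norm ((2::complex) powi k) = 1" by simp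
  then have "(2::real) powi k = 1" by (simp add: norm_power_int)
  then have "(2::real) powr real_of_int k = 1" by (simp add: powr_real_of_int')
  then show "k = 0" by simp
qed

lemma character_exponential: "character d a (\<lambda>i\<in>{0..d}. 2 powi b i) = 2 powi (\<Sum>i\<in>{0..d}. b i * a i)"
proof -
  have "character d a (\<lambda>i\<in>{0..d}. 2 powi b i) = (\<Prod>i\<in>{0..d}. 2 powi (b i * a i))"
    unfolding character_def by (intro prod.cong) (auto simp: power_int_mult)
  also have "\<dots> = 2 powi (\<Sum>i\<in>{0..d}. b i * a i)"
  proof -
    have "finite F \<Longrightarrow> (\<Prod>i\<in>F. (2::complex) powi (b i * a i)) = 2 powi (\<Sum>i\<in>F. b i * a i)" for F
      by (induction rule: finite_induct) (simp_all add: power_int_add)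
    then show ?thesis by simp
  qed
  finally show ?thesis .
qed

lemma exponential_torus: "(\<lambda>i\<in>{0..d}. 2 powi b i) \<in> torus d"
  by (auto simp: torus_def)

lemma character_diff:
  assumes "\<gamma> \<in> torus d"
  shows "character d (\<lambda>i. a i - b i) \<gamma> = character d a \<gamma> / character d b \<gamma>"
proof -
  have "character d (\<lambda>i. a i - b i) \<gamma> = (\<Prod>i\<in>{0..d}. \<gamma> i powi a i / \<gamma> i powi b i)"
    unfolding character_def using assms by (intro prod.cong) (auto simp: torus_def PiE_iff power_int_diff)
  then show ?thesis by (simp add: character_def prod_dividef)
qed

interpretation rat_fun: vector_space "\<lambda>(c::rat) (f::nat \<Rightarrow> rat) i. c * f i"
  by unfold_locales (auto simp: fun_eq_iff algebra_simps)

lemma rat_fun_dim_1: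
  assumes "vector_space.dim (\<lambda>(c::rat) (f::nat \<Rightarrow> rat) i. c * f i) X = 1"
  obtains w where "w \<noteq> 0" "w \<in> X" "\<And>a. a \<in> X \<Longrightarrow> \<exists>r. a = (\<lambda>i. r * w i)"
proof -
  obtain D where D: "D \<subseteq> X" "rat_fun.independent D" "X \<subseteq> rat_fun.span D" "card D = 1"
    using rat_fun.basis_exists[of X] assms by metis
  then obtain w where w: "D = {w}" by (auto simp: card_1_singleton_iff)
  have "w \<noteq> 0" using D(2) w rat_fun.dependent_zero by auto
  moreover have "\<exists>r. a = (\<lambda>i. r * w i)" if "a \<in> X" for a
    using D(3) that w rat_fun.span_singleton[of w] by auto
  ultimately show ?thesis using that D(1) w by auto
qed

lemma rat_fun_dim_line:
  assumes "w \<in> X" "w \<noteq> 0" "\<And>a. a \<in> X \<Longrightarrow> \<exists>r. a = (\<lambda>i. r * w i)"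
  shows "vector_space.dim (\<lambda>(c::rat) (f::nat \<Rightarrow> rat) i. c * f i) X = 1"
proof -
  have ind: "rat_fun.independent {w}" using assms(2) by simp
  have "X \<subseteq> rat_fun.span {w}" using assms(3) by (auto simp: rat_fun.span_singleton)
  then have "rat_fun.dim X = card {w}"
    by (intro rat_fun.dim_unique[of "{w}"]) (use assms(1) ind in auto)
  then show ?thesis by simp
qed

context decomposed_rep
begin

text \<open>A space stable under diagonal maps contains the projections of its vectors to joint
  eigenspaces: \<open>(\<kappa> - \<kappa> q') / (\<kappa> q0 - \<kappa> q')\<close> kills the
  coordinate \<open>q'\<close> and keeps all coordinates with the same eigenvalues as
  \<open>q0\<close>. Repetition removes all the others.\<close>

lemma projection_in:
  assumes W: "V.subspace W" "W \<subseteq> TV" and inv: "\<And>\<kappa> x. \<kappa> \<in> \<Gamma> \<Longrightarrow> x \<in> W \<Longrightarrow> diag_map M \<kappa> x \<in> W"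
  shows "x \<in> W \<Longrightarrow> comb (\<lambda>q. if \<forall>\<kappa>\<in>\<Gamma>. \<kappa> q = \<kappa> q0 then cf x q else 0) \<in> W"
proof (induction "card {q \<in> B. cf x q \<noteq> 0 \<and> \<not> (\<forall>\<kappa>\<in>\<Gamma>. \<kappa> q = \<kappa> q0)}" arbitrary: x rule: less_induct)
  case less
  let ?off = "\<lambda>x. {q \<in> B. cf x q \<noteq> 0 \<and> \<not> (\<forall>\<kappa>\<in>\<Gamma>. \<kappa> q = \<kappa> q0)}"
  have xT: "x \<in> TV" using less.prems W by auto
  have fin: "finite (?off x)" using finite_B by simp
  show ?case
  proof (cases "?off x = {}")
    case True
    have "comb (\<lambda>q. if \<forall>\<kappa>\<in>\<Gamma>. \<kappa> q = \<kappa> q0 then cf x q else 0) = x"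
      by (rule cf_ext[OF comb_in xT]) (use True in \<open>auto simp: cf_comb\<close>)
    then show ?thesis using less.prems by simp
  next
    case False
    then obtain q' \<kappa> where q': "q' \<in> B" "cf x q' \<noteq> 0" and \<kappa>: "\<kappa> \<in> \<Gamma>" "\<kappa> q' \<noteq> \<kappa> q0" by auto
    define y where "y = smult M (inverse (\<kappa> q0 - \<kappa> q')) (diag_map M \<kappa> x - smult M (\<kappa> q') x)"
    have y: "y \<in> W" unfolding y_def
      by (intro V.subspace_scale[OF W(1)] V.subspace_diff[OF W(1)] inv[OF \<kappa>(1)] less.prems)
    have cfy: "cf y q = inverse (\<kappa> q0 - \<kappa> q') * (\<kappa> q - \<kappa> q') * cf x q" if "q \<in> B" for q
      using that xT by (simp add: y_def cf_scale cf_diff diag_map_TV TV_scale TV_diff cf_diag algebra_simps)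
    have "?off y \<subset> ?off x"
    proof
      show "?off y \<subseteq> ?off x" using cfy by auto
      have "q' \<in> ?off x" using q' \<kappa> by auto
      moreover have "q' \<notin> ?off y" using cfy[OF q'(1)] by simp
      ultimately show "?off y \<noteq> ?off x" by blast
    qed
    from less.hyps[OF psubset_card_mono[OF fin this] y]
    have "comb (\<lambda>q. if \<forall>\<kappa>\<in>\<Gamma>. \<kappa> q = \<kappa> q0 then cf y q else 0) \<in> W" .
    moreover have "comb (\<lambda>q. if \<forall>\<kappa>\<in>\<Gamma>. \<kappa> q = \<kappa> q0 then cf y q else 0) = comb (\<lambda>q. if \<forall>\<kappa>\<in>\<Gamma>. \<kappa> q = \<kappa> q0 then cf x q else 0)"
    proof (rule comb_cong)
      fix q assume q: "q \<in> B"
      have "\<kappa> q0 - \<kappa> q' \<noteq> 0" using \<kappa>(2) by auto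
      then have "cf y q = cf x q" if "\<kappa> q = \<kappa> q0" using cfy[OF q] that by simp
      then show "(if \<forall>\<kappa>\<in>\<Gamma>. \<kappa> q = \<kappa> q0 then cf y q else 0) = (if \<forall>\<kappa>\<in>\<Gamma>. \<kappa> q = \<kappa> q0 then cf x q else 0)"
        using \<kappa>(1) by auto
    qed
    ultimately show ?thesis by simp
  qed
qed

definition supp :: "(nat \<Rightarrow> 'v set) \<Rightarrow> (nat \<times> nat) set" where
  "supp N = {q \<in> B. bv q \<in> N (vt q)}"

lemma pt_mem: "i < n \<Longrightarrow> x \<in> pt S i \<longleftrightarrow> x \<in> TV \<and> (\<forall>q\<in>B. vt q \<noteq> i \<or> q \<notin> S \<longrightarrow> cf x q = 0)"
  by (simp add: pt_def)

lemma supp_pt: "supp (pt S) = S \<inter> B"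
proof -
  have "bv q \<in> pt S (vt q) \<longleftrightarrow> q \<in> S" if q: "q \<in> B" for q
    using q by (auto simp: pt_mem[OF vt_less] bv_in cf_bv)
  then show ?thesis by (auto simp: supp_def)
qed

lemma supp_next: "N \<in> quiver_Gr M e \<Longrightarrow> (j, p) \<in> supp N \<Longrightarrow> (j, Suc p) \<in> B \<Longrightarrow> (j, Suc p) \<in> supp N"
  using GrD(4)[of N e "vt (j, p)" "bv (j, p)"] vt_less arrow_bv[of j p] by (auto simp: supp_def vt_Suc)

lemma supp_next': 
  assumes "N \<in> quiver_Gr M e" "(j, p) \<in> supp N"
  shows "(j, p + t) \<in> B \<Longrightarrow> (j, p + t) \<in> supp N"
proof (induction t)
  case (Suc t)
  then have "(j, p + t) \<in> B" by (auto simp: basis_index_iff)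
  then show ?case using supp_next[OF assms(1), of j "p + t"] Suc by simp
qed (use assms in simp)

lemma eq_pt_supp:
  assumes N: "N \<in> quiver_Gr M e"
    and "\<And>i x q. i < n \<Longrightarrow> x \<in> N i \<Longrightarrow> q \<in> B \<Longrightarrow> vt q = i \<Longrightarrow> cf x q \<noteq> 0 \<Longrightarrow> bv q \<in> N i"
  shows "N = pt (supp N)"
proof
  fix i
  show "N i = pt (supp N) i"
  proof (cases "i < n")
    case True
    show ?thesis
    proof (intro equalityI subsetI)
      fix x assume x: "x \<in> N i"
      have "x \<in> space M i" "x \<in> TV" using GrD[OF N True] x by auto
      then show "x \<in> pt (supp N) i" using assms(2)[OF True x] by (auto simp: pt_mem True supp_def space_eq)
    next
      fix x assume x: "x \<in> pt (supp N) i"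
      then have xT: "x \<in> TV" by (simp add: pt_mem True)
      have "x = comb (cf x)" using comb_cf[OF xT] by simp
      also have "\<dots> \<in> N i" unfolding comb_def
      proof (rule V.subspace_sum[OF GrD(1)[OF N True]])
        fix q assume q: "q \<in> B"
        show "smult M (cf x q) (bv q) \<in> N i"
        proof (cases "cf x q = 0")
          case T: True
          then show ?thesis using V.subspace_0[OF GrD(1)[OF N True]] by simp
        next
          case False
          then have "bv q \<in> N i" using x q by (auto simp: pt_mem True supp_def)
          then show ?thesis by (rule V.subspace_scale[OF GrD(1)[OF N True]])
        qed
      qed
      finally show "x \<in> N i" .
    qed
  next
    case False
    then show ?thesis using N by (auto simp: quiver_Gr_def PiE_iff extensional_def pt_def)
  qed
qed

lemma pt_dims:
  assumes "pt S \<in> quiver_Gr M e" "i < n"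
  shows "card {q \<in> S \<inter> B. vt q = i} = e i"
proof -
  let ?A = "{q \<in> S \<inter> B. vt q = i}"
  have "pt S i = V.span (bv ` ?A)"
    using span_bv[of ?A] assms(2) by (auto simp: pt_def)
  moreover have "V.independent (bv ` ?A)"
    by (rule V.independent_mono[OF indep]) (auto simp: basis_set_def)
  ultimately have "V.dim (pt S i) = card (bv ` ?A)" using V.dim_span_eq_card_independent by simp
  also have "\<dots> = card ?A" by (intro card_image inj_on_subset[OF bv_inj]) auto
  finally show ?thesis using GrD(3)[OF assms] by simp
qed

lemma stabilizer_diag:
  assumes "\<gamma> \<in> stabilizer M N" "i < n" "x \<in> N i"
  shows "diag_map M (chr \<gamma>) x \<in> N i"
proof -
  have "act M \<gamma> N i = N i" using assms(1) by (simp add: stabilizer_def)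
  then show ?thesis using assms(2,3) by (auto simp: act_chr diag_Gr_def)
qed

definition expo :: "nat \<times> nat \<Rightarrow> nat \<Rightarrow> int" where
  "expo q i = (if i = 0 then int (snd q) else if i = fst q then 1 else 0)"

lemma chr_character: "q \<in> B \<Longrightarrow> character (summands M) (expo q) \<gamma> = chr \<gamma> q"
proof -
  assume q: "q \<in> B"
  let ?d = "summands M"
  have j: "fst q \<in> {1..?d}" using q by (cases q) (simp add: basis_index_iff)
  have s: "{0..?d} = insert 0 {1..?d}" by auto
  have "character ?d (expo q) \<gamma> = \<gamma> 0 powi expo q 0 * (\<Prod>i\<in>{1..?d}. \<gamma> i powi expo q i)"
    unfolding character_def s by (subst prod.insert) auto
  also have "(\<Prod>i\<in>{1..?d}. \<gamma> i powi expo q i) = (\<Prod>i\<in>{1..?d}. if i = fst q then \<gamma> i else 1)"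
    by (intro prod.cong) (auto simp: expo_def)
  also have "\<dots> = \<gamma> (fst q)" using j by simp
  moreover have "expo q 0 = int (snd q)" by (simp add: expo_def)
  ultimately show ?thesis by (simp add: chr_def)
qed

lemma expo_orbit_character:
  assumes "q \<in> B" "q' \<in> B" "\<And>\<gamma>. \<gamma> \<in> stabilizer M N \<Longrightarrow> chr \<gamma> q = chr \<gamma> q'"
  shows "(\<lambda>i. expo q i - expo q' i) \<in> orbit_characters M N"
proof -
  have "character (summands M) (\<lambda>i. expo q i - expo q' i) \<gamma> = 1" if "\<gamma> \<in> stabilizer M N" for \<gamma>
    using that assms chr_nz[of \<gamma> q'] character_diff[of \<gamma> "summands M" "expo q" "expo q'"]
    by (simp add: chr_character stabilizer_def)
  moreover have "expo q i - expo q' i = 0" if "i > summands M" for i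
    using that assms(1,2) by (cases q; cases q') (auto simp: expo_def basis_index_iff)
  ultimately show ?thesis by (simp add: orbit_characters_def)
qed

lemma expo_inj: "q \<in> B \<Longrightarrow> q' \<in> B \<Longrightarrow> expo q = expo q' \<Longrightarrow> q = q'"
proof -
  assume q: "q \<in> B" "q' \<in> B" "expo q = expo q'"
  have "expo q 0 = expo q' 0" "expo q (fst q) = expo q' (fst q)" using q(3) by auto
  then show "q = q'"
    using q(1,2) by (cases q; cases q') (auto simp: expo_def basis_index_iff split: if_splits)
qed

lemma trivial_on_torus:
  assumes "\<And>\<gamma>. \<gamma> \<in> torus d \<Longrightarrow> character d a \<gamma> = 1" "i \<le> d"
  shows "a i = 0"
proof -
  have "(\<Sum>k\<in>{0..d}. (if k = i then 1 else 0) * a k) = 0"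
    by (rule two_powi_eq_1) (use assms(1)[OF exponential_torus] character_exponential in metis)
  then show ?thesis using assms(2) by (simp add: if_distrib[of "\<lambda>x. x * _"] cong: if_cong)
qed

lemma pt_fixed: "pt S \<in> quiver_Gr M e \<Longrightarrow> pt S \<in> fixed_points M e"
  using diag_pt chr_nz by (auto simp: fixed_points_def act_chr)

text \<open>Distinct basis vectors have distinct characters, so the joint eigenspaces of the torus
  are coordinate lines and an invariant subspace is spanned by basis vectors.\<close>

lemma fixed_iff: "N \<in> fixed_points M e \<longleftrightarrow> N \<in> quiver_Gr M e \<and> N = pt (supp N)"
proof
  assume N: "N \<in> fixed_points M e"
  then have Gr: "N \<in> quiver_Gr M e" by (simp add: fixed_points_def)
  have st: "stabilizer M N = torus (summands M)" using N by (auto simp: stabilizer_def fixed_points_def)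
  have "N = pt (supp N)"
  proof (rule eq_pt_supp[OF Gr])
    fix i x q assume i: "i < n" and x: "x \<in> N i" and q: "q \<in> B" "cf x q \<noteq> 0"
    let ?\<Gamma> = "chr ` stabilizer M N"
    have y: "comb (\<lambda>u. if \<forall>\<kappa>\<in>?\<Gamma>. \<kappa> u = \<kappa> q then cf x u else 0) \<in> N i"
      by (rule projection_in[OF GrD(1)[OF Gr i] _ _ x]) (use GrD(5)[OF Gr i] stabilizer_diag[OF _ i] in auto)
    have "(\<forall>\<kappa>\<in>?\<Gamma>. \<kappa> u = \<kappa> q) \<longleftrightarrow> u = q" if u: "u \<in> B" for u
    proof
      assume "\<forall>\<kappa>\<in>?\<Gamma>. \<kappa> u = \<kappa> q"
      then have "(\<lambda>i. expo u i - expo q i) \<in> orbit_characters M N"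
        by (intro expo_orbit_character u q) auto
      then have z: "\<forall>\<gamma>\<in>torus (summands M). character (summands M) (\<lambda>i. expo u i - expo q i) \<gamma> = 1"
        "\<forall>i>summands M. expo u i - expo q i = 0" by (auto simp: orbit_characters_def st)
      have "expo u i = expo q i" for i
        using trivial_on_torus[of "summands M" "\<lambda>i. expo u i - expo q i" i] z by (cases "i \<le> summands M") auto
      then show "u = q" using expo_inj[OF u q(1)] by (simp add: fun_eq_iff)
    qed auto
    then have "comb (\<lambda>u. if \<forall>\<kappa>\<in>?\<Gamma>. \<kappa> u = \<kappa> q then cf x u else 0) = smult M (cf x q) (bv q)"
      by (intro cf_ext comb_in TV_scale bv_in q) (use q in \<open>auto simp: cf_comb cf_scale bv_in cf_bv\<close>)
    then have "smult M (cf x q) (bv q) \<in> N i" using y by simp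
    then have "smult M (inverse (cf x q)) (smult M (cf x q) (bv q)) \<in> N i"
      by (rule V.subspace_scale[OF GrD(1)[OF Gr i]])
    then show "bv q \<in> N i" using q by simp
  qed
  then show "N \<in> quiver_Gr M e \<and> N = pt (supp N)" using Gr by simp
next
  assume "N \<in> quiver_Gr M e \<and> N = pt (supp N)"
  then show "N \<in> fixed_points M e" using pt_fixed by metis
qed

lemma orbit_dim_fixed: "N \<in> fixed_points M e \<Longrightarrow> orbit_dim M N \<noteq> 1"
proof
  assume N: "N \<in> fixed_points M e" and "orbit_dim M N = 1"
  then obtain w where w: "w \<noteq> 0" "w \<in> (\<lambda>a i. rat_of_int (a i)) ` orbit_characters M N"
    unfolding orbit_dim_def by (metis rat_fun_dim_1)
  from w(2) obtain a where a: "a \<in> orbit_characters M N" "w = (\<lambda>i. rat_of_int (a i))" by blast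
  have "stabilizer M N = torus (summands M)" using N by (auto simp: stabilizer_def fixed_points_def)
  then have "\<And>\<gamma>. \<gamma> \<in> torus (summands M) \<Longrightarrow> character (summands M) a \<gamma> = 1"
    and z: "\<And>i. i > summands M \<Longrightarrow> a i = 0" using a(1) by (simp_all add: orbit_characters_def)
  from trivial_on_torus[OF this(1)] have "a i = 0" for i using z[of i] by (cases "i \<le> summands M") simp_all
  then have "w = 0" unfolding a(2) by (simp add: fun_eq_iff)
  then show False using w(1) by simp
qed

lemma finite_fixed_points: "finite (fixed_points M e)"
proof (rule finite_surj[of "Pow B" _ pt])
  show "finite (Pow B)" using finite_B by simp
  show "fixed_points M e \<subseteq> pt ` Pow B" using fixed_iff by (force simp: supp_def)
qed

end

locale torus_pencil = pencil M K A \<tau> e for M :: "'v::ab_group_add based_rep" and K A \<tau> e +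
  fixes j j' m :: nat
  assumes jj: "j \<in> {1..summands M}" "j' \<in> {1..summands M}" "j \<noteq> j'"
    and A_j: "\<And>q. q \<in> A \<Longrightarrow> fst q = j" and tau_j: "\<And>q. q \<in> A \<Longrightarrow> \<tau> q = (j', snd q + m)"
begin

text \<open>The character by which the torus scales the coordinate of the line: the exponent of
  \<open>\<tau> q\<close> minus that of \<open>q\<close>, the same for all \<open>q\<close> in
  \<open>A\<close>.\<close>

definition slope :: "nat \<Rightarrow> int" where
  "slope i = (if i = 0 then int m else if i = j' then 1 else if i = j then -1 else 0)"

abbreviation "E \<equiv> L ` (- {0})"

lemma slope_expo: "q \<in> A \<Longrightarrow> slope i = expo (\<tau> q) i - expo q i"
  using A_j tau_j jj by (auto simp: slope_def expo_def)

lemma chr_slope: "\<gamma> \<in> torus (summands M) \<Longrightarrow> q \<in> A \<Longrightarrow> chr \<gamma> (\<tau> q) = character (summands M) slope \<gamma> * chr \<gamma> q"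
proof -
  assume g: "\<gamma> \<in> torus (summands M)" and q: "q \<in> A"
  have qB: "q \<in> B" "\<tau> q \<in> B" using subsetD[OF A_B q] tauA(1)[OF q] by auto
  have "slope = (\<lambda>i. expo (\<tau> q) i - expo q i)" using slope_expo[OF q] by auto
  then show ?thesis using character_diff[OF g] chr_nz[OF g qB(1)] by (simp add: chr_character qB)
qed

lemma act_line: "\<gamma> \<in> torus (summands M) \<Longrightarrow> act M \<gamma> (L c) = L (character (summands M) slope \<gamma> * c)"
  unfolding act_chr by (rule diag_line) (auto simp: chr_nz chr_slope)

lemma slope_character_nz: "\<gamma> \<in> torus (summands M) \<Longrightarrow> character (summands M) a \<gamma> \<noteq> 0"
  by (auto simp: character_def torus_def PiE_iff)

lemma slope_surj: "c \<noteq> 0 \<Longrightarrow> \<exists>\<gamma>\<in>torus (summands M). character (summands M) slope \<gamma> = c"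
proof (rule bexI[of _ "\<lambda>i\<in>{0..summands M}. if i = j' then c else 1"])
  assume c: "c \<noteq> 0"
  show "(\<lambda>i\<in>{0..summands M}. if i = j' then c else 1) \<in> torus (summands M)" using c by (auto simp: torus_def)
  have "character (summands M) slope (\<lambda>i\<in>{0..summands M}. if i = j' then c else 1) = (\<Prod>i\<in>{0..summands M}. if i = j' then c else 1)"
    unfolding character_def using jj by (intro prod.cong) (auto simp: slope_def)
  then show "character (summands M) slope (\<lambda>i\<in>{0..summands M}. if i = j' then c else 1) = c" using jj by simp
qed

lemma orbit_line: assumes "c \<noteq> 0" shows "orbit M (L c) = E"
proof (intro equalityI subsetI)
  fix N assume "N \<in> orbit M (L c)"
  then obtain \<gamma> where "\<gamma> \<in> torus (summands M)" "N = L (character (summands M) slope \<gamma> * c)"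
    by (auto simp: orbit_def act_line)
  then show "N \<in> E" using assms slope_character_nz by auto
next
  fix N assume "N \<in> E"
  then obtain c' where c': "c' \<noteq> 0" "N = L c'" by auto
  obtain \<gamma> where "\<gamma> \<in> torus (summands M)" "character (summands M) slope \<gamma> = c' / c"
    using slope_surj[of "c' / c"] assms c' by auto
  then show "N \<in> orbit M (L c)"
    using act_line[of \<gamma> c] assms c' unfolding orbit_def by (intro image_eqI[of _ _ \<gamma>]) simp_all
qed

lemma stabilizer_line: "c \<noteq> 0 \<Longrightarrow> stabilizer M (L c) = {\<gamma> \<in> torus (summands M). character (summands M) slope \<gamma> = 1}"
  using line_inj by (fastforce simp: stabilizer_def act_line)

text \<open>A character trivial on the kernel of \<open>slope\<close> is orthogonal to every
  cocharacter orthogonal to \<open>slope\<close>, so it is a multiple of \<open>slope\<close>; as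
  \<open>slope j' = 1\<close>, the factor is the entry at \<open>j'\<close>.\<close>

lemma trivial_on_kernel:
  assumes "\<And>\<gamma>. \<gamma> \<in> torus (summands M) \<Longrightarrow> character (summands M) slope \<gamma> = 1 \<Longrightarrow> character (summands M) a \<gamma> = 1"
    and "i \<le> summands M"
  shows "a i = a j' * slope i"
proof -
  let ?d = "summands M"
  have *: "(\<Sum>k\<in>{0..?d}. b k * a k) = 0" if "(\<Sum>k\<in>{0..?d}. b k * slope k) = 0" for b
  proof (rule two_powi_eq_1)
    have "character ?d slope (\<lambda>i\<in>{0..?d}. 2 powi b i) = 1" using that by (simp add: character_exponential)
    from assms(1)[OF exponential_torus this] show "(2::complex) powi (\<Sum>k\<in>{0..?d}. b k * a k) = 1"
      by (simp add: character_exponential)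
  qed
  have one: "(\<Sum>k\<in>{0..?d}. (if k = u then c else 0) * f k) = c * f u" if "u \<le> ?d" for u c and f :: "nat \<Rightarrow> int"
    using that by (simp add: if_distrib[of "\<lambda>x. x * _"] cong: if_cong)
  have two: "(\<Sum>k\<in>{0..?d}. ((if k = u then c else 0) + (if k = w then c' else 0)) * f k) = c * f u + c' * f w"
    if "u \<le> ?d" "w \<le> ?d" for u w c c' and f :: "nat \<Rightarrow> int"
    using that one by (simp add: distrib_right sum.distrib)
  have d: "j \<le> ?d" "j' \<le> ?d" "j \<noteq> 0" "j' \<noteq> 0" using jj by auto
  have j: "a j = - a j'"
    using *[of "\<lambda>k. (if k = j then 1 else 0) + (if k = j' then 1 else 0)"] d jj(3)
    by (simp add: two slope_def)
  have 0: "a 0 = int m * a j'"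
    using *[of "\<lambda>k. (if k = 0 then 1 else 0) + (if k = j then int m else 0)"] d jj(3) j
    by (simp add: two slope_def)
  have other: "a i = 0" if "i \<noteq> 0" "i \<noteq> j" "i \<noteq> j'"
    using *[of "\<lambda>k. if k = i then 1 else 0"] assms(2) that by (simp add: one slope_def)
  show ?thesis using j 0 other d jj(3) by (auto simp: slope_def)
qed

lemma orbit_dim_line: assumes "c \<noteq> 0" shows "orbit_dim M (L c) = 1"
  unfolding orbit_dim_def
proof (rule rat_fun_dim_line)
  have "slope \<in> orbit_characters M (L c)"
    using jj by (auto simp: orbit_characters_def stabilizer_line[OF assms] slope_def)
  then show "(\<lambda>i. of_int (slope i)) \<in> (\<lambda>a i. of_int (a i)) ` orbit_characters M (L c)" by (rule imageI)
  show "(\<lambda>i. of_int (slope i)) \<noteq> (0 :: nat \<Rightarrow> rat)"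
    using jj by (auto simp: fun_eq_iff slope_def intro!: exI[of _ j'])
  fix f assume "f \<in> (\<lambda>a i. rat_of_int (a i)) ` orbit_characters M (L c)"
  then obtain a where a: "a \<in> orbit_characters M (L c)" "f = (\<lambda>i. rat_of_int (a i))" by auto
  have "a i = a j' * slope i" for i
  proof (cases "i \<le> summands M")
    case True
    then show ?thesis using a(1) by (intro trivial_on_kernel) (auto simp: orbit_characters_def stabilizer_line[OF assms])
  next
    case False
    then show ?thesis using a(1) jj by (auto simp: orbit_characters_def slope_def)
  qed
  then show "\<exists>r. f = (\<lambda>i. r * rat_of_int (slope i))"
    unfolding a(2) by (intro exI[of _ "of_int (a j')"]) (metis of_int_mult)
qed

lemma line_in_edges: "E \<in> edges M e"
proof -
  have "E = orbit M (L 1)" using orbit_line by simp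
  moreover have "L 1 \<in> {x \<in> quiver_Gr M e. orbit_dim M x = 1}" using line_Gr orbit_dim_line by simp
  ultimately show ?thesis unfolding edges_def by (rule image_eqI)
qed

lemma line_endpoints: "endpoints M e E = {pt (K \<union> A), pt (K \<union> \<tau> ` A)}"
proof -
  have "L c \<notin> fixed_points M e" if "c \<noteq> 0" for c using orbit_dim_fixed orbit_dim_line[OF that] by auto
  moreover have "pt (K \<union> A) \<in> fixed_points M e" "pt (K \<union> \<tau> ` A) \<in> fixed_points M e"
    using pt_fixed pt_infinity(1) line_Gr[of 0] line_0 by auto
  ultimately show ?thesis unfolding endpoints_def closure_line by auto
qed

lemma endpoints_distinct: "pt (K \<union> A) \<noteq> pt (K \<union> \<tau> ` A)"
  using pt_infinity_notin[of 0] line_0 by simp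

text \<open>Both \<open>a\<close> and \<open>slope\<close> have the stabiliser of a point of the
  orbit as kernel, so \<open>a\<close> is an integral multiple of \<open>slope\<close>, and a
  nonzero one since the torus moves the orbit. The factor becomes a unit over the rationals.\<close>

lemma line_label:
  assumes "describes_action M E a"
  shows "\<exists>c. c \<noteq> 0 \<and> char_form (summands M) a = Const c * linform (summands M) (\<lambda>i. of_int (slope i))"
proof -
  let ?d = "summands M"
  obtain \<phi> where bij: "bij_betw \<phi> (- {0::complex}) E"
    and eq: "\<And>\<gamma> z. \<gamma> \<in> torus ?d \<Longrightarrow> z \<noteq> 0 \<Longrightarrow> act M \<gamma> (\<phi> z) = \<phi> (character ?d a \<gamma> * z)"
    using assms unfolding describes_action_def by blast
  have "\<phi> 1 \<in> E" using bij_betwE[OF bij] by auto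
  then obtain c where c: "c \<noteq> 0" "\<phi> 1 = L c" by auto
  have iff: "character ?d a \<gamma> = 1 \<longleftrightarrow> character ?d slope \<gamma> = 1" if g: "\<gamma> \<in> torus ?d" for \<gamma>
  proof -
    have "character ?d a \<gamma> = 1 \<longleftrightarrow> \<phi> (character ?d a \<gamma> * 1) = \<phi> 1"
      using inj_on_eq_iff[OF bij_betw_imp_inj_on[OF bij], of "character ?d a \<gamma>" 1] slope_character_nz[OF g] by simp
    also have "\<dots> \<longleftrightarrow> act M \<gamma> (L c) = L c" using eq[OF g, of 1] c by simp
    also have "\<dots> \<longleftrightarrow> character ?d slope \<gamma> = 1" using act_line[OF g, of c] line_inj[of "character ?d slope \<gamma> * c" c] c by auto
    finally show ?thesis .
  qed
  have a: "a i = a j' * slope i" if "i \<le> ?d" for i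
    by (rule trivial_on_kernel) (use iff that in auto)
  have "a j' \<noteq> 0"
  proof
    assume "a j' = 0"
    then have "a i = 0" if "i \<le> ?d" for i using a that by simp
    then have one: "character ?d a \<gamma> = 1" for \<gamma> by (simp add: character_def)
    obtain \<gamma> where "\<gamma> \<in> torus ?d" "character ?d slope \<gamma> = 2" using slope_surj[of 2] by auto
    then show False using iff[of \<gamma>] one by simp
  qed
  moreover have "char_form ?d a = Const (of_int (a j')) * linform ?d (\<lambda>i. of_int (slope i))"
    unfolding char_form_linform linform_def sum_distrib_left
  proof (intro sum.cong refl)
    fix i assume "i \<in> {0..?d}"
    then have "a i = a j' * slope i" using a by simp
    then have "(of_int (a i) :: rat) = of_int (a j') * of_int (slope i)" by (metis of_int_mult)
    then show "Const (of_int (a i)) * Var i = Const (of_int (a j')) * (Const (of_int (slope i)) * Var i)"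
      by (simp only: Const_mult mult.assoc)
  qed
  ultimately show ?thesis by (intro exI[of _ "of_int (a j')"]) simp
qed

text \<open>The cocharacter scales the coordinate by \<open>z ^ nat D\<close> with
  \<open>D > 0\<close>, so every point of the orbit tends to the end with parameter 0 and not to the
  other one.\<close>

lemma line_directed:
  assumes D: "D > 0" "\<And>q. q \<in> A \<Longrightarrow> wt (bv (\<tau> q)) = wt (bv q) + D"
    and act: "\<And>z N. z \<noteq> 0 \<Longrightarrow> N \<in> quiver_Gr M e \<Longrightarrow> act M (chi z) N = grading_act M wt z N"
  shows "directed_edge M e chi E x y \<longleftrightarrow> x = pt (K \<union> A) \<and> y = pt (K \<union> \<tau> ` A)"
proof -
  have ac: "act M (chi z) (L c) = L (z ^ nat D * c)" if "z \<noteq> 0" for z c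
  proof -
    have "grading_act M wt z (L c) = L (z powi D * c)"
      unfolding grading_act_def using D(2) that by (intro diag_line) (simp_all add: power_int_add mult.commute)
    then show ?thesis using act[OF that line_Gr] D(1) by (simp add: power_int_def)
  qed
  have lim0: "((\<lambda>z. z ^ nat D * c) \<longlongrightarrow> 0) (at 0)" for c :: complex
  proof -
    have "((\<lambda>z::complex. z ^ nat D * c) \<longlongrightarrow> 0 ^ nat D * c) (at 0)" by (intro tendsto_intros)
    then show ?thesis using D(1) by (simp add: zero_power)
  qed
  have ev: "limitin (Gr_topology M e) (\<lambda>z. act M (chi z) (L c)) u (at 0) \<longleftrightarrow>
     limitin (Gr_topology M e) (\<lambda>z. L (z ^ nat D * c)) u (at 0)" for c u
  proof -
    have "\<forall>\<^sub>F z in at 0. act M (chi z) (L c) = L (z ^ nat D * c)"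
      unfolding eventually_at_filter using ac by auto
    then show ?thesis using limitin_transform_eventually eventually_mono by (smt (verit, best))
  qed
  have 1: "limitin (Gr_topology M e) (\<lambda>z. act M (chi z) p) (pt (K \<union> A)) (at 0)" if "p \<in> E" for p
    using that limit_line[OF lim0] ev by auto
  have "L 1 \<in> E" by auto
  moreover have "\<not> limitin (Gr_topology M e) (\<lambda>z. act M (chi z) (L 1)) (pt (K \<union> \<tau> ` A)) (at 0)"
    unfolding ev by (rule not_limit_line[OF lim0]) simp
  ultimately show ?thesis
    using 1 line_in_edges line_endpoints endpoints_distinct unfolding directed_edge_def by auto
qed

end

subsection \<open>Classification of the one-dimensional orbits\<close>

context decomposed_rep
begin

lemma cf_vertex: "N \<in> quiver_Gr M e \<Longrightarrow> i < n \<Longrightarrow> x \<in> N i \<Longrightarrow> q \<in> B \<Longrightarrow> cf x q \<noteq> 0 \<Longrightarrow> vt q = i"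
  using GrD(2)[of N e i] by (auto simp: space_eq)

text \<open>The arrows shift the leading term of \<open>y\<close> along the string, so that downward induction first gives
  all later basis vectors, which are then subtracted from \<open>y\<close>.\<close>

lemma leading_vector:
  assumes N: "N \<in> quiver_Gr M e"
  shows "i < n \<Longrightarrow> y \<in> N i \<Longrightarrow> (j, p) \<in> B \<Longrightarrow> cf y (j, p) \<noteq> 0 \<Longrightarrow>
    (\<And>q. q \<in> B \<Longrightarrow> cf y q \<noteq> 0 \<Longrightarrow> fst q = j \<and> p \<le> snd q) \<Longrightarrow> (j, p) \<in> supp N"
proof (induction "len M j - p" arbitrary: i y p rule: less_induct)
  case less
  note sub = GrD(1)[OF N less.prems(1)]
  have vp: "vt (j, p) = i" using cf_vertex[OF N less.prems(1,2,3,4)] .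
  have yT: "y \<in> TV" using GrD(5)[OF N less.prems(1,2)] .
  have nxt: "(j, Suc p) \<in> supp N" if SB: "(j, Suc p) \<in> B"
  proof (rule less.hyps)
    have ys: "y \<in> space M i" using GrD(2)[OF N less.prems(1)] less.prems(2) by auto
    show "len M j - Suc p < len M j - p" using SB by (auto simp: basis_index_iff)
    show "nxt M i < n" using nxt_less .
    show "arrow M i y \<in> N (nxt M i)" using GrD(4)[OF N less.prems(1,2)] .
    show "(j, Suc p) \<in> B" using SB .
    show "cf (arrow M i y) (j, Suc p) \<noteq> 0" using cf_arrow[OF less.prems(1) ys SB] less.prems(4) by simp
    fix q assume q: "q \<in> B" "cf (arrow M i y) q \<noteq> 0"
    obtain a b where ab: "q = (a, b)" by force
    have "b \<noteq> 0" "cf y (a, b - 1) \<noteq> 0" using cf_arrow[OF less.prems(1) ys, of a b] q ab by (auto split: if_splits)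
    moreover have "(a, b - 1) \<in> B" using q ab by (auto simp: basis_index_iff)
    ultimately show "fst q = j \<and> Suc p \<le> snd q" using less.prems(5)[of "(a, b - 1)"] ab by auto
  qed
  let ?R = "{q \<in> B. cf y q \<noteq> 0 \<and> q \<noteq> (j, p)}"
  have R: "bv q \<in> N i" if qR: "q \<in> ?R" for q
  proof -
    obtain b where b: "q = (j, b)" "p < b" using less.prems(5)[of q] qR by (cases q) auto
    have "(j, Suc p) \<in> B" using that b by (auto simp: basis_index_iff)
    moreover have "b = Suc p + (b - Suc p)" using b by simp
    ultimately have "q \<in> supp N" using supp_next'[OF N nxt, of "b - Suc p"] that b by auto
    moreover have "vt q = i" using cf_vertex[OF N less.prems(1,2)] that by auto
    ultimately show ?thesis by (simp add: supp_def)
  qed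
  have "(\<Sum>q\<in>?R. smult M (cf y q) (bv q)) \<in> N i"
    using R by (intro V.subspace_sum[OF sub] V.subspace_scale[OF sub])
  then have "y - (\<Sum>q\<in>?R. smult M (cf y q) (bv q)) \<in> N i" by (rule V.subspace_diff[OF sub less.prems(2)])
  also have "y - (\<Sum>q\<in>?R. smult M (cf y q) (bv q)) = smult M (cf y (j, p)) (bv (j, p))"
  proof -
    have "y = comb (cf y)" using comb_cf[OF yT] by simp
    also have "\<dots> = (\<Sum>q\<in>insert (j, p) ?R. smult M (cf y q) (bv q))"
      unfolding comb_def using finite_B less.prems(3) by (intro sum.mono_neutral_right) auto
    also have "\<dots> = smult M (cf y (j, p)) (bv (j, p)) + (\<Sum>q\<in>?R. smult M (cf y q) (bv q))"
      using finite_B by (subst sum.insert) auto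
    finally show ?thesis by (simp add: algebra_simps)
  qed
  finally have "smult M (inverse (cf y (j, p))) (smult M (cf y (j, p)) (bv (j, p))) \<in> N i"
    by (rule V.subspace_scale[OF sub])
  then show ?case using less.prems(3,4) vp by (simp add: supp_def)
qed

text \<open>By \<open>split\<close> every nonzero coordinate is visible in a vector of
  \<open>N\<close> supported on one string. Its leading basis vector lies in \<open>N\<close> by
  \<open>leading_vector\<close>, and the later ones follow along the arrows.\<close>

lemma single_string_coordinate:
  assumes N: "N \<in> quiver_Gr M e"
    and split: "\<And>i x q0. i < n \<Longrightarrow> x \<in> N i \<Longrightarrow> q0 \<in> B \<Longrightarrow> cf x q0 \<noteq> 0 \<Longrightarrow>
      \<exists>y\<in>N i. cf y q0 \<noteq> 0 \<and> (\<forall>q\<in>B. cf y q \<noteq> 0 \<longrightarrow> fst q = fst q0)"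
  shows "N = pt (supp N)"
proof (rule eq_pt_supp[OF N])
  fix i x q0 assume i: "i < n" "x \<in> N i" and q0: "q0 \<in> B" "vt q0 = i" "cf x q0 \<noteq> 0"
  obtain y where y: "y \<in> N i" "cf y q0 \<noteq> 0" "\<forall>q\<in>B. cf y q \<noteq> 0 \<longrightarrow> fst q = fst q0"
    using split[OF i q0(1,3)] by blast
  obtain j p0 where jp: "q0 = (j, p0)" by force
  define p where "p = (LEAST p. (j, p) \<in> B \<and> cf y (j, p) \<noteq> 0)"
  have ex: "(j, p0) \<in> B \<and> cf y (j, p0) \<noteq> 0" using q0 y jp by simp
  have p: "(j, p) \<in> B" "cf y (j, p) \<noteq> 0"
    using LeastI[of "\<lambda>p. (j, p) \<in> B \<and> cf y (j, p) \<noteq> 0", OF ex] by (simp_all add: p_def)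
  have le: "p \<le> b" if "(j, b) \<in> B" "cf y (j, b) \<noteq> 0" for b
    unfolding p_def by (rule Least_le) (use that in simp)
  have "(j, p) \<in> supp N"
  proof (rule leading_vector[OF N i(1) y(1) p])
    fix q assume q: "q \<in> B" "cf y q \<noteq> 0"
    then have "q = (j, snd q)" using y(3) jp by (cases q) auto
    then show "fst q = j \<and> p \<le> snd q" using le[of "snd q"] q by (metis fst_conv)
  qed
  moreover have "p0 = p + (p0 - p)" using le ex by simp
  ultimately have "q0 \<in> supp N" using supp_next'[OF N, of j p "p0 - p"] q0 jp by simp
  then show "bv q0 \<in> N i" using q0 by (simp add: supp_def)
qed

text \<open>\<open>SP1\<close> and \<open>SP2\<close> express that all coordinates can be separated
  except the pairs \<open>q\<close>, \<open>\<tau> q\<close>. So \<open>N\<close> is made of basis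
  vectors and of rays \<open>ray c q\<close>; since arrows carry rays to rays, all rays at indices
  outside \<open>supp N\<close> have the same slope \<open>c\<close>, and \<open>N\<close> is a
  point of a single line.\<close>

lemma nonfixed_line:
  fixes j j' m :: nat and N :: "nat \<Rightarrow> 'v set" and e :: "nat \<Rightarrow> nat"
  defines "\<tau> \<equiv> \<lambda>q::nat \<times> nat. (j', snd q + m)"
  defines "dm \<equiv> {q \<in> B. fst q = j \<and> \<tau> q \<in> B}"
  assumes N: "N \<in> quiver_Gr M e" and jj: "j \<in> {1..summands M}" "j' \<in> {1..summands M}" "j \<noteq> j'"
    and lm: "len M j' \<le> len M j + m" and vtm: "\<And>p. vt (j', p + m) = vt (j, p)"
    and SP1: "\<And>i x q. i < n \<Longrightarrow> x \<in> N i \<Longrightarrow> q \<in> B \<Longrightarrow> cf x q \<noteq> 0 \<Longrightarrow> q \<notin> dm \<Longrightarrow> q \<notin> \<tau> ` dm \<Longrightarrow> bv q \<in> N i"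
    and SP2: "\<And>i x q. i < n \<Longrightarrow> x \<in> N i \<Longrightarrow> q \<in> dm \<Longrightarrow>
      smult M (cf x q) (bv q) + smult M (cf x (\<tau> q)) (bv (\<tau> q)) \<in> N i"
    and nonfixed: "N \<noteq> pt (supp N)"
  shows "\<exists>A c. c \<noteq> 0 \<and> torus_pencil M (supp N) A \<tau> e j j' m \<and> N = line (supp N) A \<tau> c"
proof -
  have sub: "V.subspace (N i)" if "i < n" for i using GrD(1)[OF N that] .
  have dmB: "q \<in> B" "\<tau> q \<in> B" "vt (\<tau> q) = vt q" if "q \<in> dm" for q
    using that vtm[of "snd q"] by (cases q; auto simp: dm_def \<tau>_def)+
  have tau_ne: "\<tau> q \<notin> dm" for q using jj by (simp add: dm_def \<tau>_def)
  have tau_inj: "q = u" if "q \<in> dm" "u \<in> dm" "\<tau> q = \<tau> u" for q u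
    using that by (cases q; cases u) (auto simp: dm_def \<tau>_def)
  define ray where "ray c q = bv q + smult M c (bv (\<tau> q))" for c q
  have rayI: "ray (cf x (\<tau> q) / cf x q) q \<in> N i" if "i < n" "x \<in> N i" "q \<in> dm" "cf x q \<noteq> 0" for i x q
  proof -
    have "smult M (inverse (cf x q)) (smult M (cf x q) (bv q) + smult M (cf x (\<tau> q)) (bv (\<tau> q))) \<in> N i"
      by (rule V.subspace_scale[OF sub SP2]) (use that in auto)
    then show ?thesis using that(4) by (simp add: ray_def V.scale_right_distrib divide_inverse mult.commute)
  qed
  have ray_supp: "\<tau> q \<in> supp N \<longleftrightarrow> q \<in> supp N" if q: "q \<in> dm" and r: "ray c q \<in> N (vt q)" "c \<noteq> 0" for q c
  proof
    assume "\<tau> q \<in> supp N"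
    then have "bv (\<tau> q) \<in> N (vt q)" using dmB[OF q] by (simp add: supp_def)
    then have "ray c q - smult M c (bv (\<tau> q)) \<in> N (vt q)"
      by (intro V.subspace_diff[OF sub] V.subspace_scale[OF sub] r vt_less)
    then show "q \<in> supp N" using dmB[OF q] by (simp add: supp_def ray_def)
  next
    assume "q \<in> supp N"
    then have "bv q \<in> N (vt q)" by (simp add: supp_def)
    then have "smult M (inverse c) (ray c q - bv q) \<in> N (vt q)"
      by (intro V.subspace_diff[OF sub] V.subspace_scale[OF sub] r vt_less)
    then show "\<tau> q \<in> supp N" using dmB[OF q] r by (simp add: supp_def ray_def)
  qed
  have tau_coord: "\<tau> q \<in> supp N" if i: "i < n" "x \<in> N i" and q: "q \<in> dm" and x: "cf x (\<tau> q) \<noteq> 0" and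
    alt: "cf x q \<noteq> 0 \<longrightarrow> q \<in> supp N" for i x q
  proof (cases "cf x q = 0")
    case True
    have vi: "vt (\<tau> q) = i" using cf_vertex[OF N i dmB(2)[OF q] x] .
    have "smult M (inverse (cf x (\<tau> q))) (smult M (cf x q) (bv q) + smult M (cf x (\<tau> q)) (bv (\<tau> q))) \<in> N i"
      by (rule V.subspace_scale[OF sub SP2]) (use i q in auto)
    then show ?thesis using True x vi dmB(2)[OF q] by (simp add: supp_def)
  next
    case False
    have "vt q = i" using cf_vertex[OF N i dmB(1)[OF q] False] .
    then show ?thesis using ray_supp[OF q] rayI[OF i q False] alt False x by auto
  qed
  have "\<exists>q c. q \<in> dm \<and> q \<notin> supp N \<and> c \<noteq> 0 \<and> ray c q \<in> N (vt q)"
  proof (rule ccontr)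
    assume no: "\<not> ?thesis"
    have dm_case: "q \<in> supp N" if i: "i < n" "x \<in> N i" and q: "q \<in> dm" "cf x q \<noteq> 0" for i x q
    proof (cases "cf x (\<tau> q) = 0")
      case True
      have "vt q = i" using cf_vertex[OF N i dmB(1)[OF q(1)] q(2)] .
      then show ?thesis using rayI[OF i q] True dmB(1)[OF q(1)] by (simp add: ray_def supp_def)
    next
      case False
      have "vt q = i" using cf_vertex[OF N i dmB(1)[OF q(1)] q(2)] .
      then have "ray (cf x (\<tau> q) / cf x q) q \<in> N (vt q)" "cf x (\<tau> q) / cf x q \<noteq> 0"
        using rayI[OF i q] False q(2) by simp_all
      then show ?thesis using no q(1) by blast
    qed
    have "N = pt (supp N)"
    proof (rule eq_pt_supp[OF N])
      fix i x q assume i: "i < n" "x \<in> N i" and q: "q \<in> B" "vt q = i" "cf x q \<noteq> 0"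
      consider "q \<in> dm" | u where "u \<in> dm" "q = \<tau> u" | "q \<notin> dm" "q \<notin> \<tau> ` dm" by blast
      then show "bv q \<in> N i"
      proof cases
        case 1
        then show ?thesis using dm_case[OF i 1 q(3)] q by (simp add: supp_def)
      next
        case 2
        then show ?thesis using tau_coord[OF i 2(1)] dm_case[OF i 2(1)] q by (auto simp: supp_def)
      next
        case 3
        then show ?thesis using SP1[OF i q(1,3)] by simp
      qed
    qed
    then show False using nonfixed by simp
  qed
  then obtain q0 c where q0: "q0 \<in> dm" "q0 \<notin> supp N" and c: "c \<noteq> 0" "ray c q0 \<in> N (vt q0)" by blast
  have arrow_ray: "arrow M (vt (j, p)) (ray c' (j, p)) =
      (if (j, Suc p) \<in> B then bv (j, Suc p) else 0) + smult M c' (if (j', Suc (p + m)) \<in> B then bv (j', Suc (p + m)) else 0)"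
    if dmp: "(j, p) \<in> dm" for p c'
  proof -
    let ?i = "vt (j, p)"
    have i: "?i < n" using vt_less .
    have B2: "(j, p) \<in> B" "(j', p + m) \<in> B" using dmB[OF dmp] by (simp_all add: \<tau>_def)
    have sp: "bv (j, p) \<in> space M ?i" "bv (j', p + m) \<in> space M ?i"
      using bv_space[OF B2(1)] bv_space[OF B2(2)] vtm by simp_all
    then show ?thesis
      using V.subspace_scale[OF space_subspace[OF i] sp(2)] arrow_bv[OF B2(1)] arrow_bv[OF B2(2)] vtm[of p]
      by (simp add: ray_def \<tau>_def arrow_add[OF i] arrow_scale[OF i])
  qed
  have ray_step: "ray c' (j, Suc p) \<in> N (vt (j, Suc p))"
    if "(j, p) \<in> dm" "(j, Suc p) \<in> dm" "ray c' (j, p) \<in> N (vt (j, p))" for p c'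
    using GrD(4)[OF N vt_less that(3)] arrow_ray[OF that(1)] dmB(1,2)[OF that(2)]
    by (simp add: vt_Suc ray_def \<tau>_def)
  have ray_steps: "(j, p + t) \<in> dm \<Longrightarrow> ray c' (j, p + t) \<in> N (vt (j, p + t))"
    if "(j, p) \<in> dm" "ray c' (j, p) \<in> N (vt (j, p))" for p c' t
  proof (induction t)
    case (Suc t)
    have "(j, p + t) \<in> dm" using Suc.prems by (auto simp: dm_def \<tau>_def basis_index_iff)
    then show ?case using ray_step[of "p + t" c'] Suc by simp
  qed (use that in simp)
  \<comment> \<open>Two rays of different slopes at the same index would put first
    \<open>bv (\<tau> ?q)\<close> and then \<open>bv ?q\<close> into \<open>N\<close>.\<close>
  have unique: "c1 = c2" if q: "(j, p) \<in> dm" "(j, p + t) \<in> dm" "(j, p + t) \<notin> supp N"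
    and r: "ray c1 (j, p) \<in> N (vt (j, p))" "ray c2 (j, p + t) \<in> N (vt (j, p + t))" "c1 \<noteq> 0 \<or> c2 \<noteq> 0" for p t c1 c2
  proof (rule ccontr)
    assume ne: "c1 \<noteq> c2"
    let ?q = "(j, p + t)"
    have c2: "c2 \<noteq> 0"
    proof
      assume "c2 = 0"
      then have "bv ?q \<in> N (vt ?q)" using r(2) by (simp add: ray_def)
      then show False using q(3) dmB(1)[OF q(2)] by (simp add: supp_def)
    qed
    have "ray c1 ?q \<in> N (vt ?q)" using ray_steps[OF q(1) r(1) q(2)] .
    then have "smult M (inverse (c1 - c2)) (ray c1 ?q - ray c2 ?q) \<in> N (vt ?q)"
      by (intro V.subspace_diff[OF sub] V.subspace_scale[OF sub] r vt_less)
    also have "ray c1 ?q - ray c2 ?q = smult M (c1 - c2) (bv (\<tau> ?q))"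
      by (simp add: ray_def V.scale_left_diff_distrib)
    finally have "\<tau> ?q \<in> supp N" using ne dmB[OF q(2)] by (simp add: supp_def)
    then show False using ray_supp[OF q(2) r(2) c2] q(3) by simp
  qed
  have same: "c' = c" if q: "q \<in> dm" "q \<notin> supp N" and r: "ray c' q \<in> N (vt q)" for q c'
  proof -
    obtain p where p: "q = (j, p)" using q by (cases q) (auto simp: dm_def)
    obtain b where b: "q0 = (j, b)" using q0 by (cases q0) (auto simp: dm_def)
    show ?thesis
    proof (cases "p \<le> b")
      case True
      then show ?thesis using unique[of p "b - p" c' c] q r q0 c p b by simp
    next
      case False
      then show ?thesis using unique[of b "p - b" c c'] q r q0 c p b by simp
    qed
  qed
  define A where "A = {q \<in> dm. q \<notin> supp N \<and> ray c q \<in> N (vt q)}"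
  have AD: "q \<in> dm" "q \<notin> supp N" "ray c q \<in> N (vt q)" "\<tau> q \<notin> supp N" if "q \<in> A" for q
    using that ray_supp[of q c] c by (auto simp: A_def)
  have data: "pencil_data M (supp N) A \<tau>"
  proof (unfold_locales)
    show "supp N \<subseteq> B" by (auto simp: supp_def)
    show "A \<subseteq> B" "\<tau> ` A \<subseteq> B" using dmB AD by blast+
    show "supp N \<inter> A = {}" using AD by blast
    show "\<tau> ` A \<inter> (supp N \<union> A) = {}" using AD tau_ne by blast
    show "inj_on \<tau> A" by (rule inj_onI) (rule tau_inj[OF AD(1) AD(1)])
    show "vt (\<tau> q) = vt q" if "q \<in> A" for q using dmB AD that by blast
    have "q0 \<in> A" using q0 c by (simp add: A_def)
    then show "A \<noteq> {}" by blast
    show "(j, p) \<in> supp N \<Longrightarrow> (j, Suc p) \<in> B \<Longrightarrow> (j, Suc p) \<in> supp N" for j p using supp_next[OF N] .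
    fix a p a' p' assume a: "(a, p) \<in> A" "\<tau> (a, p) = (a', p')"
    have eqs: "a = j" "a' = j'" "p' = p + m" using a AD(1)[OF a(1)] by (auto simp: dm_def \<tau>_def)
    have dmp: "(j, p) \<in> dm" "ray c (j, p) \<in> N (vt (j, p))" using AD a eqs by auto
    have ar: "(if (j, Suc p) \<in> B then bv (j, Suc p) else 0) + smult M c (if (j', Suc (p + m)) \<in> B then bv (j', Suc (p + m)) else 0)
       \<in> N (vt (j, Suc p))"
      using GrD(4)[OF N vt_less dmp(2)] arrow_ray[OF dmp(1), of c] by (simp add: vt_Suc)
    show "(a, Suc p) \<in> A \<and> \<tau> (a, Suc p) = (a', Suc p') \<or>
      ((a, Suc p) \<in> B \<longrightarrow> (a, Suc p) \<in> supp N) \<and> ((a', Suc p') \<in> B \<longrightarrow> (a', Suc p') \<in> supp N)"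
    proof (cases "(j', Suc (p + m)) \<in> B")
      case True
      \<comment> \<open>By \<open>lm\<close> summand \<open>j'\<close> does not outlast summand
        \<open>j\<close>, so the successor on \<open>j\<close> exists as well.\<close>
      then have "(j, Suc p) \<in> B" using lm jj by (auto simp: basis_index_iff)
      then have d: "(j, Suc p) \<in> dm" and r: "ray c (j, Suc p) \<in> N (vt (j, Suc p))"
        using True ar by (auto simp: dm_def \<tau>_def ray_def)
      show ?thesis
      proof (cases "(j, Suc p) \<in> supp N")
        case True
        then have "(j', Suc (p + m)) \<in> supp N" using ray_supp[OF d r c(1)] by (simp add: \<tau>_def)
        then show ?thesis using True eqs by simp
      next
        case False
        then show ?thesis using d r eqs by (simp add: A_def \<tau>_def)
      qed
    next
      case False
      then show ?thesis using ar eqs by (auto simp: supp_def)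
    qed
  qed
  interpret pd: pencil_data M "supp N" A \<tau> by (rule data)
  have Neq: "N i = line (supp N) A \<tau> c i" if i: "i < n" for i
  proof
    have "pd.gen c q \<in> N i" if q: "q \<in> pd.S i" for q
    proof (cases "q \<in> A")
      case True
      then have "pd.gen c q = ray c q" by (simp add: pd.gen_def ray_def)
      then show ?thesis using AD(3)[OF True] q by simp
    next
      case False
      then have "pd.gen c q = bv q" "q \<in> supp N" using q by (simp_all add: pd.gen_def)
      then show ?thesis using q by (simp add: supp_def)
    qed
    then show "line (supp N) A \<tau> c i \<subseteq> N i"
      unfolding pd.line_span[OF i] by (intro V.span_minimal sub i) blast
    show "N i \<subseteq> line (supp N) A \<tau> c i"
    proof
      fix x assume x: "x \<in> N i"
      have xT: "x \<in> TV" using GrD(5)[OF N i x] .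
      have dm_case: "q \<in> supp N \<union> A" "q \<notin> supp N \<Longrightarrow> cf x (\<tau> q) = c * cf x q" if q: "q \<in> dm" "cf x q \<noteq> 0" for q
      proof -
        have vq: "vt q = i" using cf_vertex[OF N i x dmB(1)[OF q(1)] q(2)] .
        have r: "ray (cf x (\<tau> q) / cf x q) q \<in> N (vt q)" using rayI[OF i x q] vq by simp
        have "cf x (\<tau> q) / cf x q = c" if "q \<notin> supp N" using same[OF q(1) that r] .
        then show "q \<in> supp N \<union> A" "q \<notin> supp N \<Longrightarrow> cf x (\<tau> q) = c * cf x q"
          using r q by (auto simp: A_def field_simps)
      qed
      have "cf x q = 0" if q: "q \<in> B" "vt q \<noteq> i \<or> q \<notin> supp N \<union> A \<union> \<tau> ` A" for q
      proof (rule ccontr)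
        assume xq: "cf x q \<noteq> 0"
        have vq: "vt q = i" using cf_vertex[OF N i x q(1) xq] .
        consider "q \<in> dm" | u where "u \<in> dm" "q = \<tau> u" | "q \<notin> dm" "q \<notin> \<tau> ` dm" by blast
        then have "q \<in> supp N \<union> A \<union> \<tau> ` A"
        proof cases
          case 1
          then show ?thesis using dm_case(1)[OF 1 xq] by auto
        next
          case 2
          show ?thesis
          proof (cases "cf x u \<noteq> 0 \<and> u \<notin> supp N")
            case True
            then have "u \<in> A" using dm_case(1)[OF 2(1)] by auto
            then show ?thesis using 2 by auto
          next
            case False
            then show ?thesis using tau_coord[OF i x 2(1)] xq 2 by auto
          qed
        next
          case 3
          then show ?thesis using SP1[OF i x q(1) xq] q(1) vq by (simp add: supp_def)
        qed
        then show False using q vq by auto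
      qed
      moreover have "cf x (\<tau> q) = c * cf x q" if q: "q \<in> A" for q
      proof (cases "cf x q = 0")
        case True
        have "cf x (\<tau> q) = 0"
        proof (rule ccontr)
          assume "cf x (\<tau> q) \<noteq> 0"
          then show False using tau_coord[OF i x AD(1)[OF q]] True AD(4)[OF q] by simp
        qed
        then show ?thesis using True by simp
      next
        case False
        then show ?thesis using dm_case(2)[OF AD(1)[OF q] False AD(2)[OF q]] by simp
      qed
      ultimately show "x \<in> line (supp N) A \<tau> c i" using xT i by (simp add: line_def)
    qed
  qed
  have "N = line (supp N) A \<tau> c"
  proof
    fix i show "N i = line (supp N) A \<tau> c i"
      using Neq N by (cases "i < n") (auto simp: quiver_Gr_def PiE_iff extensional_def line_def)
  qed
  moreover have "torus_pencil M (supp N) A \<tau> e j j' m"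
  proof (unfold_locales)
    show "card {q \<in> supp N \<union> A. vt q = i} = e i" if i: "i < n" for i
      using pd.gen_indep(3)[OF i, of c] GrD(3)[OF N i] Neq[OF i] pd.line_span[OF i, of c] by simp
    show "j \<in> {1..summands M}" "j' \<in> {1..summands M}" "j \<noteq> j'" using jj by auto
    show "fst q = j" if "q \<in> A" for q using AD(1)[OF that] by (simp add: dm_def)
    show "\<tau> q = (j', snd q + m)" for q by (simp add: \<tau>_def)
  qed
  ultimately show ?thesis using c(1) by blast
qed

end

section \<open>The moment graph in terms of periodic words\<close>

locale string_rep = decomposed_rep M for M :: "'v::ab_group_add based_rep" +
  fixes wt :: "'v \<Rightarrow> int" and om :: int and lo hi :: "int \<Rightarrow> int" and pos :: "nat \<Rightarrow> int"
  assumes strings: "string_structure M wt om lo hi pos"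
begin

lemma om_ge_1: "om \<ge> 1"
  and lo_anti: "P \<le> Q \<Longrightarrow> lo Q \<le> lo P" and hi_anti: "P \<le> Q \<Longrightarrow> hi Q \<le> hi P"
  and lo_hi: "lo P \<le> hi P"
  and lo_om: "lo (P + om) = lo P - int n" and hi_om: "hi (P + om) = hi P - int n"
  and lo_pos: "j \<in> {1..summands M} \<Longrightarrow> lo (pos j) = int (start M j)"
  and hi_pos: "j \<in> {1..summands M} \<Longrightarrow> hi (pos j) = int (start M j) + int (len M j)"
  and active_ex: "lo P < hi P \<Longrightarrow> \<exists>j\<in>{1..summands M}. om dvd P - pos j"
  and pos_unique: "j \<in> {1..summands M} \<Longrightarrow> j' \<in> {1..summands M} \<Longrightarrow> om dvd pos j - pos j' \<Longrightarrow> j = j'"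
  and wt_diff: "j \<in> {1..summands M} \<Longrightarrow> j' \<in> {1..summands M} \<Longrightarrow> pos j < pos j' + om * r \<Longrightarrow>
      \<exists>D>0. \<forall>p p'. p < len M j \<longrightarrow> p' < len M j' \<longrightarrow>
        int (start M j) + int p = int (start M j') - int n * r + int p' \<longrightarrow>
        wt (bas M j' p') - wt (bas M j p) = D"
proof -
  note c1 = strings[unfolded string_structure_def]
  note c2 = conjunct2[OF c1] note c3 = conjunct2[OF c2] note c4 = conjunct2[OF c3]
  note c5 = conjunct2[OF c4] note c6 = conjunct2[OF c5] note c7 = conjunct2[OF c6]
  show "om \<ge> 1" by (rule conjunct1[OF c1])
  show "P \<le> Q \<Longrightarrow> lo Q \<le> lo P" "P \<le> Q \<Longrightarrow> hi Q \<le> hi P" by (simp_all add: conjunct1[OF c2, rule_format])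
  show "lo P \<le> hi P" by (rule conjunct1[OF c3, rule_format])
  show "lo (P + om) = lo P - int n" "hi (P + om) = hi P - int n" by (simp_all add: conjunct1[OF c4, rule_format])
  show "j \<in> {1..summands M} \<Longrightarrow> lo (pos j) = int (start M j)"
    "j \<in> {1..summands M} \<Longrightarrow> hi (pos j) = int (start M j) + int (len M j)" by (simp_all add: conjunct1[OF c5, rule_format])
  show "lo P < hi P \<Longrightarrow> \<exists>j\<in>{1..summands M}. om dvd P - pos j" by (rule conjunct1[OF c6, rule_format])
  show "j \<in> {1..summands M} \<Longrightarrow> j' \<in> {1..summands M} \<Longrightarrow> om dvd pos j - pos j' \<Longrightarrow> j = j'"
    by (rule conjunct1[OF c7, rule_format])
  show "\<exists>D>0. \<forall>p p'. p < len M j \<longrightarrow> p' < len M j' \<longrightarrow>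
        int (start M j) + int p = int (start M j') - int n * r + int p' \<longrightarrow>
        wt (bas M j' p') - wt (bas M j p) = D"
    if "j \<in> {1..summands M}" "j' \<in> {1..summands M}" "pos j < pos j' + om * r"
    by (rule conjunct2[OF c7, rule_format, OF that])
qed

lemma lo_shift: "lo (P + om * k) = lo P - int n * k" using period_mult[of lo om "- int n" P k] by (simp add: lo_om)
lemma hi_shift: "hi (P + om * k) = hi P - int n * k" using period_mult[of hi om "- int n" P k] by (simp add: hi_om)

abbreviation "active P \<equiv> lo P < hi P"

definition str :: "int \<Rightarrow> nat" where
  "str P = (SOME j. j \<in> {1..summands M} \<and> om dvd P - pos j)"

lemma str: "active P \<Longrightarrow> str P \<in> {1..summands M}" "active P \<Longrightarrow> om dvd P - pos (str P)"
  using someI_ex[of "\<lambda>j. j \<in> {1..summands M} \<and> om dvd P - pos j"] active_ex[of P]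
  unfolding str_def by blast+

lemma str_obtain:
  assumes "active P"
  obtains k where "P = pos (str P) + om * k" "lo P = int (start M (str P)) - int n * k"
    "hi P = lo P + int (len M (str P))"
proof -
  obtain k where "P - pos (str P) = om * k" using str(2)[OF assms] by (rule dvdE)
  then have k: "P = pos (str P) + om * k" by simp
  have "lo P = int (start M (str P)) - int n * k"
    by (subst k) (simp add: lo_shift lo_pos[OF str(1)[OF assms]])
  moreover have "hi P = int (start M (str P)) + int (len M (str P)) - int n * k"
    by (subst k) (simp add: hi_shift hi_pos[OF str(1)[OF assms]])
  ultimately show ?thesis using that k by simp
qed

lemma str_eqI:
  assumes j: "j \<in> {1..summands M}" and d: "P = pos j + om * k"
  shows "active P" "str P = j" "lo P = int (start M j) - int n * k"
proof -
  show "lo P = int (start M j) - int n * k" by (simp add: d lo_shift lo_pos[OF j])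
  show a: "active P" using len_pos[of j] j by (simp add: d lo_shift hi_shift lo_pos[OF j] hi_pos[OF j])
  obtain k' where "P = pos (str P) + om * k'" using str_obtain[OF a] .
  then have "pos j - pos (str P) = om * (k' - k)" using d by (simp add: right_diff_distrib)
  then show "str P = j" using pos_unique[OF j str(1)[OF a]] by simp
qed

lemma active_shift: "active (P + om * k) \<longleftrightarrow> active P" by (simp add: lo_shift hi_shift)

lemma str_shift: "active P \<Longrightarrow> str (P + om * k) = str P"
proof -
  assume a: "active P"
  obtain l where "P = pos (str P) + om * l" using str_obtain[OF a] .
  then have "P + om * k = pos (str P) + om * (l + k)" by (simp add: distrib_left)
  from str_eqI(2)[OF str(1)[OF a] this] show ?thesis .
qed

lemma vt_str: assumes "active P" shows "vt (str P, p) = nat ((lo P + int p) mod int n)"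
proof -
  obtain k where "lo P = int (start M (str P)) - int n * k" using str_obtain[OF assms] .
  then have "lo P + int p = int (start M (str P) + p) + int n * (- k)" by simp
  then have "(lo P + int p) mod int n = int (start M (str P) + p) mod int n" by (metis mod_mult_self2)
  then show ?thesis by (simp add: basis_vertex_def nat_mod_as_int)
qed

lemma len_str: assumes "active P" shows "hi P = lo P + int (len M (str P))"
  using str_obtain[OF assms] by metis

lemma B_str: "active P \<Longrightarrow> (str P, p) \<in> B \<longleftrightarrow> lo P + int p < hi P"
  using str(1)[of P] len_str[of P] by (auto simp: basis_index_iff)

text \<open>Strings without basis vectors receive variables beyond those of the torus.\<close>

definition w :: "int \<Rightarrow> nat" where
  "w P = (if active P then str P else summands M + 1 + nat (P mod om))"

sublocale W: periodic_words om "int n" w "\<lambda>P. - lo P"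
proof
  show "om \<ge> 1" using om_ge_1 .
  show "int n \<ge> 1" using n_pos by simp
  show "- lo (P + om) = - lo P + int n" for P by (simp add: lo_om)
  show "w P \<ge> 1" for P using str(1)[of P] by (auto simp: w_def)
  show "w P = w Q \<longleftrightarrow> om dvd P - Q" for P Q
  proof
    assume "om dvd P - Q"
    then obtain k where "P - Q = om * k" by (rule dvdE)
    then have "P = Q + om * k" by simp
    then show "w P = w Q" by (simp add: w_def active_shift str_shift)
  next
    assume w: "w P = w Q"
    show "om dvd P - Q"
    proof (cases "active P")
      case True
      then have Q: "active Q" using w str(1)[OF True] by (auto simp: w_def split: if_splits)
      have "om dvd (P - pos (str P)) - (Q - pos (str Q))" by (rule dvd_diff[OF str(2)[OF True] str(2)[OF Q]])
      then show ?thesis using w True Q by (simp add: w_def)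
    next
      case False
      then have Q: "\<not> active Q" using w str(1)[of Q] by (auto simp: w_def split: if_splits)
      then have "nat (P mod om) = nat (Q mod om)" using w False by (simp add: w_def)
      moreover have "P mod om \<ge> 0" "Q mod om \<ge> 0" using om_ge_1 by simp_all
      ultimately have "P mod om = Q mod om" by linarith
      then show ?thesis by (simp add: mod_eq_dvd_iff)
    qed
  qed
qed

section \<open>Fixed points as periodic words\<close>

definition cut :: "(nat \<Rightarrow> 'v set) \<Rightarrow> nat \<Rightarrow> nat" where
  "cut N j = card {p. p < len M j \<and> (j, p) \<notin> supp N}"

lemma down_closed_nat:
  assumes "finite X" "\<And>a b. b \<in> X \<Longrightarrow> a \<le> b \<Longrightarrow> a \<in> X"
  shows "X = {..<card X}"
proof (cases "X = {}")
  case False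
  define k where "k = Max X"
  have "X = {..k}" using assms(2)[OF Max_in[OF assms(1) False]] Max_ge[OF assms(1)] by (auto simp: k_def)
  then show ?thesis by (metis card_atMost lessThan_Suc_atMost)
qed simp

text \<open>A subrepresentation is closed under successors, so it contains a final segment of the
  basis vectors of each summand.\<close>

lemma supp_cut:
  assumes N: "N \<in> quiver_Gr M e" and j: "j \<in> {1..summands M}"
  shows "(j, p) \<in> supp N \<longleftrightarrow> cut N j \<le> p \<and> p < len M j"
proof -
  let ?X = "{p. p < len M j \<and> (j, p) \<notin> supp N}"
  have "a \<in> ?X" if "b \<in> ?X" "a \<le> b" for a b
    using supp_next'[OF N, of j a "b - a"] that j by (auto simp: basis_index_iff)
  then have X: "?X = {..<cut N j}" unfolding cut_def by (intro down_closed_nat) auto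
  have "p < len M j" if "(j, p) \<in> supp N" using that by (simp add: supp_def basis_index_iff)
  moreover have "p \<in> ?X \<longleftrightarrow> p < cut N j" unfolding X by simp
  ultimately show ?thesis by auto
qed

lemma cut_le: "cut N j \<le> len M j"
proof -
  have "cut N j \<le> card {..<len M j}" unfolding cut_def by (rule card_mono) auto
  then show ?thesis by simp
qed

lemma cut_eqI:
  assumes "k \<le> len M j" "\<And>p. p < len M j \<Longrightarrow> (j, p) \<in> supp N \<longleftrightarrow> k \<le> p"
  shows "cut N j = k"
proof -
  have "{p. p < len M j \<and> (j, p) \<notin> supp N} = {..<k}" using assms by auto
  then show ?thesis by (simp add: cut_def)
qed

text \<open>In the fixed point \<open>N\<close> string \<open>P\<close> starts at the vertex \<open>H N P\<close> of the universal cover.  Residues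
  modulo \<open>om\<close> that carry no basis vector (\<open>lo P = hi P\<close>) are kept as constant dummy entries.\<close>

definition H :: "(nat \<Rightarrow> 'v set) \<Rightarrow> int \<Rightarrow> int" where
  "H N P = (if active P then lo P + int (cut N (str P)) else lo P)"

lemma H_C: "H N \<in> W.C"
  using lo_om active_shift[of _ 1] str_shift[of _ 1] by (auto simp: W.C_def H_def)

lemma H_shift: "H N (P + om * k) = H N P - int n * k" using W.C_shift[OF H_C] .

lemma H_bounds: "lo P \<le> H N P" "H N P \<le> hi P"
  using cut_le[of N "str P"] len_str[of P] lo_hi[of P] by (auto simp: H_def)

lemma H_inj:
  assumes "N \<in> fixed_points M e" "N' \<in> fixed_points M e" "H N = H N'"
  shows "N = N'"
proof -
  have Gr: "N \<in> quiver_Gr M e" "N' \<in> quiver_Gr M e" and eq: "N = pt (supp N)" "N' = pt (supp N')"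
    using assms fixed_iff by auto
  have "cut N j = cut N' j" if j: "j \<in> {1..summands M}" for j
    using fun_cong[OF assms(3), of "pos j"] str_eqI(1,2)[OF j, of "pos j" 0] by (simp add: H_def)
  then have "(j, p) \<in> supp N \<longleftrightarrow> (j, p) \<in> supp N'" for j p
  proof (cases "j \<in> {1..summands M}")
    case True
    then show ?thesis using supp_cut[OF Gr(1) True] supp_cut[OF Gr(2) True] \<open>\<And>j. j \<in> _ \<Longrightarrow> _\<close> by simp
  next
    case False
    then show ?thesis by (auto simp: supp_def basis_index_iff)
  qed
  then have "supp N = supp N'" by auto
  then show ?thesis using eq by simp
qed

text \<open>\<open>lo Q \<le> lo P \<le> H N P < H N Q \<le> hi Q \<le> hi P\<close>, so both
  strings are nonempty and the vertices from \<open>H N P\<close> to before \<open>H N Q\<close> lie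
  on both of them.\<close>

lemma Inv_active:
  assumes "(P, Q) \<in> W.Inv (H N)"
  shows "active P" "active Q" "str P \<noteq> str Q" "P < Q" "H N P < H N Q"
proof -
  have PQ: "P < Q" "H N P < H N Q" "\<not> om dvd P - Q" using assms by (auto simp: W.Inv_def W.Phi_def)
  show "P < Q" "H N P < H N Q" using PQ by auto
  have le: "lo Q \<le> lo P" "hi Q \<le> hi P" using lo_anti hi_anti PQ(1) by auto
  show a: "active P" "active Q"
    using H_bounds[where P=P and N=N] H_bounds[where P=Q and N=N] le PQ(2) by linarith+
  show "str P \<noteq> str Q" using W.w_iff[of P Q] PQ(3) a by (simp add: w_def)
qed

text \<open>The edge at \<open>N\<close> given by an inversion \<open>(P, Q)\<close> of its word: \<open>AA\<close> is the part of string \<open>P\<close>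
  that is moved to string \<open>Q\<close> by \<open>tau\<close>, and \<open>KK\<close> is the rest of \<open>N\<close>.\<close>

definition mm :: "int \<times> int \<Rightarrow> nat" where "mm \<beta> = nat (lo (fst \<beta>) - lo (snd \<beta>))"

definition tau :: "int \<times> int \<Rightarrow> nat \<times> nat \<Rightarrow> nat \<times> nat" where
  "tau \<beta> q = (str (snd \<beta>), snd q + mm \<beta>)"

definition AA :: "(nat \<Rightarrow> 'v set) \<Rightarrow> int \<times> int \<Rightarrow> (nat \<times> nat) set" where
  "AA N \<beta> = {q \<in> B. fst q = str (fst \<beta>) \<and> cut N (str (fst \<beta>)) \<le> snd q \<and> lo (fst \<beta>) + int (snd q) < H N (snd \<beta>)}"

definition KK :: "(nat \<Rightarrow> 'v set) \<Rightarrow> int \<times> int \<Rightarrow> (nat \<times> nat) set" where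
  "KK N \<beta> = supp N - AA N \<beta>"

definition EL :: "(nat \<Rightarrow> 'v set) \<Rightarrow> int \<times> int \<Rightarrow> (nat \<Rightarrow> 'v set) set" where
  "EL N \<beta> = line (KK N \<beta>) (AA N \<beta>) (tau \<beta>) ` (- {0})"

context
  fixes N :: "nat \<Rightarrow> 'v set" and e :: "nat \<Rightarrow> nat" and P Q :: int
  assumes N: "N \<in> fixed_points M e" and inv: "(P, Q) \<in> W.Inv (H N)"
begin

lemma N_Gr: "N \<in> quiver_Gr M e" and N_pt: "N = pt (supp N)" using N fixed_iff by auto

lemma act_PQ: "active P" "active Q" and str_ne: "str P \<noteq> str Q" and less_PQ: "P < Q"
  using Inv_active[OF inv] by auto

lemma mm_eq: "int (mm (P, Q)) = lo P - lo Q"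
  using lo_anti[of P Q] less_PQ by (simp add: mm_def)

lemma hi_PQ: "hi Q \<le> hi P" using hi_anti less_PQ by auto

lemma H_P: "H N P = lo P + int (cut N (str P))" and H_Q: "H N Q = lo Q + int (cut N (str Q))"
  using act_PQ by (simp_all add: H_def)

lemma AA_iff: "(a, p) \<in> AA N (P, Q) \<longleftrightarrow> a = str P \<and> cut N (str P) \<le> p \<and> p + mm (P, Q) < cut N (str Q)"
proof -
  have "(str P, p) \<in> B" if "p + mm (P, Q) < cut N (str Q)"
  proof -
    have "lo P + int p < H N Q" using that mm_eq H_Q by linarith
    then show ?thesis using B_str[OF act_PQ(1)] H_bounds(2)[where P=Q and N=N] hi_PQ by auto
  qed
  moreover have "lo P + int p < H N Q \<longleftrightarrow> p + mm (P, Q) < cut N (str Q)" using mm_eq H_Q by linarith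
  ultimately show ?thesis by (auto simp: AA_def)
qed

lemma supp_P: "(str P, p) \<in> supp N \<longleftrightarrow> cut N (str P) \<le> p \<and> p < len M (str P)"
  and supp_Q: "(str Q, p) \<in> supp N \<longleftrightarrow> cut N (str Q) \<le> p \<and> p < len M (str Q)"
  using supp_cut[OF N_Gr str(1)] act_PQ by auto

lemma AA_B: "q \<in> AA N (P, Q) \<Longrightarrow> q \<in> B" by (simp add: AA_def)

lemma AA_supp: "AA N (P, Q) \<subseteq> supp N"
proof
  fix q assume q: "q \<in> AA N (P, Q)"
  obtain a p where ap: "q = (a, p)" by force
  then show "q \<in> supp N" using q AA_B[OF q] AA_iff[of a p] supp_P[of p] by (auto simp: basis_index_iff)
qed

lemma tau_mem: assumes "(a, p) \<in> AA N (P, Q)" shows "(str Q, p + mm (P, Q)) \<in> B - supp N"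
proof -
  have "p + mm (P, Q) < cut N (str Q)" using assms AA_iff by auto
  then show ?thesis using cut_le[of N "str Q"] supp_Q str(1)[OF act_PQ(2)] by (auto simp: basis_index_iff)
qed

lemma KK_AA: "KK N (P, Q) \<union> AA N (P, Q) = supp N" using AA_supp by (auto simp: KK_def)

text \<open>The vectors of \<open>N\<close> on string \<open>P\<close> over the vertices from
  \<open>H N P\<close> to before \<open>H N Q\<close> can be replaced by those of string
  \<open>Q\<close> over the same vertices. At the vertex \<open>H N Q\<close> each of the two
  strings is in \<open>N\<close> or has ended, which is the second alternative of
  \<open>A_next\<close>.\<close>

lemma inversion_pencil:
  "torus_pencil M (KK N (P, Q)) (AA N (P, Q)) (tau (P, Q)) e (str P) (str Q) (mm (P, Q))"
proof (unfold_locales)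
  let ?K = "KK N (P, Q)" and ?A = "AA N (P, Q)" and ?\<tau> = "tau (P, Q)"
  show "?K \<subseteq> B" by (auto simp: KK_def supp_def)
  show "?A \<subseteq> B" by (auto simp: AA_def)
  show "?K \<inter> ?A = {}" by (auto simp: KK_def)
  have t: "?\<tau> q \<in> B - supp N" if "q \<in> ?A" for q
    using tau_mem[of "fst q" "snd q"] that by (simp add: tau_def)
  show "?\<tau> ` ?A \<subseteq> B" "?\<tau> ` ?A \<inter> (?K \<union> ?A) = {}" unfolding KK_AA using t by auto
  show fA: "fst q = str P" if "q \<in> ?A" for q using that by (simp add: AA_def)
  show "inj_on ?\<tau> ?A" using fA by (auto simp: inj_on_def tau_def AA_def)
  show "vt (?\<tau> q) = vt q" if "q \<in> ?A" for q
  proof -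
    have "q = (str P, snd q)" using fA[OF that] by (cases q) simp
    then have "vt q = nat ((lo P + int (snd q)) mod int n)" using vt_str[OF act_PQ(1), of "snd q"] by simp
    moreover have "vt (?\<tau> q) = nat ((lo Q + int (snd q + mm (P, Q))) mod int n)"
      using vt_str[OF act_PQ(2)] by (simp add: tau_def)
    moreover have "lo Q + int (snd q + mm (P, Q)) = lo P + int (snd q)" using mm_eq by simp
    ultimately show ?thesis by (simp only:)
  qed
  have "(str P, cut N (str P)) \<in> ?A"
    using Inv_active(5)[OF inv] mm_eq H_P H_Q by (simp add: AA_iff)
  then show "?A \<noteq> {}" by auto
  show "card {q \<in> ?K \<union> ?A. vt q = i} = e i" if "i < n" for i
  proof -
    have "pt (supp N) \<in> quiver_Gr M e" using N_Gr N_pt by simp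
    moreover have "supp N \<inter> B = supp N" by (auto simp: supp_def)
    ultimately show ?thesis using pt_dims[of "supp N" e i] that by (simp add: KK_AA)
  qed
  show "(a, Suc p) \<in> ?K" if "(a, p) \<in> ?K" "(a, Suc p) \<in> B" for a p
    using that supp_next[OF N_Gr, of a p] supp_P[of p] by (auto simp: KK_def AA_iff)
  show "(a, Suc p) \<in> ?A \<and> ?\<tau> (a, Suc p) = (a', Suc p') \<or>
      ((a, Suc p) \<in> B \<longrightarrow> (a, Suc p) \<in> ?K) \<and> ((a', Suc p') \<in> B \<longrightarrow> (a', Suc p') \<in> ?K)"
    if a: "(a, p) \<in> ?A" "?\<tau> (a, p) = (a', p')" for a p a' p'
  proof (cases "Suc p + mm (P, Q) < cut N (str Q)")
    case True
    then show ?thesis using a by (auto simp: AA_iff tau_def)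
  next
    case False
    have e: "a = str P" "a' = str Q" "p' = p + mm (P, Q)" using a by (auto simp: AA_iff tau_def)
    have "(a, p) \<in> supp N" using AA_supp a(1) by blast
    then have "(a, Suc p) \<in> B \<longrightarrow> (a, Suc p) \<in> ?K"
      using False supp_next[OF N_Gr, of a p] by (auto simp: KK_def AA_iff)
    moreover have "(a', Suc p') \<in> B \<longrightarrow> (a', Suc p') \<in> ?K"
      using False e supp_Q str_ne by (auto simp: KK_def AA_iff basis_index_iff)
    ultimately show ?thesis by simp
  qed
  show "str P \<in> {1..summands M}" "str Q \<in> {1..summands M}" "str P \<noteq> str Q"
    using str(1) act_PQ str_ne by auto
  show "?\<tau> q = (str Q, snd q + mm (P, Q))" for q by (simp add: tau_def)
qed

interpretation tp: torus_pencil M "KK N (P, Q)" "AA N (P, Q)" "tau (P, Q)" e "str P" "str Q" "mm (P, Q)"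
  by (rule inversion_pencil)

abbreviation "N' \<equiv> pt (KK N (P, Q) \<union> tau (P, Q) ` AA N (P, Q))"

lemma N'_fixed: "N' \<in> fixed_points M e" using tp.pt_infinity(1) pt_fixed by auto

lemma N_zero: "pt (KK N (P, Q) \<union> AA N (P, Q)) = N" using N_pt KK_AA by simp

lemma supp_N': "supp N' = KK N (P, Q) \<union> tau (P, Q) ` AA N (P, Q)"
proof -
  have "KK N (P, Q) \<union> tau (P, Q) ` AA N (P, Q) \<subseteq> B" using tp.K_B tp.tau_B by (rule Un_least)
  then show ?thesis unfolding supp_pt by (rule Int_absorb2)
qed

text \<open>After the move string \<open>P\<close> starts where \<open>Q\<close> started, and
  conversely; \<open>mm\<close> converts between the counts of missing vectors on the two
  strings.\<close>

lemma H_N': "H N' = W.rf (P, Q) (H N)"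
proof
  fix R
  have sP: "str P \<in> {1..summands M}" and sQ: "str Q \<in> {1..summands M}" using str(1) act_PQ by auto
  have lens: "hi P = lo P + int (len M (str P))" "hi Q = lo Q + int (len M (str Q))" using len_str act_PQ by auto
  have tau_iff: "(b, p) \<in> tau (P, Q) ` AA N (P, Q) \<longleftrightarrow>
     b = str Q \<and> mm (P, Q) \<le> p \<and> cut N (str P) + mm (P, Q) \<le> p \<and> p < cut N (str Q)" for b p
  proof
    assume "(b, p) \<in> tau (P, Q) ` AA N (P, Q)"
    then obtain a u where "(a, u) \<in> AA N (P, Q)" "(b, p) = tau (P, Q) (a, u)" by auto
    then show "b = str Q \<and> mm (P, Q) \<le> p \<and> cut N (str P) + mm (P, Q) \<le> p \<and> p < cut N (str Q)"
      by (auto simp: AA_iff tau_def)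
  next
    assume a: "b = str Q \<and> mm (P, Q) \<le> p \<and> cut N (str P) + mm (P, Q) \<le> p \<and> p < cut N (str Q)"
    then have "(str P, p - mm (P, Q)) \<in> AA N (P, Q)" by (auto simp: AA_iff)
    moreover have "(b, p) = tau (P, Q) (str P, p - mm (P, Q))" using a by (simp add: tau_def)
    ultimately show "(b, p) \<in> tau (P, Q) ` AA N (P, Q)" by (rule rev_image_eqI)
  qed
  have lt: "cut N (str P) + mm (P, Q) < cut N (str Q)" using Inv_active(5)[OF inv] mm_eq H_P H_Q by simp
  have cutP: "cut N' (str P) = cut N (str Q) - mm (P, Q)"
  proof (rule cut_eqI)
    show "cut N (str Q) - mm (P, Q) \<le> len M (str P)"
      using cut_le[of N "str Q"] lens hi_PQ mm_eq by linarith
    show "(str P, p) \<in> supp N' \<longleftrightarrow> cut N (str Q) - mm (P, Q) \<le> p" if "p < len M (str P)" for p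
      using that lt str_ne unfolding supp_N' by (auto simp: tau_iff KK_def AA_iff supp_P)
  qed
  have cutQ: "cut N' (str Q) = cut N (str P) + mm (P, Q)"
  proof (rule cut_eqI)
    show "cut N (str P) + mm (P, Q) \<le> len M (str Q)" using cut_le[of N "str Q"] lt by simp
    show "(str Q, p) \<in> supp N' \<longleftrightarrow> cut N (str P) + mm (P, Q) \<le> p" if "p < len M (str Q)" for p
      using that lt str_ne unfolding supp_N' by (auto simp: tau_iff KK_def AA_iff supp_Q)
  qed
  have cutR: "cut N' a = cut N a" if "a \<in> {1..summands M}" "a \<noteq> str P" "a \<noteq> str Q" for a
    by (rule cut_eqI[OF cut_le]; unfold supp_N')
      (use that in \<open>auto simp: tau_iff KK_def AA_iff supp_cut[OF N_Gr]\<close>)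
  have HP: "H N' P = H N Q" using act_PQ cutP lt mm_eq H_Q by (simp add: H_def of_nat_diff)
  have HQ: "H N' Q = H N P" using act_PQ cutQ mm_eq H_P by (simp add: H_def)
  have nd: "\<not> om dvd P - Q" using inv by (auto simp: W.Inv_def W.Phi_def)
  show "H N' R = W.rf (P, Q) (H N) R"
  proof (rule W.swap_cases[where R=R and P=P and Q=Q])
    fix k assume R: "R = P + om * k"
    show ?thesis unfolding R W.rf_def comp_def W.swap_fst H_shift HP ..
  next
    fix k assume R: "R = Q + om * k"
    show ?thesis unfolding R W.rf_def comp_def W.swap_snd[OF nd] H_shift HQ ..
  next
    assume R: "\<not> om dvd R - P" "\<not> om dvd R - Q" "W.swap (P, Q) R = R"
    have "H N' R = H N R"
    proof (cases "active R")
      case True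
      then have "str R \<noteq> str P" "str R \<noteq> str Q"
        using R(1,2) W.w_iff[of R P] W.w_iff[of R Q] act_PQ by (auto simp: w_def)
      then show ?thesis using cutR[OF str(1)[OF True]] by (simp add: H_def)
    qed (simp add: H_def)
    then show ?thesis by (simp add: W.rf_def R(3))
  qed
qed

lemma EL_edge: "EL N (P, Q) \<in> edges M e" unfolding EL_def by (rule tp.line_in_edges)

lemma EL_endpoints: "endpoints M e (EL N (P, Q)) = {N, N'}"
  unfolding EL_def using tp.line_endpoints N_zero by simp

lemma EL_orbit: "x \<in> EL N (P, Q) \<Longrightarrow> orbit M x = EL N (P, Q)"
  unfolding EL_def using tp.orbit_line by auto

lemma EL_directed:
  assumes "\<And>z N. z \<noteq> 0 \<Longrightarrow> N \<in> quiver_Gr M e \<Longrightarrow> act M (chi z) N = grading_act M wt z N"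
  shows "directed_edge M e chi (EL N (P, Q)) x y \<longleftrightarrow> x = N \<and> y = N'"
proof -
  obtain a where a: "P = pos (str P) + om * a" "lo P = int (start M (str P)) - int n * a"
    using str_obtain[OF act_PQ(1)] .
  obtain b where b: "Q = pos (str Q) + om * b" "lo Q = int (start M (str Q)) - int n * b"
    using str_obtain[OF act_PQ(2)] .
  \<comment> \<open>\<open>b - a\<close> is the relative lift of the two summands determined by the
    positions \<open>P\<close> and \<open>Q\<close>.\<close>
  have "pos (str P) < pos (str Q) + om * (b - a)" using a(1) b(1) less_PQ by (simp add: right_diff_distrib)
  from wt_diff[OF str(1)[OF act_PQ(1)] str(1)[OF act_PQ(2)] this] obtain D where D0: "D > 0 \<and>
    (\<forall>p p'. p < len M (str P) \<longrightarrow> p' < len M (str Q) \<longrightarrow>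
        int (start M (str P)) + int p = int (start M (str Q)) - int n * (b - a) + int p' \<longrightarrow>
        wt (bas M (str Q) p') - wt (bas M (str P) p) = D)" by (rule exE)
  note D = conjunct1[OF D0] conjunct2[OF D0, rule_format]
  have "wt (bv (tau (P, Q) q)) = wt (bv q) + D" if q: "q \<in> AA N (P, Q)" for q
  proof -
    have qe: "q = (str P, snd q)" using tp.A_j[OF q] by (cases q) simp
    have "int (start M (str P)) + int (snd q) = int (start M (str Q)) - int n * (b - a) + int (snd q + mm (P, Q))"
      using mm_eq a(2) b(2) by (simp add: right_diff_distrib)
    moreover have "snd q < len M (str P)" "snd q + mm (P, Q) < len M (str Q)"
      using AA_B[OF q] tp.A_j[OF q] tp.tauA(1)[OF q] by (cases q; simp add: tau_def basis_index_iff)+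
    ultimately have "wt (bas M (str Q) (snd q + mm (P, Q))) - wt (bas M (str P) (snd q)) = D" by (intro D(2))
    then show ?thesis using tp.A_j[OF q] by (simp add: basis_vec_def tau_def)
  qed
  from tp.line_directed[OF D(1) this assms] show ?thesis unfolding EL_def N_zero .
qed

text \<open>The slope is the weight of string \<open>Q\<close> minus that of string
  \<open>P\<close>, hence minus the label; the sign goes into the constant.\<close>

lemma EL_label:
  assumes "describes_action M (EL N (P, Q)) a"
  shows "\<exists>c. c \<noteq> 0 \<and> char_form (summands M) a = Const c * W.lab (P, Q)"
proof -
  let ?d = "summands M"
  obtain c where c: "c \<noteq> 0" "char_form ?d a = Const c * linform ?d (\<lambda>i. of_int (tp.slope i))"
    using tp.line_label assms unfolding EL_def by blast
  have sd: "str P \<in> {1..?d}" "str Q \<in> {1..?d}" using str(1) act_PQ by auto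
  have "linform ?d (\<lambda>i. of_int (tp.slope i)) = - W.lab (P, Q)"
  proof -
    let ?f = "\<lambda>i. if i = w P then 1 else if i = w Q then -1
      else if i = 0 then of_int (- lo P - - lo Q) else (0::rat)"
    have lab: "W.lab (P, Q) = linform ?d ?f"
      by (rule W.lab_linform) (use sd str_ne act_PQ in \<open>auto simp: w_def\<close>)
    have neg: "linform ?d (\<lambda>i. - f i) = - linform ?d f" for f
    proof -
      have "Const (- f i) = - Const (f i)" for i by (simp add: Const_def single_uminus)
      then show ?thesis by (simp add: linform_def sum_negf)
    qed
    have sl: "(\<lambda>i. rat_of_int (tp.slope i)) = (\<lambda>i. - ?f i)"
    proof
      fix i show "rat_of_int (tp.slope i) = - ?f i"
        using sd str_ne act_PQ arg_cong[OF mm_eq, of rat_of_int] by (auto simp: tp.slope_def w_def)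
    qed
    show ?thesis unfolding sl lab by (rule neg)
  qed
  then have "char_form ?d a = Const (- c) * W.lab (P, Q)"
    using c(2) by (simp add: Const_def single_uminus)
  then show ?thesis using c(1) by (intro exI[of _ "- c"]) simp
qed

end

end

context string_rep
begin

text \<open>A point that is not fixed has two indices on different summands over one vertex that its
  stabiliser does not separate. As the characters of the orbit have rank one, every other
  unseparated pair has a proportional exponent difference and hence is a translate of the first
  along the summands. This yields the separation required by \<open>nonfixed_line\<close>, and the
  resulting line is matched with an inversion at its end with parameter 0.\<close>

lemma one_dim_orbit:
  assumes N: "N \<in> quiver_Gr M e" and dim1: "orbit_dim M N = 1"
  shows "\<exists>x\<in>fixed_points M e. \<exists>\<beta>\<in>W.Inv (H x). N \<in> EL x \<beta>"
proof -
  define rel where "rel q q' \<longleftrightarrow> (\<forall>\<gamma>\<in>stabilizer M N. chr \<gamma> q = chr \<gamma> q')" for q q'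
  define pr where "pr x q0 = comb (\<lambda>q. if rel q q0 then cf x q else 0)" for x q0
  have rel_sym: "rel q q' \<Longrightarrow> rel q' q" for q q' by (auto simp: rel_def)
  have pr: "pr x q0 \<in> N i" if "i < n" "x \<in> N i" for x q0 i
  proof -
    have "comb (\<lambda>q. if \<forall>\<kappa>\<in>chr ` stabilizer M N. \<kappa> q = \<kappa> q0 then cf x q else 0) \<in> N i"
      by (rule projection_in[OF GrD(1)[OF N that(1)] _ _ that(2)])
        (use GrD(5)[OF N that(1)] stabilizer_diag[OF _ that(1)] in auto)
    then show ?thesis by (simp add: pr_def rel_def)
  qed
  have cf_pr: "cf (pr x q0) q = (if rel q q0 then cf x q else 0)" if "q \<in> B" for x q0 q
    using that by (simp add: pr_def cf_comb)
  have "N \<notin> fixed_points M e" using orbit_dim_fixed dim1 by auto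
  then have nonpt: "N \<noteq> pt (supp N)" using fixed_iff N by auto
  have "\<exists>u u'. u \<in> B \<and> u' \<in> B \<and> rel u u' \<and> fst u \<noteq> fst u' \<and> vt u = vt u'"
  proof (rule ccontr)
    assume no: "\<not> ?thesis"
    have "N = pt (supp N)"
    proof (rule single_string_coordinate[OF N])
      fix i x q0 assume i: "i < n" "x \<in> N i" and q0: "q0 \<in> B" "cf x q0 \<noteq> 0"
      have "cf (pr x q0) q0 \<noteq> 0" using q0 by (simp add: cf_pr rel_def)
      moreover have "fst q = fst q0" if q: "q \<in> B" "cf (pr x q0) q \<noteq> 0" for q
      proof -
        have "rel q q0" "cf x q \<noteq> 0" using q cf_pr by (auto split: if_splits)
        moreover from this have "vt q = vt q0" using cf_vertex[OF N i] q q0 by metis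
        ultimately show ?thesis using no q(1) q0(1) by blast
      qed
      ultimately show "\<exists>y\<in>N i. cf y q0 \<noteq> 0 \<and> (\<forall>q\<in>B. cf y q \<noteq> 0 \<longrightarrow> fst q = fst q0)"
        using pr[OF i] by blast
    qed
    then show False using nonpt by simp
  qed
  then obtain u1 u2 where u12: "u1 \<in> B" "u2 \<in> B" "rel u1 u2" "fst u1 \<noteq> fst u2" "vt u1 = vt u2" by blast
  \<comment> \<open>Lifts the pair to the universal cover: strings through \<open>u\<close> and
    \<open>u'\<close> on which these vectors lie over the same vertex. The symmetry of
    \<open>rel\<close> then allows \<open>P < Q\<close>, and a common shift puts the pair into
    \<open>Phi\<close>.\<close>
  define good where "good u u' P Q \<longleftrightarrow> u \<in> B \<and> u' \<in> B \<and> rel u u' \<and> active P \<and> active Q \<and>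
     str P = fst u \<and> str Q = fst u' \<and> lo P + int (snd u) = lo Q + int (snd u')" for u u' P Q
  have jB: "fst u \<in> {1..summands M}" if "u \<in> B" for u using that by (cases u) (auto simp: basis_index_iff)
  have "\<exists>P Q. good u1 u2 P Q"
  proof -
    have "(start M (fst u1) + snd u1) mod n = (start M (fst u2) + snd u2) mod n"
      using u12(5) by (simp add: basis_vertex_def)
    then have "int (start M (fst u1) + snd u1) mod int n = int (start M (fst u2) + snd u2) mod int n"
      by (simp only: zmod_int[symmetric])
    then have "int n dvd int (start M (fst u1) + snd u1) - int (start M (fst u2) + snd u2)"
      by (simp add: mod_eq_dvd_iff)
    then obtain r where r: "int (start M (fst u1) + snd u1) - int (start M (fst u2) + snd u2) = int n * r" by (rule dvdE)
    note s1 = str_eqI[OF jB[OF u12(1)], of "pos (fst u1)" 0]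
    note s2 = str_eqI[OF jB[OF u12(2)], of "pos (fst u2) + om * (- r)" "- r"]
    have "good u1 u2 (pos (fst u1)) (pos (fst u2) + om * (- r))"
      unfolding good_def using u12 s1 s2 r by simp
    then show ?thesis by blast
  qed
  then obtain P1 Q1 where g1: "good u1 u2 P1 Q1" by blast
  have "P1 \<noteq> Q1" using g1 u12(4) by (auto simp: good_def)
  moreover have "good u2 u1 Q1 P1" using g1 rel_sym by (auto simp: good_def)
  ultimately obtain u u' P2 Q2 where g2: "good u u' P2 Q2" "P2 < Q2" "fst u \<noteq> fst u'"
    using g1 u12(4) by (metis linorder_neqE)
  obtain k where k: "W.nrm (P2, Q2) = (P2 + om * k, Q2 + om * k)" by (rule W.nrm_obtain)
  define P Q where "P = P2 + om * k" and "Q = Q2 + om * k"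
  have nd: "\<not> om dvd P2 - Q2" using W.w_iff[of P2 Q2] g2 by (auto simp: good_def w_def)
  have Phi: "(P, Q) \<in> W.Phi" using W.nrm_Phi[OF g2(2) nd] k by (simp add: P_def Q_def)
  have g: "good u u' P Q"
    using g2(1) unfolding good_def P_def Q_def active_shift by (auto simp: str_shift lo_shift)
  define j j' m where "j = str P" and "j' = str Q" and "m = mm (P, Q)"
  have aP: "active P" "active Q" using g by (auto simp: good_def)
  have PQ: "P < Q" using g2(2) by (simp add: P_def Q_def)
  have jj: "j \<in> {1..summands M}" "j' \<in> {1..summands M}" "j \<noteq> j'"
    using str(1)[OF aP(1)] str(1)[OF aP(2)] g g2(3) by (simp_all add: j_def j'_def good_def)
  have mi: "int m = lo P - lo Q" using lo_anti[of P Q] PQ by (simp add: m_def mm_def)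
  have uj: "fst u = j" "fst u' = j'" "snd u' = snd u + m"
    using g mi by (auto simp: good_def j_def j'_def)
  have uB: "u \<in> B" "u' \<in> B" "rel u u'" using g by (auto simp: good_def)
  define \<tau> where "\<tau> q = (j', snd q + m)" for q :: "nat \<times> nat"
  have tau_eq: "tau (P, Q) = \<tau>" by (simp add: fun_eq_iff tau_def \<tau>_def j'_def m_def)
  define dm where "dm = {q \<in> B. fst q = j \<and> \<tau> q \<in> B}"
  have rel_tau: "rel q (\<tau> q)" if "fst q = j" for q
    unfolding rel_def
  proof
    fix \<gamma> assume \<gamma>: "\<gamma> \<in> stabilizer M N"
    have nz: "\<gamma> 0 \<noteq> 0" using \<gamma> torus_nz[of \<gamma> "summands M" 0] by (simp add: stabilizer_def)
    have "chr \<gamma> u = chr \<gamma> u'" using uB(3) \<gamma> by (simp add: rel_def)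
    then have "\<gamma> j = \<gamma> 0 ^ m * \<gamma> j'" using nz by (simp add: chr_def uj power_add)
    then show "chr \<gamma> q = chr \<gamma> (\<tau> q)" using that by (simp add: chr_def \<tau>_def power_add)
  qed
  have rel_pairs: "fst q1 = j \<and> q2 = \<tau> q1 \<or> fst q2 = j \<and> q1 = \<tau> q2"
    if q: "q1 \<in> B" "q2 \<in> B" "rel q1 q2" "q1 \<noteq> q2" for q1 q2
  proof -
    \<comment> \<open>Rank one: the exponent differences of unseparated pairs are all rational
      multiples of one vector \<open>z\<close>.\<close>
    obtain z where z: "\<And>a. a \<in> (\<lambda>a i. rat_of_int (a i)) ` orbit_characters M N \<Longrightarrow> \<exists>r. a = (\<lambda>i. r * z i)"
      using rat_fun_dim_1[OF dim1[unfolded orbit_dim_def]] by metis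
    have ex: "\<exists>r. (\<lambda>i. rat_of_int (expo a i - expo b i)) = (\<lambda>i. r * z i)" if "a \<in> B" "b \<in> B" "rel a b" for a b
      by (rule z, rule imageI, rule expo_orbit_character) (use that in \<open>auto simp: rel_def\<close>)
    obtain s where s: "(\<lambda>i. rat_of_int (expo u i - expo u' i)) = (\<lambda>i. s * z i)" using ex[OF uB] by blast
    obtain t where t: "(\<lambda>i. rat_of_int (expo q1 i - expo q2 i)) = (\<lambda>i. t * z i)" using ex[OF q(1-3)] by blast
    have "s * z j = 1" using fun_cong[OF s, of j] jj uj by (simp add: expo_def)
    then have s0: "s \<noteq> 0" by auto
    define \<rho> where "\<rho> = t / s"
    have prp: "rat_of_int (expo q1 i - expo q2 i) = \<rho> * rat_of_int (expo u i - expo u' i)" for i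
      using fun_cong[OF s, of i] fun_cong[OF t, of i] s0 by (simp add: \<rho>_def)
    obtain a1 p1 a2 p2 where q12: "q1 = (a1, p1)" "q2 = (a2, p2)" by force
    have a: "a1 \<noteq> 0" "a2 \<noteq> 0" using q(1,2) q12 by (auto simp: basis_index_iff)
    have j0: "j \<noteq> 0" "j' \<noteq> 0" using jj by auto
    have e0: "rat_of_int (int p1 - int p2) = - \<rho> * rat_of_nat m"
      using prp[of 0] by (simp add: expo_def q12 uj)
    have ei: "(if i = a1 then 1 else 0) - (if i = a2 then 1 else 0) = \<rho> * ((if i = j then 1 else 0) - (if i = j' then 1 else 0))"
      if "i \<noteq> 0" for i
      using prp[of i] that by (simp add: expo_def q12 uj split: if_splits)
    have "\<rho> \<noteq> 0"
    proof
      assume "\<rho> = 0"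
      then have "p1 = p2" "a1 = a2" using e0 ei[OF a(1)] by (auto split: if_splits)
      then show False using q(4) q12 by simp
    qed
    then consider "a1 = j" "a2 = j'" "\<rho> = 1" | "a1 = j'" "a2 = j" "\<rho> = -1"
      using ei[OF j0(1)] ei[OF j0(2)] jj(3) by (auto split: if_splits)
    then show ?thesis
    proof cases
      case 1
      then have "rat_of_int (int p2) = rat_of_int (int (p1 + m))" using e0 by simp
      then have "p2 = p1 + m" by (simp only: of_int_eq_iff of_nat_eq_iff)
      then show ?thesis using 1 q12 by (simp add: \<tau>_def)
    next
      case 2
      then have "rat_of_int (int p1) = rat_of_int (int (p2 + m))" using e0 by simp
      then have "p1 = p2 + m" by (simp only: of_int_eq_iff of_nat_eq_iff)
      then show ?thesis using 2 q12 by (simp add: \<tau>_def)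
    qed
  qed
  have lens: "hi P = lo P + int (len M j)" "hi Q = lo Q + int (len M j')" using len_str aP by (simp_all add: j_def j'_def)
  have lm: "len M j' \<le> len M j + m" using hi_anti[of P Q] PQ lens mi by linarith
  have vtm: "vt (j', p + m) = vt (j, p)" for p
  proof -
    have "lo Q + int (p + m) = lo P + int p" using mi by simp
    then show ?thesis unfolding j_def j'_def vt_str[OF aP(1)] vt_str[OF aP(2)] by (simp only:)
  qed
  have "\<exists>A c. c \<noteq> 0 \<and> torus_pencil M (supp N) A (\<lambda>q. (j', snd q + m)) e j j' m \<and>
    N = line (supp N) A (\<lambda>q. (j', snd q + m)) c"
  proof (rule nonfixed_line[OF N jj lm vtm _ _ nonpt])
    fix i x q assume i: "i < n" "x \<in> N i" and q: "q \<in> B" "cf x q \<noteq> 0"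
      "q \<notin> {q \<in> B. fst q = j \<and> (j', snd q + m) \<in> B}" "q \<notin> (\<lambda>q. (j', snd q + m)) ` {q \<in> B. fst q = j \<and> (j', snd q + m) \<in> B}"
    have nq: "q \<notin> dm" "q \<notin> \<tau> ` dm" using q(3,4) by (simp_all add: dm_def \<tau>_def image_def)
    have single: "v = q" if "v \<in> B" "rel v q" for v
    proof (rule ccontr)
      assume "v \<noteq> q"
      from rel_pairs[OF that(1) q(1) that(2) this] show False using nq that(1) q(1) by (auto simp: dm_def)
    qed
    have "pr x q = smult M (cf x q) (bv q)"
      unfolding pr_def using single
      by (intro cf_ext comb_in TV_scale bv_in q) (auto simp: cf_comb cf_scale bv_in cf_bv q(1) rel_def)
    then have "smult M (inverse (cf x q)) (smult M (cf x q) (bv q)) \<in> N i"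
      using V.subspace_scale[OF GrD(1)[OF N i(1)] pr[OF i, of q]] by metis
    then show "bv q \<in> N i" using q(2) by simp
  next
    fix i x q assume i: "i < n" "x \<in> N i" and q: "q \<in> {q \<in> B. fst q = j \<and> (j', snd q + m) \<in> B}"
    have ft: "fst (\<tau> z) = j'" for z by (simp add: \<tau>_def)
    have "\<tau> q \<noteq> q"
    proof
      assume "\<tau> q = q"
      then have "fst q = j'" using ft[of q] by simp
      then show False using q jj(3) by simp
    qed
    with q have qB: "q \<in> B" "\<tau> q \<in> B" "fst q = j" "\<tau> q \<noteq> q" by (simp_all add: \<tau>_def)
    have pair: "v = q \<or> v = \<tau> q" if "v \<in> B" "rel v q" for v
      using rel_pairs[OF that(1) qB(1) that(2)] qB(3) jj(3) ft[of v] by metis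
    have "pr x q = smult M (cf x q) (bv q) + smult M (cf x (\<tau> q)) (bv (\<tau> q))"
      unfolding pr_def
    proof (rule cf_ext)
      fix v assume v: "v \<in> B"
      have "rel (\<tau> q) q" "rel q q" using rel_tau[OF qB(3)] rel_sym by (auto simp: rel_def)
      then show "cf (comb (\<lambda>v. if rel v q then cf x v else 0)) v = cf (smult M (cf x q) (bv q) + smult M (cf x (\<tau> q)) (bv (\<tau> q))) v"
        using pair[OF v] v qB by (auto simp: cf_comb cf_add cf_scale TV_scale bv_in cf_bv)
    qed (auto intro!: comb_in TV_add TV_scale bv_in qB)
    then show "smult M (cf x q) (bv q) + smult M (cf x (j', snd q + m)) (bv (j', snd q + m)) \<in> N i"
      using pr[OF i, of q] by (simp add: \<tau>_def)
  qed
  then obtain A c where c: "c \<noteq> 0" and tp: "torus_pencil M (supp N) A \<tau> e j j' m"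
    and NL: "N = line (supp N) A \<tau> c" unfolding \<tau>_def[abs_def, symmetric] by blast
  interpret tp: torus_pencil M "supp N" A \<tau> e j j' m by (rule tp)
  define x where "x = pt (supp N \<union> A)"
  have x_Gr: "x \<in> quiver_Gr M e" using tp.line_Gr[of 0] tp.line_0 by (simp add: x_def)
  then have xF: "x \<in> fixed_points M e" unfolding x_def by (rule pt_fixed)
  have sx: "supp x = supp N \<union> A" unfolding x_def supp_pt using tp.K_B tp.A_B by blast
  let ?x' = "pt (supp N \<union> \<tau> ` A)"
  have sx': "supp ?x' = supp N \<union> \<tau> ` A" unfolding supp_pt using tp.K_B tp.tau_B by blast
  note cutP = supp_cut[OF x_Gr jj(1)] and cutQ = supp_cut[OF x_Gr jj(2)]
  have HQ: "lo P + int p < H x Q \<longleftrightarrow> p + m < cut x j'" for p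
    using aP mi by (auto simp: H_def j'_def)
  have A_cut: "cut x j \<le> p \<and> p + m < cut x j'" if "(j, p) \<in> A" for p
  proof -
    have "(j, p) \<in> supp x" "(j', p + m) \<in> B" "(j', p + m) \<notin> supp x"
      using that tp.tauA[OF that] by (auto simp: sx \<tau>_def)
    then show ?thesis using cutP[of p] cutQ[of "p + m"] by (auto simp: basis_index_iff)
  qed
  obtain p0 where p0: "(j, p0) \<in> A" using tp.A_ne tp.A_j by (metis equals0I prod.collapse)
  \<comment> \<open>\<open>A\<close> has no gaps between the two cuts. A missing vector before
    \<open>p0\<close> would put \<open>p0\<close> into \<open>supp N\<close> along the arrows; one
    after \<open>p0\<close> is excluded because the support of the other end point is closed under
    successors, too.\<close>
  have A_eq: "(j, p) \<in> A" if h: "cut x j \<le> p" "p + m < cut x j'" for p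
  proof -
    have "p < len M j" using h(2) cut_le[of x j'] lm by linarith
    then have S: "(j, p) \<in> supp x" using cutP h by simp
    have nS: "(j', p + m) \<notin> supp x" and pB: "(j', p + m) \<in> B"
      using cutQ h cut_le[of x j'] jj(2) by (auto simp: basis_index_iff)
    show ?thesis
    proof (rule ccontr)
      assume nA: "(j, p) \<notin> A"
      then have K: "(j, p) \<in> supp N" using S sx by auto
      show False
      proof (cases "p \<le> p0")
        case True
        have "(j, p + (p0 - p)) \<in> supp N" using supp_next'[OF N K, of "p0 - p"] p0 tp.A_B True by auto
        then show False using True p0 tp.KA by auto
      next
        case False
        have e: "p0 + m + (p - p0) = p + m" using False by simp
        have "(j', p0 + m) \<in> supp ?x'" using p0 unfolding sx' by (force simp: \<tau>_def)
        from supp_next'[OF tp.pt_infinity(1) this, of "p - p0", unfolded e, OF pB]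
        have "(j', p + m) \<in> supp ?x'" .
        then have "(j', p + m) \<in> \<tau> ` A" using nS unfolding sx sx' by auto
        then obtain q where "q \<in> A" "(j', p + m) = \<tau> q" by auto
        then have "(j, p) \<in> A" using tp.A_j[of q] by (cases q) (simp add: \<tau>_def)
        then show False using nA by simp
      qed
    qed
  qed
  have AA: "AA x (P, Q) = A"
  proof (intro equalityI subsetI)
    fix q assume "q \<in> AA x (P, Q)"
    then show "q \<in> A" using A_eq[of "snd q"] HQ[of "snd q"] by (cases q) (auto simp: AA_def j_def)
  next
    fix q assume q: "q \<in> A"
    then have "q = (j, snd q)" using tp.A_j[OF q] by (cases q) simp
    then show "q \<in> AA x (P, Q)"
      using A_cut[of "snd q"] HQ[of "snd q"] tp.A_B q tp.A_j[OF q] by (auto simp: AA_def j_def)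
  qed
  have KK: "KK x (P, Q) = supp N" unfolding KK_def AA sx using tp.KA by auto
  have "H x P < H x Q"
    using A_cut[OF p0] HQ[of p0] aP by (auto simp: H_def j_def j'_def)
  then have "(P, Q) \<in> W.Inv (H x)" using Phi by (simp add: W.Inv_def)
  moreover have "N \<in> EL x (P, Q)" unfolding EL_def AA KK tau_eq using NL c by auto
  ultimately show ?thesis using xF by blast
qed

end

section \<open>Knutson-Tao classes\<close>

locale moment_graph = string_rep M wt om lo hi pos
  for M :: "'v::ab_group_add based_rep" and wt om lo hi pos +
  fixes e :: "nat \<Rightarrow> nat" and chi :: "complex \<Rightarrow> nat \<Rightarrow> complex"
    and \<alpha> :: "(nat \<Rightarrow> 'v set) set \<Rightarrow> nat \<Rightarrow> int"
  assumes chi_act: "\<And>z N. z \<noteq> 0 \<Longrightarrow> N \<in> quiver_Gr M e \<Longrightarrow> act M (chi z) N = grading_act M wt z N"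
    and label: "\<And>E. E \<in> edges M e \<Longrightarrow> describes_action M E (\<alpha> E)"
begin

abbreviation "F \<equiv> fixed_points M e"
abbreviation "R \<equiv> coeff_ring (summands M)"
abbreviation "ivs x \<equiv> W.Inv (H x)"
abbreviation "lng x \<equiv> card (W.Inv (H x))"
abbreviation "nb x \<beta> \<equiv> pt (KK x \<beta> \<union> tau \<beta> ` AA x \<beta>)"

lemma edge_facts:
  assumes "x \<in> F" "\<beta> \<in> ivs x"
  shows "EL x \<beta> \<in> edges M e" "endpoints M e (EL x \<beta>) = {x, nb x \<beta>}" "nb x \<beta> \<in> F"
    "H (nb x \<beta>) = W.rf \<beta> (H x)" "directed_edge M e chi (EL x \<beta>) y z \<longleftrightarrow> y = x \<and> z = nb x \<beta>"
    "\<exists>c. c \<noteq> 0 \<and> char_form (summands M) (\<alpha> (EL x \<beta>)) = Const c * W.lab \<beta>"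
proof -
  obtain P Q where \<beta>: "\<beta> = (P, Q)" by force
  note i = assms[unfolded \<beta>]
  show *: "EL x \<beta> \<in> edges M e" unfolding \<beta> by (rule EL_edge[OF i])
  show "endpoints M e (EL x \<beta>) = {x, nb x \<beta>}" unfolding \<beta> by (rule EL_endpoints[OF i])
  show "nb x \<beta> \<in> F" unfolding \<beta> by (rule N'_fixed[OF i])
  show "H (nb x \<beta>) = W.rf \<beta> (H x)" unfolding \<beta> by (rule H_N'[OF i])
  show "directed_edge M e chi (EL x \<beta>) y z \<longleftrightarrow> y = x \<and> z = nb x \<beta>"
    unfolding \<beta> by (rule EL_directed[OF i chi_act])
  show "\<exists>c. c \<noteq> 0 \<and> char_form (summands M) (\<alpha> (EL x \<beta>)) = Const c * W.lab \<beta>"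
    using EL_label[OF i, of "\<alpha> (EL x \<beta>)"] label[OF *] unfolding \<beta> by blast
qed

lemma edges_cases:
  assumes "E \<in> edges M e"
  obtains x \<beta> where "x \<in> F" "\<beta> \<in> ivs x" "E = EL x \<beta>"
proof -
  obtain N where N: "N \<in> quiver_Gr M e" "orbit_dim M N = 1" "E = orbit M N"
    using assms by (auto simp: edges_def)
  obtain x \<beta> where x: "x \<in> F" "\<beta> \<in> ivs x" "N \<in> EL x \<beta>" using one_dim_orbit[OF N(1,2)] by blast
  obtain P Q where \<beta>: "\<beta> = (P, Q)" by force
  have "E = EL x \<beta>" using EL_orbit[OF x[unfolded \<beta>]] N(3) \<beta> by simp
  then show ?thesis using that x by blast
qed

lemma ln_nb: "x \<in> F \<Longrightarrow> \<beta> \<in> ivs x \<Longrightarrow> lng (nb x \<beta>) < lng x"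
  using edge_facts(4) W.card_Inv_less[OF H_C] by simp

lemma finite_inv: "finite (ivs x)" using W.finite_Inv[OF H_C] .

lemma inv_Phi: "ivs x \<subseteq> W.Phi" by (auto simp: W.Inv_def)

definition coef :: "(nat \<Rightarrow> 'v set) \<Rightarrow> int \<times> int \<Rightarrow> rat" where
  "coef x \<beta> = (SOME c. c \<noteq> 0 \<and> char_form (summands M) (\<alpha> (EL x \<beta>)) = Const c * W.lab \<beta>)"

lemma coef: "x \<in> F \<Longrightarrow> \<beta> \<in> ivs x \<Longrightarrow> coef x \<beta> \<noteq> 0"
  "x \<in> F \<Longrightarrow> \<beta> \<in> ivs x \<Longrightarrow> char_form (summands M) (\<alpha> (EL x \<beta>)) = Const (coef x \<beta>) * W.lab \<beta>"
  using someI_ex[OF edge_facts(6)] unfolding coef_def by blast+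

lemma Const_cancel: "c \<noteq> 0 \<Longrightarrow> Const (inverse c) * (Const c * f) = f"
  by (simp flip: Const_mult mult.assoc)

lemma lab_R: assumes "x \<in> F" "\<beta> \<in> ivs x" shows "W.lab \<beta> \<in> R"
proof -
  have "W.lab \<beta> = Const (inverse (coef x \<beta>)) * char_form (summands M) (\<alpha> (EL x \<beta>))"
    unfolding coef(2)[OF assms] Const_cancel[OF coef(1)[OF assms]] ..
  then show ?thesis using linform_in_coeff_ring coeff_ring_closed(3,6) by (simp add: char_form_linform)
qed

text \<open>Equal orbits have equal labels, and the labels of different reflections do not divide
  each other.\<close>

lemma EL_inj: assumes x: "x \<in> F" shows "inj_on (EL x) (ivs x)"
proof (rule inj_onI)
  fix \<beta> \<beta>' assume b: "\<beta> \<in> ivs x" "\<beta>' \<in> ivs x" and eq: "EL x \<beta> = EL x \<beta>'"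
  have "Const (coef x \<beta>) * W.lab \<beta> = Const (coef x \<beta>') * W.lab \<beta>'"
    using coef(2)[OF x b(1)] coef(2)[OF x b(2)] eq by simp
  then have "W.lab \<beta>' = Const (inverse (coef x \<beta>')) * (Const (coef x \<beta>) * W.lab \<beta>)"
    using Const_cancel[OF coef(1)[OF x b(2)], of "W.lab \<beta>'"] by metis
  then have "W.lab \<beta>' = W.lab \<beta> * (Const (inverse (coef x \<beta>')) * Const (coef x \<beta>))"
    by (simp only: ac_simps)
  then have "W.lab \<beta> dvd W.lab \<beta>'" by (rule dvdI)
  then show "\<beta> = \<beta>'" using W.lab_ndvd inv_Phi b by blast
qed

lemma edges_from_eq: assumes x: "x \<in> F" shows "edges_from M e chi x = EL x ` ivs x"
proof (intro equalityI subsetI)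
  fix E assume "E \<in> edges_from M e chi x"
  then obtain y where y: "directed_edge M e chi E x y" by (auto simp: edges_from_def)
  then have "E \<in> edges M e" by (simp add: directed_edge_def)
  then obtain x0 \<beta> where b: "x0 \<in> F" "\<beta> \<in> ivs x0" "E = EL x0 \<beta>" by (rule edges_cases)
  then show "E \<in> EL x ` ivs x" using y edge_facts(5)[OF b(1,2)] by auto
next
  fix E assume "E \<in> EL x ` ivs x"
  then obtain \<beta> where b: "\<beta> \<in> ivs x" "E = EL x \<beta>" by auto
  show "E \<in> edges_from M e chi x" using edge_facts(5)[OF x b(1)] b(2) by (auto simp: edges_from_def)
qed

definition scal :: "(nat \<Rightarrow> 'v set) \<Rightarrow> rat" where "scal x = (\<Prod>\<beta>\<in>ivs x. coef x \<beta>)"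

definition diag :: "(nat \<Rightarrow> 'v set) \<Rightarrow> qpoly" where "diag x = Const (scal x) * prod W.lab (ivs x)"

lemma scal_nz: "x \<in> F \<Longrightarrow> scal x \<noteq> 0" using coef(1) finite_inv by (simp add: scal_def)

lemma prod_lab: "prod W.lab (ivs x) \<noteq> 0" "homogeneous_poly (2 * lng x) (prod W.lab (ivs x))"
proof -
  have "W.lab \<beta> \<noteq> 0" if "\<beta> \<in> ivs x" for \<beta> by (rule W.lab_nz) (rule subsetD[OF inv_Phi that])
  then show "prod W.lab (ivs x) \<noteq> 0" using finite_inv[of x] by simp
  show "homogeneous_poly (2 * lng x) (prod W.lab (ivs x))"
    by (rule homogeneous_prod[OF W.rs.a_hom finite_inv]) (use inv_Phi[of x] in blast)
qed

lemma diag_nz: "x \<in> F \<Longrightarrow> diag x \<noteq> 0" using scal_nz prod_lab(1) by (simp add: diag_def)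

lemma diag_hom: "homogeneous_poly (2 * lng x) (diag x)"
  unfolding diag_def by (rule homogeneous_Const_mult[OF prod_lab(2)])

lemma diag_R: "x \<in> F \<Longrightarrow> diag x \<in> R"
  unfolding diag_def by (intro coeff_ring_closed(3,6) coeff_ring_prod lab_R)

lemma diag_edges: "x \<in> F \<Longrightarrow> (\<Prod>E\<in>edges_from M e chi x. char_form (summands M) (\<alpha> E)) = diag x"
  unfolding edges_from_eq diag_def scal_def
  by (simp add: prod.reindex[OF EL_inj] coef(2) prod.distrib Const_prod cong: prod.cong)

section \<open>Compatible families in terms of words\<close>

definition compat :: "((nat \<Rightarrow> 'v set) \<Rightarrow> qpoly) \<Rightarrow> bool" where
  "compat f \<longleftrightarrow> (\<forall>x\<in>F. f x \<in> R) \<and> (\<forall>x\<in>F. \<forall>\<beta>\<in>ivs x. W.lab \<beta> dvd f x - f (nb x \<beta>))"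

text \<open>Every edge joins a fixed point to a neighbour given by an inversion, and its label is a
  nonzero constant times \<open>W.lab \<beta>\<close>; so the congruences may be stated once per
  inversion.\<close>

lemma eq_cohomology_iff: "f \<in> eq_cohomology M e \<alpha> \<longleftrightarrow> f \<in> extensional F \<and> compat f"
proof
  assume f: "f \<in> eq_cohomology M e \<alpha>"
  have "W.lab \<beta> dvd f x - f (nb x \<beta>)" if x: "x \<in> F" "\<beta> \<in> ivs x" for x \<beta>
  proof -
    have "x \<in> endpoints M e (EL x \<beta>)" "nb x \<beta> \<in> endpoints M e (EL x \<beta>)" using edge_facts(2)[OF x] by auto
    then obtain r where "f x - f (nb x \<beta>) = char_form (summands M) (\<alpha> (EL x \<beta>)) * r"
      using f edge_facts(1)[OF x] unfolding eq_cohomology_def by blast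
    then have "f x - f (nb x \<beta>) = W.lab \<beta> * (Const (coef x \<beta>) * r)"
      unfolding coef(2)[OF x] by (simp add: ac_simps)
    then show ?thesis by (rule dvdI)
  qed
  then show "f \<in> extensional F \<and> compat f"
    using f by (auto simp: eq_cohomology_def PiE_iff compat_def)
next
  assume f: "f \<in> extensional F \<and> compat f"
  have "\<exists>r\<in>R. f y - f z = char_form (summands M) (\<alpha> E) * r"
    if E: "E \<in> edges M e" and yz: "y \<in> endpoints M e E" "z \<in> endpoints M e E" for E y z
  proof -
    obtain x \<beta> where x: "x \<in> F" "\<beta> \<in> ivs x" "E = EL x \<beta>" using edges_cases[OF E] .
    have nbF: "nb x \<beta> \<in> F" by (rule edge_facts(3)[OF x(1,2)])
    have "W.lab \<beta> dvd f x - f (nb x \<beta>)" using f x by (simp add: compat_def)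
    moreover have "f x - f (nb x \<beta>) \<in> R" using f x nbF by (simp add: compat_def coeff_ring_closed)
    ultimately obtain r where r: "r \<in> R" "f x - f (nb x \<beta>) = W.lab \<beta> * r"
      using coeff_ring_dvd[OF lab_R[OF x(1,2)]] by blast
    define s where "s = Const (inverse (coef x \<beta>)) * r"
    have s: "s \<in> R" unfolding s_def by (intro coeff_ring_closed(3,6) r)
    have "char_form (summands M) (\<alpha> E) * s = (Const (inverse (coef x \<beta>)) * (Const (coef x \<beta>) * W.lab \<beta>)) * r"
      unfolding x(3) coef(2)[OF x(1,2)] s_def by (simp add: ac_simps)
    then have eq: "f x - f (nb x \<beta>) = char_form (summands M) (\<alpha> E) * s"
      unfolding Const_cancel[OF coef(1)[OF x(1,2)]] using r(2) by simp
    have "y = x \<or> y = nb x \<beta>" "z = x \<or> z = nb x \<beta>" using yz edge_facts(2)[OF x(1,2)] x(3) by auto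
    then consider "y = z" | "y = x" "z = nb x \<beta>" | "y = nb x \<beta>" "z = x" by blast
    then show ?thesis
    proof cases
      case 1 then show ?thesis by (intro bexI[of _ 0] coeff_ring_closed) simp
    next
      case 2 then show ?thesis using eq s by blast
    next
      case 3
      have "f y - f z = char_form (summands M) (\<alpha> E) * (0 - s)" using eq 3 by (simp add: algebra_simps)
      then show ?thesis using s coeff_ring_closed(1,5) by blast
    qed
  qed
  then show "f \<in> eq_cohomology M e \<alpha>"
    using f unfolding eq_cohomology_def compat_def by (auto simp: PiE_iff)
qed

lemma compat_diff: "compat f \<Longrightarrow> compat g \<Longrightarrow> compat (\<lambda>x. f x - g x)"
  unfolding compat_def
proof (intro conjI ballI; elim conjE)
  fix x \<beta> assume a: "\<forall>x\<in>F. \<forall>\<beta>\<in>ivs x. W.lab \<beta> dvd f x - f (nb x \<beta>)"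
    "\<forall>x\<in>F. \<forall>\<beta>\<in>ivs x. W.lab \<beta> dvd g x - g (nb x \<beta>)" and x: "x \<in> F" "\<beta> \<in> ivs x"
  have "W.lab \<beta> dvd (f x - f (nb x \<beta>)) - (g x - g (nb x \<beta>))" by (rule dvd_diff) (use a x in blast)+
  then show "W.lab \<beta> dvd f x - g x - (f (nb x \<beta>) - g (nb x \<beta>))" by (simp add: algebra_simps)
qed (auto simp: coeff_ring_closed)

lemma compat_linear_sum:
  assumes "\<And>u. u \<in> F \<Longrightarrow> c u \<in> R" "\<And>u. u \<in> F \<Longrightarrow> compat (P u)"
  shows "compat (\<lambda>x. \<Sum>u\<in>F. c u * P u x)"
  unfolding compat_def
proof (intro conjI ballI)
  fix x assume x: "x \<in> F"
  show "(\<Sum>u\<in>F. c u * P u x) \<in> R"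
    using assms x by (intro coeff_ring_sum coeff_ring_closed(6)) (auto simp: compat_def)
  fix \<beta> assume b: "\<beta> \<in> ivs x"
  have "W.lab \<beta> dvd (\<Sum>u\<in>F. c u * (P u x - P u (nb x \<beta>)))"
    using assms(2) x b by (intro dvd_sum dvd_mult) (auto simp: compat_def)
  then show "W.lab \<beta> dvd (\<Sum>u\<in>F. c u * P u x) - (\<Sum>u\<in>F. c u * P u (nb x \<beta>))"
    by (simp add: right_diff_distrib sum_subtractf)
qed

lemma prod_lab_dvd:
  assumes "compat g" "y \<in> F" "\<And>z. z \<in> F \<Longrightarrow> lng z < lng y \<Longrightarrow> g z = 0"
  shows "prod W.lab (ivs y) dvd g y"
proof (rule W.rs.prod_dvd_Phi[OF finite_inv inv_Phi])
  fix \<beta> assume b: "\<beta> \<in> ivs y"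
  have "W.lab \<beta> dvd g y - g (nb y \<beta>)" using assms(1,2) b by (simp add: compat_def)
  then show "W.lab \<beta> dvd g y" using assms(3)[OF edge_facts(3)[OF assms(2) b] ln_nb[OF assms(2) b]] by simp
qed

lemma low_degree_zero:
  assumes "prod W.lab (ivs y) dvd f" "homogeneous_poly (2 * k) f" "k < lng y"
  shows "f = 0"
proof -
  obtain q where q: "f = prod W.lab (ivs y) * q" using assms(1) by (rule dvdE)
  have "q = 0"
    using homogeneous_factor(1)[of k "prod W.lab (ivs y)" q "lng y"] assms(2,3) prod_lab q by auto
  then show ?thesis using q by simp
qed

text \<open>At a nonzero value of least length all lower neighbours vanish, so the product of
  \<open>lng y\<close> labels divides it; for \<open>lng y > k\<close> the degree
  \<open>2 * k\<close> is too small for that.\<close>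

lemma compat_vanish:
  assumes "compat g" "\<And>y. y \<in> F \<Longrightarrow> homogeneous_poly (2 * k) (g y)" "\<And>y. y \<in> F \<Longrightarrow> lng y \<le> k \<Longrightarrow> g y = 0"
  shows "y \<in> F \<Longrightarrow> g y = 0"
proof (induction "lng y" arbitrary: y rule: less_induct)
  case less
  show ?case
  proof (cases "lng y \<le> k")
    case True then show ?thesis using assms(3) less.prems by simp
  next
    case False
    have "prod W.lab (ivs y) dvd g y" using prod_lab_dvd[OF assms(1) less.prems] less.hyps by blast
    then show ?thesis using low_degree_zero assms(2)[OF less.prems] False by simp
  qed
qed

lemma graph_ge_len: "graph_ge M e chi y x \<Longrightarrow> y = x \<or> lng x < lng y"
  unfolding graph_ge_def
proof (induction rule: converse_rtranclp_induct)
  case (step y z)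
  then obtain E where E: "directed_edge M e chi E y z" by blast
  then have "E \<in> edges M e" by (simp add: directed_edge_def)
  then obtain x0 \<beta> where b: "x0 \<in> F" "\<beta> \<in> ivs x0" "E = EL x0 \<beta>" by (rule edges_cases)
  then have "y = x0" "z = nb x0 \<beta>" using E edge_facts(5)[OF b(1,2)] by auto
  then have "lng z < lng y" using ln_nb[OF b(1,2)] by simp
  then show ?case using step.IH by auto
qed simp

lemma KT_class_iff:
  assumes x: "x \<in> F"
  shows "KT_class M e chi \<alpha> x f \<longleftrightarrow> f \<in> extensional F \<and> compat f \<and> f x = diag x \<and>
    (\<forall>y\<in>F. homogeneous_poly (2 * lng x) (f y)) \<and> (\<forall>y\<in>F. \<not> graph_ge M e chi y x \<longrightarrow> f y = 0)"
proof -
  have "poly_deg (diag x) = 2 * lng x" by (rule poly_deg_homogeneous[OF diag_hom diag_nz[OF x]])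
  then show ?thesis unfolding KT_class_def eq_cohomology_iff diag_edges[OF x] by auto
qed

text \<open>The difference of two classes vanishes at \<open>x\<close>, and also at every other
  fixed point of length at most \<open>lng x\<close>, because no such point lies above
  \<open>x\<close>. Its degree then leaves no room for nonzero values.\<close>

lemma KT_class_unique:
  assumes x: "x \<in> F" and f: "KT_class M e chi \<alpha> x f" and g: "KT_class M e chi \<alpha> x g"
  shows "f = g"
proof (rule extensionalityI)
  note f' = f[unfolded KT_class_iff[OF x]] and g' = g[unfolded KT_class_iff[OF x]]
  show "f \<in> extensional F" "g \<in> extensional F" using f' g' by auto
  have "f y - g y = 0" if "y \<in> F" for y
  proof (rule compat_vanish[OF compat_diff _ _ that, where k="lng x"])
    show "compat f" "compat g" using f' g' by auto
    show "homogeneous_poly (2 * lng x) (f u - g u)" if "u \<in> F" for u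
      using f' g' that by (intro homogeneous_diff) auto
    show "f u - g u = 0" if u: "u \<in> F" "lng u \<le> lng x" for u
    proof (cases "u = x")
      case True then show ?thesis using f' g' by simp
    next
      case False
      then have "\<not> graph_ge M e chi u x" using graph_ge_len[of u x] u(2) by auto
      then show ?thesis using f' g' u(1) by simp
    qed
  qed
  then show "f y = g y" if "y \<in> F" for y using that by simp
qed

text \<open>The class on words is restricted to the fixed points, the variables of empty strings are
  set to zero, and \<open>scal x\<close> adapts the diagonal value to the chosen labels.\<close>

lemma KT_class_exists:
  assumes x: "x \<in> F"
  shows "\<exists>f. KT_class M e chi \<alpha> x f"
proof -
  let ?d = "summands M"
  let ?\<rho> = "restrict_vars ?d"
  define f where "f = (\<lambda>y\<in>F. Const (scal x) * ?\<rho> (W.rs.xi (H x) (H y)))"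
  have f: "f y = Const (scal x) * ?\<rho> (W.rs.xi (H x) (H y))" if "y \<in> F" for y using that by (simp add: f_def)
  have compat: "compat f" unfolding compat_def
  proof (intro conjI ballI)
    show "f y \<in> R" if "y \<in> F" for y
      unfolding f[OF that] by (intro coeff_ring_closed(3,6) restrict_vars_in)
    fix y \<beta> assume y: "y \<in> F" "\<beta> \<in> ivs y"
    have "W.lab \<beta> dvd W.rs.xi (H x) (H y) - W.rs.xi (H x) (W.rf \<beta> (H y))"
      by (rule W.rs.xi_GKM[OF H_C H_C y(2)])
    then have "?\<rho> (W.lab \<beta>) dvd ?\<rho> (W.rs.xi (H x) (H y) - W.rs.xi (H x) (W.rf \<beta> (H y)))"
      unfolding restrict_vars_def by (rule subst_dvd)
    then have "W.lab \<beta> dvd ?\<rho> (W.rs.xi (H x) (H y)) - ?\<rho> (W.rs.xi (H x) (W.rf \<beta> (H y)))"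
      using restrict_vars_ident[OF lab_R[OF y]] by (simp add: restrict_vars_def subst_diff)
    then have "W.lab \<beta> dvd Const (scal x) * (?\<rho> (W.rs.xi (H x) (H y)) - ?\<rho> (W.rs.xi (H x) (W.rf \<beta> (H y))))"
      by (rule dvd_mult)
    then show "W.lab \<beta> dvd f y - f (nb y \<beta>)"
      unfolding f[OF y(1)] f[OF edge_facts(3)[OF y]] edge_facts(4)[OF y] by (simp add: right_diff_distrib)
  qed
  have hom: "homogeneous_poly (2 * lng x) (f y)" if "y \<in> F" for y
    unfolding f[OF that] restrict_vars_def
    by (intro homogeneous_Const_mult homogeneous_subst W.rs.xi_hom H_C) (simp add: homogeneous_Var)
  have "prod W.lab (ivs x) \<in> R" by (intro coeff_ring_prod lab_R[OF x])
  then have fx: "f x = diag x"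
    unfolding f[OF x] W.rs.xi_diag[OF H_C] diag_def by (simp add: restrict_vars_ident)
  \<comment> \<open>The support condition is not visible in the recursion. If \<open>f\<close>
    vanishes at all lower neighbours of \<open>y\<close>, the degree bounds the length of
    \<open>y\<close> by that of \<open>x\<close>, and \<open>xi_low\<close> leaves only
    \<open>y = x\<close>; otherwise one descends along an edge.\<close>
  have "graph_ge M e chi y x" if "y \<in> F" "f y \<noteq> 0" for y
    using that
  proof (induction "lng y" arbitrary: y rule: less_induct)
    case less
    show ?case
    proof (cases "\<exists>\<beta>\<in>ivs y. f (nb y \<beta>) \<noteq> 0")
      case True
      then obtain \<beta> where b: "\<beta> \<in> ivs y" "f (nb y \<beta>) \<noteq> 0" by auto
      have "graph_ge M e chi (nb y \<beta>) x"
        using less.hyps[OF ln_nb[OF less.prems(1) b(1)] edge_facts(3)[OF less.prems(1) b(1)] b(2)] .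
      moreover have "directed_edge M e chi (EL y \<beta>) y (nb y \<beta>)" using edge_facts(5)[OF less.prems(1) b(1)] by simp
      ultimately show ?thesis unfolding graph_ge_def by (blast intro: converse_rtranclp_into_rtranclp)
    next
      case False
      have "prod W.lab (ivs y) dvd f y"
      proof (rule W.rs.prod_dvd_Phi[OF finite_inv inv_Phi])
        fix \<beta> assume b: "\<beta> \<in> ivs y"
        then have "W.lab \<beta> dvd f y - f (nb y \<beta>)" using compat less.prems(1) by (simp add: compat_def)
        then show "W.lab \<beta> dvd f y" using False b by simp
      qed
      then have "lng y \<le> lng x" using low_degree_zero[OF _ hom[OF less.prems(1)]] less.prems(2) by (meson not_less)
      have "H x = H y"
      proof (rule ccontr)
        assume "H x \<noteq> H y"
        then have "W.rs.xi (H x) (H y) = 0" by (rule W.rs.xi_low[OF H_C H_C \<open>lng y \<le> lng x\<close>])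
        then show False using less.prems(2) f[OF less.prems(1)] by (simp add: restrict_vars_def)
      qed
      then have "y = x" using H_inj[OF x less.prems(1)] by simp
      then show ?thesis by (simp add: graph_ge_def)
    qed
  qed
  then have "KT_class M e chi \<alpha> x f"
    unfolding KT_class_iff[OF x] using compat hom fx by (auto simp: f_def)
  then show ?thesis by blast
qed

text \<open>The matrix of the classes is triangular with respect to length, with diagonal entries
  \<open>diag x\<close>. Subtracting a combination that is correct in smaller lengths leaves a
  compatible family whose value at \<open>y\<close> is divisible by \<open>diag y\<close>; the
  quotients are the next coefficients.\<close>

lemma KT_basis:
  assumes P: "\<And>x. x \<in> F \<Longrightarrow> KT_class M e chi \<alpha> x (P x)"
  shows "module_basis R F (eq_cohomology M e \<alpha>) P"
proof -
  have Pc: "compat (P x)" and Px: "P x x = diag x" if "x \<in> F" for x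
    using P[OF that] KT_class_iff[OF that] by auto
  have P0: "P x y = 0" if "x \<in> F" "y \<in> F" "y \<noteq> x" "\<not> lng x < lng y" for x y
    using P[OF that(1)] KT_class_iff[OF that(1)] graph_ge_len[of y x] that by auto
  have fin: "finite F" by (rule finite_fixed_points)
  have single: "(\<Sum>x\<in>F. c x * P x y) = c y * diag y"
    if y: "y \<in> F" and c: "\<And>x. x \<in> F \<Longrightarrow> lng x < lng y \<Longrightarrow> c x = 0" for c y
  proof -
    have "(\<Sum>x\<in>F. c x * P x y) = (\<Sum>x\<in>F. if x = y then c y * diag y else 0)"
    proof (rule sum.cong[OF refl])
      fix x assume x: "x \<in> F"
      show "c x * P x y = (if x = y then c y * diag y else 0)"
        using Px[OF y] P0[OF x y] c[OF x] by (cases "x = y") auto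
    qed
    then show ?thesis using fin y by simp
  qed
  have ex: "\<exists>c. (\<forall>x. c x \<in> R) \<and> (\<forall>y\<in>F. lng y < K \<longrightarrow> f y = (\<Sum>x\<in>F. c x * P x y))" if f: "compat f" for f K
  proof (induction K)
    case 0
    show ?case by (intro exI[of _ "\<lambda>_. 0"]) (simp add: coeff_ring_closed)
  next
    case (Suc K)
    then obtain c where c: "\<And>x. c x \<in> R" "\<And>y. y \<in> F \<Longrightarrow> lng y < K \<Longrightarrow> f y = (\<Sum>x\<in>F. c x * P x y)" by blast
    define g where "g y = f y - (\<Sum>x\<in>F. c x * P x y)" for y
    have g: "compat g" unfolding g_def by (rule compat_diff[OF f compat_linear_sum]) (use c Pc in auto)
    have "\<exists>r\<in>R. g y = diag y * r" if y: "y \<in> F" "lng y = K" for y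
    proof (rule coeff_ring_dvd[OF diag_R[OF y(1)]])
      show "g y \<in> R" using g y by (simp add: compat_def)
      have "prod W.lab (ivs y) dvd g y" by (rule prod_lab_dvd[OF g y(1)]) (use c(2) y(2) in \<open>simp add: g_def\<close>)
      then obtain q where "g y = prod W.lab (ivs y) * q" by (rule dvdE)
      also have "\<dots> = (Const (inverse (scal y)) * (Const (scal y) * prod W.lab (ivs y))) * q"
        unfolding Const_cancel[OF scal_nz[OF y(1)]] ..
      also have "\<dots> = diag y * (Const (inverse (scal y)) * q)" by (simp add: diag_def ac_simps)
      finally show "diag y dvd g y" by (rule dvdI)
    qed
    then have "\<forall>y. \<exists>r. y \<in> F \<and> lng y = K \<longrightarrow> r \<in> R \<and> g y = diag y * r" by blast
    then obtain r where r: "\<And>y. y \<in> F \<Longrightarrow> lng y = K \<Longrightarrow> r y \<in> R \<and> g y = diag y * r y" by metis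
    \<comment> \<open>Corrections at length \<open>K\<close> disturb neither one another nor smaller
      lengths, since these classes vanish at all other fixed points of length at most
      \<open>K\<close>.\<close>
    define b where "b x = (if x \<in> F \<and> lng x = K then r x else 0)" for x
    have bR: "b x \<in> R" for x using r by (simp add: b_def coeff_ring_closed)
    have "f y = (\<Sum>x\<in>F. (c x + b x) * P x y)" if y: "y \<in> F" "lng y < Suc K" for y
    proof -
      have bs: "(\<Sum>x\<in>F. b x * P x y) = b y * diag y" by (rule single[OF y(1)]) (use y(2) in \<open>auto simp: b_def\<close>)
      have "f y = (\<Sum>x\<in>F. c x * P x y) + b y * diag y"
      proof (cases "lng y = K")
        case True
        then show ?thesis using r[OF y(1) True] y(1) by (simp add: b_def g_def algebra_simps)
      next
        case False
        then show ?thesis using c(2)[OF y(1)] y(2) by (simp add: b_def)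
      qed
      then show ?thesis unfolding bs[symmetric] by (simp add: distrib_right sum.distrib)
    qed
    then show ?case using c(1) bR coeff_ring_closed(4) by (intro exI[of _ "\<lambda>x. c x + b x"]) blast
  qed
  show ?thesis unfolding module_basis_def
  proof (intro conjI ballI)
    show "P x \<in> eq_cohomology M e \<alpha>" if "x \<in> F" for x using P[OF that] by (simp add: KT_class_def)
    fix f assume "f \<in> eq_cohomology M e \<alpha>"
    then have f: "compat f" by (simp add: eq_cohomology_iff)
    define K where "K = Suc (Max (lng ` F))"
    have K: "lng y < K" if "y \<in> F" for y using that fin by (simp add: K_def less_Suc_eq_le)
    obtain c where c: "\<forall>x. c x \<in> R" "\<forall>y\<in>F. lng y < K \<longrightarrow> f y = (\<Sum>x\<in>F. c x * P x y)" using ex[OF f] by blast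
    show "\<exists>!c. c \<in> F \<rightarrow>\<^sub>E R \<and> (\<forall>y\<in>F. f y = (\<Sum>x\<in>F. c x * P x y))"
    proof (rule ex1I[of _ "restrict c F"])
      show "restrict c F \<in> F \<rightarrow>\<^sub>E R \<and> (\<forall>y\<in>F. f y = (\<Sum>x\<in>F. restrict c F x * P x y))"
        using c K by auto
      fix c' assume c': "c' \<in> F \<rightarrow>\<^sub>E R \<and> (\<forall>y\<in>F. f y = (\<Sum>x\<in>F. c' x * P x y))"
      have "c' y - c y = 0" if "y \<in> F" for y
        using that
      proof (induction "lng y" arbitrary: y rule: less_induct)
        case less
        have "(c' y - c y) * diag y = (\<Sum>x\<in>F. (c' x - c x) * P x y)"
          by (rule single[OF less.prems, symmetric]) (rule less.hyps)
        also have "\<dots> = f y - f y"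
          using c c' K less.prems by (simp add: left_diff_distrib sum_subtractf)
        finally show ?case using diag_nz[OF less.prems] by simp
      qed
      then show "c' = restrict c F" using c' by (intro extensionalityI[of _ F]) (auto simp: PiE_iff)
    qed
  qed
qed

end

theorem theorem3p20:
  fixes M :: "'v::ab_group_add based_rep"
    and v :: "nat \<Rightarrow> nat \<Rightarrow> 'v"
    and wt :: "'v \<Rightarrow> int"
    and e :: "nat \<Rightarrow> nat"
    and chi :: "complex \<Rightarrow> nat \<Rightarrow> complex"
    and \<alpha> :: "(nat \<Rightarrow> 'v set) set \<Rightarrow> nat \<Rightarrow> int"
  assumes "is_rep M"
    and "nilpotent_rep M"
    and "homogeneous_choice M v wt"
    and "quiver_Gr M e \<noteq> {}"
    and "generic_cocharacter M e chi"
    and "\<And>z N. z \<noteq> 0 \<Longrightarrow> N \<in> quiver_Gr M e \<Longrightarrow> act M (chi z) N = grading_act M wt z N"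
    and "\<And>E. E \<in> edges M e \<Longrightarrow> describes_action M E (\<alpha> E)"
  shows "(\<forall>x\<in>fixed_points M e. \<exists>!f. KT_class M e chi \<alpha> x f) \<and>
    (\<forall>P. (\<forall>x\<in>fixed_points M e. KT_class M e chi \<alpha> x (P x)) \<longrightarrow>
       module_basis (coeff_ring (summands M)) (fixed_points M e) (eq_cohomology M e \<alpha>) P)"
proof -
  have "decomposition_basis M" using assms(3) by (simp add: homogeneous_choice_def)
  then interpret hr: homogeneous_rep M v wt using assms(1,3) by unfold_locales
  obtain om lo hi pos where ss: "string_structure M wt om lo hi pos"
    using hr.string_structure_exists by blast
  interpret moment_graph M wt om lo hi pos e chi \<alpha>
    by unfold_locales (use ss assms(6,7) in auto)
  show ?thesis
  proof (intro conjI ballI allI impI)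
    fix x assume x: "x \<in> fixed_points M e"
    obtain f where f: "KT_class M e chi \<alpha> x f" using KT_class_exists[OF x] by (rule exE)
    show "\<exists>!f. KT_class M e chi \<alpha> x f"
      by (rule ex1I[of _ f]) (rule f, rule KT_class_unique[OF x _ f])
  next
    fix P assume P: "\<forall>x\<in>fixed_points M e. KT_class M e chi \<alpha> x (P x)"
    show "module_basis (coeff_ring (summands M)) (fixed_points M e) (eq_cohomology M e \<alpha>) P"
      by (rule KT_basis) (rule bspec[OF P])
  qed
qed

end
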